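(* (i) If $\mathfrak{f}$ is the Schur function of the Krein system with coefficient $A_{\mathfrak{f}}\in L^2(\mathbb{R}^+)$ and $g$ is analytic in $\mathbb{C}^+$ with $|g|\le1$, then $g\mathfrak{f}$ is the Schur function of a Krein system with coefficient $A_{g\mathfrak{f}}\in L^2(\mathbb{R}^+)$, and $\|A_{g\mathfrak{f}}\|_2\le\|A_{\mathfrak{f}}\|_2$. (ii) The set of measures $\sigma$ that are spectral measures of Krein systems with coefficient in $L^2(\mathbb{R}^+)$ is convex.
   Context: $\mathbb{C}^+$ is the open upper half-plane. For complex-valued $A\in L^2_{\rm loc}(\mathbb{R}^+)$ (i.e. $A\in L^2[0,R]$ for all $R>0$) and $\lambda\in\mathbb{C}$ let $X(r,\lambda)$ solve $X'=\begin{bmatrix}i\lambda&-\overline{A(r)}\\-A(r)&0\end{bmatrix}X$, $X(0,\lambda)=I$, and write its second row as $(\mathfrak{B}(r,\lambda),\mathfrak{A}(r,\lambda))$. The Schur function of the Krein system with coefficient $A$ is $\mathfrak{f}(\lambda)=\lim_{r\to\infty}\mathfrak{B}(r,\lambda)\mathfrak{A}^{-1}(r,\lambda)$, $\lambda\in\mathbb{C}^+$; the limit exists and satisfies $|\mathfrak{f}|\le1$, and $\mathfrak f$ determines $A$. Spectral measure: an accelerant is a function $H\in L^2_{\rm loc}(\mathbb{R})$ with $H(-x)=\overline{H(x)}$ such that for every $r>0$ the operator $(\mathcal{H}_rf)(x)=\int_0^rH(x-t)f(t)dt$ on $L^2[0,r]$ satisfies $I+\mathcal{H}_r>0$; its resolvent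 kernel $\Gamma_r$ satisfies $\Gamma_r(t,s)+\int_0^rH(t-u)\Gamma_r(u,s)du=H(t-s)$. Each $A\in L^2_{\rm loc}(\mathbb{R}^+)$ has a unique accelerant $H$ with $\overline{A(r)}=H(r)-\int_0^rH(r-u)\Gamma_r(u,0)du$ a.e. The spectral measure $\sigma$ is the unique positive Borel measure on $\mathbb{R}$ with $\int\frac{d\sigma}{1+\lambda^2}<\infty$ such that for some $\beta\in\mathbb{R}$ and all $x\in\mathbb{R}$ $$\frac{|x|}{2}+\int_0^x(x-s)H(s)ds=i\beta x+\int_{-\infty}^\infty\left(1+\frac{i\lambda x}{1+\lambda^2}-e^{i\lambda x}\right)\frac{d\sigma(\lambda)}{\lambda^2}$$ (integrand extended by continuity to $\lambda=0$). With $F=\frac{1-\mathfrak{f}}{1+\mathfrak{f}}$ one has, equivalently, $\frac{F(\lambda)}2=-i\beta+i\int\frac{1+\lambda t}{(\lambda-t)(1+t^2)}d\sigma(t)$ for $\lambda\in\mathbb{C}^+$. *)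

theory Defs
  imports "HOL-Analysis.Analysis"
begin

section \<open>Square-integrable functions\<close>

text \<open>Elements of \<open>L\<^sup>2(S)\<close> are represented by total functions on the real line whose values off
  \<open>S\<close> are irrelevant. Every Lebesgue class has a Borel representative, so Borel measurability
  loses nothing.\<close>

definition L2_on :: "real set \<Rightarrow> (real \<Rightarrow> complex) \<Rightarrow> bool" where
  "L2_on S f \<longleftrightarrow>
     set_borel_measurable lborel S f \<and> set_integrable lborel S (\<lambda>x. (norm (f x))\<^sup>2)"

definition L2_norm_on :: "real set \<Rightarrow> (real \<Rightarrow> complex) \<Rightarrow> real" where
  "L2_norm_on S f = sqrt (set_lebesgue_integral lborel S (\<lambda>x. (norm (f x))\<^sup>2))"


section \<open>Krein systems and their Schur functions\<close>

definition krein_matrix :: "(real \<Rightarrow> complex) \<Rightarrow> complex \<Rightarrow> real \<Rightarrow> complex^2^2" where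
  "krein_matrix A l r = vector [vector [\<i> * l, - cnj (A r)], vector [- A r, 0]]"

text \<open>The coefficient is only locally square-integrable, so the initial value problem
  \<open>X' = krein_matrix A l X\<close>, \<open>X(0) = I\<close> is read in the Caratheodory sense, that is, as an
  integral equation for a continuous \<open>X\<close>. This determines \<open>X\<close> on \<open>[0,\<infinity>)\<close>.\<close>

definition krein_solution ::
    "(real \<Rightarrow> complex) \<Rightarrow> complex \<Rightarrow> (real \<Rightarrow> complex^2^2) \<Rightarrow> bool" where
  "krein_solution A l X \<longleftrightarrow>
     continuous_on {0..} X \<and>
     (\<forall>r\<ge>0. X r = mat 1 +
        set_lebesgue_integral lborel {0..r} (\<lambda>s. krein_matrix A l s ** X s))"

text \<open>Only the values of \<open>f\<close> on the open upper half-plane matter. There the entry \<open>X r $ 2 $ 2\<close>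
  is never zero.\<close>

definition schur_function :: "(real \<Rightarrow> complex) \<Rightarrow> (complex \<Rightarrow> complex) \<Rightarrow> bool" where
  "schur_function A f \<longleftrightarrow>
     (\<forall>l. Im l > 0 \<longrightarrow>
        (\<exists>X. krein_solution A l X \<and> ((\<lambda>r. X r $ 2 $ 1 / X r $ 2 $ 2) \<longlongrightarrow> f l) at_top))"


section \<open>Accelerants and spectral measures\<close>

definition convolution_op ::
    "(real \<Rightarrow> complex) \<Rightarrow> real \<Rightarrow> (real \<Rightarrow> complex) \<Rightarrow> real \<Rightarrow> complex" where
  "convolution_op H r f x = set_lebesgue_integral lborel {0..r} (\<lambda>t. H (x - t) * f t)"

text \<open>The last conjunct is \<open>I + \<H>\<^sub>r > 0\<close> on \<open>L\<^sup>2[0,r]\<close>. The operator is self-adjoint, so its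
  quadratic form is real and \<open>Re\<close> only changes the type.\<close>

definition accelerant :: "(real \<Rightarrow> complex) \<Rightarrow> bool" where
  "accelerant H \<longleftrightarrow>
     (\<forall>R>0. L2_on {-R..R} H) \<and>
     (AE x in lborel. H (- x) = cnj (H x)) \<and>
     (\<forall>r>0. \<forall>f. L2_on {0..r} f \<and> \<not> (AE x in lborel. x \<in> {0..r} \<longrightarrow> f x = 0) \<longrightarrow>
        Re (set_lebesgue_integral lborel {0..r}
              (\<lambda>x. (f x + convolution_op H r f x) * cnj (f x))) > 0)"

text \<open>For every \<open>s\<close>, including \<open>s = 0\<close>, the section \<open>G(\<cdot>,s)\<close> is an element of \<open>L\<^sup>2[0,r]\<close> and the
  resolvent equation is an identity in that space. This makes the section at \<open>s = 0\<close>
  meaningful.\<close>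

definition resolvent_kernel ::
    "(real \<Rightarrow> complex) \<Rightarrow> real \<Rightarrow> (real \<Rightarrow> real \<Rightarrow> complex) \<Rightarrow> bool" where
  "resolvent_kernel H r G \<longleftrightarrow>
     (\<forall>s\<in>{0..r}. L2_on {0..r} (\<lambda>t. G t s) \<and>
        (AE t in lborel. t \<in> {0..r} \<longrightarrow>
           G t s + set_lebesgue_integral lborel {0..r} (\<lambda>u. H (t - u) * G u s) = H (t - s)))"

definition accelerant_of :: "(real \<Rightarrow> complex) \<Rightarrow> (real \<Rightarrow> complex) \<Rightarrow> bool" where
  "accelerant_of A H \<longleftrightarrow>
     accelerant H \<and>
     (\<exists>\<Gamma>. (\<forall>r>0. resolvent_kernel H r (\<Gamma> r)) \<and>
        (AE r in lborel. r > 0 \<longrightarrow>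
           cnj (A r) = H r - set_lebesgue_integral lborel {0..r} (\<lambda>u. H (r - u) * \<Gamma> r u 0)))"

text \<open>The value \<open>x\<^sup>2 / 2\<close> at \<open>l = 0\<close> is the continuous extension.\<close>

definition levy_integrand :: "real \<Rightarrow> real \<Rightarrow> complex" where
  "levy_integrand x l =
     (if l = 0 then of_real (x\<^sup>2 / 2)
      else (1 + \<i> * of_real (l * x / (1 + l\<^sup>2)) - exp (\<i> * of_real (l * x))) / of_real (l\<^sup>2))"

text \<open>The integral from \<open>0\<close> to \<open>x\<close> is oriented, as \<open>x\<close> may be negative.\<close>

definition spectral_measure :: "(real \<Rightarrow> complex) \<Rightarrow> real measure \<Rightarrow> bool" where
  "spectral_measure A \<sigma> \<longleftrightarrow>
     sets \<sigma> = sets borel \<and>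
     integrable \<sigma> (\<lambda>l. 1 / (1 + l\<^sup>2)) \<and>
     (\<exists>H. accelerant_of A H \<and>
        (\<exists>\<beta>::real. \<forall>x::real.
           of_real (\<bar>x\<bar> / 2) +
             interval_lebesgue_integral lborel (ereal 0) (ereal x) (\<lambda>s. of_real (x - s) * H s)
           = \<i> * of_real (\<beta> * x) + integral\<^sup>L \<sigma> (levy_integrand x)))"


section \<open>Convexity of sets of measures\<close>

text \<open>Measures do not form a real vector space in the library, so convex combinations are defined
  directly.\<close>

definition mix_measure :: "real \<Rightarrow> 'a measure \<Rightarrow> 'a measure \<Rightarrow> 'a measure" where
  "mix_measure t M N =
     measure_of (space M) (sets M)
       (\<lambda>E. ennreal t * emeasure M E + ennreal (1 - t) * emeasure N E)"

lemma sets_mix_measure [simp]: "sets (mix_measure t M N) = sets M"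
  by (simp add: mix_measure_def)

lemma emeasure_mix_measure:
  assumes "sets N = sets M" "E \<in> sets M"
  shows "emeasure (mix_measure t M N) E =
           ennreal t * emeasure M E + ennreal (1 - t) * emeasure N E"
  unfolding mix_measure_def
proof (rule emeasure_measure_of_sigma)
  show "sigma_algebra (space M) (sets M)" by (rule sets.sigma_algebra_axioms)
  show "positive (sets M) (\<lambda>E. ennreal t * emeasure M E + ennreal (1 - t) * emeasure N E)"
    by (simp add: positive_def)
  show "countably_additive (sets M)
          (\<lambda>E. ennreal t * emeasure M E + ennreal (1 - t) * emeasure N E)"
  proof (rule countably_additiveI)
    fix F :: "nat \<Rightarrow> 'a set"
    assume F: "range F \<subseteq> sets M" "disjoint_family F"
    have "(\<Sum>i. emeasure M (F i)) = emeasure M (\<Union>i. F i)"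
      using F by (intro suminf_emeasure) auto
    moreover have "(\<Sum>i. emeasure N (F i)) = emeasure N (\<Union>i. F i)"
      using F assms(1) by (intro suminf_emeasure) auto
    moreover have "(\<Sum>i. ennreal t * emeasure M (F i) + ennreal (1 - t) * emeasure N (F i)) =
        (\<Sum>i. ennreal t * emeasure M (F i)) + (\<Sum>i. ennreal (1 - t) * emeasure N (F i))"
      by (rule suminf_add[symmetric]) auto
    ultimately show "(\<Sum>i. ennreal t * emeasure M (F i) + ennreal (1 - t) * emeasure N (F i)) =
        ennreal t * emeasure M (\<Union>i. F i) + ennreal (1 - t) * emeasure N (\<Union>i. F i)"
      by simp
  qed
  show "E \<in> sets M" by fact
qed

definition convex_measures :: "'a measure set \<Rightarrow> bool" where
  "convex_measures S \<longleftrightarrow>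
     (\<forall>M\<in>S. \<forall>N\<in>S. \<forall>t\<in>{0..1}. mix_measure t M N \<in> S)"

end

theory Submission
  imports Defs "HOL-Complex_Analysis.Cauchy_Integral_Formula" "HOL-Real_Asymp.Real_Asymp"
begin

text \<open>If \<open>H\<close> is the accelerant of \<open>A\<close>, then the squared norm of \<open>A\<close> on \<open>[0,R]\<close> is the supremum over \<open>u \<in> L\<^sup>2[0,R]\<close> of
  \<open>2 Re \<langle>H,u\<rangle> - \<langle>(I + \<H>\<^sub>R)u,u\<rangle>\<close>, because \<open>A\<close> is the diagonal of the triangular factor of the inverse of \<open>I + \<H>\<^sub>R\<close>.
  This expression is affine in \<open>H\<close>, hence its supremum is convex in \<open>H\<close>; mixing spectral measures mixes accelerants.

  For Schur functions the same formula holds with \<open>I - T T\<^sup>*\<close> in place of \<open>I + \<H>\<^sub>R\<close>, where \<open>T\<close> is convolution with a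
  causal \<open>k\<close> whose Fourier transform is \<open>\<ff>\<close>. On combinations of decaying exponentials \<open>e\<^sub>\<lambda>\<close> it reads
  \<open>2 Re (\<Sum> cnj c\<^sub>\<lambda> * \<ff> \<lambda>) - \<parallel>\<Sum> c\<^sub>\<lambda> e\<^sub>\<lambda>\<parallel>\<^sup>2 + \<parallel>\<Sum> c\<^sub>\<lambda> cnj (\<ff> \<lambda>) e\<^sub>\<lambda>\<parallel>\<^sup>2 \<le> \<parallel>A\<parallel>\<^sup>2\<close>, and Pick's inequality for \<open>g\<close> allows
  to replace \<open>\<ff>\<close> by \<open>g \<ff>\<close>. Conversely, this inequality yields \<open>k\<close> by Riesz representation, a Gronwall argument makes
  \<open>I - T T\<^sup>*\<close> coercive on every \<open>[0,r]\<close>, and the factorisation of its inverse produces a coefficient and the solution of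
  the corresponding Krein system.\<close>

section \<open>The Hilbert space of square-integrable functions\<close>

text \<open>Both halves meet in the locale \<open>chain\<close>, where I + K on [0,R] has a kernel
  with bounded rows. The coefficient is a diagonal value there, and an L2 class has none; it becomes
  meaningful because the rows exist at every x. The kernel is not continuous, so the derivative in r
  of <(I + K)^-1 h, h'> on [0,r] is replaced by exact increments over a grid and a dominated limit.
  Lower bounds are the second obstacle. An accelerant gives only strict positivity, and coercivity
  comes from the convolution being Hilbert-Schmidt on [0,R]. For I minus T times its adjoint,
  contractivity gives only nonnegativity; the constant exp(-M r), with M the bound on the squared
  norm, quantifies how far the form stays from degenerating. Last, a coefficient assembled from
  finite intervals must have the prescribed function as its limit at infinity. Testing the
  variational inequality with a competitor that reaches beyond r bounds what is still missing at r,
  uniformly in how far the competitor reaches.\<close>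

lemma measurable_cnj_comp [measurable]:
  assumes [measurable]: "f \<in> borel_measurable M"
  shows "(\<lambda>x. cnj (f x)) \<in> borel_measurable M"
  by (rule measurable_compose[OF assms borel_measurable_continuous_onI]) (intro continuous_intros)

definition sqi :: "(real \<Rightarrow> complex) \<Rightarrow> bool" where
  "sqi f \<longleftrightarrow> f \<in> borel_measurable borel \<and> integrable lborel (\<lambda>x. (cmod (f x))\<^sup>2)"

lemma sqi_measurable [measurable_dest]: "sqi f \<Longrightarrow> f \<in> borel_measurable borel"
  by (simp add: sqi_def)

lemma sqi_bound:
  assumes "integrable lborel g" "f \<in> borel_measurable borel" "AE x in lborel. (cmod (f x))\<^sup>2 \<le> g x"
  shows "sqi f"
proof -
  note [measurable] = assms(2)
  have "integrable lborel (\<lambda>x. (cmod (f x))\<^sup>2)"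
    by (rule Bochner_Integration.integrable_bound[OF assms(1)]) (use assms(3) in \<open>auto elim: eventually_mono\<close>)
  with assms(2) show ?thesis by (simp add: sqi_def)
qed

lemma sqi_zero [simp]: "sqi (\<lambda>_. 0)"
  by (simp add: sqi_def)

lemma norm_add_sq_le: "(norm (a + b))\<^sup>2 \<le> 2 * (norm a)\<^sup>2 + 2 * (norm b)\<^sup>2" for a b :: "'a::real_normed_vector"
proof -
  have "(norm (a + b))\<^sup>2 \<le> (norm a + norm b)\<^sup>2" by (simp add: norm_triangle_ineq power_mono)
  also have "\<dots> \<le> 2 * (norm a)\<^sup>2 + 2 * (norm b)\<^sup>2"
    using sum_squares_bound[of "norm a" "norm b"] by (simp add: power2_sum)
  finally show ?thesis .
qed

lemma sqi_add: assumes "sqi f" "sqi g" shows "sqi (\<lambda>x. f x + g x)"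
proof (rule sqi_bound)
  show "integrable lborel (\<lambda>x. 2 * (cmod (f x))\<^sup>2 + 2 * (cmod (g x))\<^sup>2)"
    using assms by (auto simp: sqi_def)
  show "(\<lambda>x. f x + g x) \<in> borel_measurable borel" using assms by (auto simp: sqi_def)
qed (simp add: norm_add_sq_le)

lemma sqi_cmult: assumes "sqi f" shows "sqi (\<lambda>x. c * f x)"
  using assms by (auto simp: sqi_def norm_mult power_mult_distrib)

lemma sqi_uminus: assumes "sqi f" shows "sqi (\<lambda>x. - f x)"
  using assms by (auto simp: sqi_def)

lemma sqi_diff: assumes "sqi f" "sqi g" shows "sqi (\<lambda>x. f x - g x)"
  using sqi_add[OF assms(1) sqi_uminus[OF assms(2)]] by simp

lemma sqi_cong_norm:
  assumes "sqi f" "g \<in> borel_measurable borel" "\<And>x. cmod (g x) \<le> cmod (f x)"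
  shows "sqi g"
proof (rule sqi_bound)
  show "integrable lborel (\<lambda>x. (cmod (f x))\<^sup>2)" using assms(1) by (simp add: sqi_def)
qed (use assms(2,3) in \<open>auto intro: power_mono\<close>)

lemma sqi_cnj: "sqi f \<Longrightarrow> sqi (\<lambda>x. cnj (f x))"
  by (rule sqi_cong_norm, assumption, measurable) auto

lemma sqi_norm: "sqi f \<Longrightarrow> sqi (\<lambda>x. of_real (cmod (f x)))"
  by (rule sqi_cong_norm, assumption, measurable) auto

lemma sqi_indicator: "sqi f \<Longrightarrow> S \<in> sets borel \<Longrightarrow> sqi (\<lambda>x. indicator S x * f x)"
  by (rule sqi_cong_norm, assumption, measurable) (auto simp: indicator_def)

lemma sqi_affine: assumes "sqi f" "a \<noteq> 0" shows "sqi (\<lambda>x. f (b + a * x))"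
proof -
  have "integrable lborel (\<lambda>x. (cmod (f (b + a * x)))\<^sup>2)"
    using assms lborel_integrable_real_affine[of "\<lambda>x. (cmod (f x))\<^sup>2" a b] by (auto simp: sqi_def)
  moreover have "(\<lambda>x. f (b + a * x)) \<in> borel_measurable borel" using assms by (auto simp: sqi_def)
  ultimately show ?thesis by (simp add: sqi_def)
qed

lemma cmod_mult_le_sq: "cmod (a * b) \<le> (cmod a)\<^sup>2 + (cmod b)\<^sup>2"
proof -
  have "2 * (cmod a * cmod b) \<le> (cmod a)\<^sup>2 + (cmod b)\<^sup>2"
    using sum_squares_bound[of "cmod a" "cmod b"] by simp
  moreover have "0 \<le> (cmod a)\<^sup>2 + (cmod b)\<^sup>2" by simp
  ultimately show ?thesis unfolding norm_mult by linarith
qed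

lemma sqi_integrable_mult: assumes "sqi f" "sqi g" shows "integrable lborel (\<lambda>x. f x * g x)"
proof (rule Bochner_Integration.integrable_bound)
  show "integrable lborel (\<lambda>x. (cmod (f x))\<^sup>2 + (cmod (g x))\<^sup>2)"
    using assms by (auto simp: sqi_def)
  show "(\<lambda>x. f x * g x) \<in> borel_measurable lborel" using assms by (auto simp: sqi_def)
qed (auto simp: cmod_mult_le_sq)

lemma part_equivp_sqi: "part_equivp (\<lambda>f g. sqi f \<and> sqi g \<and> (AE x in lborel. f x = g x))"
proof (rule part_equivpI)
  show "\<exists>x. sqi x \<and> sqi x \<and> (AE xa in lborel. x xa = x xa)" using sqi_zero by blast
  show "symp (\<lambda>f g. sqi f \<and> sqi g \<and> (AE x in lborel. f x = g x))"
    by (auto simp: symp_def elim: eventually_mono)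
  show "transp (\<lambda>f g. sqi f \<and> sqi g \<and> (AE x in lborel. f x = g x))"
    unfolding transp_def
  proof (intro allI impI, elim conjE, intro conjI)
    fix f g h :: "real \<Rightarrow> complex"
    assume "AE x in lborel. f x = g x" "AE x in lborel. g x = h x"
    then show "AE x in lborel. f x = h x" by eventually_elim simp
  qed
qed

text \<open>The value \<open>mk f\<close> is unspecified unless \<open>f\<close> is square-integrable.\<close>

quotient_type ltwo = "real \<Rightarrow> complex" / partial: "\<lambda>f g. sqi f \<and> sqi g \<and> (AE x in lborel. f x = g x)"
  morphisms rep mk
  by (rule part_equivp_sqi)

lemma sqi_rep [simp]: "sqi (rep u)"
  using Quotient3_rep_reflp[OF Quotient3_ltwo] by blast

lemma rep_measurable [measurable]: "rep u \<in> borel_measurable borel"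
  using sqi_rep[of u] by (simp add: sqi_def)

lemma rep_mk: assumes "sqi f" shows "AE x in lborel. rep (mk f) x = f x"
proof -
  have "AE x in lborel. f x = rep (mk f) x"
    using rep_abs_rsp[OF Quotient3_ltwo, of f f] assms by simp
  then show ?thesis by eventually_elim simp
qed

lemma mk_rep [simp]: "mk (rep u) = u"
  using Quotient3_abs_rep[OF Quotient3_ltwo] .

lemma ltwo_eqI: "(AE x in lborel. rep u x = rep v x) \<Longrightarrow> u = v"
  using Quotient3_rel_rep[OF Quotient3_ltwo, of u v] by simp

lemma mk_eqI: assumes "sqi f" "AE x in lborel. f x = rep v x" shows "mk f = v"
proof (rule ltwo_eqI)
  show "AE x in lborel. rep (mk f) x = rep v x"
    using rep_mk[OF assms(1)] assms(2) by eventually_elim simp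
qed

instantiation ltwo :: real_vector
begin

definition "0 = mk (\<lambda>_. 0)"

definition "u + v = mk (\<lambda>x. rep u x + rep v x)"

definition "u - v = mk (\<lambda>x. rep u x - rep v x)"

definition "- u = mk (\<lambda>x. - rep u x)"

definition "c *\<^sub>R u = mk (\<lambda>x. of_real c * rep u x)"

lemma rep_zero: "AE x in lborel. rep 0 x = 0"
  unfolding zero_ltwo_def by (rule rep_mk) simp

lemma rep_plus: "AE x in lborel. rep (u + v) x = rep u x + rep v x"
  unfolding plus_ltwo_def by (rule rep_mk) (simp add: sqi_add)

lemma rep_minus: "AE x in lborel. rep (u - v) x = rep u x - rep v x"
  unfolding minus_ltwo_def by (rule rep_mk) (simp add: sqi_diff)

lemma rep_uminus: "AE x in lborel. rep (- u) x = - rep u x"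
  unfolding uminus_ltwo_def by (rule rep_mk) (simp add: sqi_uminus)

lemma rep_scaleR: "AE x in lborel. rep (c *\<^sub>R u) x = of_real c * rep u x"
  unfolding scaleR_ltwo_def by (rule rep_mk) (simp add: sqi_cmult)

instance
proof
  fix u v w :: ltwo and c d :: real
  show "u + v + w = u + (v + w)"
    by (rule ltwo_eqI) (use rep_plus[of "u+v" w] rep_plus[of u v] rep_plus[of u "v+w"] rep_plus[of v w] in eventually_elim, simp)
  show "u + v = v + u"
    by (rule ltwo_eqI) (use rep_plus[of u v] rep_plus[of v u] in eventually_elim, simp)
  show "0 + u = u"
    by (rule ltwo_eqI) (use rep_plus[of 0 u] rep_zero in eventually_elim, simp)
  show "- u + u = 0"
    by (rule ltwo_eqI) (use rep_plus[of "-u" u] rep_uminus[of u] rep_zero in eventually_elim, simp)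
  show "u - v = u + - v"
    by (rule ltwo_eqI) (use rep_plus[of u "- v"] rep_uminus[of v] rep_minus[of u v] in eventually_elim, simp)
  show "c *\<^sub>R (u + v) = c *\<^sub>R u + c *\<^sub>R v"
    by (rule ltwo_eqI) (use rep_plus[of u v] rep_plus[of "c *\<^sub>R u" "c *\<^sub>R v"] rep_scaleR[of c u] rep_scaleR[of c v] rep_scaleR[of c "u+v"] in eventually_elim, simp add: algebra_simps)
  show "(c + d) *\<^sub>R u = c *\<^sub>R u + d *\<^sub>R u"
    by (rule ltwo_eqI) (use rep_plus[of "c *\<^sub>R u" "d *\<^sub>R u"] rep_scaleR[of c u] rep_scaleR[of d u] rep_scaleR[of "c+d" u] in eventually_elim, simp add: algebra_simps)
  show "c *\<^sub>R d *\<^sub>R u = (c * d) *\<^sub>R u"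
    by (rule ltwo_eqI) (use rep_scaleR[of d u] rep_scaleR[of c "d *\<^sub>R u"] rep_scaleR[of "c*d" u] in eventually_elim, simp add: algebra_simps)
  show "1 *\<^sub>R u = u"
    by (rule ltwo_eqI) (use rep_scaleR[of 1 u] in eventually_elim, simp)
qed
end

section \<open>Complex inner product and scalar multiplication\<close>

text \<open>The norm of the type comes from the real part alone; the complex form is kept beside it
  because pairings with exponentials are complex numbers. It is recovered from the real form by also
  pairing with imaginary multiples.\<close>

definition cin :: "ltwo \<Rightarrow> ltwo \<Rightarrow> complex" where
  "cin u v = (LINT x|lborel. rep u x * cnj (rep v x))"

definition cscale :: "complex \<Rightarrow> ltwo \<Rightarrow> ltwo" (infixr "\<cdot>" 75) where
  "c \<cdot> u = mk (\<lambda>x. c * rep u x)"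

lemma rep_cscale: "AE x in lborel. rep (c \<cdot> u) x = c * rep u x"
  unfolding cscale_def by (rule rep_mk) (simp add: sqi_cmult)

lemma integrable_cin [simp]: "integrable lborel (\<lambda>x. rep u x * cnj (rep v x))"
  using sqi_integrable_mult[OF sqi_rep sqi_cnj[OF sqi_rep]] .

lemma cin_cong:
  assumes "AE x in lborel. rep u x * cnj (rep v x) = f x" "f \<in> borel_measurable borel"
  shows "cin u v = (LINT x|lborel. f x)"
  unfolding cin_def by (rule integral_cong_AE) (use assms in auto)

lemma cin_add_left: "cin (u + v) w = cin u w + cin v w"
proof -
  have "cin (u + v) w = (LINT x|lborel. rep u x * cnj (rep w x) + rep v x * cnj (rep w x))"
    by (rule cin_cong) (use rep_plus[of u v] in \<open>eventually_elim, simp add: algebra_simps\<close>, measurable)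
  then show ?thesis by (simp add: cin_def)
qed

lemma cin_cscale_left: "cin (c \<cdot> u) w = c * cin u w"
proof -
  have "cin (c \<cdot> u) w = (LINT x|lborel. c * (rep u x * cnj (rep w x)))"
    by (rule cin_cong) (use rep_cscale[of c u] in \<open>eventually_elim, simp add: algebra_simps\<close>, measurable)
  then show ?thesis by (simp add: cin_def)
qed

lemma cnj_cin: "cnj (cin u v) = cin v u"
proof -
  have "cnj (cin u v) = (LINT x|lborel. cnj (rep u x * cnj (rep v x)))"
    unfolding cin_def using integral_bounded_linear[OF bounded_linear_cnj integrable_cin] by simp
  then show ?thesis by (simp add: cin_def mult.commute)
qed

lemma scaleR_cscale: "c *\<^sub>R u = of_real c \<cdot> u"
  by (simp add: scaleR_ltwo_def cscale_def)

lemma uminus_cscale: "- u = (- 1) \<cdot> u"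
  by (simp add: uminus_ltwo_def cscale_def)

lemma cin_scaleR_left: "cin (c *\<^sub>R u) w = of_real c * cin u w"
  by (simp add: scaleR_cscale cin_cscale_left)

lemma cin_minus_left: "cin (- u) w = - cin u w"
  by (simp add: uminus_cscale cin_cscale_left)

lemma cin_diff_left: "cin (u - v) w = cin u w - cin v w"
  using cin_add_left[of u "- v" w] by (simp add: cin_minus_left)

lemma cin_zero_left [simp]: "cin 0 w = 0"
  using cin_diff_left[of 0 0 w] by simp

lemma cin_self: "cin u u = of_real (LINT x|lborel. (cmod (rep u x))\<^sup>2)"
proof -
  have "rep u x * cnj (rep u x) = complex_of_real ((cmod (rep u x))\<^sup>2)" for x
    by (simp only: complex_norm_square)
  then show ?thesis
    unfolding cin_def by (simp only: integral_complex_of_real)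
qed

instantiation ltwo :: real_inner
begin

definition "inner u v = Re (cin u v)"

definition "norm (u :: ltwo) = sqrt (inner u u)"

definition "dist u (v :: ltwo) = norm (u - v)"

definition "sgn (u :: ltwo) = u /\<^sub>R norm u"

definition [code del]: "(uniformity :: (ltwo \<times> ltwo) filter) = (INF e\<in>{0<..}. principal {(x, y). dist x y < e})"

definition [code del]: "open (U :: ltwo set) = (\<forall>x\<in>U. eventually (\<lambda>(x', y). x' = x \<longrightarrow> y \<in> U) uniformity)"

instance
proof
  fix u v w :: ltwo and c :: real and U :: "ltwo set"
  show "dist u v = norm (u - v)" by (simp add: dist_ltwo_def)
  show "sgn u = u /\<^sub>R norm u" by (simp add: sgn_ltwo_def)
  show "uniformity = (INF e\<in>{0<..}. principal {(x, y). dist x (y::ltwo) < e})" by (rule uniformity_ltwo_def)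
  show "open U = (\<forall>x\<in>U. eventually (\<lambda>(x', y). x' = x \<longrightarrow> y \<in> U) uniformity)" by (rule open_ltwo_def)
  show "norm u = sqrt (inner u u)" by (simp add: norm_ltwo_def)
  show "inner u v = inner v u" unfolding inner_ltwo_def by (metis cnj_cin cnj.simps(1))
  show "inner (u + v) w = inner u w + inner v w" by (simp add: inner_ltwo_def cin_add_left)
  show "inner (c *\<^sub>R u) w = c * inner u w" by (simp add: inner_ltwo_def cin_scaleR_left)
  show "0 \<le> inner u u" by (simp add: inner_ltwo_def cin_self)
  show "inner u u = 0 \<longleftrightarrow> u = 0"
  proof
    assume "inner u u = 0"
    then have "(LINT x|lborel. (cmod (rep u x))\<^sup>2) = 0" by (simp add: inner_ltwo_def cin_self)
    then have "AE x in lborel. (cmod (rep u x))\<^sup>2 = 0"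
      using sqi_rep[of u] by (subst (asm) integral_nonneg_eq_0_iff_AE) (auto simp: sqi_def)
    with rep_zero have "AE x in lborel. rep u x = rep 0 x" by eventually_elim simp
    then show "u = 0" by (rule ltwo_eqI)
  qed (simp add: inner_ltwo_def)
qed
end

lemma cin_self_norm: "cin u u = of_real ((norm u)\<^sup>2)"
  by (simp add: power2_norm_eq_inner inner_ltwo_def cin_self)

lemma norm_ltwo_sq: "(norm u)\<^sup>2 = (LINT x|lborel. (cmod (rep u x))\<^sup>2)"
  by (simp add: power2_norm_eq_inner inner_ltwo_def cin_self)

lemma cin_add_right: "cin w (u + v) = cin w u + cin w v"
  by (metis cin_add_left cnj_cin complex_cnj_add)

lemma cin_diff_right: "cin w (u - v) = cin w u - cin w v"
  by (metis cin_diff_left cnj_cin complex_cnj_diff)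

lemma cin_cscale_right: "cin w (c \<cdot> u) = cnj c * cin w u"
  by (metis cin_cscale_left cnj_cin complex_cnj_mult)

lemma cin_scaleR_right: "cin w (c *\<^sub>R u) = of_real c * cin w u"
  by (simp add: scaleR_cscale cin_cscale_right)

lemma cin_minus_right: "cin w (- u) = - cin w u"
  by (simp add: uminus_cscale cin_cscale_right)

lemma cin_zero_right [simp]: "cin w 0 = 0"
  using cin_diff_right[of w 0 0] by simp

lemma cin_sum_left: "cin (\<Sum>i\<in>I. u i) w = (\<Sum>i\<in>I. cin (u i) w)"
  by (induction I rule: infinite_finite_induct) (auto simp: cin_add_left)

lemma cin_sum_right: "cin w (\<Sum>i\<in>I. u i) = (\<Sum>i\<in>I. cin w (u i))"
  by (induction I rule: infinite_finite_induct) (auto simp: cin_add_right)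

lemma cscale_add_right: "c \<cdot> (u + v) = c \<cdot> u + c \<cdot> v"
  by (rule ltwo_eqI)
     (use rep_plus[of u v] rep_cscale[of c "u+v"] rep_cscale[of c u] rep_cscale[of c v] rep_plus[of "c \<cdot> u" "c \<cdot> v"] in eventually_elim,
      simp add: algebra_simps)

lemma cscale_cscale: "c \<cdot> d \<cdot> u = (c * d) \<cdot> u"
  by (rule ltwo_eqI) (use rep_cscale[of d u] rep_cscale[of c "d \<cdot> u"] rep_cscale[of "c * d" u] in eventually_elim, simp)

lemma cscale_one [simp]: "1 \<cdot> u = u"
  using scaleR_cscale[of 1 u] by simp

lemma cscale_add_left: "(c + d) \<cdot> u = c \<cdot> u + d \<cdot> u"
  by (rule ltwo_eqI)
     (use rep_cscale[of "c+d" u] rep_cscale[of c u] rep_cscale[of d u] rep_plus[of "c \<cdot> u" "d \<cdot> u"] in eventually_elim,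
      simp add: algebra_simps)

lemma cscale_zero_left [simp]: "0 \<cdot> u = 0"
  using scaleR_cscale[of 0 u] by simp

lemma cscale_zero_right [simp]: "c \<cdot> 0 = 0"
  using cscale_add_right[of c 0 0] by simp

lemma cscale_sum_right: "c \<cdot> (\<Sum>i\<in>I. u i) = (\<Sum>i\<in>I. c \<cdot> u i)"
  by (induction I rule: infinite_finite_induct) (auto simp: cscale_add_right)

lemma norm_cscale: "norm (c \<cdot> u) = cmod c * norm u"
proof -
  have "(norm (c \<cdot> u))\<^sup>2 = Re (c * cnj c * cin u u)"
    unfolding power2_norm_eq_inner inner_ltwo_def by (simp add: cin_cscale_left cin_cscale_right algebra_simps)
  also have "\<dots> = (cmod c * norm u)\<^sup>2"
    by (simp add: cin_self_norm power_mult_distrib flip: complex_norm_square)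
  finally show ?thesis by (simp add: power2_eq_iff_nonneg)
qed

lemma norm_cin_le: "cmod (cin u v) \<le> norm u * norm v"
proof -
  \<comment> \<open>Rotating \<open>u\<close> by this phase makes the pairing real and nonnegative,
    so the real Cauchy-Schwarz inequality sees its full modulus.\<close>
  define c where "c = cis (- Arg (cin u v))"
  have "c * cin u v = of_real (cmod (cin u v))"
  proof -
    have "c * rcis (cmod (cin u v)) (Arg (cin u v)) = of_real (cmod (cin u v))"
      by (simp add: c_def rcis_def cis_mult mult.left_commute)
    then show ?thesis by (simp only: rcis_cmod_Arg)
  qed
  then have "cmod (cin u v) = inner (c \<cdot> u) v" by (simp add: inner_ltwo_def cin_cscale_left)
  also have "\<dots> \<le> norm (c \<cdot> u) * norm v" by (rule norm_cauchy_schwarz)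
  also have "\<dots> = norm u * norm v" by (simp add: norm_cscale c_def)
  finally show ?thesis .
qed

lemma cin_mk:
  assumes "sqi f" "sqi g"
  shows "cin (mk f) (mk g) = (LINT x|lborel. f x * cnj (g x))"
proof (rule cin_cong)
  show "AE x in lborel. rep (mk f) x * cnj (rep (mk g) x) = f x * cnj (g x)"
    using rep_mk[OF assms(1)] rep_mk[OF assms(2)] by eventually_elim simp
  show "(\<lambda>x. f x * cnj (g x)) \<in> borel_measurable borel"
    using assms[THEN sqi_measurable] by measurable
qed

lemma cin_mk_right: "sqi g \<Longrightarrow> cin u (mk g) = (LINT x|lborel. rep u x * cnj (g x))"
  using cin_mk[OF sqi_rep] by simp

lemma cin_mk_left: "sqi f \<Longrightarrow> cin (mk f) v = (LINT x|lborel. f x * cnj (rep v x))"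
  using cin_mk[OF _ sqi_rep] by simp

lemma norm_mk_sq: "sqi f \<Longrightarrow> (norm (mk f))\<^sup>2 = (LINT x|lborel. (cmod (f x))\<^sup>2)"
  unfolding norm_ltwo_sq
  by (rule integral_cong_AE) (use rep_mk[of f] in \<open>auto simp: sqi_def elim: eventually_mono\<close>)

lemma nn_integral_rep_sq: "(\<integral>\<^sup>+x. ennreal ((cmod (rep u x))\<^sup>2) \<partial>lborel) = ennreal ((norm u)\<^sup>2)"
  unfolding norm_ltwo_sq using sqi_rep[of u] by (intro nn_integral_eq_integral) (auto simp: sqi_def)

lemma sqi_nn_integral:
  assumes [measurable]: "f \<in> borel_measurable borel"
    and "(\<integral>\<^sup>+x. ennreal ((cmod (f x))\<^sup>2) \<partial>lborel) \<le> ennreal (c\<^sup>2)" "c \<ge> 0"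
  shows "sqi f" "norm (mk f) \<le> c"
proof -
  show "sqi f" unfolding sqi_def
    using assms(2) by (auto intro!: integrableI_bounded simp: le_less_trans[OF _ ennreal_less_top])
  then have "(\<integral>\<^sup>+x. ennreal ((cmod (f x))\<^sup>2) \<partial>lborel) = ennreal ((norm (mk f))\<^sup>2)"
    unfolding norm_mk_sq[OF \<open>sqi f\<close>] by (intro nn_integral_eq_integral) (auto simp: sqi_def)
  with assms(2) have "(norm (mk f))\<^sup>2 \<le> c\<^sup>2" by simp
  then show "norm (mk f) \<le> c" using assms(3) by (rule power2_le_imp_le)
qed

section \<open>Completeness\<close>

text \<open>The triangle inequality applied to the moduli of the increments: the norms sum to at
  most 2, whence the square 4. The bound is independent of \<open>n\<close>, as monotone convergence
  requires.\<close>

lemma norm_sum_abs_le: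
  fixes d :: "nat \<Rightarrow> ltwo"
  assumes "\<And>k. norm (d k) \<le> (1/2)^k"
  shows "(\<integral>\<^sup>+x. ennreal ((\<Sum>k<n. cmod (rep (d k) x))\<^sup>2) \<partial>lborel) \<le> 4"
proof -
  define a where "a k = mk (\<lambda>x. of_real (cmod (rep (d k) x)))" for k
  have na: "norm (a k) = norm (d k)" for k
  proof -
    have "(norm (a k))\<^sup>2 = (norm (d k))\<^sup>2"
      unfolding a_def norm_mk_sq[OF sqi_norm[OF sqi_rep]] by (simp add: norm_ltwo_sq)
    then show ?thesis by (simp add: power2_eq_iff_nonneg)
  qed
  have rs: "AE x in lborel. rep (\<Sum>k<n. a k) x = of_real (\<Sum>k<n. cmod (rep (d k) x))" for n
  proof (induction n)
    case 0 then show ?case using rep_zero by eventually_elim simp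
  next
    case (Suc n)
    have "AE x in lborel. rep (a n) x = of_real (cmod (rep (d n) x))"
      unfolding a_def by (rule rep_mk) (simp add: sqi_norm)
    with Suc rep_plus[of "\<Sum>k<n. a k" "a n"] show ?case by eventually_elim simp
  qed
  have "(\<integral>\<^sup>+x. ennreal ((\<Sum>k<n. cmod (rep (d k) x))\<^sup>2) \<partial>lborel) = (\<integral>\<^sup>+x. ennreal ((cmod (rep (\<Sum>k<n. a k) x))\<^sup>2) \<partial>lborel)"
    by (rule nn_integral_cong_AE) (use rs[of n] in \<open>eventually_elim, simp add: norm_of_real del: of_real_sum\<close>)
  also have "\<dots> = ennreal ((norm (\<Sum>k<n. a k))\<^sup>2)" by (rule nn_integral_rep_sq)
  also have "\<dots> \<le> ennreal (2\<^sup>2)"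
  proof (rule ennreal_leI, rule power_mono)
    have "norm (\<Sum>k<n. a k) \<le> (\<Sum>k<n. (1/2)^k)"
      by (rule order_trans[OF norm_sum sum_mono]) (simp add: na assms)
    also have "\<dots> \<le> 2" by (simp add: sum_gp_strict)
    finally show "norm (\<Sum>k<n. a k) \<le> 2" .
  qed simp
  finally show ?thesis by simp
qed

text \<open>The pointwise half of the Riesz-Fischer theorem: by monotone convergence the sum of the
  moduli of the increments is square integrable, hence finite almost everywhere, and there the
  telescoping series converges absolutely.\<close>

lemma Cauchy_ltwo_AE_subseq:
  fixes Y :: "nat \<Rightarrow> ltwo"
  assumes "\<And>k. norm (Y (Suc k) - Y k) \<le> (1/2)^k"
  shows "AE x in lborel. convergent (\<lambda>n. rep (Y n) x)"
proof -
  define d where "d k = Y (Suc k) - Y k" for k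
  define G where "G n x = (\<Sum>k<n. cmod (rep (d k) x))" for n x
  have [measurable]: "G n \<in> borel_measurable borel" for n unfolding G_def by measurable
  have G0: "0 \<le> G n x" for n x by (simp add: G_def sum_nonneg)
  have Gm: "G n x \<le> G (Suc n) x" for n x by (simp add: G_def)
  have "(\<integral>\<^sup>+x. (SUP n. ennreal ((G n x)\<^sup>2)) \<partial>lborel) = (SUP n. \<integral>\<^sup>+x. ennreal ((G n x)\<^sup>2) \<partial>lborel)"
  proof (rule nn_integral_monotone_convergence_SUP)
    show "incseq (\<lambda>n x. ennreal ((G n x)\<^sup>2))"
      by (rule incseq_SucI) (auto simp: le_fun_def intro!: ennreal_leI power_mono Gm G0)
  qed measurable
  also have "\<dots> \<le> 4" by (rule SUP_least) (use assms in \<open>simp add: G_def norm_sum_abs_le d_def\<close>)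
  finally have "(\<integral>\<^sup>+x. (SUP n. ennreal ((G n x)\<^sup>2)) \<partial>lborel) \<noteq> \<infinity>"
    by (auto simp: top_unique)
  then have fin: "AE x in lborel. (SUP n. ennreal ((G n x)\<^sup>2)) \<noteq> \<infinity>"
    by (intro nn_integral_PInf_AE) measurable
  have "AE x in lborel. \<forall>k. rep (d k) x = rep (Y (Suc k)) x - rep (Y k) x"
    unfolding AE_all_countable d_def using rep_minus by blast
  with fin show ?thesis
  proof eventually_elim
    case (elim x)
    then obtain b where b: "(SUP n. ennreal ((G n x)\<^sup>2)) = ennreal b" "b \<ge> 0"
      by (metis ennreal_cases infinity_ennreal_def)
    have "G n x \<le> sqrt b" for n
    proof -
      have "ennreal ((G n x)\<^sup>2) \<le> ennreal b" unfolding b(1)[symmetric] by (rule SUP_upper) simp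
      then show ?thesis using b(2) by (intro real_le_rsqrt) simp
    qed
    then have "summable (\<lambda>k. cmod (rep (d k) x))"
      by (intro bounded_imp_summable[of _ "sqrt b"]) (auto simp: G_def lessThan_Suc_atMost[symmetric] simp del: sum.lessThan_Suc)
    then have "summable (\<lambda>k. rep (d k) x)" by (rule summable_norm_cancel)
    then have "convergent (\<lambda>n. rep (Y 0) x + (\<Sum>k<n. rep (d k) x))"
      by (intro convergent_add convergent_const) (simp add: summable_iff_convergent)
    moreover have "rep (Y 0) x + (\<Sum>k<n. rep (d k) x) = rep (Y n) x" for n
      by (induction n) (simp_all only: lessThan_0 sum.empty add_0_right sum.lessThan_Suc add.assoc[symmetric] elim(2), simp)
    ultimately show ?case by simp
  qed
qed

instance ltwo :: complete_space
proof
  fix X :: "nat \<Rightarrow> ltwo" assume X: "Cauchy X"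
  have "\<exists>r::nat\<Rightarrow>nat. strict_mono r \<and> (\<forall>n. \<forall>m\<ge>r n. norm (X m - X (r n)) \<le> (1/2)^n)"
  proof -
    have ex: "\<exists>N. \<forall>m\<ge>N. \<forall>k\<ge>N. norm (X m - X k) < (1/2)^n" for n
      using CauchyD[OF X, of "(1/2)^n"] by simp
    then obtain N where N: "\<And>n m k. m \<ge> N n \<Longrightarrow> k \<ge> N n \<Longrightarrow> norm (X m - X k) < (1/2)^n" by metis
    \<comment> \<open>Partial sums of \<open>Suc (N i)\<close> are strictly increasing and dominate
      every \<open>N n\<close>.\<close>
    define r where "r n = (\<Sum>i\<le>n. Suc (N i))" for n
    have "strict_mono r" by (simp add: strict_mono_Suc_iff r_def)
    moreover have "N n \<le> r n" for n
      using sum_mono2[of "{..n}" "{n}" "\<lambda>i. Suc (N i)"] by (simp add: r_def)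
    ultimately show ?thesis using N by (meson less_imp_le order.trans)
  qed
  then obtain r where r: "strict_mono r" "\<And>n m. m \<ge> r n \<Longrightarrow> norm (X m - X (r n)) \<le> (1/2)^n" by blast
  define Y where "Y n = X (r n)" for n
  have Y: "norm (Y m - Y n) \<le> (1/2)^n" if "m \<ge> n" for m n
    using r(2)[of n "r m"] that r(1) by (simp add: Y_def strict_mono_less_eq)
  define f where "f x = lim (\<lambda>n. rep (Y n) x)" for x
  have [measurable]: "f \<in> borel_measurable borel"
    unfolding f_def by (rule borel_measurable_lim_metric) measurable
  have "AE x in lborel. convergent (\<lambda>n. rep (Y n) x)"
    by (rule Cauchy_ltwo_AE_subseq) (simp add: Y)
  then have lim: "AE x in lborel. (\<lambda>n. rep (Y n) x) \<longlonglongrightarrow> f x"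
    by eventually_elim (simp add: f_def convergent_LIMSEQ_iff)
  \<comment> \<open>Fatou's lemma along \<open>m\<close> compares the pointwise limit with
    \<open>Y n\<close>; it yields both square integrability of the difference and the rate.\<close>
  have key: "(\<integral>\<^sup>+x. ennreal ((cmod (f x - rep (Y n) x))\<^sup>2) \<partial>lborel) \<le> ennreal (((1/2)^n)\<^sup>2)" for n
  proof -
    have "(\<integral>\<^sup>+x. ennreal ((cmod (f x - rep (Y n) x))\<^sup>2) \<partial>lborel) =
      (\<integral>\<^sup>+x. liminf (\<lambda>m. ennreal ((cmod (rep (Y m) x - rep (Y n) x))\<^sup>2)) \<partial>lborel)"
    proof (rule nn_integral_cong_AE, use lim in eventually_elim)
      case (elim x)
      then have "(\<lambda>m. ennreal ((cmod (rep (Y m) x - rep (Y n) x))\<^sup>2)) \<longlonglongrightarrow> ennreal ((cmod (f x - rep (Y n) x))\<^sup>2)"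
        by (intro tendsto_intros)
      then show ?case by (rule lim_imp_Liminf[OF sequentially_bot, symmetric])
    qed
    also have "\<dots> \<le> liminf (\<lambda>m. \<integral>\<^sup>+x. ennreal ((cmod (rep (Y m) x - rep (Y n) x))\<^sup>2) \<partial>lborel)"
      by (rule nn_integral_liminf) measurable
    also have "\<dots> = liminf (\<lambda>m. ennreal ((norm (Y m - Y n))\<^sup>2))"
    proof -
      have "(\<integral>\<^sup>+x. ennreal ((cmod (rep (Y m) x - rep (Y n) x))\<^sup>2) \<partial>lborel) = ennreal ((norm (Y m - Y n))\<^sup>2)" for m
        unfolding nn_integral_rep_sq[symmetric]
        by (rule nn_integral_cong_AE) (use rep_minus[of "Y m" "Y n"] in \<open>eventually_elim, simp\<close>)
      then show ?thesis by simp
    qed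
    also have "\<dots> \<le> ennreal (((1/2)^n)\<^sup>2)"
    proof (rule Liminf_le)
      show "eventually (\<lambda>m. ennreal ((norm (Y m - Y n))\<^sup>2) \<le> ennreal (((1/2)^n)\<^sup>2)) sequentially"
        using eventually_ge_at_top[of n]
        by eventually_elim (auto intro!: ennreal_leI power_mono Y)
    qed simp
    finally show ?thesis .
  qed
  have sd: "sqi (\<lambda>x. f x - rep (Y n) x)" "norm (mk (\<lambda>x. f x - rep (Y n) x)) \<le> (1/2)^n" for n
    by (rule sqi_nn_integral[OF _ key], measurable)+
  have sf: "sqi f" using sqi_add[OF sd(1)[of 0] sqi_rep[of "Y 0"]] by simp
  have "norm (Y n - mk f) \<le> (1/2)^n" for n
  proof -
    have "mk (\<lambda>x. f x - rep (Y n) x) = mk f - Y n"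
      by (rule mk_eqI[OF sd(1)]) (use rep_minus[of "mk f" "Y n"] rep_mk[OF sf] in \<open>eventually_elim, simp\<close>)
    then show ?thesis using sd(2)[of n] by (simp add: norm_minus_commute)
  qed
  then have "Y \<longlonglongrightarrow> mk f"
    using tendsto_0_le[of "\<lambda>n. (1/2::real)^n" sequentially "\<lambda>n. Y n - mk f" 1] LIMSEQ_power_zero[of "1/2::real"]
    by (simp add: LIM_zero_cancel always_eventually)
  then have "X \<longlonglongrightarrow> mk f"
    using Cauchy_converges_subseq[OF X r(1), of "mk f"] by (simp add: Y_def[abs_def] o_def)
  then show "convergent X" by (auto simp: convergent_def)
qed

section \<open>Coercive operators and representation of functionals\<close>

text \<open>The Lax-Milgram argument: a solution is a fixed point of
  \<open>u - \<tau> *\<^sub>R (S u - h)\<close>, and coercivity makes this map a contraction for a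
  small step.\<close>

lemma coercive_imp_surj:
  fixes S :: "'a::{real_inner,complete_space} \<Rightarrow> 'a"
  assumes S: "bounded_linear S" and c: "c > 0" "\<And>u. inner (S u) u \<ge> c * (norm u)\<^sup>2"
  shows "\<exists>u. S u = h"
proof -
  interpret bounded_linear S by fact
  obtain K0 where K0: "\<And>u. norm (S u) \<le> norm u * K0" "K0 > 0" using pos_bounded by blast
  \<comment> \<open>Raising the operator bound to at least \<open>c\<close> keeps
    \<open>1 - c\<^sup>2 / K\<^sup>2\<close> nonnegative.\<close>
  define K where "K = max K0 c"
  have K: "K > 0" "c \<le> K" using c by (auto simp: K_def)
  have bd: "norm (S u) \<le> K * norm u" for u
  proof -
    have "norm u * K0 \<le> norm u * K" by (intro mult_left_mono) (auto simp: K_def)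
    then show ?thesis using K0(1)[of u] by (simp add: mult.commute)
  qed
  \<comment> \<open>This step minimises
    \<open>1 - 2 * \<tau> * c + \<tau>\<^sup>2 * K\<^sup>2\<close>, and the minimum is
    \<open>q\<^sup>2\<close>.\<close>
  define \<tau> where "\<tau> = c / K\<^sup>2"
  define q where "q = sqrt (1 - c\<^sup>2 / K\<^sup>2)"
  have q: "0 \<le> q" "q < 1" "q\<^sup>2 = 1 - c\<^sup>2 / K\<^sup>2"
  proof -
    have "c\<^sup>2 \<le> K\<^sup>2" using K c by (intro power_mono) auto
    then have "0 \<le> 1 - c\<^sup>2 / K\<^sup>2" using K by simp
    moreover have "1 - c\<^sup>2 / K\<^sup>2 < 1" using K c by simp
    ultimately show "0 \<le> q" "q < 1" "q\<^sup>2 = 1 - c\<^sup>2 / K\<^sup>2" by (simp_all add: q_def)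
  qed
  have contr: "norm (d - \<tau> *\<^sub>R S d) \<le> q * norm d" for d
  proof -
    have "(norm (d - \<tau> *\<^sub>R S d))\<^sup>2 = (norm d)\<^sup>2 - 2 * \<tau> * inner (S d) d + \<tau>\<^sup>2 * (norm (S d))\<^sup>2"
      unfolding power2_norm_eq_inner
      by (simp add: inner_diff_left inner_diff_right algebra_simps inner_commute[of d "S d"] power2_eq_square)
    also have "\<dots> \<le> (norm d)\<^sup>2 - 2 * \<tau> * (c * (norm d)\<^sup>2) + \<tau>\<^sup>2 * (K * norm d)\<^sup>2"
    proof -
      have "2 * \<tau> * (c * (norm d)\<^sup>2) \<le> 2 * \<tau> * inner (S d) d"
        by (rule mult_left_mono[OF c(2)]) (use c K in \<open>simp add: \<tau>_def\<close>)
      moreover have "\<tau>\<^sup>2 * (norm (S d))\<^sup>2 \<le> \<tau>\<^sup>2 * (K * norm d)\<^sup>2"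
        by (rule mult_left_mono[OF power_mono[OF bd]]) auto
      ultimately show ?thesis by linarith
    qed
    also have "\<dots> = (1 - c\<^sup>2 / K\<^sup>2) * (norm d)\<^sup>2"
    proof -
      have "\<tau>\<^sup>2 * (K * norm d)\<^sup>2 = \<tau> * c * (norm d)\<^sup>2"
        using K by (simp add: \<tau>_def power2_eq_square)
      moreover have "c\<^sup>2 / K\<^sup>2 = \<tau> * c" by (simp add: \<tau>_def power2_eq_square)
      ultimately show ?thesis by (simp add: algebra_simps)
    qed
    also have "\<dots> = (q * norm d)\<^sup>2" by (simp add: power_mult_distrib q(3))
    finally show ?thesis by (rule power2_le_imp_le) (use q(1) in simp)
  qed
  have "\<exists>!u. u - \<tau> *\<^sub>R (S u - h) = u"
  proof (rule banach_fix_type[OF q(1,2)], intro allI)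
    fix x y
    have "(x - \<tau> *\<^sub>R (S x - h)) - (y - \<tau> *\<^sub>R (S y - h)) = (x - y) - \<tau> *\<^sub>R S (x - y)"
      by (simp add: diff algebra_simps)
    then show "dist (x - \<tau> *\<^sub>R (S x - h)) (y - \<tau> *\<^sub>R (S y - h)) \<le> q * dist x y"
      unfolding dist_norm using contr[of "x - y"] by metis
  qed
  then obtain u where u: "u - \<tau> *\<^sub>R (S u - h) = u" by blast
  have "\<tau> *\<^sub>R (S u - h) = u - (u - \<tau> *\<^sub>R (S u - h))" by (simp only: diff_diff_eq2 add_diff_cancel_left')
  also have "\<dots> = 0" by (simp only: u diff_self)
  finally have "\<tau> *\<^sub>R (S u - h) = 0" .
  then show ?thesis using c K by (auto simp: \<tau>_def)
qed

section \<open>From strict positivity to coercivity\<close>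

definition orthonormal :: "'a::real_inner set \<Rightarrow> bool" where
  "orthonormal E \<longleftrightarrow> finite E \<and> (\<forall>e\<in>E. norm e = 1) \<and> (\<forall>e\<in>E. \<forall>f\<in>E. e \<noteq> f \<longrightarrow> inner e f = 0)"

definition perp_part :: "'a::real_inner set \<Rightarrow> 'a \<Rightarrow> 'a" where
  "perp_part E u = u - (\<Sum>e\<in>E. inner u e *\<^sub>R e)"

lemma bounded_linear_perp_part: "bounded_linear (perp_part E)"
  unfolding perp_part_def
  by (rule bounded_linear_sub[OF bounded_linear_ident], rule bounded_linear_sum)
     (rule bounded_linear_compose[OF bounded_linear_scaleR_left bounded_linear_inner_left])

lemma inner_perp_part:
  assumes "orthonormal E" "f \<in> E" shows "inner (perp_part E u) f = 0"
proof -
  have "(\<Sum>e\<in>E. inner u e * inner e f) = (\<Sum>e\<in>E. if e = f then inner u f else 0)"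
    using assms by (intro sum.cong) (auto simp: orthonormal_def norm_eq_1)
  then show ?thesis
    using assms by (simp add: perp_part_def inner_diff_left inner_sum_left orthonormal_def)
qed

lemma inner_perp_part_perp:
  assumes "\<And>e. e \<in> E \<Longrightarrow> inner w e = 0" shows "inner (perp_part E u) w = inner u w"
proof -
  have "inner e w = 0" if "e \<in> E" for e using assms[OF that] by (simp add: inner_commute)
  then show ?thesis by (simp add: perp_part_def inner_diff_left inner_sum_left)
qed

lemma norm_perp_part:
  assumes "orthonormal E"
  shows "(norm u)\<^sup>2 = (norm (perp_part E u))\<^sup>2 + (norm (u - perp_part E u))\<^sup>2"
    and "inner (perp_part E u) (u - perp_part E u) = 0"
proof -
  have "inner (perp_part E u) u = inner u (perp_part E u)" by (rule inner_commute)
  moreover have "inner (perp_part E u) (perp_part E u) = inner u (perp_part E u)"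
    by (rule inner_perp_part_perp) (use inner_perp_part[OF assms] in auto)
  ultimately show *: "inner (perp_part E u) (u - perp_part E u) = 0"
    by (simp add: inner_diff_right)
  have "(norm (perp_part E u + (u - perp_part E u)))\<^sup>2 = (norm (perp_part E u))\<^sup>2 + (norm (u - perp_part E u))\<^sup>2"
    using * unfolding power2_norm_eq_inner inner_add_left inner_add_right by (simp add: inner_commute)
  then show "(norm u)\<^sup>2 = (norm (perp_part E u))\<^sup>2 + (norm (u - perp_part E u))\<^sup>2" by simp
qed

text \<open>A Schur complement. Correcting \<open>e\<close> by some \<open>w\<close> orthogonal to
  \<open>insert e E\<close> produces \<open>v\<close> with \<open>S v\<close> orthogonal to that
  whole complement. In the decomposition \<open>u = z + t *\<^sub>R v\<close> the cross terms
  vanish, leaving a coercive form in \<open>z\<close> and the positive number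
  \<open>inner (S v) v\<close> for the one new direction.\<close>

lemma coercive_codim_one:
  fixes S :: "'a::{real_inner,complete_space} \<Rightarrow> 'a"
  assumes S: "bounded_linear S" and sym: "\<And>u v. inner (S u) v = inner u (S v)"
    and pos: "\<And>u. u \<noteq> 0 \<Longrightarrow> inner (S u) u > 0"
    and E: "orthonormal (insert e E)" "e \<notin> E"
    and c: "c > 0" "\<And>u. (\<And>f. f \<in> insert e E \<Longrightarrow> inner u f = 0) \<Longrightarrow> inner (S u) u \<ge> c * (norm u)\<^sup>2"
  shows "\<exists>c'>0. \<forall>u. (\<forall>f\<in>E. inner u f = 0) \<longrightarrow> inner (S u) u \<ge> c' * (norm u)\<^sup>2"
proof -
  interpret S: bounded_linear S by fact
  let ?F = "insert e E"
  interpret P: bounded_linear "perp_part ?F" by (rule bounded_linear_perp_part)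
  define P where "P = perp_part ?F"
  \<comment> \<open>The compression of \<open>S\<close> to the orthogonal complement of
    \<open>?F\<close>, completed by the identity so that it is coercive on the whole space and
    surjectivity applies.\<close>
  define S' where "S' u = P (S (P u)) + (u - P u)" for u
  have Pbl: "bounded_linear P" unfolding P_def by (rule bounded_linear_perp_part)
  have blS': "bounded_linear S'"
    unfolding S'_def
    by (intro bounded_linear_add bounded_linear_sub bounded_linear_ident Pbl bounded_linear_compose[OF Pbl] bounded_linear_compose[OF S])
  have P0: "inner (P u) f = 0" if "f \<in> ?F" for u f using inner_perp_part[OF E(1) that] by (simp add: P_def)
  have Pw: "inner (P u) w = inner u w" if "\<And>f. f \<in> ?F \<Longrightarrow> inner w f = 0" for u w
    unfolding P_def by (rule inner_perp_part_perp[OF that])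
  have nP: "(norm u)\<^sup>2 = (norm (P u))\<^sup>2 + (norm (u - P u))\<^sup>2" "inner (P u) (u - P u) = 0" for u
    unfolding P_def by (rule norm_perp_part[OF E(1)])+
  have co: "inner (S' u) u \<ge> min c 1 * (norm u)\<^sup>2" for u
  proof -
    have "inner (P (S (P u))) u = inner (S (P u)) (P u)"
    proof -
      have "inner (P (S (P u))) u = inner (P u) (P (S (P u)))"
        using Pw[OF P0, of u "S (P u)"] by (metis inner_commute)
      also have "\<dots> = inner (P (S (P u))) (P u)" by (rule inner_commute)
      also have "\<dots> = inner (S (P u)) (P u)" by (rule Pw) (rule P0)
      finally show ?thesis .
    qed
    moreover have "inner (u - P u) u = (norm (u - P u))\<^sup>2"
    proof -
      have "inner (u - P u) (P u + (u - P u)) = (norm (u - P u))\<^sup>2"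
        using nP(2)[of u] unfolding inner_add_right power2_norm_eq_inner by (simp add: inner_commute)
      then show ?thesis by simp
    qed
    ultimately have "inner (S' u) u = inner (S (P u)) (P u) + (norm (u - P u))\<^sup>2"
      by (simp add: S'_def inner_add_left)
    also have "\<dots> \<ge> min c 1 * (norm (P u))\<^sup>2 + min c 1 * (norm (u - P u))\<^sup>2"
    proof (rule add_mono)
      have "min c 1 * (norm (P u))\<^sup>2 \<le> c * (norm (P u))\<^sup>2" by (intro mult_right_mono) auto
      also have "\<dots> \<le> inner (S (P u)) (P u)" by (rule c(2)) (rule P0)
      finally show "min c 1 * (norm (P u))\<^sup>2 \<le> inner (S (P u)) (P u)" .
      show "min c 1 * (norm (u - P u))\<^sup>2 \<le> (norm (u - P u))\<^sup>2"
        using mult_right_mono[of "min c 1" 1 "(norm (u - P u))\<^sup>2"] by simp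
    qed
    finally show ?thesis by (simp add: nP(1)[of u] algebra_simps)
  qed
  \<comment> \<open>On the complement this equation says that \<open>S (P w0)\<close> and
    \<open>S e\<close> have the same component, which is the orthogonality
    \<open>vS\<close>.\<close>
  obtain w0 where w0: "S' w0 = P (S e)"
    using coercive_imp_surj[OF blS' _ co, of "P (S e)"] c(1) by auto
  define w where "w = P w0"
  define v where "v = e - w"
  have wperp: "inner w f = 0" if "f \<in> ?F" for f using P0[OF that] by (simp add: w_def)
  have e1: "inner e e = 1" using E by (simp add: orthonormal_def norm_eq_1)
  have eE: "inner e f = 0" if "f \<in> E" for f
    using E that unfolding orthonormal_def by auto
  have vS: "inner (S v) z = 0" if z: "\<And>f. f \<in> ?F \<Longrightarrow> inner z f = 0" for z
  proof -
    have zP: "P z = z"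
      using z unfolding P_def perp_part_def by simp
    have "inner (S' w0) z = inner (S w) z + inner (w0 - P w0) z"
      using Pw[of z "S (P w0)"] z by (simp add: S'_def inner_add_left w_def)
    moreover have "inner (w0 - P w0) z = 0"
      using Pw[OF z, of w0] by (simp add: inner_diff_left)
    moreover have "inner (P (S e)) z = inner (S e) z" by (rule Pw) (rule z)
    ultimately show ?thesis using w0 by (simp add: v_def S.diff inner_diff_left)
  qed
  have "inner v e = 1" using wperp[of e] e1 by (simp add: v_def inner_diff_left)
  then have v0: "v \<noteq> 0" by auto
  define b where "b = inner (S v) v"
  have b: "b > 0" using pos[OF v0] by (simp add: b_def)
  \<comment> \<open>The halves pay for the factors 2 in the estimate of the squared norm of
    \<open>z + t *\<^sub>R v\<close>; each entry of the minimum serves one of the two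
    summands.\<close>
  define c' where "c' = min (c/2) (b / (2 * (norm v)\<^sup>2))"
  have "c' > 0" using b v0 c(1) by (simp add: c'_def)
  moreover have "inner (S u) u \<ge> c' * (norm u)\<^sup>2" if u: "\<forall>f\<in>E. inner u f = 0" for u
  proof -
    define t where "t = inner u e"
    define z where "z = (u - t *\<^sub>R e) + t *\<^sub>R w"
    have zp: "inner z f = 0" if "f \<in> ?F" for f
      using that u eE wperp[OF that] e1 by (auto simp: z_def t_def inner_add_left inner_diff_left)
    have uz: "u = z + t *\<^sub>R v" by (simp add: z_def v_def algebra_simps)
    have "inner (S u) u = inner (S z) z + t\<^sup>2 * b"
      using vS[OF zp] sym[of z v]
      by (simp add: uz S.add S.scaleR inner_add_left inner_add_right b_def power2_eq_square inner_commute[of z "S v"])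
    moreover have "c * (norm z)\<^sup>2 \<le> inner (S z) z" by (rule c(2)) (rule zp)
    moreover have "c' * (norm u)\<^sup>2 \<le> c * (norm z)\<^sup>2 + t\<^sup>2 * b"
    proof -
      have "(norm u)\<^sup>2 \<le> 2 * (norm z)\<^sup>2 + 2 * (norm (t *\<^sub>R v))\<^sup>2"
      proof -
        have "(norm u)\<^sup>2 \<le> (norm z + norm (t *\<^sub>R v))\<^sup>2"
          unfolding uz by (intro power_mono norm_triangle_ineq) simp
        also have "\<dots> \<le> 2 * (norm z)\<^sup>2 + 2 * (norm (t *\<^sub>R v))\<^sup>2"
          using sum_squares_bound[of "norm z" "norm (t *\<^sub>R v)"] by (simp only: power2_sum)
        finally show ?thesis .
      qed
      then have "c' * (norm u)\<^sup>2 \<le> c' * (2 * (norm z)\<^sup>2 + 2 * (norm (t *\<^sub>R v))\<^sup>2)"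
        using \<open>c' > 0\<close> by (intro mult_left_mono) auto
      also have "\<dots> = c' * (2 * (norm z)\<^sup>2) + c' * (2 * (t\<^sup>2 * (norm v)\<^sup>2))"
        by (simp add: power_mult_distrib distrib_left)
      also have "c' * (2 * (norm z)\<^sup>2) \<le> c/2 * (2 * (norm z)\<^sup>2)"
        by (intro mult_right_mono) (auto simp: c'_def)
      also have "c' * (2 * (t\<^sup>2 * (norm v)\<^sup>2)) \<le> (b / (2 * (norm v)\<^sup>2)) * (2 * (t\<^sup>2 * (norm v)\<^sup>2))"
        by (intro mult_right_mono) (auto simp: c'_def)
      also have "\<dots> = t\<^sup>2 * b" using v0 by (simp add: field_simps)
      finally show ?thesis by simp
    qed
    ultimately show ?thesis by simp
  qed
  ultimately show ?thesis by blast
qed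

lemma coercive_finite_codim:
  fixes S :: "'a::{real_inner,complete_space} \<Rightarrow> 'a"
  assumes S: "bounded_linear S" and sym: "\<And>u v. inner (S u) v = inner u (S v)"
    and pos: "\<And>u. u \<noteq> 0 \<Longrightarrow> inner (S u) u > 0"
    and E: "orthonormal E"
    and c: "c > 0" "\<And>u. (\<forall>f\<in>E. inner u f = 0) \<Longrightarrow> inner (S u) u \<ge> c * (norm u)\<^sup>2"
  shows "\<exists>c>0. \<forall>u. inner (S u) u \<ge> c * (norm u)\<^sup>2"
proof -
  have "finite E" using E by (simp add: orthonormal_def)
  then show ?thesis using E c
  proof (induction E arbitrary: c rule: finite_induct)
    case (insert e E)
    have "orthonormal E" using insert.prems(1) by (simp add: orthonormal_def)
    moreover obtain c' where "c' > 0" "\<And>u. (\<forall>f\<in>E. inner u f = 0) \<Longrightarrow> inner (S u) u \<ge> c' * (norm u)\<^sup>2"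
      using coercive_codim_one[OF S sym pos insert.prems(1) insert.hyps(2) insert.prems(2)] insert.prems(3) by blast
    ultimately show ?case by (rule insert.IH)
  qed auto
qed

text \<open>The bound \<open>HS\<close> says that \<open>K\<close> is Hilbert-Schmidt. Failure of
  coercivity would supply arbitrarily many orthonormal directions in which \<open>K\<close> cancels
  half of the identity, each adding at least 1/4 to the sum.\<close>

lemma positive_imp_coercive:
  fixes K :: "'a::{real_inner,complete_space} \<Rightarrow> 'a"
  assumes K: "bounded_linear K" and sym: "\<And>u v. inner (K u) v = inner u (K v)"
    and pos: "\<And>u. u \<noteq> 0 \<Longrightarrow> inner (u + K u) u > 0"
    and HS: "\<And>E. orthonormal E \<Longrightarrow> (\<Sum>e\<in>E. (norm (K e))\<^sup>2) \<le> N"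
  shows "\<exists>c>0. \<forall>u. inner (u + K u) u \<ge> c * (norm u)\<^sup>2"
proof (rule ccontr)
  assume not: "\<not> ?thesis"
  have S: "bounded_linear (\<lambda>u. u + K u)" by (intro bounded_linear_add bounded_linear_ident K)
  have Ss: "inner (u + K u) v = inner u (v + K v)" for u v by (simp add: inner_add_left inner_add_right sym)
  have "\<exists>E. orthonormal E \<and> card E = n \<and> (\<forall>e\<in>E. inner (e + K e) e \<le> 1/2)" for n
  proof (induction n)
    case 0 then show ?case by (intro exI[of _ "{}"]) (simp add: orthonormal_def)
  next
    case (Suc n)
    then obtain E where E: "orthonormal E" "card E = n" "\<forall>e\<in>E. inner (e + K e) e \<le> 1/2" by blast
    \<comment> \<open>Otherwise the form would be coercive with constant 1/2 off the finite set
      \<open>E\<close>, hence everywhere by \<open>coercive_finite_codim\<close>.\<close>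
    have "\<exists>u. (\<forall>f\<in>E. inner u f = 0) \<and> inner (u + K u) u < 1/2 * (norm u)\<^sup>2"
    proof (rule ccontr)
      assume "\<not> ?thesis"
      then have "\<And>u. (\<forall>f\<in>E. inner u f = 0) \<Longrightarrow> inner (u + K u) u \<ge> 1/2 * (norm u)\<^sup>2" by force
      from coercive_finite_codim[OF S Ss pos E(1) _ this] not show False by simp
    qed
    then obtain u where u: "\<forall>f\<in>E. inner u f = 0" "inner (u + K u) u < 1/2 * (norm u)\<^sup>2" by blast
    then have u0: "u \<noteq> 0" by auto
    define e where "e = u /\<^sub>R norm u"
    have e: "norm e = 1" "\<forall>f\<in>E. inner e f = 0" using u0 u(1) by (auto simp: e_def)
    have eE: "e \<notin> E" using e by (auto simp: norm_eq_1)
    have "inner (e + K e) e = inner (u + K u) u / (norm u)\<^sup>2"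
      using u0 by (simp add: e_def linear_simps[OF K] inner_add_left power2_eq_square field_simps del: scaleR_conv_of_real)
    also have "\<dots> < 1/2" using u(2) u0 by (simp add: divide_less_eq)
    finally have "inner (e + K e) e \<le> 1/2" by simp
    moreover have "orthonormal (insert e E)"
      using E(1) e unfolding orthonormal_def by (auto simp: inner_commute)
    moreover have "card (insert e E) = Suc n" using E eE by (simp add: orthonormal_def)
    ultimately show ?case using E(3) by (intro exI[of _ "insert e E"]) simp
  qed
  \<comment> \<open>The cardinality is chosen so that a quarter of it exceeds
    \<open>N\<close>.\<close>
  then obtain E where E: "orthonormal E" "card E = nat \<lceil>4 * \<bar>N\<bar>\<rceil> + 1" "\<forall>e\<in>E. inner (e + K e) e \<le> 1/2" by blast
  have "1/4 \<le> (norm (K e))\<^sup>2" if "e \<in> E" for e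
  proof -
    have e1: "norm e = 1" using E that by (simp add: orthonormal_def)
    then have "inner (K e) e \<le> -1/2" using E(3) that by (force simp: inner_add_left norm_eq_1)
    then have "1/2 \<le> \<bar>inner (K e) e\<bar>" by simp
    also have "\<dots> \<le> norm (K e)" using Cauchy_Schwarz_ineq2[of "K e" e] e1 by simp
    finally show ?thesis using power_mono[of "1/2" "norm (K e)" 2] by (simp add: power2_eq_square)
  qed
  then have "card E * (1/4) \<le> (\<Sum>e\<in>E. (norm (K e))\<^sup>2)"
    using sum_bounded_below[of E "1/4" "\<lambda>e. (norm (K e))\<^sup>2"] by simp
  also have "\<dots> \<le> N" by (rule HS[OF E(1)])
  finally show False using E(2) by linarith
qed

section \<open>Riesz representation from a one-sided quadratic bound\<close>

text \<open>\<open>G\<close> plays the role of the graph of a functional, but that it is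
  single-valued is a consequence of the bound: a pair \<open>(0, s)\<close> with nonzero
  \<open>s\<close> would violate it after scaling. The representing vector is the limit of a
  maximising sequence, which also places it in the closure of the domain.\<close>

lemma Riesz_span:
  fixes G :: "('a::{real_inner,complete_space} \<times> real) set"
  assumes G: "subspace G" and M: "\<And>u s. (u, s) \<in> G \<Longrightarrow> 2 * s - (norm u)\<^sup>2 \<le> M"
  shows "\<exists>k. (\<forall>u s. (u, s) \<in> G \<longrightarrow> inner k u = s) \<and> k \<in> closure (fst ` G)"
proof -
  define V where "V = (\<lambda>(u, s). 2 * s - (norm u)\<^sup>2) ` G"
  define m where "m = Sup V"
  have 0: "(0, 0) \<in> G" using subspace_0[OF G] by (simp add: zero_prod_def)
  have bdd: "bdd_above V" unfolding V_def bdd_above_def using M by (intro exI[of _ M]) auto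
  have le: "2 * s - (norm u)\<^sup>2 \<le> m" if "(u, s) \<in> G" for u s
    unfolding m_def by (rule cSup_upper[OF _ bdd]) (use that in \<open>auto simp: V_def\<close>)
  have "\<exists>p\<in>G. 2 * snd p - (norm (fst p))\<^sup>2 > m - inverse (Suc n)" for n
  proof -
    have "V \<noteq> {}" using 0 by (auto simp: V_def)
    then obtain y where "y \<in> V" "y > m - inverse (Suc n)"
      unfolding m_def using less_cSup_iff[OF _ bdd, of "Sup V - inverse (Suc n)"] by auto
    then show ?thesis unfolding V_def by force
  qed
  then have "\<forall>n. \<exists>p. p \<in> G \<and> 2 * snd p - (norm (fst p))\<^sup>2 > m - inverse (Suc n)" by blast
  then obtain p where p: "\<And>n. p n \<in> G" "\<And>n. 2 * snd (p n) - (norm (fst (p n)))\<^sup>2 > m - inverse (Suc n)"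
    using choice[of "\<lambda>n p. p \<in> G \<and> 2 * snd p - (norm (fst p))\<^sup>2 > m - inverse (Suc n)"] by blast
  define u s where "u n = fst (p n)" and "s n = snd (p n)" for n
  have us: "(u n, s n) \<in> G" "2 * s n - (norm (u n))\<^sup>2 > m - inverse (Suc n)" for n
    using p by (auto simp: u_def s_def)
  \<comment> \<open>The midpoint of two near-maximisers has value at most \<open>m\<close>; the
    parallelogram law converts this into closeness.\<close>
  have near: "(norm (u i - u j))\<^sup>2 \<le> 2 * inverse (Suc i) + 2 * inverse (Suc j)" for i j
  proof -
    have "(1/2) *\<^sub>R ((u i, s i) + (u j, s j)) \<in> G"
      by (intro subspace_scale[OF G] subspace_add[OF G] us)
    then have "2 * ((s i + s j) / 2) - (norm ((1/2) *\<^sub>R (u i + u j)))\<^sup>2 \<le> m"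
      by (intro le) (simp add: field_simps)
    moreover have "(norm ((1/2) *\<^sub>R (u i + u j)))\<^sup>2 = (norm (u i + u j))\<^sup>2 / 4"
      by (simp add: power_divide)
    moreover have "(norm (u i - u j))\<^sup>2 = 2 * (norm (u i))\<^sup>2 + 2 * (norm (u j))\<^sup>2 - (norm (u i + u j))\<^sup>2"
      unfolding power2_norm_eq_inner by (simp add: inner_simps inner_commute)
    ultimately show ?thesis using us(2)[of i] us(2)[of j] by argo
  qed
  have "Cauchy u"
  proof (rule metric_CauchyI)
    fix e :: real assume e: "e > 0"
    obtain N where N: "inverse (Suc N) < e\<^sup>2 / 4" using reals_Archimedean[of "e\<^sup>2 / 4"] e by auto
    have "dist (u i) (u j) < e" if "i \<ge> N" "j \<ge> N" for i j
    proof -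
      have "inverse (real (Suc i)) \<le> inverse (Suc N)" "inverse (real (Suc j)) \<le> inverse (Suc N)"
        using that by (auto intro!: le_imp_inverse_le)
      then have "(norm (u i - u j))\<^sup>2 < e\<^sup>2" using near[of i j] N by linarith
      then show ?thesis using e by (simp add: dist_norm power2_less_imp_less)
    qed
    then show "\<exists>M. \<forall>m\<ge>M. \<forall>n\<ge>M. dist (u m) (u n) < e" by blast
  qed
  then obtain k where k: "u \<longlonglongrightarrow> k" using Cauchy_convergent_iff convergent_def by blast
  have "inner k v = t" if vt: "(v, t) \<in> G" for v t
  proof -
    \<comment> \<open>Moving along \<open>(v, t)\<close> from a maximising sequence cannot exceed
      the supremum. Since this holds for both signs of the parameter, the first variation must
      vanish.\<close>
    have ineq: "2 * \<tau> * (t - inner k v) - \<tau>\<^sup>2 * (norm v)\<^sup>2 \<le> 0" for \<tau>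
    proof (rule LIMSEQ_le)
      show "(\<lambda>n. 2 * \<tau> * (t - inner (u n) v) - \<tau>\<^sup>2 * (norm v)\<^sup>2) \<longlonglongrightarrow> 2 * \<tau> * (t - inner k v) - \<tau>\<^sup>2 * (norm v)\<^sup>2"
        by (intro tendsto_intros k)
      show "(\<lambda>n. inverse (real (Suc n))) \<longlonglongrightarrow> 0" by (rule LIMSEQ_inverse_real_of_nat)
      have "2 * \<tau> * (t - inner (u n) v) - \<tau>\<^sup>2 * (norm v)\<^sup>2 \<le> inverse (Suc n)" for n
      proof -
        have "(u n, s n) + \<tau> *\<^sub>R (v, t) \<in> G"
          by (intro subspace_add[OF G] subspace_scale[OF G] us vt)
        then have "2 * (s n + \<tau> * t) - (norm (u n + \<tau> *\<^sub>R v))\<^sup>2 \<le> m" by (intro le) simp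
        moreover have "(norm (u n + \<tau> *\<^sub>R v))\<^sup>2 = (norm (u n))\<^sup>2 + 2 * \<tau> * inner (u n) v + \<tau>\<^sup>2 * (norm v)\<^sup>2"
          unfolding power2_norm_eq_inner by (simp add: inner_simps inner_commute power2_eq_square)
        ultimately show ?thesis using us(2)[of n] by (simp add: algebra_simps)
      qed
      then show "\<exists>N. \<forall>n\<ge>N. 2 * \<tau> * (t - inner (u n) v) - \<tau>\<^sup>2 * (norm v)\<^sup>2 \<le> inverse (real (Suc n))" by blast
    qed
    show ?thesis
    proof (rule ccontr)
      define d where "d = t - inner k v"
      assume "inner k v \<noteq> t"
      then have d: "d \<noteq> 0" by (simp add: d_def)
      have *: "2 * \<tau> * d - \<tau>\<^sup>2 * (norm v)\<^sup>2 \<le> 0" for \<tau> using ineq by (simp add: d_def)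
      show False
      proof (cases "v = 0")
        case True then show False using *[of d] d not_real_square_gt_zero[of d] by simp
      next
        case False
        then have "2 * (d / (norm v)\<^sup>2) * d - (d / (norm v)\<^sup>2)\<^sup>2 * (norm v)\<^sup>2 = d\<^sup>2 / (norm v)\<^sup>2"
          by (simp add: field_simps power2_eq_square)
        then show False using *[of "d / (norm v)\<^sup>2"] d False by (simp add: divide_le_0_iff)
      qed
    qed
  qed
  moreover have "k \<in> closure (fst ` G)"
    unfolding closure_sequential using k us(1) by (intro exI[of _ u]) force
  ultimately show ?thesis by blast
qed

section \<open>Truncation, translation and convolution\<close>

definition cut :: "real set \<Rightarrow> ltwo \<Rightarrow> ltwo" where
  "cut S u = mk (\<lambda>x. indicator S x * rep u x)"

context
  fixes S :: "real set" assumes S [measurable]: "S \<in> sets borel"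
begin

lemma rep_cut: "AE x in lborel. rep (cut S u) x = indicator S x * rep u x"
  unfolding cut_def by (rule rep_mk) (simp add: sqi_indicator S)

lemma cin_cut: "cin (cut S u) v = cin u (cut S v)"
  unfolding cut_def using S
  by (simp add: cin_mk_left cin_mk_right sqi_indicator) (rule Bochner_Integration.integral_cong, auto simp: indicator_def)

lemma cut_idem [simp]: "cut S (cut S u) = cut S u"
  by (rule ltwo_eqI) (use rep_cut[of u] rep_cut[of "cut S u"] in \<open>eventually_elim, auto simp: indicator_def\<close>)

lemma cut_add: "cut S (u + v) = cut S u + cut S v"
  by (rule ltwo_eqI) (use rep_cut[of u] rep_cut[of v] rep_cut[of "u+v"] rep_plus[of u v] rep_plus[of "cut S u" "cut S v"] in
      \<open>eventually_elim, auto simp: indicator_def\<close>)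

lemma cut_cscale: "cut S (c \<cdot> u) = c \<cdot> cut S u"
  by (rule ltwo_eqI) (use rep_cut[of u] rep_cut[of "c \<cdot> u"] rep_cscale[of c u] rep_cscale[of c "cut S u"] in
      \<open>eventually_elim, auto simp: indicator_def\<close>)

lemma cut_scaleR: "cut S (c *\<^sub>R u) = c *\<^sub>R cut S u"
  by (simp add: scaleR_cscale cut_cscale)

lemma cut_minus: "cut S (- u) = - cut S u"
  by (simp add: uminus_cscale cut_cscale)

lemma cut_diff: "cut S (u - v) = cut S u - cut S v"
  using cut_add[of u "- v"] by (simp add: cut_minus)

lemma cut_zero [simp]: "cut S 0 = 0"
  using cut_diff[of 0 0] by simp

lemma norm_cut_split: "(norm u)\<^sup>2 = (norm (cut S u))\<^sup>2 + (norm (u - cut S u))\<^sup>2"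
proof -
  have "cin u u = cin (cut S u) (cut S u) + cin (u - cut S u) (u - cut S u)"
    by (simp add: cin_diff_left cin_diff_right cin_cut)
  then show ?thesis unfolding power2_norm_eq_inner inner_ltwo_def by simp
qed

lemma norm_cut_le: "norm (cut S u) \<le> norm u"
  by (rule power2_le_imp_le) (use norm_cut_split[of u] in auto)

lemma bounded_linear_cut: "bounded_linear (cut S)"
  by (rule bounded_linear_intro[where K = 1]) (auto simp: cut_add cut_scaleR norm_cut_le)

lemma norm_cut_sq: "(norm (cut S u))\<^sup>2 = (LINT x|lborel. indicator S x * (cmod (rep u x))\<^sup>2)"
  unfolding cut_def norm_mk_sq[OF sqi_indicator[OF sqi_rep S]]
  by (rule Bochner_Integration.integral_cong) (auto simp: indicator_def)

lemma cut_eq_selfI: "(AE x in lborel. x \<notin> S \<longrightarrow> rep u x = 0) \<Longrightarrow> cut S u = u"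
  by (rule ltwo_eqI) (use rep_cut[of u] in \<open>auto simp: indicator_def elim: eventually_elim2\<close>)

lemma cut_eq_selfD: "cut S u = u \<Longrightarrow> AE x in lborel. x \<notin> S \<longrightarrow> rep u x = 0"
  using rep_cut[of u] by eventually_elim (auto simp: indicator_def)

end

lemma cut_cut:
  assumes [measurable]: "S \<in> sets borel" "T \<in> sets borel"
  shows "cut S (cut T u) = cut (S \<inter> T) u"
  by (rule ltwo_eqI)
     (use rep_cut[OF assms(1), of "cut T u"] rep_cut[OF assms(2), of u] rep_cut[of "S \<inter> T" u] in
      \<open>auto simp: indicator_def elim!: eventually_elim2\<close>)

section \<open>Translation and reflection of the line\<close>

definition shift :: "real \<Rightarrow> ltwo \<Rightarrow> ltwo" where
  "shift t u = mk (\<lambda>x. rep u (x - t))"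

lemma sqi_shift: "sqi f \<Longrightarrow> sqi (\<lambda>x. f (x - t))"
  using sqi_affine[of f 1 "- t"] by (simp add: add.commute)

lemma sqi_reflect: "sqi f \<Longrightarrow> sqi (\<lambda>x. f (t - x))"
  using sqi_affine[of f "- 1" t] by simp

lemma rep_shift: "AE x in lborel. rep (shift t u) x = rep u (x - t)"
  unfolding shift_def by (rule rep_mk) (simp add: sqi_shift)

lemma AE_lborel_affine:
  assumes "AE x in lborel. P x" "a \<noteq> 0" shows "AE x in lborel. P (b + a * (x::real))"
proof -
  from assms(1) obtain N where N: "{x. \<not> P x} \<subseteq> N" "N \<in> null_sets lborel"
    by (auto elim!: AE_E simp: null_sets_def space_lborel)
  have [measurable]: "N \<in> sets borel" using N(2) by auto
  have "emeasure lborel ((\<lambda>x. b + a * x) -` N) = 0"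
  proof -
    have "(\<integral>\<^sup>+x. indicator N x \<partial>lborel) = ennreal \<bar>a\<bar> * (\<integral>\<^sup>+x. indicator N (b + a * x) \<partial>lborel)"
      using nn_integral_real_affine[of "indicator N" a b] assms(2) by simp
    moreover have "(\<integral>\<^sup>+x. indicator N (b + a * x) \<partial>lborel) = emeasure lborel ((\<lambda>x. b + a * x) -` N)"
    proof -
      have m: "(\<lambda>x. b + a * x) -` N \<in> sets borel"
        using measurable_sets[of "\<lambda>x. b + a * x" borel borel N] by simp
      have "(\<integral>\<^sup>+x. indicator N (b + a * x) \<partial>lborel) = (\<integral>\<^sup>+x. indicator ((\<lambda>x. b + a * x) -` N) x \<partial>lborel)"
        by (simp add: indicator_def)
      then show ?thesis using m by simp
    qed
    ultimately show ?thesis using N(2) assms(2) by (auto simp: null_sets_def)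
  qed
  then have "(\<lambda>x. b + a * x) -` N \<in> null_sets lborel"
    using measurable_sets[of "\<lambda>x. b + a * x" borel borel N] by (simp add: null_sets_def)
  then show ?thesis by (rule AE_I') (use N(1) in auto)
qed

lemma AE_lborel_shift: "AE x in lborel. P x \<Longrightarrow> AE x in lborel. P (x - t :: real)"
  using AE_lborel_affine[of P 1 "- t"] by (simp add: add.commute)

lemma AE_lborel_reflect: "AE x in lborel. P x \<Longrightarrow> AE x in lborel. P (t - x :: real)"
  using AE_lborel_affine[of P "- 1" t] by simp

lemma integral_shift: "(LINT x|lborel. f (x - t :: real)) = (LINT x|lborel. (f x :: complex))"
  using lborel_integral_real_affine[of 1 f "- t"] by (simp add: add.commute)

lemma integral_reflect: "(LINT x|lborel. f (t - x :: real)) = (LINT x|lborel. (f x :: complex))"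
  using lborel_integral_real_affine[of "- 1" f t] by simp

lemma cin_shift: "cin (shift t u) (shift t v) = cin u v"
  unfolding shift_def cin_mk[OF sqi_shift[OF sqi_rep] sqi_shift[OF sqi_rep]]
  using integral_shift[of "\<lambda>x. rep u x * cnj (rep v x)" t] by (simp add: cin_def)

lemma shift_shift: "shift s (shift t u) = shift (s + t) u"
proof (rule ltwo_eqI)
  show "AE x in lborel. rep (shift s (shift t u)) x = rep (shift (s + t) u) x"
    using rep_shift[of s "shift t u"] AE_lborel_shift[OF rep_shift[of t u], of s] rep_shift[of "s + t" u]
    by eventually_elim (simp add: algebra_simps)
qed

lemma shift_cut:
  assumes [measurable]: "S \<in> sets borel"
  shows "shift t (cut S u) = cut ((\<lambda>x. x - t) -` S) (shift t u)"
proof (rule ltwo_eqI)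
  have m: "(\<lambda>x. x - t) -` S \<in> sets borel"
    using measurable_sets[of "\<lambda>x. x - t" borel borel S] by simp
  show "AE x in lborel. rep (shift t (cut S u)) x = rep (cut ((\<lambda>x. x - t) -` S) (shift t u)) x"
    using rep_shift[of t "cut S u"] AE_lborel_shift[OF rep_cut[OF assms, of u], of t] rep_cut[OF m, of "shift t u"] rep_shift[of t u]
    by eventually_elim (simp add: indicator_def)
qed

lemma cin_shift_right: "cin u (shift t v) = cin (shift (- t) u) v"
proof -
  have "shift 0 v = v" for v
    by (rule ltwo_eqI) (use rep_shift[of 0 v] in \<open>eventually_elim, simp\<close>)
  then show ?thesis using cin_shift[of t "shift (- t) u" v] by (simp add: shift_shift)
qed

lemma norm_shift [simp]: "norm (shift t u) = norm u"
  by (simp add: norm_eq_sqrt_inner inner_ltwo_def cin_shift)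

section \<open>Adjoint kernels, reversal of an interval, truncated convolution\<close>

text \<open>The kernel of the adjoint convolution; see \<open>cin_conv\<close>.\<close>

definition star :: "ltwo \<Rightarrow> ltwo" where
  "star m = mk (\<lambda>x. cnj (rep m (- x)))"

lemma rep_star: "AE x in lborel. rep (star m) x = cnj (rep m (- x))"
  unfolding star_def by (rule rep_mk) (use sqi_cnj[OF sqi_reflect[of "rep m" 0]] in simp)

text \<open>The conjugate-linear reversal of [0,r]. It carries a convolution into its adjoint
  (\<open>refl_conv\<close>), and this symmetry produces the top row of the Krein solution from the
  bottom one.\<close>

definition refl :: "real \<Rightarrow> ltwo \<Rightarrow> ltwo" where
  "refl r u = mk (\<lambda>x. indicator {0..r} x * cnj (rep u (r - x)))"

lemma sqi_refl: "sqi (\<lambda>x. indicator {0..r} x * cnj (rep u (t - x)))"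
  by (simp add: sqi_indicator sqi_cnj sqi_reflect)

lemma rep_refl: "AE x in lborel. rep (refl r u) x = indicator {0..r} x * cnj (rep u (r - x))"
  unfolding refl_def by (rule rep_mk[OF sqi_refl])

lemma cut_refl [simp]: "cut {0..r} (refl r u) = refl r u"
  by (rule ltwo_eqI) (use rep_cut[of "{0..r}" "refl r u"] rep_refl[of r u] in \<open>auto simp: indicator_def elim: eventually_elim2\<close>)

lemma refl_cut [simp]: "refl r (cut {0..r} u) = refl r u"
proof (rule ltwo_eqI)
  show "AE x in lborel. rep (refl r (cut {0..r} u)) x = rep (refl r u) x"
    using rep_refl[of r "cut {0..r} u"] rep_refl[of r u] AE_lborel_reflect[OF rep_cut[of "{0..r}" u], of r, simplified]
    by eventually_elim (simp add: indicator_def)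
qed

lemma refl_add: "refl r (u + v) = refl r u + refl r v"
proof (rule ltwo_eqI)
  show "AE x in lborel. rep (refl r (u + v)) x = rep (refl r u + refl r v) x"
    using rep_refl[of r "u + v"] rep_refl[of r u] rep_refl[of r v] rep_plus[of "refl r u" "refl r v"]
      AE_lborel_reflect[OF rep_plus[of u v], of r]
    by eventually_elim (simp add: algebra_simps)
qed

lemma refl_minus: "refl r (- u) = - refl r u"
proof (rule ltwo_eqI)
  show "AE x in lborel. rep (refl r (- u)) x = rep (- refl r u) x"
    using rep_refl[of r "- u"] rep_refl[of r u] rep_uminus[of "refl r u"] AE_lborel_reflect[OF rep_uminus[of u], of r]
    by eventually_elim (simp add: algebra_simps)
qed

lemma refl_diff: "refl r (u - v) = refl r u - refl r v"
  using refl_add[of r u "- v"] by (simp add: refl_minus)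

lemma cin_refl: "cin (refl r u) v = cin (refl r v) u"
proof -
  have "cin (refl r u) v = (LINT x|lborel. indicator {0..r} x * cnj (rep u (r - x)) * cnj (rep v x))"
    unfolding refl_def by (rule cin_mk_left[OF sqi_refl])
  also have "\<dots> = (LINT x|lborel. indicator {0..r} (r - x) * cnj (rep u (r - (r - x))) * cnj (rep v (r - x)))"
    by (rule integral_reflect[symmetric])
  also have "\<dots> = (LINT x|lborel. indicator {0..r} x * cnj (rep v (r - x)) * cnj (rep u x))"
    by (rule Bochner_Integration.integral_cong) (auto simp: indicator_def)
  also have "\<dots> = cin (refl r v) u"
    unfolding refl_def by (rule cin_mk_left[OF sqi_refl, symmetric])
  finally show ?thesis .
qed

text \<open>The \<open>x\<close>-th row of the truncated convolution kernel is conjugated, so that pairing \<open>u\<close> with it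
  gives the value at \<open>x\<close> of the convolution of \<open>m\<close> and \<open>u\<close> over \<open>[0,R]\<close>.\<close>

definition row :: "ltwo \<Rightarrow> real \<Rightarrow> real \<Rightarrow> ltwo" where
  "row m R x = mk (\<lambda>t. indicator {0..R} t * cnj (rep m (x - t)))"

lemma rep_row: "AE t in lborel. rep (row m R x) t = indicator {0..R} t * cnj (rep m (x - t))"
  unfolding row_def by (rule rep_mk[OF sqi_refl])

lemma norm_row_le: "norm (row m R x) \<le> norm m"
proof (rule power2_le_imp_le)
  have i: "integrable lborel (\<lambda>t. (cmod (rep m (x - t)))\<^sup>2)"
    using sqi_reflect[OF sqi_rep, of m x] by (simp add: sqi_def)
  have "(norm (row m R x))\<^sup>2 \<le> (LINT t|lborel. (cmod (rep m (x - t)))\<^sup>2)"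
    unfolding row_def norm_mk_sq[OF sqi_refl]
    by (rule integral_mono'[OF i]) (auto simp: indicator_def norm_mult)
  also have "\<dots> = (norm m)\<^sup>2"
    unfolding norm_ltwo_sq using lborel_integral_real_affine[of "- 1" "\<lambda>t. (cmod (rep m t))\<^sup>2" x] by simp
  finally show "(norm (row m R x))\<^sup>2 \<le> (norm m)\<^sup>2" .
qed simp

lemma cut_row [simp]: "cut {0..R} (row m R x) = row m R x"
  by (rule ltwo_eqI) (use rep_cut[of "{0..R}" "row m R x"] rep_row[of m R x] in \<open>auto simp: indicator_def elim: eventually_elim2\<close>)

lemma cin_row: "cin u (row m R x) = (LINT t|lborel. rep u t * (indicator {0..R} t * rep m (x - t)))"
  unfolding row_def
  by (subst cin_mk_right[OF sqi_refl]) (auto intro!: Bochner_Integration.integral_cong simp: indicator_def)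

lemma measurable_cin_row [measurable]: "(\<lambda>x. cin u (row m R x)) \<in> borel_measurable borel"
  unfolding cin_row by measurable

text \<open>The class is built from a representative that has a value at every point, namely a
  pairing with a row. These values persist on the diagonal of later constructions.\<close>

definition conv :: "ltwo \<Rightarrow> real \<Rightarrow> ltwo \<Rightarrow> ltwo" where
  "conv m R u = mk (\<lambda>x. indicator {0..R} x * cin u (row m R x))"

lemma integrable_indicator_Icc [simp]: "integrable lborel (indicat_real {a..b::real})"
  by (rule integrable_real_indicator) (simp_all add: emeasure_lborel_Icc_eq)

lemma sqi_bounded_interval:
  assumes [measurable]: "f \<in> borel_measurable borel" and "\<And>x. x \<in> {a..b} \<Longrightarrow> cmod (f x) \<le> C"
  shows "sqi (\<lambda>x. indicator {a..b} x * f x)"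
proof (rule sqi_bound)
  show "integrable lborel (\<lambda>x. C\<^sup>2 * indicat_real {a..b} x)" by simp
  show "AE x in lborel. (cmod (indicator {a..b} x * f x))\<^sup>2 \<le> C\<^sup>2 * indicat_real {a..b} x"
    using assms(2) by (auto simp: indicator_def intro!: power_mono)
qed measurable

lemma cin_row_bound: "cmod (cin u (row m R x)) \<le> norm u * norm m"
  by (rule order_trans[OF norm_cin_le mult_left_mono[OF norm_row_le]]) simp

lemma sqi_conv: "sqi (\<lambda>x. indicator {0..R} x * cin u (row m R x))"
  by (rule sqi_bounded_interval) (measurable, rule cin_row_bound)

lemma rep_conv: "AE x in lborel. rep (conv m R u) x = indicator {0..R} x * cin u (row m R x)"
  unfolding conv_def by (rule rep_mk[OF sqi_conv])

lemma cut_conv [simp]: "cut {0..R} (conv m R u) = conv m R u"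
  by (rule ltwo_eqI) (use rep_cut[of "{0..R}" "conv m R u"] rep_conv[of m R u] in \<open>auto simp: indicator_def elim: eventually_elim2\<close>)

lemma conv_cut [simp]: "conv m R (cut {0..R} u) = conv m R u"
  by (simp add: conv_def cin_cut)

lemma conv_add: "conv m R (u + v) = conv m R u + conv m R v"
  by (rule ltwo_eqI) (use rep_conv[of m R u] rep_conv[of m R v] rep_conv[of m R "u + v"] rep_plus[of "conv m R u" "conv m R v"] in
      \<open>eventually_elim, simp add: cin_add_left algebra_simps\<close>)

lemma conv_cscale: "conv m R (c \<cdot> u) = c \<cdot> conv m R u"
  by (rule ltwo_eqI) (use rep_conv[of m R u] rep_conv[of m R "c \<cdot> u"] rep_cscale[of c "conv m R u"] in
      \<open>eventually_elim, simp add: cin_cscale_left\<close>)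

lemma conv_scaleR: "conv m R (c *\<^sub>R u) = c *\<^sub>R conv m R u"
  by (simp add: scaleR_cscale conv_cscale)

lemma conv_minus: "conv m R (- u) = - conv m R u"
  by (simp add: uminus_cscale conv_cscale)

lemma conv_diff: "conv m R (u - v) = conv m R u - conv m R v"
  using conv_add[of m R u "- v"] by (simp add: conv_minus)

lemma norm_conv_sq: "(norm (conv m R u))\<^sup>2 = (LINT x|lborel. indicator {0..R} x * (cmod (cin u (row m R x)))\<^sup>2)"
  unfolding conv_def norm_mk_sq[OF sqi_conv]
  by (rule Bochner_Integration.integral_cong) (auto simp: indicator_def)

lemma norm_conv_le: "norm (conv m R u) \<le> norm u * (sqrt \<bar>R\<bar> * norm m)"
proof (rule power2_le_imp_le)
  have "(norm (conv m R u))\<^sup>2 \<le> (LINT x|lborel. (norm u * norm m)\<^sup>2 * indicat_real {0..R} x)"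
    unfolding norm_conv_sq
    by (rule integral_mono'[OF integrable_mult_right[OF integrable_indicator_Icc]])
       (auto simp: indicator_def cin_row_bound power_mono)
  also have "\<dots> \<le> (norm u * (sqrt \<bar>R\<bar> * norm m))\<^sup>2"
    by (cases "R \<ge> 0") (simp_all add: power_mult_distrib mult_nonneg_nonpos mult_nonpos_nonneg)
  finally show "(norm (conv m R u))\<^sup>2 \<le> (norm u * (sqrt \<bar>R\<bar> * norm m))\<^sup>2" .
qed simp

lemma bounded_linear_conv: "bounded_linear (conv m R)"
  by (rule bounded_linear_intro[OF conv_add conv_scaleR norm_conv_le])

lemma row_star: "row (star m) R x = cut {0..R} (shift x m)"
proof (rule ltwo_eqI)
  show "AE t in lborel. rep (row (star m) R x) t = rep (cut {0..R} (shift x m)) t"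
    using rep_row[of "star m" R x] AE_lborel_reflect[OF rep_star[of m], of x] rep_cut[of "{0..R}" "shift x m", simplified] rep_shift[of x m]
    by eventually_elim simp
qed

lemma cin_conv: "cin (conv m R u) v = cin u (conv (star m) R v)"
proof -
  let ?k = "\<lambda>x t. rep u t * (indicator {0..R} t * rep m (x - t)) * (indicator {0..R} x * cnj (rep v x))"
  have int: "integrable (lborel \<Otimes>\<^sub>M lborel) (\<lambda>(x, t). ?k x t)"
  proof (rule lborel_pair.Fubini_integrable)
    show "(\<lambda>(x, t). ?k x t) \<in> borel_measurable (lborel \<Otimes>\<^sub>M lborel)" by measurable
    have isl: "integrable lborel (\<lambda>t. rep u t * (indicator {0..R} t * rep m (x - t)))" for x
      by (rule sqi_integrable_mult) (auto intro!: sqi_indicator sqi_reflect)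
    have bd: "(LINT t|lborel. cmod (?k x t)) \<le> norm u * norm m * (indicator {0..R} x * cmod (rep v x))" for x
    proof -
      \<comment> \<open>Replacing kernel and argument by their moduli turns the integral of absolute
        values into a pairing, to which the bound on rows applies; this justifies Fubini.\<close>
      define m' where "m' = mk (\<lambda>x. of_real (cmod (rep m x)))"
      define u' where "u' = mk (\<lambda>x. of_real (cmod (rep u x)))"
      have nm: "norm m' = norm m" "norm u' = norm u"
      proof -
        have "(norm m')\<^sup>2 = (norm m)\<^sup>2" "(norm u')\<^sup>2 = (norm u)\<^sup>2"
          unfolding m'_def u'_def norm_mk_sq[OF sqi_norm[OF sqi_rep]] by (simp_all add: norm_ltwo_sq)
        then show "norm m' = norm m" "norm u' = norm u" by (simp_all add: power2_eq_iff_nonneg)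
      qed
      have "complex_of_real (LINT t|lborel. cmod (rep u t * (indicator {0..R} t * rep m (x - t)))) =
         (LINT t|lborel. of_real (cmod (rep u t * (indicator {0..R} t * rep m (x - t)))))"
        by simp
      also have "\<dots> = cin u' (row m' R x)"
        unfolding cin_row
      proof (rule integral_cong_AE)
        show "AE t in lborel. complex_of_real (cmod (rep u t * (indicator {0..R} t * rep m (x - t)))) =
            rep u' t * (indicator {0..R} t * rep m' (x - t))"
          using rep_mk[OF sqi_norm[OF sqi_rep[of u]]] AE_lborel_reflect[OF rep_mk[OF sqi_norm[OF sqi_rep[of m]]], of x]
          by eventually_elim (auto simp: u'_def m'_def norm_mult indicator_def)
      qed measurable
      finally have "(LINT t|lborel. cmod (rep u t * (indicator {0..R} t * rep m (x - t)))) \<le> cmod (cin u' (row m' R x))"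
        by (metis abs_ge_self norm_of_real)
      also have "\<dots> \<le> norm u * norm m" using cin_row_bound[of u' m' R x] nm by simp
      finally have *: "(LINT t|lborel. cmod (rep u t * (indicator {0..R} t * rep m (x - t)))) \<le> norm u * norm m" .
      have "(LINT t|lborel. cmod (?k x t)) =
          (LINT t|lborel. cmod (rep u t * (indicator {0..R} t * rep m (x - t))) * (indicator {0..R} x * cmod (rep v x)))"
        by (simp add: norm_mult indicator_def)
      also have "\<dots> = (LINT t|lborel. cmod (rep u t * (indicator {0..R} t * rep m (x - t)))) * (indicator {0..R} x * cmod (rep v x))"
        by (rule integral_mult_left_zero)
      also have "\<dots> \<le> norm u * norm m * (indicator {0..R} x * cmod (rep v x))"
        by (intro mult_right_mono *) (auto simp: indicator_def)
      finally show ?thesis .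
    qed
    have "integrable lborel (\<lambda>x. norm u * norm m * (indicator {0..R} x * cmod (rep v x)))"
    proof -
      have "integrable lborel (\<lambda>x. (indicator {0..R} x * 1) * (rep v x :: complex))"
        by (rule sqi_integrable_mult[OF sqi_bounded_interval[of _ _ _ 1] sqi_rep]) auto
      then have "integrable lborel (\<lambda>x. cmod ((indicator {0..R} x * 1) * (rep v x :: complex)))"
        by (rule integrable_norm)
      moreover have "cmod ((indicator {0..R} x * 1) * (rep v x :: complex)) = indicator {0..R} x * cmod (rep v x)" for x
        by (simp add: indicator_def)
      ultimately show ?thesis by (simp only:) (rule integrable_mult_right)
    qed
    then show "integrable lborel (\<lambda>x. LINT t|lborel. norm (case (x, t) of (x, t) \<Rightarrow> ?k x t))"
    proof (rule Bochner_Integration.integrable_bound)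
      show "AE x in lborel. norm (LINT t|lborel. norm (case (x, t) of (x, t) \<Rightarrow> ?k x t))
        \<le> norm (norm u * norm m * (indicator {0..R} x * cmod (rep v x)))"
      proof (rule AE_I2)
        fix x
        have "0 \<le> (LINT t|lborel. cmod (?k x t))" by simp
        with bd[of x] show "norm (LINT t|lborel. norm (case (x, t) of (x, t) \<Rightarrow> ?k x t))
          \<le> norm (norm u * norm m * (indicator {0..R} x * cmod (rep v x)))"
          by (simp del: norm_mult)
      qed
    qed measurable
    show "AE x in lborel. integrable lborel (\<lambda>t. case (x, t) of (x, t) \<Rightarrow> ?k x t)"
      using isl by auto
  qed
  have "cin (conv m R u) v = (LINT x|lborel. (LINT t|lborel. ?k x t))"
    unfolding conv_def cin_mk_left[OF sqi_conv] unfolding cin_row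
    by (rule Bochner_Integration.integral_cong[OF HOL.refl], subst integral_mult_left_zero, simp only: mult_ac)
  also have "\<dots> = (LINT t|lborel. (LINT x|lborel. ?k x t))"
    using lborel_pair.Fubini_integral[OF int] by simp
  also have "\<dots> = (LINT t|lborel. rep u t * cnj (indicator {0..R} t * cin v (row (star m) R t)))"
  proof (rule Bochner_Integration.integral_cong[OF HOL.refl])
    fix t
    have "cin v (row (star m) R t) = cin v (mk (\<lambda>x. indicator {0..R} x * rep m (x - t)))"
    proof -
      have "row (star m) R t = mk (\<lambda>x. indicator {0..R} x * rep m (x - t))"
        unfolding row_star
      proof (rule mk_eqI[OF sqi_indicator[OF sqi_shift[OF sqi_rep]], symmetric])
        show "AE x in lborel. indicator {0..R} x * rep m (x - t) = rep (cut {0..R} (shift t m)) x"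
          using rep_cut[of "{0..R}" "shift t m", simplified] rep_shift[of t m] by eventually_elim simp
      qed simp
      then show ?thesis by simp
    qed
    also have "\<dots> = (LINT x|lborel. rep v x * cnj (indicator {0..R} x * rep m (x - t)))"
      by (rule cin_mk_right[OF sqi_indicator[OF sqi_shift[OF sqi_rep]]]) simp
    also have "cnj \<dots> = (LINT x|lborel. cnj (rep v x * cnj (indicator {0..R} x * rep m (x - t))))"
      by (rule integral_bounded_linear[OF bounded_linear_cnj, symmetric])
         (rule sqi_integrable_mult[OF sqi_rep sqi_cnj[OF sqi_indicator[OF sqi_shift[OF sqi_rep]]]], simp)
    finally have "cnj (cin v (row (star m) R t)) = (LINT x|lborel. cnj (rep v x) * (indicator {0..R} x * rep m (x - t)))"
      by (simp add: indicator_def)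
    moreover have "(LINT x|lborel. ?k x t) =
        (LINT x|lborel. (rep u t * indicator {0..R} t) * (cnj (rep v x) * (indicator {0..R} x * rep m (x - t))))"
      by (rule Bochner_Integration.integral_cong[OF HOL.refl]) (simp only: mult_ac)
    moreover have "cnj (indicator {0..R} t) = (indicator {0..R} t :: complex)" by (simp add: indicator_def)
    ultimately show "(LINT x|lborel. ?k x t) = rep u t * cnj (indicator {0..R} t * cin v (row (star m) R t))"
      by (simp only: integral_mult_right_zero complex_cnj_mult mult.assoc)
  qed
  also have "\<dots> = cin u (conv (star m) R v)"
    unfolding conv_def cin_mk_right[OF sqi_conv] ..
  finally show ?thesis .
qed

section \<open>Triangular factorisation along truncations\<close>

lemma Bessel:
  assumes "orthonormal E" shows "(\<Sum>e\<in>E. (inner u e)\<^sup>2) \<le> (norm u)\<^sup>2"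
proof -
  define w where "w = u - perp_part E u"
  have "inner w u = inner w (perp_part E u) + inner w w" by (simp add: w_def inner_diff_right)
  moreover have "inner w (perp_part E u) = 0"
    using norm_perp_part(2)[OF assms, of u] by (simp add: w_def inner_commute)
  moreover have "inner w u = (\<Sum>e\<in>E. (inner u e)\<^sup>2)"
    by (auto simp: w_def perp_part_def inner_sum_left inner_sum_right power2_eq_square inner_commute intro!: sum.cong)
  ultimately have "(\<Sum>e\<in>E. (inner u e)\<^sup>2) = (norm w)\<^sup>2" by (simp add: power2_norm_eq_inner)
  then show ?thesis using norm_perp_part(1)[OF assms, of u] by (simp add: w_def)
qed

text \<open>\<open>E\<close> is orthonormal for the real form only. Real and imaginary parts of the
  coefficients are those of \<open>u\<close> and of its multiple by the imaginary unit, and Bessel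
  for each gives the factor 2.\<close>

lemma Bessel_cin:
  assumes "orthonormal E" shows "(\<Sum>e\<in>E. (cmod (cin e u))\<^sup>2) \<le> 2 * (norm u)\<^sup>2"
proof -
  have "(cmod (cin e u))\<^sup>2 = (inner u e)\<^sup>2 + (inner (\<i> \<cdot> u) e)\<^sup>2" for e
  proof -
    have "Re (cin e u) = inner u e" by (metis inner_commute inner_ltwo_def)
    moreover have "Im (cin e u) = inner (\<i> \<cdot> u) e"
      by (metis inner_commute inner_ltwo_def cin_cscale_right complex_cnj_i minus_mult_left Re_i_times
          minus_complex.simps(1) uminus_complex.simps(1) add.inverse_inverse)
    ultimately show ?thesis by (simp add: cmod_power2)
  qed
  then have "(\<Sum>e\<in>E. (cmod (cin e u))\<^sup>2) = (\<Sum>e\<in>E. (inner u e)\<^sup>2) + (\<Sum>e\<in>E. (inner (\<i> \<cdot> u) e)\<^sup>2)"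
    by (simp add: sum.distrib)
  also have "\<dots> \<le> (norm u)\<^sup>2 + (norm (\<i> \<cdot> u))\<^sup>2" by (intro add_mono Bessel assms)
  finally show ?thesis by (simp add: norm_cscale)
qed

text \<open>For fixed \<open>x\<close> the values at \<open>x\<close> of all
  \<open>conv m R e\<close> are coefficients against a single row of norm at most
  \<open>norm m\<close>; Bessel at each \<open>x\<close> is integrated over [0,R].\<close>

lemma HS_conv:
  assumes "orthonormal E" shows "(\<Sum>e\<in>E. (norm (conv m R e))\<^sup>2) \<le> 2 * \<bar>R\<bar> * (norm m)\<^sup>2"
proof -
  have i: "integrable lborel (\<lambda>x. indicator {0..R} x * (cmod (cin e (row m R x)))\<^sup>2)" for e
  proof -
    have "(cmod (indicator {0..R} x * cin e (row m R x)))\<^sup>2 = indicator {0..R} x * (cmod (cin e (row m R x)))\<^sup>2" for x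
      by (simp add: indicator_def)
    then show ?thesis using sqi_conv[of R e m] by (simp add: sqi_def)
  qed
  have "(\<Sum>e\<in>E. (norm (conv m R e))\<^sup>2) = (LINT x|lborel. (\<Sum>e\<in>E. indicator {0..R} x * (cmod (cin e (row m R x)))\<^sup>2))"
    unfolding norm_conv_sq by (rule Bochner_Integration.integral_sum[symmetric]) (rule i)
  also have "\<dots> \<le> (LINT x|lborel. (2 * (norm m)\<^sup>2) * indicat_real {0..R} x)"
  proof (rule integral_mono'[OF integrable_mult_right[OF integrable_indicator_Icc]])
    fix x
    have "(\<Sum>e\<in>E. (cmod (cin e (row m R x)))\<^sup>2) \<le> 2 * (norm (row m R x))\<^sup>2" by (rule Bessel_cin[OF assms])
    also have "\<dots> \<le> 2 * (norm m)\<^sup>2" using norm_row_le[of m R x] by (simp add: power_mono)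
    finally show "(\<Sum>e\<in>E. indicator {0..R} x * (cmod (cin e (row m R x)))\<^sup>2) \<le> (2 * (norm m)\<^sup>2) * indicat_real {0..R} x"
      by (simp add: indicator_def)
  qed (simp add: indicator_def)
  also have "\<dots> \<le> 2 * \<bar>R\<bar> * (norm m)\<^sup>2"
    by (cases "R \<ge> 0") (auto simp: mult_le_0_iff)
  finally show ?thesis .
qed

section \<open>Inverses on the intervals [0,r] and their increments\<close>

lemma norm_cut_Ioc_tendsto_0:
  assumes "s \<longlonglongrightarrow> x" "t \<longlonglongrightarrow> x"
  shows "(\<lambda>n. norm (cut {s n<..t n} h)) \<longlonglongrightarrow> 0"
proof -
  have eq: "(norm (cut {s n<..t n} h))\<^sup>2 = (LINT x|lborel. indicator {s n<..t n} x * (cmod (rep h x))\<^sup>2)" for n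
    by (rule norm_cut_sq) simp
  have "(\<lambda>n. (norm (cut {s n<..t n} h))\<^sup>2) \<longlonglongrightarrow> (LINT y::real|lborel. (0::real))"
    unfolding eq
  proof (rule integral_dominated_convergence)
    show "integrable lborel (\<lambda>y. (cmod (rep h y))\<^sup>2)" using sqi_rep[of h] by (simp add: sqi_def)
    show "AE y in lborel. (\<lambda>n. indicator {s n<..t n} y * (cmod (rep h y))\<^sup>2) \<longlonglongrightarrow> 0"
      using AE_lborel_singleton[of x]
    proof eventually_elim
      case (elim y)
      have "eventually (\<lambda>n. y \<notin> {s n<..t n}) sequentially"
      proof (cases "y < x")
        case True
        show ?thesis by (rule eventually_mono[OF order_tendstoD(1)[OF assms(1) True]]) simp
      next
        case False
        with elim have "x < y" by simp
        then show ?thesis by (intro eventually_mono[OF order_tendstoD(2)[OF assms(2)]]) auto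
      qed
      then show ?case by (intro tendsto_eventually) (auto elim: eventually_mono)
    qed
  qed (auto simp: indicator_def)
  then have "(\<lambda>n. sqrt ((norm (cut {s n<..t n} h))\<^sup>2)) \<longlonglongrightarrow> sqrt 0"
    by (intro tendsto_real_sqrt) simp
  then show ?thesis by simp
qed

text \<open>The operator \<open>I + K\<close> on \<open>L\<^sup>2[0,R]\<close> is inverted on each \<open>[0,r]\<close>. The functional \<open>D h x\<close> below is the value at
  the endpoint \<open>x\<close> of the residual of that inversion, and \<open>chain_identity\<close> says that \<open>D\<close> factors the inverse of \<open>I + K\<close>
  simultaneously on all \<open>[0,r]\<close>.\<close>

locale chain =
  fixes R :: real and K :: "ltwo \<Rightarrow> ltwo" and \<kappa> :: "real \<Rightarrow> ltwo" and c C :: real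
  assumes K_lin: "bounded_linear K"
    and K_sym: "\<And>u v. cin (K u) v = cin u (K v)"
    and K_rep: "\<And>u. AE x in lborel. x \<in> {0..R} \<longrightarrow> rep (K u) x = cin u (\<kappa> x)"
    and \<kappa>_bound: "\<And>x. x \<in> {0..R} \<Longrightarrow> norm (\<kappa> x) \<le> C"
    and \<kappa>_meas [measurable]: "\<And>u. (\<lambda>x. cin u (\<kappa> x)) \<in> borel_measurable borel"
    and c_pos: "c > 0"
    and coercive: "\<And>u. cut {0..R} u = u \<Longrightarrow> inner (u + K u) u \<ge> c * (norm u)\<^sup>2"
    and C_pos: "C \<ge> 0"
begin

abbreviation P :: "real \<Rightarrow> ltwo \<Rightarrow> ltwo" where "P r \<equiv> cut {0..r}"

lemma K_add: "K (u + v) = K u + K v" and K_diff: "K (u - v) = K u - K v"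
  using K_lin by (simp_all add: linear_simps)

lemma cut_le: "r \<le> s \<Longrightarrow> P r (P s u) = P r u" "r \<le> s \<Longrightarrow> P s (P r u) = P r u"
  by (simp_all add: cut_cut Int_absorb1 Int_absorb2)

definition sol_of :: "ltwo \<Rightarrow> real \<Rightarrow> ltwo \<Rightarrow> bool" where
  "sol_of h r a \<longleftrightarrow> P r a = a \<and> P r (a + K a) = P r h"

lemma sol_of_exists:
  assumes "r \<le> R" shows "\<exists>a. sol_of h r a"
proof -
  \<comment> \<open>The compression of K to [0,r] is extended by zero, so the operator is the
    identity off [0,r] and coercive on the whole space with constant \<open>min c 1\<close>.\<close>
  have bl: "bounded_linear (\<lambda>u. u + P r (K (P r u)))"
    by (intro bounded_linear_add bounded_linear_ident
        bounded_linear_compose[OF bounded_linear_cut] bounded_linear_compose[OF K_lin] bounded_linear_cut) auto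
  have co: "inner (u + P r (K (P r u))) u \<ge> min c 1 * (norm u)\<^sup>2" for u
  proof -
    have "c * (norm (P r u))\<^sup>2 \<le> inner (P r u + K (P r u)) (P r u)"
      by (rule coercive) (use assms in \<open>simp add: cut_le\<close>)
    moreover have "inner (u + P r (K (P r u))) u = (norm (u - P r u))\<^sup>2 + inner (P r u + K (P r u)) (P r u)"
      by (simp add: power2_norm_eq_inner inner_ltwo_def cin_add_left cin_diff_left cin_diff_right cin_cut)
    moreover have "min c 1 * (norm (P r u))\<^sup>2 \<le> c * (norm (P r u))\<^sup>2"
      by (intro mult_right_mono) auto
    moreover have "min c 1 * (norm (u - P r u))\<^sup>2 \<le> 1 * (norm (u - P r u))\<^sup>2"
      by (intro mult_right_mono) auto
    moreover have "min c 1 * (norm u)\<^sup>2 = min c 1 * (norm (P r u))\<^sup>2 + min c 1 * (norm (u - P r u))\<^sup>2"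
      by (subst norm_cut_split[of "{0..r}" u]) (simp_all add: distrib_left)
    ultimately show ?thesis by linarith
  qed
  obtain a where a: "a + P r (K (P r a)) = P r h"
    using coercive_imp_surj[of "\<lambda>u. u + P r (K (P r u))" "min c 1" "P r h"] bl co c_pos by auto
  then have "a = P r h - P r (K (P r a))" by (simp add: algebra_simps)
  then have *: "P r a = a" by (metis borel_closed closed_atLeastAtMost cut_diff cut_idem)
  then show ?thesis using a by (intro exI[of _ a]) (simp add: sol_of_def cut_add)
qed

definition sol :: "ltwo \<Rightarrow> real \<Rightarrow> ltwo" where "sol h r = (SOME a. sol_of h r a)"

lemma sol: assumes "r \<le> R" shows "P r (sol h r) = sol h r" "P r (sol h r + K (sol h r)) = P r h"
  using someI_ex[OF sol_of_exists[OF assms, of h]] by (auto simp: sol_def sol_of_def)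

lemma sol_of_bound:
  assumes "r \<le> R" "sol_of h r a" shows "norm a \<le> norm (P r h) / c"
proof -
  have a: "P r a = a" "P r (a + K a) = P r h" using assms by (auto simp: sol_of_def)
  have "P R a = a" using a(1) cut_le(2)[OF assms(1), of a] by simp
  then have "c * (norm a)\<^sup>2 \<le> inner (a + K a) a" by (rule coercive)
  also have "\<dots> = inner (P r (a + K a)) a" using a(1) by (metis cin_cut inner_ltwo_def borel_closed closed_atLeastAtMost)
  also have "\<dots> \<le> norm (P r h) * norm a" unfolding a(2) by (rule norm_cauchy_schwarz)
  finally have "c * norm a * norm a \<le> norm (P r h) * norm a" by (simp add: power2_eq_square)
  then have "c * norm a \<le> norm (P r h)" by (cases "norm a = 0") (auto simp: c_pos)
  then show ?thesis using c_pos by (simp add: field_simps)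
qed

lemma sol_unique:
  assumes "r \<le> R" "sol_of h r a" shows "a = sol h r"
proof -
  have a: "P r a = a" "a + P r (K a) = P r h"
    using assms(2) by (auto simp: sol_of_def cut_add)
  have b: "P r (sol h r) = sol h r" "sol h r + P r (K (sol h r)) = P r h"
    using sol[OF assms(1), of h] by (auto simp: cut_add)
  have "(a - sol h r) + P r (K (a - sol h r)) = (a + P r (K a)) - (sol h r + P r (K (sol h r)))"
    by (simp add: K_diff cut_diff)
  also have "\<dots> = 0" unfolding a(2) b(2) by simp
  finally have "sol_of 0 r (a - sol h r)"
    by (simp add: sol_of_def cut_add cut_diff a(1) b(1))
  from sol_of_bound[OF assms(1) this] show ?thesis by simp
qed

lemma norm_sol_le: assumes "r \<le> R" shows "norm (sol h r) \<le> norm h / c"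
proof -
  have "norm (sol h r) \<le> norm (P r h) / c" by (rule sol_of_bound[OF assms]) (use sol[OF assms] in \<open>simp add: sol_of_def\<close>)
  also have "\<dots> \<le> norm h / c" using c_pos norm_cut_le[of "{0..r}" h] by (intro divide_right_mono) auto
  finally show ?thesis .
qed

text \<open>On [0,r] the residual coincides with \<open>sol h r\<close> (\<open>sol_eq_res\<close>);
  just beyond \<open>r\<close> it is the source that makes the solution change when the interval
  grows (\<open>sol_diff\<close>).\<close>

definition res :: "ltwo \<Rightarrow> real \<Rightarrow> ltwo" where "res h r = h - K (sol h r)"

lemma cut_Ioc:
  assumes "0 \<le> r" "r \<le> s" shows "P s u - P r u = cut {r<..s} u"
proof (rule ltwo_eqI)
  show "AE x in lborel. rep (P s u - P r u) x = rep (cut {r<..s} u) x"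
    using rep_minus[of "P s u" "P r u"] rep_cut[of "{0..s}" u, simplified] rep_cut[of "{0..r}" u, simplified]
      rep_cut[of "{r<..s}" u, simplified]
    by eventually_elim (use assms in \<open>auto simp: indicator_def\<close>)
qed

lemma sol_eq_res: "r \<le> R \<Longrightarrow> sol h r = P r (res h r)"
  using sol[of r h] by (simp add: res_def cut_diff cut_add algebra_simps)

lemma sol_diff:
  assumes "0 \<le> r" "r \<le> s" "s \<le> R"
  shows "P s (sol h s - sol h r + K (sol h s - sol h r)) = cut {r<..s} (res h r)"
proof -
  have "P s (sol h r) = sol h r" using sol(1)[of r h] cut_le(2)[OF assms(2), of "sol h r"] assms by simp
  then have "P s (sol h s - sol h r + K (sol h s - sol h r)) = P s (h - K (sol h r)) - sol h r"
    using sol(2)[OF assms(3), of h] by (simp add: cut_add cut_diff K_diff algebra_simps)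
  also have "\<dots> = P s (res h r) - P r (res h r)"
    using sol_eq_res[of r h] assms by (simp add: res_def)
  also have "\<dots> = cut {r<..s} (res h r)" by (rule cut_Ioc[OF assms(1,2)])
  finally show ?thesis .
qed

text \<open>The difference of the two solutions solves the equation on [0,s] with the residual on
  (r,s] as right-hand side. Testing against \<open>sol h' s\<close> and using self-adjointness
  localises everything to (r,s]. The identity is exact, with one residual taken at the left endpoint
  and the other at the right.\<close>

lemma sol_increment:
  assumes "0 \<le> r" "r \<le> s" "s \<le> R"
  shows "cin (sol h s) h' - cin (sol h r) h' = cin (cut {r<..s} (res h r)) (res h' s)"
proof -
  define d where "d = sol h s - sol h r"
  have dP: "P s d = d" using sol(1)[of r h] sol(1)[of s h] cut_le(2)[OF assms(2), of "sol h r"] assms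
    by (simp add: d_def cut_diff)
  have "cin d h' = cin d (P s h')" using dP by (metis cin_cut borel_closed closed_atLeastAtMost)
  also have "\<dots> = cin d (P s (sol h' s + K (sol h' s)))" using sol(2)[OF assms(3)] by simp
  also have "\<dots> = cin d (sol h' s + K (sol h' s))" using dP by (metis cin_cut borel_closed closed_atLeastAtMost)
  also have "\<dots> = cin (d + K d) (sol h' s)" by (simp add: cin_add_left cin_add_right K_sym)
  also have "\<dots> = cin (P s (d + K d)) (sol h' s)" using sol(1)[OF assms(3)] by (simp add: cin_cut)
  also have "\<dots> = cin (cut {r<..s} (res h r)) (P s (res h' s))"
    using sol_diff[OF assms, of h] sol_eq_res[OF assms(3)] by (simp add: d_def)
  also have "\<dots> = cin (P s (cut {r<..s} (res h r))) (res h' s)" by (simp add: cin_cut)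
  also have "P s (cut {r<..s} (res h r)) = cut {r<..s} (res h r)"
  proof -
    have "{0..s} \<inter> {r<..s} = {r<..s}" using assms by auto
    then show ?thesis by (simp add: cut_cut)
  qed
  finally show ?thesis by (simp add: d_def cin_diff_left)
qed

text \<open>A representative of \<open>res h r\<close> on [0,R] with a definite value at every
  point, so that the diagonal \<open>F h x x\<close> makes sense.\<close>

definition F :: "ltwo \<Rightarrow> real \<Rightarrow> real \<Rightarrow> complex" where
  "F h r x = rep h x - cin (sol h r) (\<kappa> x)"

definition D :: "ltwo \<Rightarrow> real \<Rightarrow> complex" where
  "D h x = indicator {0<..R} x * F h x x"

lemma F_measurable [measurable]: "F h r \<in> borel_measurable borel"
  unfolding F_def by measurable

lemma rep_res: "AE x in lborel. x \<in> {0..R} \<longrightarrow> rep (res h r) x = F h r x"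
  using K_rep[of "sol h r"] rep_minus[of h "K (sol h r)"] unfolding res_def F_def
  by eventually_elim simp

lemma F_bound:
  assumes "x \<in> {0..R}" "r \<le> R" shows "cmod (F h r x) \<le> cmod (rep h x) + C * norm h / c"
proof -
  have "cmod (cin (sol h r) (\<kappa> x)) \<le> norm (sol h r) * norm (\<kappa> x)" by (rule norm_cin_le)
  also have "\<dots> \<le> (norm h / c) * C"
    using norm_sol_le[OF assms(2), of h] \<kappa>_bound[OF assms(1)] c_pos by (intro mult_mono) auto
  finally have "cmod (cin (sol h r) (\<kappa> x)) \<le> C * norm h / c" by (simp add: mult.commute)
  then show ?thesis unfolding F_def using norm_triangle_ineq4[of "rep h x" "cin (sol h r) (\<kappa> x)"] by linarith
qed

lemma sol_increment_F:
  assumes "0 \<le> r" "r \<le> s" "s \<le> R"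
  shows "cin (sol h s) h' - cin (sol h r) h' = (LINT x|lborel. indicator {r<..s} x * (F h r x * cnj (F h' s x)))"
  unfolding sol_increment[OF assms]
proof (rule cin_cong)
  show "AE x in lborel. rep (cut {r<..s} (res h r)) x * cnj (rep (res h' s) x) = indicator {r<..s} x * (F h r x * cnj (F h' s x))"
    using rep_cut[of "{r<..s}" "res h r", simplified] rep_res[of h r] rep_res[of h' s]
    by eventually_elim (use assms in \<open>auto simp: indicator_def\<close>)
qed measurable

lemma sol_diff_le:
  assumes "0 \<le> r" "r \<le> s" "s \<le> R"
  shows "norm (sol h s - sol h r) \<le> norm (cut {r<..s} (res h r)) / c"
proof -
  have "sol_of (cut {r<..s} (res h r)) s (sol h s - sol h r)"
    unfolding sol_of_def sol_diff[OF assms]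
  proof
    show "P s (sol h s - sol h r) = sol h s - sol h r"
      using sol(1)[of r h] sol(1)[of s h] cut_le(2)[OF assms(2), of "sol h r"] assms by (simp add: cut_diff)
    have "{0..s} \<inter> {r<..s} = {r<..s}" using assms by auto
    then show "cut {r<..s} (res h r) = P s (cut {r<..s} (res h r))" by (simp add: cut_cut)
  qed
  from sol_of_bound[OF assms(3) this]
  have "norm (sol h s - sol h r) \<le> norm (P s (cut {r<..s} (res h r))) / c" .
  also have "\<dots> \<le> norm (cut {r<..s} (res h r)) / c"
    using c_pos by (intro divide_right_mono norm_cut_le) auto
  finally show ?thesis .
qed

lemma norm_cut_res_le:
  assumes "0 \<le> r" "r \<le> s" "s \<le> R"
  shows "norm (cut {r<..s} (res h r)) \<le> norm (cut {r<..s} h) + sqrt (s - r) * (C * norm h / c)"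
proof -
  have "norm (cut {r<..s} (res h r)) \<le> norm (cut {r<..s} h) + norm (cut {r<..s} (K (sol h r)))"
    unfolding res_def by (simp add: cut_diff norm_triangle_ineq4)
  also have "norm (cut {r<..s} (K (sol h r))) \<le> sqrt (s - r) * (C * norm h / c)"
  proof (rule power2_le_imp_le)
    have "(norm (cut {r<..s} (K (sol h r))))\<^sup>2 = (LINT x|lborel. indicator {r<..s} x * (cmod (rep (K (sol h r)) x))\<^sup>2)"
      by (simp add: norm_cut_sq)
    also have "\<dots> \<le> (LINT x|lborel. (C * norm h / c)\<^sup>2 * indicat_real {r..s} x)"
    proof (rule integral_mono_AE')
      show "AE x in lborel. indicator {r<..s} x * (cmod (rep (K (sol h r)) x))\<^sup>2 \<le> (C * norm h / c)\<^sup>2 * indicat_real {r..s} x"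
        using K_rep[of "sol h r"]
      proof eventually_elim
        case (elim x)
        show ?case
        proof (cases "x \<in> {r<..s}")
          case True
          then have x: "x \<in> {0..R}" using assms by auto
          have "cmod (cin (sol h r) (\<kappa> x)) \<le> (norm h / c) * C"
            using norm_cin_le[of "sol h r" "\<kappa> x"] norm_sol_le[of r h] \<kappa>_bound[OF x] c_pos assms
            by (intro order_trans[OF norm_cin_le] mult_mono) auto
          then have "(cmod (rep (K (sol h r)) x))\<^sup>2 \<le> (C * norm h / c)\<^sup>2"
            using elim x by (intro power_mono) (auto simp: mult.commute)
          then show ?thesis using True by simp
        qed simp
      qed
    qed (auto intro!: integrable_mult_right)
    also have "\<dots> = (sqrt (s - r) * (C * norm h / c))\<^sup>2" using assms by (simp add: power_mult_distrib power_divide)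
    finally show "(norm (cut {r<..s} (K (sol h r))))\<^sup>2 \<le> (sqrt (s - r) * (C * norm h / c))\<^sup>2" .
    show "0 \<le> sqrt (s - r) * (C * norm h / c)" using assms C_pos c_pos by simp
  qed
  finally show ?thesis by simp
qed

text \<open>Norm continuity in the length of the interval. Since \<open>\<kappa> x\<close> is a
  fixed vector, it makes \<open>F h s x\<close> converge to the diagonal value as \<open>s\<close>
  tends to \<open>x\<close>, whatever the regularity of the kernel.\<close>

lemma sol_tendsto:
  assumes s: "s \<longlonglongrightarrow> x" "\<And>n. s n \<in> {0..R}" and x: "x \<in> {0..R}"
  shows "(\<lambda>n. sol h (s n)) \<longlonglongrightarrow> sol h x"
proof -
  \<comment> \<open>The estimates need ordered endpoints, while \<open>s n\<close> may lie on either
    side of \<open>x\<close>.\<close>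
  define lo hi where "lo n = min (s n) x" and "hi n = max (s n) x" for n
  have lim: "lo \<longlonglongrightarrow> x" "hi \<longlonglongrightarrow> x"
    unfolding lo_def hi_def using tendsto_min[OF s(1) tendsto_const[of x]] tendsto_max[OF s(1) tendsto_const[of x]] by simp_all
  have bd: "norm (sol h (s n) - sol h x) \<le> (norm (cut {lo n<..hi n} h) + sqrt (hi n - lo n) * (C * norm h / c)) / c" for n
  proof -
    have lh: "0 \<le> lo n" "lo n \<le> hi n" "hi n \<le> R" using s(2)[of n] x by (auto simp: lo_def hi_def)
    have "norm (sol h (s n) - sol h x) = norm (sol h (hi n) - sol h (lo n))"
      by (cases "s n \<le> x") (simp_all add: lo_def hi_def norm_minus_commute[of "sol h (s n)"])
    also have "\<dots> \<le> norm (cut {lo n<..hi n} (res h (lo n))) / c" by (rule sol_diff_le[OF lh])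
    also have "\<dots> \<le> (norm (cut {lo n<..hi n} h) + sqrt (hi n - lo n) * (C * norm h / c)) / c"
      using c_pos by (intro divide_right_mono norm_cut_res_le[OF lh]) auto
    finally show ?thesis .
  qed
  have "(\<lambda>n. (norm (cut {lo n<..hi n} h) + sqrt (hi n - lo n) * (C * norm h / c)) / c) \<longlonglongrightarrow> (0 + sqrt (x - x) * (C * norm h / c)) / c"
    by (intro tendsto_divide tendsto_add[OF norm_cut_Ioc_tendsto_0[OF lim]] tendsto_mult tendsto_real_sqrt
        tendsto_diff lim tendsto_const) (use c_pos in simp)
  then have "(\<lambda>n. (norm (cut {lo n<..hi n} h) + sqrt (hi n - lo n) * (C * norm h / c)) / c) \<longlonglongrightarrow> 0" by simp
  then have "(\<lambda>n. sol h (s n) - sol h x) \<longlonglongrightarrow> 0"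
    by (rule Lim_null_comparison[OF always_eventually[OF allI[OF bd]]])
  then show ?thesis by (rule LIM_zero_cancel)
qed

lemma F_tendsto:
  assumes "s \<longlonglongrightarrow> x" "\<And>n. s n \<in> {0..R}" "x \<in> {0..R}"
  shows "(\<lambda>n. F h (s n) x) \<longlonglongrightarrow> F h x x"
proof -
  have "(\<lambda>n. cin (sol h (s n)) (\<kappa> x) - cin (sol h x) (\<kappa> x)) \<longlonglongrightarrow> 0"
  proof (rule Lim_null_comparison)
    show "\<forall>\<^sub>F n in sequentially. norm (cin (sol h (s n)) (\<kappa> x) - cin (sol h x) (\<kappa> x)) \<le> norm (sol h (s n) - sol h x) * norm (\<kappa> x)"
      by (intro always_eventually allI) (simp only: cin_diff_left[symmetric] norm_cin_le)
    have "(\<lambda>n. norm (sol h (s n) - sol h x) * norm (\<kappa> x)) \<longlonglongrightarrow> norm (sol h x - sol h x) * norm (\<kappa> x)"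
      by (intro tendsto_mult tendsto_norm tendsto_diff sol_tendsto[OF assms] tendsto_const)
    then show "(\<lambda>n. norm (sol h (s n) - sol h x) * norm (\<kappa> x)) \<longlonglongrightarrow> 0" by simp
  qed
  then show ?thesis unfolding F_def by (intro tendsto_diff tendsto_const) (rule LIM_zero_cancel)
qed

end

section \<open>Uniform grids and the diagonal limit\<close>

lemma grid_sum_single:
  fixes \<phi> :: "nat \<Rightarrow> complex"
  assumes "r > 0" "i < N" "x \<in> {r * real i / N<..r * real (Suc i) / N}"
  shows "(\<Sum>j<N. indicator {r * real j / N<..r * real (Suc j) / N} x * \<phi> j) = \<phi> i"
proof -
  have N: "real N > 0" using assms by simp
  have "indicator {r * real j / N<..r * real (Suc j) / N} x * \<phi> j = (if j = i then \<phi> i else 0)" for j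
  proof (cases j i rule: linorder_cases)
    case less
    then have "r * real (Suc j) / N \<le> r * real i / N"
      using N assms(1) by (intro divide_right_mono mult_left_mono) auto
    then show ?thesis using less assms(3) by (auto simp: indicator_def)
  next
    case greater
    then have "r * real (Suc i) / N \<le> r * real j / N"
      using N assms(1) by (intro divide_right_mono mult_left_mono) auto
    then show ?thesis using greater assms(3) by (auto simp: indicator_def)
  qed (use assms in simp)
  then show ?thesis using assms(2) by simp
qed

lemma grid_ex:
  assumes "r > 0" "N > 0" "x \<in> {0<..r}"
  shows "\<exists>i<N. x \<in> {r * real i / N<..r * real (Suc i) / N}"
proof -
  define y where "y = N * x / r"
  have y: "0 < y" "y \<le> N" using assms by (auto simp: y_def field_simps)
  define i where "i = nat (\<lceil>y\<rceil> - 1)"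
  have c: "\<lceil>y\<rceil> \<ge> 1" using y by simp
  have "real i = of_int \<lceil>y\<rceil> - 1" using c by (simp add: i_def)
  then have "real i < y" "y \<le> real (Suc i)" by linarith+
  moreover have "i < N" using \<open>real i < y\<close> y(2) by linarith
  ultimately show ?thesis
    using assms by (intro exI[of _ i]) (auto simp: y_def field_simps)
qed

lemma grid_sum_zero:
  fixes \<phi> :: "nat \<Rightarrow> complex"
  assumes "r > 0" "N > 0" "x \<notin> {0<..r}"
  shows "(\<Sum>j<N. indicator {r * real j / N<..r * real (Suc j) / N} x * \<phi> j) = 0"
proof (rule sum.neutral, intro ballI)
  fix j assume j: "j \<in> {..<N}"
  have "real (Suc j) \<le> real N" using j by simp
  then have "r * real (Suc j) \<le> r * real N" using assms(1) by (intro mult_left_mono) auto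
  then have "r * real (Suc j) / N \<le> r * 1" using assms(2) by (simp add: divide_le_eq)
  moreover have "0 \<le> r * real j / N" using assms by simp
  ultimately show "indicator {r * real j / N<..r * real (Suc j) / N} x * \<phi> j = 0"
    using assms(3) by (auto simp: indicator_def)
qed

lemma grid_sum_bound:
  fixes \<phi> :: "nat \<Rightarrow> complex"
  assumes "r > 0" "N > 0" "\<And>i. i < N \<Longrightarrow> x \<in> {0<..r} \<Longrightarrow> cmod (\<phi> i) \<le> B"
  shows "cmod (\<Sum>j<N. indicator {r * real j / N<..r * real (Suc j) / N} x * \<phi> j) \<le> indicator {0<..r} x * B"
proof (cases "x \<in> {0<..r}")
  case True
  then obtain i where i: "i < N" "x \<in> {r * real i / N<..r * real (Suc i) / N}"
    using grid_ex[OF assms(1,2)] by blast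
  show ?thesis unfolding grid_sum_single[OF assms(1) i] using assms(3)[OF i(1) True] True by simp
next
  case False
  show ?thesis unfolding grid_sum_zero[OF assms(1,2) False] using False by simp
qed

text \<open>Half-open cells partition (0,r], so the sum has exactly one nonzero indicator at
  \<open>x\<close>, and the two endpoints of its cell converge to \<open>x\<close>.\<close>

lemma grid_tendsto:
  fixes \<phi> :: "real \<Rightarrow> real \<Rightarrow> complex"
  assumes r: "r > 0" and x: "x \<in> {0<..r}"
    and lim: "\<And>s t. s \<longlonglongrightarrow> x \<Longrightarrow> t \<longlonglongrightarrow> x \<Longrightarrow> (\<And>n. s n \<in> {0..r}) \<Longrightarrow> (\<And>n. t n \<in> {0..r}) \<Longrightarrow>
      (\<lambda>n. \<phi> (s n) (t n)) \<longlonglongrightarrow> L"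
  shows "(\<lambda>n. \<Sum>i<Suc n. indicator {r * real i / Suc n<..r * real (Suc i) / Suc n} x * \<phi> (r * real i / Suc n) (r * real (Suc i) / Suc n)) \<longlonglongrightarrow> L"
proof -
  have "\<forall>n. \<exists>i. i < Suc n \<and> x \<in> {r * real i / Suc n<..r * real (Suc i) / Suc n}"
    using grid_ex[OF r _ x] by blast
  then obtain i where i: "\<And>n. i n < Suc n" "\<And>n. x \<in> {r * real (i n) / Suc n<..r * real (Suc (i n)) / Suc n}"
    by metis
  define s t where "s n = r * real (i n) / Suc n" and "t n = r * real (Suc (i n)) / Suc n" for n
  have ts: "t n - s n = r * inverse (Suc n)" for n
  proof -
    have "t n - s n = (r * real (Suc (i n)) - r * real (i n)) / real (Suc n)"
      by (simp only: s_def t_def diff_divide_distrib)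
    also have "r * real (Suc (i n)) - r * real (i n) = r" by (simp add: algebra_simps)
    finally show ?thesis by (simp add: divide_inverse)
  qed
  have xs: "s n < x" "x \<le> t n" for n using i(2)[of n] by (auto simp: s_def t_def)
  have "(\<lambda>n. r * inverse (real (Suc n))) \<longlonglongrightarrow> r * 0" by (intro tendsto_mult tendsto_const LIMSEQ_inverse_real_of_nat)
  then have lim0: "(\<lambda>n. r * inverse (real (Suc n))) \<longlonglongrightarrow> 0" by simp
  have "norm (s n - x) \<le> r * inverse (real (Suc n))" "norm (t n - x) \<le> r * inverse (real (Suc n))" for n
    using xs[of n] ts[of n] by simp_all
  then have "s \<longlonglongrightarrow> x" "t \<longlonglongrightarrow> x"
    by (auto intro!: LIM_zero_cancel[OF Lim_null_comparison[OF always_eventually lim0]])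
  moreover have "s n \<in> {0..r}" "t n \<in> {0..r}" for n
  proof -
    have "real (Suc (i n)) \<le> Suc n" using i(1)[of n] by linarith
    then have "r * real (i n) \<le> r * real (Suc n)" "r * real (Suc (i n)) \<le> r * real (Suc n)"
      using r by (auto intro!: mult_left_mono)
    then show "s n \<in> {0..r}" "t n \<in> {0..r}"
      using r unfolding s_def t_def by (simp_all add: divide_le_eq del: of_nat_Suc)
  qed
  ultimately have "(\<lambda>n. \<phi> (s n) (t n)) \<longlonglongrightarrow> L" by (rule lim)
  moreover have "(\<Sum>i<Suc n. indicator {r * real i / Suc n<..r * real (Suc i) / Suc n} x * \<phi> (r * real i / Suc n) (r * real (Suc i) / Suc n)) = \<phi> (s n) (t n)" for n
    unfolding s_def t_def by (rule grid_sum_single[OF r i(1) i(2)])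
  ultimately show ?thesis by simp
qed

context chain
begin

text \<open>For each frozen \<open>r\<close> the function \<open>F h r\<close> is measurable;
  freezing \<open>r\<close> at the left end of the cell containing \<open>x\<close> approximates the
  diagonal by measurable step constructions.\<close>

lemma D_measurable [measurable]: "D h \<in> borel_measurable borel"
proof (cases "R > 0")
  case False
  then have "D h = (\<lambda>_. 0)" by (auto simp: D_def indicator_def)
  then show ?thesis by simp
next
  case R: True
  define G where "G n x = (\<Sum>i<Suc n. indicator {R * real i / Suc n<..R * real (Suc i) / Suc n} x * F h (R * real i / Suc n) x)" for n x
  show ?thesis
  proof (rule borel_measurable_LIMSEQ_metric)
    show "G n \<in> borel_measurable borel" for n unfolding G_def by measurable
    fix x :: real
    show "(\<lambda>n. G n x) \<longlonglongrightarrow> D h x"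
    proof (cases "x \<in> {0<..R}")
      case True
      then have "D h x = F h x x" by (simp add: D_def)
      moreover have "(\<lambda>n. G n x) \<longlonglongrightarrow> F h x x"
        unfolding G_def by (rule grid_tendsto[OF R True]) (use True in \<open>auto intro!: F_tendsto\<close>)
      ultimately show ?thesis by simp
    next
      case False
      then show ?thesis unfolding G_def grid_sum_zero[OF R zero_less_Suc False] by (simp add: D_def)
    qed
  qed
qed

lemma D_bound: "cmod (D h x) \<le> indicator {0..R} x * (cmod (rep h x) + C * norm h / c)"
  using F_bound[of x x h] C_pos c_pos by (auto simp: D_def indicator_def)

lemma sqi_F_bound: "sqi (\<lambda>x. of_real (indicator {0..R} x * (cmod (rep h x) + C * norm h / c)))"
proof -
  have "sqi (\<lambda>x. indicator {0..R} x * of_real (C * norm h / c))"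
    by (rule sqi_bounded_interval[where C = "\<bar>C * norm h / c\<bar>"]) (simp_all only: norm_of_real, simp_all)
  moreover have "sqi (\<lambda>x. indicator {0..R} x * of_real (cmod (rep h x)))"
    by (rule sqi_indicator[OF sqi_norm[OF sqi_rep]]) simp
  ultimately have "sqi (\<lambda>x. indicator {0..R} x * of_real (cmod (rep h x)) + indicator {0..R} x * of_real (C * norm h / c))"
    by (rule sqi_add[rotated])
  moreover have "indicator {0..R} x * of_real (cmod (rep h x)) + indicator {0..R} x * of_real (C * norm h / c) =
      complex_of_real (indicator {0..R} x * (cmod (rep h x) + C * norm h / c))" for x
    by (simp add: indicator_def)
  ultimately show ?thesis by (simp only:)
qed

lemma sqi_D: "sqi (D h)"
  by (rule sqi_cong_norm[OF sqi_F_bound[of h] D_measurable], rule order_trans[OF D_bound]) (simp only: norm_of_real abs_ge_self)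

text \<open>The integrated form of the statement that the derivative of
  \<open>cin (sol h r) h'\<close> is the product of the diagonal residuals. Summing the exact
  increments over any grid gives the left-hand side, so it suffices to refine the grid under the
  integral.\<close>

theorem chain_identity:
  assumes "0 \<le> r" "r \<le> R"
  shows "cin (sol h r) h' = (LINT x|lborel. indicator {0..r} x * (D h x * cnj (D h' x)))"
proof (cases "r = 0")
  case True
  have "cut {0..0::real} u = 0" for u
  proof (rule ltwo_eqI)
    show "AE x in lborel. rep (cut {0..0} u) x = rep 0 x"
      using rep_cut[of "{0..0}" u, simplified] rep_zero AE_lborel_singleton[of 0] by eventually_elim simp
  qed
  then have "sol h r = 0" using sol(1)[of r h] assms True by metis
  moreover have "(\<lambda>x. indicator {0..r} x * (D h x * cnj (D h' x))) = (\<lambda>_. 0)"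
    using True by (auto simp: D_def indicator_def)
  ultimately show ?thesis by (simp only: cin_zero_left integral_zero)
next
  case False
  with assms have r: "r > 0" by simp
  define p where "p n i = r * real i / real (Suc n)" for n i
  have p: "0 \<le> p n i" "p n i \<le> p n (Suc i)" for n i
    using r by (auto simp: p_def intro!: divide_right_mono mult_left_mono)
  have pr: "p n i \<le> r" if "i \<le> Suc n" for n i
  proof -
    have "r * real i \<le> r * real (Suc n)" using r that by (intro mult_left_mono) auto
    then show ?thesis by (simp add: p_def divide_le_eq del: of_nat_Suc)
  qed
  define G where "G n x = (\<Sum>i<Suc n. indicator {r * real i / Suc n<..r * real (Suc i) / Suc n} x * (F h (r * real i / Suc n) x * cnj (F h' (r * real (Suc i) / Suc n) x)))" for n x
  \<comment> \<open>A majorant valid for all truncation points at once, from \<open>F_bound\<close>;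
    it is integrable as a product of two square-integrable functions.\<close>
  define b where "b x = (indicator {0..R} x * (cmod (rep h x) + C * norm h / c)) * (indicator {0..R} x * (cmod (rep h' x) + C * norm h' / c))" for x
  have b_int: "integrable lborel b"
  proof -
    have "integrable lborel (\<lambda>x. complex_of_real (b x))"
      unfolding b_def of_real_mult[of "indicator {0..R} _ * _" "indicator {0..R} _ * _"]
      by (rule sqi_integrable_mult) (rule sqi_F_bound)+
    then have "integrable lborel (\<lambda>x. Re (complex_of_real (b x)))" by (rule integrable_Re)
    then show ?thesis unfolding Re_complex_of_real .
  qed
  have bound: "cmod (F h s x * cnj (F h' t x)) \<le> b x" if "x \<in> {0<..r}" "s \<le> R" "t \<le> R" for s t x
  proof -
    have x: "x \<in> {0..R}" using that assms by auto
    have "cmod (F h s x) * cmod (F h' t x) \<le> (cmod (rep h x) + C * norm h / c) * (cmod (rep h' x) + C * norm h' / c)"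
      by (intro mult_mono F_bound[OF x] that) (use C_pos c_pos in auto)
    then show ?thesis using x by (simp add: b_def norm_mult)
  qed
  have b0: "0 \<le> b x" for x unfolding b_def using C_pos c_pos by (auto simp: indicator_def)
  have int_term: "integrable lborel (\<lambda>x. indicator {p n i<..p n (Suc i)} x * (F h (p n i) x * cnj (F h' (p n (Suc i)) x)))" if "i < Suc n" for n i
  proof (rule Bochner_Integration.integrable_bound[OF b_int])
    show "AE x in lborel. norm (indicator {p n i<..p n (Suc i)} x * (F h (p n i) x * cnj (F h' (p n (Suc i)) x))) \<le> norm (b x)"
    proof (rule AE_I2)
      fix x :: real
      have "{p n i<..p n (Suc i)} \<subseteq> {0<..r}" using p[of n i] pr[of "Suc i" n] that by auto
      moreover have "p n i \<le> R" "p n (Suc i) \<le> R" using pr[of i n] pr[of "Suc i" n] that assms by auto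
      ultimately show "norm (indicator {p n i<..p n (Suc i)} x * (F h (p n i) x * cnj (F h' (p n (Suc i)) x))) \<le> norm (b x)"
        using bound[of x "p n i" "p n (Suc i)"] b0[of x] by (auto simp: indicator_def)
    qed
  qed measurable
  have "cin (sol h r) h' = (LINT x|lborel. G n x)" for n
  proof -
    have "cin (sol h (p n (Suc n))) h' - cin (sol h (p n 0)) h' = (\<Sum>i<Suc n. cin (sol h (p n (Suc i))) h' - cin (sol h (p n i)) h')"
      by (rule sum_lessThan_telescope[symmetric])
    also have "\<dots> = (\<Sum>i<Suc n. LINT x|lborel. indicator {p n i<..p n (Suc i)} x * (F h (p n i) x * cnj (F h' (p n (Suc i)) x)))"
    proof (rule sum.cong[OF HOL.refl])
      fix i assume "i \<in> {..<Suc n}"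
      then show "cin (sol h (p n (Suc i))) h' - cin (sol h (p n i)) h' = (LINT x|lborel. indicator {p n i<..p n (Suc i)} x * (F h (p n i) x * cnj (F h' (p n (Suc i)) x)))"
        using pr[of "Suc i" n] assms by (intro sol_increment_F p) auto
    qed
    also have "\<dots> = (LINT x|lborel. (\<Sum>i<Suc n. indicator {p n i<..p n (Suc i)} x * (F h (p n i) x * cnj (F h' (p n (Suc i)) x))))"
      by (rule Bochner_Integration.integral_sum[symmetric]) (use int_term in auto)
    also have "\<dots> = (LINT x|lborel. G n x)" by (simp only: G_def p_def)
    finally have 1: "cin (sol h (p n (Suc n))) h' - cin (sol h (p n 0)) h' = (LINT x|lborel. G n x)" .
    have "p n (Suc n) = r" "p n 0 = 0" by (simp_all add: p_def)
    moreover have "cin (sol h 0) h' = 0"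
    proof -
      have "cut {0..0::real} u = 0" for u
      proof (rule ltwo_eqI)
        show "AE x in lborel. rep (cut {0..0} u) x = rep 0 x"
          using rep_cut[of "{0..0}" u, simplified] rep_zero AE_lborel_singleton[of 0] by eventually_elim simp
      qed
      then have "sol h 0 = 0" using sol(1)[of 0 h] assms by simp
      then show ?thesis by simp
    qed
    ultimately show ?thesis using 1 by simp
  qed
  then have const: "(\<lambda>n. LINT x|lborel. G n x) = (\<lambda>n. cin (sol h r) h')" by simp
  have "(\<lambda>n. LINT x|lborel. G n x) \<longlonglongrightarrow> (LINT x|lborel. indicator {0..r} x * (D h x * cnj (D h' x)))"
  proof (rule integral_dominated_convergence[where w = b])
    show "G n \<in> borel_measurable lborel" for n unfolding G_def by measurable
    show "(\<lambda>x. indicator {0..r} x * (D h x * cnj (D h' x))) \<in> borel_measurable lborel" by measurable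
    show "AE x in lborel. norm (G n x) \<le> b x" for n
    proof (rule AE_I2)
      fix x
      have "cmod (G n x) \<le> indicator {0<..r} x * b x"
        unfolding G_def
      proof (rule grid_sum_bound[OF r zero_less_Suc])
        fix i assume "i < Suc n" "x \<in> {0<..r}"
        then show "cmod (F h (r * real i / real (Suc n)) x * cnj (F h' (r * real (Suc i) / real (Suc n)) x)) \<le> b x"
          using pr[of i n] pr[of "Suc i" n] assms by (intro bound) (auto simp: p_def)
      qed
      also have "\<dots> \<le> b x" using b0[of x] by (auto simp: indicator_def)
      finally show "norm (G n x) \<le> b x" .
    qed
    show "AE x in lborel. (\<lambda>n. G n x) \<longlonglongrightarrow> indicator {0..r} x * (D h x * cnj (D h' x))"
    proof (rule AE_I2)
      fix x
      show "(\<lambda>n. G n x) \<longlonglongrightarrow> indicator {0..r} x * (D h x * cnj (D h' x))"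
      proof (cases "x \<in> {0<..r}")
        case True
        then have "indicator {0..r} x * (D h x * cnj (D h' x)) = F h x x * cnj (F h' x x)"
          using assms by (auto simp: D_def)
        moreover have "(\<lambda>n. G n x) \<longlonglongrightarrow> F h x x * cnj (F h' x x)"
          unfolding G_def
        proof (rule grid_tendsto[OF r True])
          fix s t :: "nat \<Rightarrow> real"
          assume st: "s \<longlonglongrightarrow> x" "t \<longlonglongrightarrow> x" "\<And>n. s n \<in> {0..r}" "\<And>n. t n \<in> {0..r}"
          have "s n \<in> {0..R}" "t n \<in> {0..R}" for n using st(3,4)[of n] assms by auto
          then show "(\<lambda>n. F h (s n) x * cnj (F h' (t n) x)) \<longlonglongrightarrow> F h x x * cnj (F h' x x)"
            using True assms by (intro tendsto_mult tendsto_cnj F_tendsto st) auto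
        qed
        ultimately show ?thesis by simp
      next
        case False
        then have "D h x = 0 \<or> x \<notin> {0..r}" by (auto simp: D_def)
        then show ?thesis unfolding G_def grid_sum_zero[OF r zero_less_Suc False] by auto
      qed
    qed
  qed (rule b_int)
  then show ?thesis unfolding const by (simp add: LIMSEQ_const_iff)
qed

lemma chain_identity_norm:
  assumes "0 \<le> r" "r \<le> R"
  shows "inner (sol h r) h = (norm (cut {0..r} (mk (D h))))\<^sup>2"
proof -
  have "cin (sol h r) h = (LINT x|lborel. of_real (indicator {0..r} x * (cmod (D h x))\<^sup>2))"
    unfolding chain_identity[OF assms]
    by (rule Bochner_Integration.integral_cong) (auto simp: indicator_def complex_norm_square[symmetric])
  also have "\<dots> = of_real (LINT x|lborel. indicator {0..r} x * (cmod (D h x))\<^sup>2)"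
    by (rule integral_complex_of_real)
  also have "(LINT x|lborel. indicator {0..r} x * (cmod (D h x))\<^sup>2) = (norm (cut {0..r} (mk (D h))))\<^sup>2"
  proof (subst norm_cut_sq, simp, rule integral_cong_AE)
    show "AE x in lborel. indicator {0..r} x * (cmod (D h x))\<^sup>2 = indicator {0..r} x * (cmod (rep (mk (D h)) x))\<^sup>2"
      using rep_mk[OF sqi_D[of h]] by eventually_elim simp
  qed measurable
  finally show ?thesis by (simp add: inner_ltwo_def)
qed

end

section \<open>Accelerants and convexity\<close>

definition tr :: "real set \<Rightarrow> (real \<Rightarrow> complex) \<Rightarrow> ltwo" where
  "tr S f = mk (\<lambda>x. indicat_real S x *\<^sub>R f x)"

lemma L2_on_iff_sqi: "L2_on S f \<longleftrightarrow> sqi (\<lambda>x. indicat_real S x *\<^sub>R f x)"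
proof -
  have "(cmod (indicat_real S x *\<^sub>R f x))\<^sup>2 = indicat_real S x *\<^sub>R (cmod (f x))\<^sup>2" for x
    by (simp add: indicator_def)
  then show ?thesis
    by (simp add: L2_on_def sqi_def set_borel_measurable_def set_integrable_def)
qed

lemma indicat_scaleR: "indicat_real S x *\<^sub>R (z :: complex) = indicator S x * z"
  by (simp add: indicator_def)

lemma L2_on_rep [simp]: "S \<in> sets borel \<Longrightarrow> L2_on S (rep u)"
  using sqi_indicator[OF sqi_rep, of S u] by (simp only: L2_on_iff_sqi indicat_scaleR)

lemma rep_tr: "L2_on S f \<Longrightarrow> AE x in lborel. rep (tr S f) x = indicat_real S x *\<^sub>R f x"
  unfolding tr_def L2_on_iff_sqi by (rule rep_mk)

lemma L2_on_subset:
  assumes "L2_on S f" "T \<subseteq> S" "T \<in> sets borel" shows "L2_on T f"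
proof -
  have "indicator T x * (indicat_real S x *\<^sub>R f x) = indicat_real T x *\<^sub>R f x" for x
    using assms(2) by (auto simp: indicator_def)
  then show ?thesis using sqi_indicator[OF assms(1)[unfolded L2_on_iff_sqi] assms(3)] by (simp add: L2_on_iff_sqi)
qed

lemma norm_tr: "L2_on S f \<Longrightarrow> (norm (tr S f))\<^sup>2 = set_lebesgue_integral lborel S (\<lambda>x. (cmod (f x))\<^sup>2)"
  unfolding tr_def L2_on_iff_sqi set_lebesgue_integral_def
  by (subst norm_mk_sq) (auto intro!: Bochner_Integration.integral_cong simp: indicator_def)

lemma cut_tr:
  assumes "L2_on S f" "T \<subseteq> S" "T \<in> sets borel" shows "cut T (tr S f) = tr T f"
proof (rule ltwo_eqI)
  show "AE x in lborel. rep (cut T (tr S f)) x = rep (tr T f) x"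
    using rep_cut[OF assms(3), of "tr S f"] rep_tr[OF assms(1)] rep_tr[OF L2_on_subset[OF assms]]
    by eventually_elim (use assms(2) in \<open>auto simp: indicator_def\<close>)
qed

lemma tr_rep: "S \<in> sets borel \<Longrightarrow> tr S (rep u) = cut S u"
  unfolding tr_def cut_def by (simp only: indicat_scaleR)

text \<open>For \<open>x\<close> in [0,R] and \<open>t\<close> in [0,r] the difference stays in
  [-R,R], so restricting \<open>H\<close> there loses nothing. A single restricted kernel thus
  serves all \<open>r\<close> up to \<open>R\<close>.\<close>

lemma cin_row_tr:
  assumes f: "L2_on {0..r} f" and H: "L2_on {-R..R} H" and r: "r \<le> R" and x: "x \<in> {0..R}"
  shows "cin (tr {0..r} f) (row (tr {-R..R} H) R x) = set_lebesgue_integral lborel {0..r} (\<lambda>t. H (x - t) * f t)"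
  unfolding cin_row set_lebesgue_integral_def
proof (rule integral_cong_AE)
  note [measurable] = f[unfolded L2_on_iff_sqi, THEN sqi_measurable] H[unfolded L2_on_iff_sqi, THEN sqi_measurable]
  have eq: "indicat_real {0..r} t *\<^sub>R (H (x - t) * f t) = (indicat_real {-R..R} (x - t) *\<^sub>R H (x - t)) * (indicat_real {0..r} t *\<^sub>R f t)" for t
    using r x by (auto simp: indicator_def)
  show "(\<lambda>t. indicat_real {0..r} t *\<^sub>R (H (x - t) * f t)) \<in> borel_measurable lborel"
    unfolding eq by measurable
  show "AE t in lborel. rep (tr {0..r} f) t * (indicator {0..R} t * rep (tr {-R..R} H) (x - t)) = indicat_real {0..r} t *\<^sub>R (H (x - t) * f t)"
    using rep_tr[OF f] AE_lborel_reflect[OF rep_tr[OF H], of x]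
    by eventually_elim (use r x in \<open>auto simp: indicator_def\<close>)
qed measurable

lemma form_eq:
  assumes f: "L2_on {0..r} f" and H: "L2_on {-r..r} H"
  shows "Re (set_lebesgue_integral lborel {0..r} (\<lambda>x. (f x + convolution_op H r f x) * cnj (f x)))
     = inner (tr {0..r} f + conv (tr {-r..r} H) r (tr {0..r} f)) (tr {0..r} f)"
proof -
  note [measurable] = f[unfolded L2_on_iff_sqi, THEN sqi_measurable] H[unfolded L2_on_iff_sqi, THEN sqi_measurable]
  let ?u = "tr {0..r} f" and ?m = "tr {-r..r} H"
  have "cin (?u + conv ?m r ?u) ?u = (LINT x|lborel. indicat_real {0..r} x *\<^sub>R ((f x + convolution_op H r f x) * cnj (f x)))"
    unfolding cin_def
  proof (rule integral_cong_AE)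
    have eq: "indicat_real {0..r} x *\<^sub>R ((f x + convolution_op H r f x) * cnj (f x)) =
        indicator {0..r} x * (((indicat_real {0..r} x *\<^sub>R f x) + cin ?u (row ?m r x)) * cnj (indicat_real {0..r} x *\<^sub>R f x))" for x
      by (auto simp: indicator_def convolution_op_def cin_row_tr[OF f H])
    show "(\<lambda>x. indicat_real {0..r} x *\<^sub>R ((f x + convolution_op H r f x) * cnj (f x))) \<in> borel_measurable lborel"
      unfolding eq by measurable
    show "AE x in lborel. rep (?u + conv ?m r ?u) x * cnj (rep ?u x) = indicat_real {0..r} x *\<^sub>R ((f x + convolution_op H r f x) * cnj (f x))"
      unfolding eq using rep_tr[OF f] rep_conv[of ?m r ?u] rep_plus[of ?u "conv ?m r ?u"]
      by eventually_elim (auto simp: indicator_def)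
  qed measurable
  then show ?thesis by (simp add: inner_ltwo_def set_lebesgue_integral_def)
qed

lemma star_tr:
  assumes H: "L2_on {-R..R} H" and herm: "AE x in lborel. H (- x) = cnj (H x)"
  shows "star (tr {-R..R} H) = tr {-R..R} H"
proof (rule ltwo_eqI)
  show "AE x in lborel. rep (star (tr {-R..R} H)) x = rep (tr {-R..R} H) x"
    using rep_star[of "tr {-R..R} H"] AE_lborel_reflect[OF rep_tr[OF H], of 0, simplified] rep_tr[OF H] herm
    by eventually_elim (auto simp: indicator_def)
qed

lemma accelerant_form_pos:
  assumes H: "accelerant H" and R: "R > 0" and u: "u \<noteq> 0"
  shows "inner (u + conv (tr {-R..R} H) R u) u > 0"
proof -
  let ?m = "tr {-R..R} H"
  define w where "w = cut {0..R} u"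
  have HL: "L2_on {-R..R} H" using H R by (auto simp: accelerant_def)
  have split: "inner (u + conv ?m R u) u = (norm (u - w))\<^sup>2 + inner (w + conv ?m R w) w"
  proof -
    have "cin (conv ?m R u) u = cin (conv ?m R w) w"
    proof -
      have "cin (conv ?m R w) w = cin (conv ?m R u) (cut {0..R} u)" by (simp add: w_def)
      also have "\<dots> = cin (cut {0..R} (conv ?m R u)) u" by (rule cin_cut[symmetric]) simp
      finally show ?thesis by simp
    qed
    moreover have "cin u u = cin (u - w) (u - w) + cin w w"
      by (simp add: w_def cin_diff_left cin_diff_right cin_cut)
    ultimately show ?thesis by (simp add: power2_norm_eq_inner inner_ltwo_def cin_add_left)
  qed
  show ?thesis
  proof (cases "w = 0")
    case True
    have "conv ?m R 0 = 0" using conv_diff[of ?m R 0 0] by simp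
    then show ?thesis using split u by (simp add: True)
  next
    case False
    have "\<not> (AE x in lborel. x \<in> {0..R} \<longrightarrow> rep w x = 0)"
    proof
      assume "AE x in lborel. x \<in> {0..R} \<longrightarrow> rep w x = 0"
      then have "AE x in lborel. rep w x = rep 0 x"
        using rep_cut[of "{0..R}" u, simplified] rep_zero unfolding w_def
        by eventually_elim (auto simp: indicator_def)
      then show False using False ltwo_eqI by blast
    qed
    moreover have "L2_on {0..R} (rep w)" by simp
    ultimately have "Re (set_lebesgue_integral lborel {0..R} (\<lambda>x. (rep w x + convolution_op H R (rep w) x) * cnj (rep w x))) > 0"
      using H R unfolding accelerant_def by blast
    also have "Re (set_lebesgue_integral lborel {0..R} (\<lambda>x. (rep w x + convolution_op H R (rep w) x) * cnj (rep w x)))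
        = inner (w + conv ?m R w) w"
      using form_eq[of R "rep w" H] HL by (simp add: tr_rep) (simp add: w_def)
    finally show ?thesis using split by (smt (verit) zero_le_power2)
  qed
qed

text \<open>The definition of an accelerant supplies no lower bound for the form;
  \<open>HS_conv\<close> together with \<open>positive_imp_coercive\<close> does.\<close>

lemma chain_accelerant:
  assumes H: "accelerant H" and R: "R > 0"
  shows "\<exists>c C. chain R (conv (tr {-R..R} H) R) (row (tr {-R..R} H) R) c C"
proof -
  let ?m = "tr {-R..R} H"
  have HL: "L2_on {-R..R} H" and herm: "AE x in lborel. H (- x) = cnj (H x)" using H R by (auto simp: accelerant_def)
  have sym: "cin (conv ?m R u) v = cin u (conv ?m R v)" for u v
    using cin_conv[of ?m R u v] star_tr[OF HL herm] by simp
  obtain c where c: "c > 0" "\<And>u. inner (u + conv ?m R u) u \<ge> c * (norm u)\<^sup>2"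
    using positive_imp_coercive[OF bounded_linear_conv _ accelerant_form_pos[OF H R] HS_conv] sym
    unfolding inner_ltwo_def by metis
  have "chain R (conv ?m R) (row ?m R) c (norm ?m)"
  proof (rule chain.intro)
    show "AE x in lborel. x \<in> {0..R} \<longrightarrow> rep (conv ?m R u) x = cin u (row ?m R x)" for u
      using rep_conv[of ?m R u] by eventually_elim (auto simp: indicator_def)
  qed (rule bounded_linear_conv sym norm_row_le measurable_cin_row c norm_ge_zero)+
  then show ?thesis by blast
qed

lemma L2_on_translate:
  assumes H: "L2_on {-R..R} H" and "r \<le> R" and s: "s \<in> {0..r}"
  shows "L2_on {0..r} (\<lambda>t. H (t - s))"
proof -
  have "sqi (\<lambda>t. indicator {0..r} t * (indicat_real {-R..R} (t - s) *\<^sub>R H (t - s)))"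
    by (rule sqi_indicator[OF sqi_shift[OF H[unfolded L2_on_iff_sqi]]]) simp
  moreover have "indicator {0..r} t * (indicat_real {-R..R} (t - s) *\<^sub>R H (t - s)) = indicat_real {0..r} t *\<^sub>R H (t - s)" for t
    using s assms by (auto simp: indicator_def)
  ultimately show ?thesis by (simp add: L2_on_iff_sqi)
qed

text \<open>It identifies every resolvent section on [0,r] with a truncated solution for the fixed
  kernel on [-R,R], so that all \<open>r\<close> up to \<open>R\<close> belong to one chain.\<close>

lemma resolvent_sol:
  assumes H: "L2_on {-R..R} H" and "0 < r" "r \<le> R" and s: "s \<in> {0..r}"
  shows "(L2_on {0..r} g \<and> (AE t in lborel. t \<in> {0..r} \<longrightarrow>
           g t + set_lebesgue_integral lborel {0..r} (\<lambda>u. H (t - u) * g u) = H (t - s))) \<longleftrightarrow>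
     (L2_on {0..r} g \<and> cut {0..r} (tr {0..r} g + conv (tr {-R..R} H) R (tr {0..r} g)) = tr {0..r} (\<lambda>t. H (t - s)))"
proof (rule conj_cong[OF HOL.refl])
  assume g: "L2_on {0..r} g"
  note [measurable] = H[unfolded L2_on_iff_sqi, THEN sqi_measurable]
  let ?u = "tr {0..r} g" and ?m = "tr {-R..R} H"
  have Hs: "L2_on {0..r} (\<lambda>t. H (t - s))" by (rule L2_on_translate[OF H assms(3) s])
  have ev: "AE t in lborel. rep (cut {0..r} (?u + conv ?m R ?u)) t = indicator {0..r} t * (g t + set_lebesgue_integral lborel {0..r} (\<lambda>u. H (t - u) * g u))"
    using rep_cut[of "{0..r}" "?u + conv ?m R ?u", simplified] rep_plus[of ?u "conv ?m R ?u"] rep_tr[OF g] rep_conv[of ?m R ?u]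
    by eventually_elim (use assms in \<open>auto simp: indicator_def cin_row_tr[OF g H]\<close>)
  show "(AE t in lborel. t \<in> {0..r} \<longrightarrow> g t + set_lebesgue_integral lborel {0..r} (\<lambda>u. H (t - u) * g u) = H (t - s)) \<longleftrightarrow>
     (cut {0..r} (?u + conv ?m R ?u) = tr {0..r} (\<lambda>t. H (t - s)))" (is "?L \<longleftrightarrow> ?R")
  proof
    assume ?L
    with ev rep_tr[OF Hs] have "AE t in lborel. rep (cut {0..r} (?u + conv ?m R ?u)) t = rep (tr {0..r} (\<lambda>t. H (t - s))) t"
      by eventually_elim (auto simp: indicator_def)
    then show ?R by (rule ltwo_eqI)
  next
    assume R: ?R
    show ?L using ev rep_tr[OF Hs] unfolding R by eventually_elim (auto simp: indicator_def)
  qed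
qed

lemma resolvent_kernel_exists:
  assumes H: "accelerant H" and r: "r > 0" shows "\<exists>G. resolvent_kernel H r G"
proof -
  have HL: "L2_on {-r..r} H" using H r by (auto simp: accelerant_def)
  obtain c C where "chain r (conv (tr {-r..r} H) r) (row (tr {-r..r} H) r) c C"
    using chain_accelerant[OF H r] by blast
  then interpret chain r "conv (tr {-r..r} H) r" "row (tr {-r..r} H) r" c C .
  define a where "a s = sol (tr {0..r} (\<lambda>t. H (t - s))) r" for s
  have L: "L2_on {0..r} (rep (a s))" for s by simp
  have "cut {0..r} (tr {0..r} (rep (a s)) + conv (tr {-r..r} H) r (tr {0..r} (rep (a s)))) = tr {0..r} (\<lambda>t. H (t - s))" if s: "s \<in> {0..r}" for s
  proof -
    have "tr {0..r} (rep (a s)) = a s" using sol(1)[of r] by (simp add: tr_rep a_def)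
    moreover have "cut {0..r} (tr {0..r} (\<lambda>t. H (t - s))) = tr {0..r} (\<lambda>t. H (t - s))"
      by (rule cut_tr[OF L2_on_translate[OF HL order_refl s]]) auto
    ultimately show ?thesis using sol(2)[of r "tr {0..r} (\<lambda>t. H (t - s))"] by (simp add: a_def)
  qed
  then have "resolvent_kernel H r (\<lambda>t s. rep (a s) t)"
    using resolvent_sol[OF HL r order_refl, of _ "rep (a _)"] L unfolding resolvent_kernel_def by blast
  then show ?thesis by blast
qed

text \<open>\<open>N\<close> is the conjugate of the coefficient. The resolvent section at 0 is
  \<open>sol h x\<close>, so \<open>N\<close> agrees almost everywhere with the diagonal residual
  \<open>D h\<close>, and \<open>chain_identity_norm\<close> turns its squared norm into the inverse
  form at \<open>h\<close>. That number is the maximum of the quadratic functional, attained at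
  \<open>sol h R\<close>.\<close>

lemma accelerant_extremal:
  assumes H: "accelerant H" and R: "R > 0" and G: "\<And>r. r > 0 \<Longrightarrow> resolvent_kernel H r (\<Gamma> r)"
  defines "N \<equiv> \<lambda>x. H x - set_lebesgue_integral lborel {0..x} (\<lambda>u. H (x - u) * \<Gamma> x u 0)"
    and "h \<equiv> tr {0..R} H" and "S \<equiv> \<lambda>u. u + conv (tr {-R..R} H) R u"
  shows "L2_on {0<..R} N"
    and "\<And>u. cut {0..R} u = u \<Longrightarrow> 2 * inner h u - inner (S u) u \<le> (norm (tr {0<..R} N))\<^sup>2"
    and "\<exists>u. cut {0..R} u = u \<and> 2 * inner h u - inner (S u) u = (norm (tr {0<..R} N))\<^sup>2"
proof -
  let ?m = "tr {-R..R} H"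
  have HL: "L2_on {-R..R} H" using H R by (auto simp: accelerant_def)
  have HL0: "L2_on {0..R} H" by (rule L2_on_subset[OF HL]) (use R in auto)
  obtain c C where "chain R (conv ?m R) (row ?m R) c C" using chain_accelerant[OF H R] by blast
  then interpret chain R "conv ?m R" "row ?m R" c C .
  have Gs: "tr {0..x} (\<lambda>t. \<Gamma> x t 0) = sol h x" "L2_on {0..x} (\<lambda>t. \<Gamma> x t 0)" if x: "0 < x" "x \<le> R" for x
  proof -
    have "L2_on {0..x} (\<lambda>t. \<Gamma> x t 0) \<and> cut {0..x} (tr {0..x} (\<lambda>t. \<Gamma> x t 0) + conv ?m R (tr {0..x} (\<lambda>t. \<Gamma> x t 0))) = tr {0..x} (\<lambda>t. H (t - 0))"
    proof -
      have 0: "0 \<in> {0..x}" using x by simp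
      show ?thesis
        using bspec[OF G[OF x(1), unfolded resolvent_kernel_def] 0]
        unfolding resolvent_sol[OF HL x 0, of "\<lambda>t. \<Gamma> x t 0", symmetric] .
    qed
    moreover have "tr {0..x} H = cut {0..x} h"
      unfolding h_def by (rule cut_tr[symmetric, OF HL0]) (use x in auto)
    ultimately have *: "L2_on {0..x} (\<lambda>t. \<Gamma> x t 0)" "cut {0..x} (tr {0..x} (\<lambda>t. \<Gamma> x t 0) + conv ?m R (tr {0..x} (\<lambda>t. \<Gamma> x t 0))) = cut {0..x} h"
      by auto
    have "sol_of h x (tr {0..x} (\<lambda>t. \<Gamma> x t 0))"
      unfolding sol_of_def using * cut_tr[OF *(1), of "{0..x}"] by auto
    then show "tr {0..x} (\<lambda>t. \<Gamma> x t 0) = sol h x" using sol_unique[OF x(2)] by blast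
    show "L2_on {0..x} (\<lambda>t. \<Gamma> x t 0)" by fact
  qed
  \<comment> \<open>\<open>N\<close> uses the given function \<open>H\<close> and \<open>D\<close>
    the chosen representative of its class; the correction term vanishes almost everywhere.\<close>
  have Neq: "indicat_real {0<..R} x *\<^sub>R N x = D h x + indicator {0<..R} x * ((indicat_real {-R..R} x *\<^sub>R H x) - rep h x)" for x
  proof (cases "x \<in> {0<..R}")
    case True
    then have "cin (sol h x) (row ?m R x) = set_lebesgue_integral lborel {0..x} (\<lambda>u. H (x - u) * \<Gamma> x u 0)"
      using cin_row_tr[OF Gs(2)[of x] HL, of x] Gs(1)[of x] by simp
    then show ?thesis using True by (simp add: N_def D_def F_def)
  qed (simp add: D_def)
  have "sqi (\<lambda>x. D h x + indicator {0<..R} x * ((indicat_real {-R..R} x *\<^sub>R H x) - rep h x))"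
    by (intro sqi_add sqi_D sqi_indicator sqi_diff sqi_rep) (use HL in \<open>auto simp: L2_on_iff_sqi\<close>)
  then show L: "L2_on {0<..R} N" unfolding L2_on_iff_sqi Neq .
  have trN: "cut {0..R} (mk (D h)) = tr {0<..R} N"
  proof (rule ltwo_eqI)
    show "AE x in lborel. rep (cut {0..R} (mk (D h))) x = rep (tr {0<..R} N) x"
      using rep_cut[of "{0..R}" "mk (D h)", simplified] rep_mk[OF sqi_D[of h]] rep_tr[OF L] rep_tr[OF HL0]
      unfolding Neq by eventually_elim (auto simp: indicator_def h_def[symmetric] D_def)
  qed
  have Q: "inner (sol h R) h = (norm (tr {0<..R} N))\<^sup>2"
    using chain_identity_norm[of R h] R by (simp add: trN)
  let ?a = "sol h R"
  have a: "cut {0..R} ?a = ?a" "cut {0..R} (S ?a) = cut {0..R} h"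
    using sol[of R h] by (auto simp: S_def)
  have hS: "inner (S ?a) u = inner h u" if "cut {0..R} u = u" for u
  proof -
    have "cin (S ?a) u = cin (S ?a) (cut {0..R} u)" using that by simp
    also have "\<dots> = cin (cut {0..R} (S ?a)) u" by (simp add: cin_cut)
    also have "\<dots> = cin h (cut {0..R} u)" by (simp add: a cin_cut)
    finally show ?thesis using that by (simp add: inner_ltwo_def)
  qed
  show "2 * inner h u - inner (S u) u \<le> (norm (tr {0<..R} N))\<^sup>2" if u: "cut {0..R} u = u" for u
  proof -
    \<comment> \<open>Completing the square: nonnegativity of the form at the distance to the
      maximiser is the claimed inequality.\<close>
    have "0 \<le> inner (S (u - ?a)) (u - ?a)"
    proof -
      have "0 \<le> c * (norm (u - ?a))\<^sup>2" using c_pos by simp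
      also have "\<dots> \<le> inner (S (u - ?a)) (u - ?a)"
        unfolding S_def by (rule coercive) (simp add: cut_diff u a(1))
      finally show ?thesis .
    qed
    also have "S (u - ?a) = S u - S ?a" by (simp add: S_def conv_diff)
    also have "inner (S u - S ?a) (u - ?a) = inner (S u) u - inner (S u) ?a - inner (S ?a) u + inner (S ?a) ?a"
      by (simp add: inner_diff_left inner_diff_right)
    also have "inner (S u) ?a = inner (S ?a) u"
    proof -
      have "cin (S u) ?a = cin u (S ?a)" by (simp add: S_def cin_add_left cin_add_right K_sym)
      then have "inner (S u) ?a = inner u (S ?a)" by (simp add: inner_ltwo_def)
      then show ?thesis by (simp add: inner_commute)
    qed
    finally show ?thesis using hS[OF u] hS[OF a(1)] Q by (simp add: inner_commute)
  qed
  show "\<exists>u. cut {0..R} u = u \<and> 2 * inner h u - inner (S u) u = (norm (tr {0<..R} N))\<^sup>2"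
    using a(1) hS[OF a(1)] Q by (intro exI[of _ ?a]) (simp add: inner_commute)
qed

section \<open>Linearity in the kernel and mixtures of accelerants\<close>

lemma row_add: "row (m + n) R x = row m R x + row n R x"
proof (rule ltwo_eqI)
  show "AE t in lborel. rep (row (m + n) R x) t = rep (row m R x + row n R x) t"
    using rep_row[of "m + n" R x] rep_row[of m R x] rep_row[of n R x] rep_plus[of "row m R x" "row n R x"]
      AE_lborel_reflect[OF rep_plus[of m n], of x]
    by eventually_elim (simp add: algebra_simps)
qed

lemma row_scaleR: "row (a *\<^sub>R m) R x = a *\<^sub>R row m R x"
proof (rule ltwo_eqI)
  show "AE t in lborel. rep (row (a *\<^sub>R m) R x) t = rep (a *\<^sub>R row m R x) t"
    using rep_row[of "a *\<^sub>R m" R x] rep_row[of m R x] rep_scaleR[of a "row m R x"]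
      AE_lborel_reflect[OF rep_scaleR[of a m], of x]
    by eventually_elim (simp add: algebra_simps)
qed

lemma conv_kernel_add: "conv (m + n) R u = conv m R u + conv n R u"
proof (rule ltwo_eqI)
  show "AE x in lborel. rep (conv (m + n) R u) x = rep (conv m R u + conv n R u) x"
    using rep_conv[of "m + n" R u] rep_conv[of m R u] rep_conv[of n R u] rep_plus[of "conv m R u" "conv n R u"]
    by eventually_elim (simp add: row_add cin_add_right algebra_simps)
qed

lemma conv_kernel_scaleR: "conv (a *\<^sub>R m) R u = a *\<^sub>R conv m R u"
proof (rule ltwo_eqI)
  show "AE x in lborel. rep (conv (a *\<^sub>R m) R u) x = rep (a *\<^sub>R conv m R u) x"
    using rep_conv[of "a *\<^sub>R m" R u] rep_conv[of m R u] rep_scaleR[of a "conv m R u"]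
    by eventually_elim (simp add: row_scaleR cin_scaleR_right algebra_simps)
qed

context
  fixes H1 H2 :: "real \<Rightarrow> complex" and t :: real
begin

definition mixH :: "real \<Rightarrow> complex" where "mixH x = of_real t * H1 x + of_real (1 - t) * H2 x"

lemma L2_on_mix: "L2_on S H1 \<Longrightarrow> L2_on S H2 \<Longrightarrow> L2_on S mixH"
  unfolding L2_on_iff_sqi mixH_def
  using sqi_add[OF sqi_cmult[of "\<lambda>x. indicat_real S x *\<^sub>R H1 x" "of_real t"] sqi_cmult[of "\<lambda>x. indicat_real S x *\<^sub>R H2 x" "of_real (1 - t)"]]
  by (simp add: algebra_simps scaleR_conv_of_real)

lemma tr_mix:
  assumes "L2_on S H1" "L2_on S H2" shows "tr S mixH = t *\<^sub>R tr S H1 + (1 - t) *\<^sub>R tr S H2"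
proof (rule ltwo_eqI)
  show "AE x in lborel. rep (tr S mixH) x = rep (t *\<^sub>R tr S H1 + (1 - t) *\<^sub>R tr S H2) x"
    using rep_tr[OF assms(1)] rep_tr[OF assms(2)] rep_tr[OF L2_on_mix[OF assms]] rep_scaleR[of t "tr S H1"]
      rep_scaleR[of "1 - t" "tr S H2"] rep_plus[of "t *\<^sub>R tr S H1" "(1 - t) *\<^sub>R tr S H2"]
    by eventually_elim (simp only: mixH_def scaleR_conv_of_real, simp add: algebra_simps del: of_real_diff)
qed

lemma form_mix:
  assumes "L2_on {-R..R} H1" "L2_on {-R..R} H2"
  shows "inner (u + conv (tr {-R..R} mixH) R u) u =
    t * inner (u + conv (tr {-R..R} H1) R u) u + (1 - t) * inner (u + conv (tr {-R..R} H2) R u) u"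
  unfolding tr_mix[OF assms] conv_kernel_add conv_kernel_scaleR by (simp add: inner_add_left algebra_simps)

lemma accelerant_mix:
  assumes H1: "accelerant H1" and H2: "accelerant H2" and t: "t \<in> {0..1}"
  shows "accelerant mixH"
  unfolding accelerant_def
proof (intro conjI allI impI)
  show L: "L2_on {-R..R} mixH" if "R > 0" for R using L2_on_mix H1 H2 that by (auto simp: accelerant_def)
  have "AE x in lborel. H1 (- x) = cnj (H1 x)" "AE x in lborel. H2 (- x) = cnj (H2 x)"
    using H1 H2 by (auto simp: accelerant_def)
  then show "AE x in lborel. mixH (- x) = cnj (mixH x)" by eventually_elim (simp add: mixH_def)
  fix r :: real and f assume r: "r > 0" and f: "L2_on {0..r} f \<and> \<not> (AE x in lborel. x \<in> {0..r} \<longrightarrow> f x = 0)"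
  have L1: "L2_on {-r..r} H1" and L2: "L2_on {-r..r} H2" using H1 H2 r by (auto simp: accelerant_def)
  have p1: "Re (set_lebesgue_integral lborel {0..r} (\<lambda>x. (f x + convolution_op H1 r f x) * cnj (f x))) > 0"
    using H1 r f unfolding accelerant_def by blast
  have p2: "Re (set_lebesgue_integral lborel {0..r} (\<lambda>x. (f x + convolution_op H2 r f x) * cnj (f x))) > 0"
    using H2 r f unfolding accelerant_def by blast
  have fL: "L2_on {0..r} f" using f by blast
  show "Re (set_lebesgue_integral lborel {0..r} (\<lambda>x. (f x + convolution_op mixH r f x) * cnj (f x))) > 0"
    using p1 p2 unfolding form_eq[OF fL L1] form_eq[OF fL L2] form_eq[OF fL L[OF r]] form_mix[OF L1 L2]
    using t by (cases "t = 0") (simp_all add: add_pos_nonneg)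
qed

end

text \<open>Fatou's lemma along the intervals (0,n]; the bound on the norms is uniform, so it
  survives on the half-line.\<close>

lemma L2_on_limit:
  assumes "\<And>R. R > 0 \<Longrightarrow> L2_on {0<..R} N" "\<And>R. R > 0 \<Longrightarrow> (norm (tr {0<..R} N))\<^sup>2 \<le> B"
  shows "L2_on {0<..} N" "set_lebesgue_integral lborel {0<..} (\<lambda>x. (cmod (N x))\<^sup>2) \<le> B"
proof -
  define g where "g n x = indicat_real {0<..real (Suc n)} x *\<^sub>R N x" for n x
  have s: "sqi (g n)" for n using assms(1)[of "real (Suc n)"] by (simp add: L2_on_iff_sqi g_def[abs_def])
  have lim: "(\<lambda>n. g n x) \<longlonglongrightarrow> indicat_real {0<..} x *\<^sub>R N x" for x
  proof (rule tendsto_eventually)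
    obtain n0 where n0: "x \<le> real n0" using real_arch_simple by blast
    show "eventually (\<lambda>n. g n x = indicat_real {0<..} x *\<^sub>R N x) sequentially"
      using eventually_ge_at_top[of n0] by eventually_elim (use n0 in \<open>auto simp: g_def indicator_def\<close>)
  qed
  have meas: "(\<lambda>x. indicat_real {0<..} x *\<^sub>R N x) \<in> borel_measurable borel"
    by (rule borel_measurable_LIMSEQ_metric[OF sqi_measurable[OF s] lim])
  have B: "0 \<le> B" using order_trans[OF zero_le_power2 assms(2)[of 1]] by simp
  have *: "(\<integral>\<^sup>+x. ennreal ((cmod (indicat_real {0<..} x *\<^sub>R N x))\<^sup>2) \<partial>lborel) \<le> ennreal ((sqrt B)\<^sup>2)"
  proof -
    have "(\<integral>\<^sup>+x. ennreal ((cmod (indicat_real {0<..} x *\<^sub>R N x))\<^sup>2) \<partial>lborel) =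
      (\<integral>\<^sup>+x. liminf (\<lambda>n. ennreal ((cmod (g n x))\<^sup>2)) \<partial>lborel)"
    proof (rule nn_integral_cong)
      fix x
      have "(\<lambda>n. ennreal ((cmod (g n x))\<^sup>2)) \<longlonglongrightarrow> ennreal ((cmod (indicat_real {0<..} x *\<^sub>R N x))\<^sup>2)"
        by (intro tendsto_ennrealI tendsto_power tendsto_norm lim)
      then show "ennreal ((cmod (indicat_real {0<..} x *\<^sub>R N x))\<^sup>2) = liminf (\<lambda>n. ennreal ((cmod (g n x))\<^sup>2))"
        by (rule lim_imp_Liminf[OF sequentially_bot, symmetric])
    qed
    also have "\<dots> \<le> liminf (\<lambda>n. \<integral>\<^sup>+x. ennreal ((cmod (g n x))\<^sup>2) \<partial>lborel)"
      by (rule nn_integral_liminf) (use s[THEN sqi_measurable] in measurable)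
    also have "\<dots> \<le> ennreal ((sqrt B)\<^sup>2)"
    proof (rule Liminf_le)
      have "(\<integral>\<^sup>+x. ennreal ((cmod (g n x))\<^sup>2) \<partial>lborel) \<le> ennreal ((sqrt B)\<^sup>2)" for n
      proof -
        have "(\<integral>\<^sup>+x. ennreal ((cmod (g n x))\<^sup>2) \<partial>lborel) = ennreal ((norm (mk (g n)))\<^sup>2)"
          unfolding norm_mk_sq[OF s] by (intro nn_integral_eq_integral) (use s[of n] in \<open>auto simp: sqi_def\<close>)
        also have "mk (g n) = tr {0<..real (Suc n)} N" by (simp only: tr_def g_def[abs_def])
        finally show ?thesis using assms(2)[of "real (Suc n)"] B by (simp add: ennreal_leI)
      qed
      then show "eventually (\<lambda>n. (\<integral>\<^sup>+x. ennreal ((cmod (g n x))\<^sup>2) \<partial>lborel) \<le> ennreal ((sqrt B)\<^sup>2)) sequentially" by simp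
    qed simp
    finally show ?thesis .
  qed
  note S = sqi_nn_integral[OF meas * real_sqrt_ge_zero[OF B]]
  show L: "L2_on {0<..} N" using S(1) by (simp add: L2_on_iff_sqi)
  have "norm (tr {0<..} N) \<le> sqrt B" using S(2) by (simp add: tr_def)
  then have "(norm (tr {0<..} N))\<^sup>2 \<le> (sqrt B)\<^sup>2" by (rule power_mono) simp
  then show "set_lebesgue_integral lborel {0<..} (\<lambda>x. (cmod (N x))\<^sup>2) \<le> B"
    using B by (simp add: norm_tr[OF L])
qed

theorem accelerant_mix_L2:
  assumes A1: "accelerant_of A1 H1" "L2_on {0..} A1" and A2: "accelerant_of A2 H2" "L2_on {0..} A2"
    and t: "t \<in> {0..1}"
  shows "\<exists>A. accelerant_of A (mixH H1 H2 t) \<and> L2_on {0..} A"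
proof -
  let ?H = "mixH H1 H2 t"
  have H1: "accelerant H1" and H2: "accelerant H2" using A1 A2 by (auto simp: accelerant_of_def)
  have H: "accelerant ?H" by (rule accelerant_mix[OF H1 H2 t])
  have bound: "\<And>u. cut {0..R} u = u \<Longrightarrow> 2 * inner (tr {0..R} Hi) u - inner (u + conv (tr {-R..R} Hi) R u) u \<le> (norm (tr {0..} Ai))\<^sup>2"
    if i: "accelerant_of Ai Hi" "L2_on {0..} Ai" and R: "R > 0" for Ai Hi R
  proof -
    obtain \<Gamma> where G: "\<And>r. r > 0 \<Longrightarrow> resolvent_kernel Hi r (\<Gamma> r)"
      and Aeq: "AE r in lborel. r > 0 \<longrightarrow> cnj (Ai r) = Hi r - set_lebesgue_integral lborel {0..r} (\<lambda>u. Hi (r - u) * \<Gamma> r u 0)"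
      using i(1) unfolding accelerant_of_def by blast
    have acc: "accelerant Hi" using i by (simp add: accelerant_of_def)
    note ext = accelerant_extremal[OF acc R, of \<Gamma>, OF G]
    define N where "N x = Hi x - set_lebesgue_integral lborel {0..x} (\<lambda>u. Hi (x - u) * \<Gamma> x u 0)" for x
    have N: "L2_on {0<..R} N" using ext(1) by (simp add: N_def[abs_def])
    have LA: "L2_on {0<..R} Ai" by (rule L2_on_subset[OF i(2)]) auto
    have "(norm (tr {0<..R} N))\<^sup>2 = (norm (tr {0<..R} Ai))\<^sup>2"
      unfolding norm_ltwo_sq
    proof (rule integral_cong_AE)
      show "AE x in lborel. (cmod (rep (tr {0<..R} N) x))\<^sup>2 = (cmod (rep (tr {0<..R} Ai) x))\<^sup>2"
        using rep_tr[OF N] rep_tr[OF LA] Aeq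
      proof eventually_elim
        case (elim x)
        then have "x > 0 \<Longrightarrow> cmod (N x) = cmod (Ai x)" by (metis N_def complex_mod_cnj)
        then show ?case using elim(1,2) by (auto simp: indicator_def)
      qed
    qed measurable
    also have "tr {0<..R} Ai = cut {0<..R} (tr {0..} Ai)" by (rule cut_tr[symmetric, OF i(2)]) auto
    finally have le: "(norm (tr {0<..R} N))\<^sup>2 \<le> (norm (tr {0..} Ai))\<^sup>2"
      by (simp add: norm_cut_le power_mono)
    fix u assume "cut {0..R} u = u"
    then have "2 * inner (tr {0..R} Hi) u - inner (u + conv (tr {-R..R} Hi) R u) u \<le> (norm (tr {0<..R} N))\<^sup>2"
      using ext(2)[of u] by (simp add: N_def[abs_def])
    then show "2 * inner (tr {0..R} Hi) u - inner (u + conv (tr {-R..R} Hi) R u) u \<le> (norm (tr {0..} Ai))\<^sup>2"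
      using le by (rule order_trans)
  qed
  obtain \<Gamma> where G: "\<And>r. r > 0 \<Longrightarrow> resolvent_kernel ?H r (\<Gamma> r)"
    using resolvent_kernel_exists[OF H] by metis
  define N where "N x = ?H x - set_lebesgue_integral lborel {0..x} (\<lambda>u. ?H (x - u) * \<Gamma> x u 0)" for x
  define M where "M = t * (norm (tr {0..} A1))\<^sup>2 + (1 - t) * (norm (tr {0..} A2))\<^sup>2"
  have N: "L2_on {0<..R} N" "(norm (tr {0<..R} N))\<^sup>2 \<le> M" if R: "R > 0" for R
  proof -
    note ext = accelerant_extremal[OF H R, of \<Gamma>, OF G]
    show "L2_on {0<..R} N" using ext(1) by (simp add: N_def[abs_def])
    obtain u where u: "cut {0..R} u = u" "2 * inner (tr {0..R} ?H) u - inner (u + conv (tr {-R..R} ?H) R u) u = (norm (tr {0<..R} N))\<^sup>2"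
      using ext(3) by (auto simp: N_def[abs_def])
    have L1: "L2_on {-R..R} H1" and L2: "L2_on {-R..R} H2" using H1 H2 R by (auto simp: accelerant_def)
    have L1': "L2_on {0..R} H1" and L2': "L2_on {0..R} H2"
      using L2_on_subset[OF L1, of "{0..R}"] L2_on_subset[OF L2, of "{0..R}"] R by auto
    \<comment> \<open>The maximiser for the mixture is a competitor for each of the two accelerants,
      so each summand is at most the squared norm of the corresponding coefficient.\<close>
    have "(norm (tr {0<..R} N))\<^sup>2 = t * (2 * inner (tr {0..R} H1) u - inner (u + conv (tr {-R..R} H1) R u) u)
       + (1 - t) * (2 * inner (tr {0..R} H2) u - inner (u + conv (tr {-R..R} H2) R u) u)"
      unfolding u(2)[symmetric] form_mix[OF L1 L2] tr_mix[OF L1' L2'] by (simp add: inner_add_left algebra_simps)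
    also have "\<dots> \<le> M"
      unfolding M_def using t by (intro add_mono mult_left_mono bound A1 A2 R u(1)) auto
    finally show "(norm (tr {0<..R} N))\<^sup>2 \<le> M" .
  qed
  note LN = L2_on_limit[OF N]
  \<comment> \<open>Accelerants determine the coefficient for positive arguments only; the value 0
    elsewhere makes restriction to the closed and to the open half-line agree.\<close>
  define A where "A x = (if x > 0 then cnj (N x) else 0)" for x
  have "accelerant_of A ?H"
    unfolding accelerant_of_def
    by (intro conjI H exI[of _ \<Gamma>] allI impI G AE_I2) (auto simp: A_def N_def)
  moreover have "L2_on {0..} A"
  proof -
    have "indicat_real {0..} x *\<^sub>R A x = cnj (indicat_real {0<..} x *\<^sub>R N x)" for x
      by (auto simp: A_def indicator_def)
    then show ?thesis
      using sqi_cnj[OF LN(1)[unfolded L2_on_iff_sqi]] by (simp only: L2_on_iff_sqi)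
  qed
  ultimately show ?thesis by blast
qed

section \<open>Integration against mixtures and the Levy formula\<close>

lemma nn_integral_mix_measure:
  assumes N: "sets N = sets M" and f: "f \<in> borel_measurable M"
  shows "(\<integral>\<^sup>+x. f x \<partial>mix_measure t M N) = ennreal t * (\<integral>\<^sup>+x. f x \<partial>M) + ennreal (1 - t) * (\<integral>\<^sup>+x. f x \<partial>N)"
  using f
proof (induction rule: borel_measurable_induct)
  case (cong f g)
  have sp: "space N = space M" "space (mix_measure t M N) = space M"
    using N sets_eq_imp_space_eq[of N M] sets_eq_imp_space_eq[of "mix_measure t M N" M] by auto
  have "(\<integral>\<^sup>+x. f x \<partial>K) = (\<integral>\<^sup>+x. g x \<partial>K)" if "space K = space M" for K
    by (rule nn_integral_cong) (use cong that in auto)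
  then show ?case using cong sp by simp
next
  case (set A)
  then show ?case using N by (simp add: emeasure_mix_measure)
next
  case (mult u c)
  have "u \<in> borel_measurable N" "u \<in> borel_measurable (mix_measure t M N)"
    using mult N by (auto simp: measurable_cong_sets[of N M] measurable_cong_sets[of "mix_measure t M N" M])
  then show ?case using mult by (simp add: nn_integral_cmult algebra_simps)
next
  case (add u v)
  have "u \<in> borel_measurable N" "u \<in> borel_measurable (mix_measure t M N)"
       "v \<in> borel_measurable N" "v \<in> borel_measurable (mix_measure t M N)"
    using add N by (auto simp: measurable_cong_sets[of N M] measurable_cong_sets[of "mix_measure t M N" M])
  then show ?case using add by (simp add: nn_integral_add algebra_simps)
next
  case (seq U)
  have m: "U i \<in> borel_measurable N" "U i \<in> borel_measurable (mix_measure t M N)" for i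
    using seq N by (auto simp: measurable_cong_sets[of N M] measurable_cong_sets[of "mix_measure t M N" M])
  have e: "(\<integral>\<^sup>+x. (SUP i. U i) x \<partial>K) = (SUP i. \<integral>\<^sup>+x. U i x \<partial>K)" if "\<And>i. U i \<in> borel_measurable K" for K :: "'a measure"
    unfolding SUP_apply by (rule nn_integral_monotone_convergence_SUP[OF seq(3) that])
  have inc: "incseq (\<lambda>i. c * (\<integral>\<^sup>+x. U i x \<partial>K))" for K :: "'a measure" and c :: ennreal
    using seq(3) by (intro incseq_SucI mult_left_mono nn_integral_mono) (auto simp: incseq_def le_fun_def)
  have "(\<integral>\<^sup>+x. (SUP i. U i) x \<partial>mix_measure t M N) = (SUP i. ennreal t * (\<integral>\<^sup>+x. U i x \<partial>M) + ennreal (1 - t) * (\<integral>\<^sup>+x. U i x \<partial>N))"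
    using e[OF m(2)] seq by simp
  also have "\<dots> = (SUP i. ennreal t * (\<integral>\<^sup>+x. U i x \<partial>M)) + (SUP i. ennreal (1 - t) * (\<integral>\<^sup>+x. U i x \<partial>N))"
    by (rule ennreal_SUP_add[OF inc inc])
  also have "\<dots> = ennreal t * (\<integral>\<^sup>+x. (SUP i. U i) x \<partial>M) + ennreal (1 - t) * (\<integral>\<^sup>+x. (SUP i. U i) x \<partial>N)"
    using e[OF m(1)] e[of M] seq by (simp add: SUP_mult_left_ennreal)
  finally show ?case .
qed

lemma integrable_mix_measure:
  fixes f :: "'a \<Rightarrow> 'b::{banach, second_countable_topology}"
  assumes N: "sets N = sets M" and f: "integrable M f" "integrable N f"
  shows "integrable (mix_measure t M N) f"
proof (rule integrableI_bounded)
  show "f \<in> borel_measurable (mix_measure t M N)"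
    using f(1) by (simp add: measurable_cong_sets[of "mix_measure t M N" M])
  have "(\<integral>\<^sup>+x. ennreal (norm (f x)) \<partial>M) < \<infinity>" "(\<integral>\<^sup>+x. ennreal (norm (f x)) \<partial>N) < \<infinity>"
    using f by (auto simp: integrable_iff_bounded)
  then show "(\<integral>\<^sup>+x. ennreal (norm (f x)) \<partial>mix_measure t M N) < \<infinity>"
    using f by (subst nn_integral_mix_measure[OF N]) (auto simp: ennreal_mult_less_top)
qed

lemma integral_mix_measure_real:
  fixes f :: "'a \<Rightarrow> real"
  assumes N: "sets N = sets M" and f: "integrable M f" "integrable N f" and t: "t \<in> {0..1}"
  shows "integral\<^sup>L (mix_measure t M N) f = t * integral\<^sup>L M f + (1 - t) * integral\<^sup>L N f"
proof -
  have e: "enn2real (\<integral>\<^sup>+x. ennreal (g x) \<partial>mix_measure t M N) =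
      t * enn2real (\<integral>\<^sup>+x. ennreal (g x) \<partial>M) + (1 - t) * enn2real (\<integral>\<^sup>+x. ennreal (g x) \<partial>N)"
    if "integrable M g" "integrable N g" for g :: "'a \<Rightarrow> real"
  proof -
    have "(\<integral>\<^sup>+x. ennreal (g x) \<partial>K) < \<infinity>" if "integrable K g" for K :: "'a measure"
    proof -
      have "(\<integral>\<^sup>+x. ennreal (g x) \<partial>K) \<le> (\<integral>\<^sup>+x. ennreal (norm (g x)) \<partial>K)"
        by (intro nn_integral_mono ennreal_leI) simp
      also have "\<dots> < \<infinity>" using that by (auto simp: integrable_iff_bounded)
      finally show ?thesis .
    qed
    with that have fin: "(\<integral>\<^sup>+x. ennreal (g x) \<partial>M) < \<infinity>" "(\<integral>\<^sup>+x. ennreal (g x) \<partial>N) < \<infinity>" by auto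
    have gm: "(\<lambda>x. ennreal (g x)) \<in> borel_measurable M" using that by measurable
    have "enn2real (ennreal t * (\<integral>\<^sup>+x. ennreal (g x) \<partial>M) + ennreal (1 - t) * (\<integral>\<^sup>+x. ennreal (g x) \<partial>N)) =
        enn2real (ennreal t * (\<integral>\<^sup>+x. ennreal (g x) \<partial>M)) + enn2real (ennreal (1 - t) * (\<integral>\<^sup>+x. ennreal (g x) \<partial>N))"
      using fin by (intro enn2real_plus) (auto simp: ennreal_mult_less_top)
    then show ?thesis
      using t unfolding nn_integral_mix_measure[OF N gm] by (simp add: enn2real_mult)
  qed
  have f': "integrable M (\<lambda>x. - f x)" "integrable N (\<lambda>x. - f x)" using f by auto
  show ?thesis
    unfolding real_lebesgue_integral_def[OF f(1)] real_lebesgue_integral_def[OF f(2)]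
      real_lebesgue_integral_def[OF integrable_mix_measure[OF N f]] e[OF f] e[OF f']
    by (simp add: algebra_simps)
qed

lemma integral_mix_measure_complex:
  fixes f :: "'a \<Rightarrow> complex"
  assumes N: "sets N = sets M" and f: "integrable M f" "integrable N f" and t: "t \<in> {0..1}"
  shows "integral\<^sup>L (mix_measure t M N) f = of_real t * integral\<^sup>L M f + of_real (1 - t) * integral\<^sup>L N f"
proof (rule complex_eqI)
  note i = integrable_mix_measure[OF N f, of t]
  show "Re (integral\<^sup>L (mix_measure t M N) f) = Re (of_real t * integral\<^sup>L M f + of_real (1 - t) * integral\<^sup>L N f)"
    using integral_mix_measure_real[OF N integrable_Re[OF f(1)] integrable_Re[OF f(2)] t]
    by (simp add: integral_Re[OF i] integral_Re[OF f(1)] integral_Re[OF f(2)])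
  show "Im (integral\<^sup>L (mix_measure t M N) f) = Im (of_real t * integral\<^sup>L M f + of_real (1 - t) * integral\<^sup>L N f)"
    using integral_mix_measure_real[OF N integrable_Im[OF f(1)] integrable_Im[OF f(2)] t]
    by (simp add: integral_Im[OF i] integral_Im[OF f(1)] integral_Im[OF f(2)])
qed

text \<open>The bound makes the integral in the Levy formula absolutely convergent. For small
  \<open>l\<close> the numerator vanishes to second order; for large \<open>l\<close> it is bounded
  and division by the square of \<open>l\<close> gives the decay.\<close>

lemma levy_integrand_bound:
  "cmod (levy_integrand x l) \<le> 2 * (x\<^sup>2 + \<bar>x\<bar> + 2) * (1 / (1 + l\<^sup>2))"
proof (cases "l = 0")
  case True
  then have "cmod (levy_integrand x l) = x\<^sup>2 / 2" by (simp add: levy_integrand_def norm_divide norm_power)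
  also have "\<dots> \<le> 2 * (x\<^sup>2 + \<bar>x\<bar> + 2)" using zero_le_power2[of x] by (smt (verit) field_sum_of_halves)
  finally show ?thesis using True by simp
next
  case l: False
  define z where "z = \<i> * complex_of_real (l * x)"
  define w where "w = \<i> * complex_of_real (l * x / (1 + l\<^sup>2))"
  have nz: "cmod z = \<bar>l * x\<bar>" "Re z = 0" by (simp_all add: z_def norm_mult abs_mult)
  have l2: "0 < 1 + l\<^sup>2" by (simp add: add_pos_nonneg)
  have eq: "cmod (levy_integrand x l) = cmod (1 + w - exp z) / l\<^sup>2"
    using l by (simp add: levy_integrand_def w_def z_def norm_divide norm_power)
  show ?thesis
  proof (cases "\<bar>l\<bar> \<le> 1")
    case True
    have l1: "l\<^sup>2 \<le> 1" using True by (simp add: abs_square_le_1)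
    have "cmod (exp z - (\<Sum>k\<le>1. z ^ k / fact k)) \<le> exp \<bar>Re z\<bar> * cmod z ^ Suc 1 / fact 1"
      by (rule Taylor_exp)
    then have 1: "cmod (exp z - (1 + z)) \<le> (l * x)\<^sup>2"
      using nz by (simp add: power2_eq_square abs_mult)
    \<comment> \<open>The compensator \<open>w\<close> differs from the linear Taylor term
      \<open>z\<close> only to third order in \<open>l\<close>, so it does not spoil the
      cancellation.\<close>
    have "w - z = - \<i> * complex_of_real (l * x * l\<^sup>2 / (1 + l\<^sup>2))"
    proof -
      have "l * x / (1 + l\<^sup>2) - l * x = - (l * x * l\<^sup>2 / (1 + l\<^sup>2))" using l2 by (simp add: field_simps)
      then show ?thesis unfolding w_def z_def
        by (metis (no_types, lifting) minus_mult_commute of_real_diff of_real_minus right_diff_distrib)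
    qed
    then have "cmod (w - z) = \<bar>l * x * l\<^sup>2 / (1 + l\<^sup>2)\<bar>" by (simp only: norm_mult norm_minus_cancel norm_ii norm_of_real mult_1)
    also have "\<dots> \<le> \<bar>x\<bar> * l\<^sup>2"
    proof -
      have "\<bar>l * x * l\<^sup>2 / (1 + l\<^sup>2)\<bar> = (\<bar>l\<bar> * (\<bar>x\<bar> * l\<^sup>2)) / (1 + l\<^sup>2)" using l2 by (simp add: abs_mult)
      also have "\<dots> \<le> (1 * (\<bar>x\<bar> * l\<^sup>2)) / 1"
        by (rule frac_le[OF _ mult_right_mono[OF True]]) auto
      finally show ?thesis by simp
    qed
    finally have 2: "cmod (w - z) \<le> \<bar>x\<bar> * l\<^sup>2" .
    have "cmod (1 + w - exp z) \<le> cmod (w - z) + cmod (exp z - (1 + z))"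
      using norm_triangle_ineq4[of "w - z" "exp z - (1 + z)"] by (simp add: algebra_simps)
    also have "\<dots> \<le> (x\<^sup>2 + \<bar>x\<bar>) * l\<^sup>2" using 1 2 by (simp add: power_mult_distrib algebra_simps)
    finally have "cmod (levy_integrand x l) \<le> x\<^sup>2 + \<bar>x\<bar>" using l by (simp add: eq divide_le_eq)
    also have "\<dots> \<le> (x\<^sup>2 + \<bar>x\<bar> + 2) * (2 / (1 + l\<^sup>2))"
    proof -
      have "1 \<le> 2 / (1 + l\<^sup>2)" using l1 l2 by (simp add: le_divide_eq)
      then have "(x\<^sup>2 + \<bar>x\<bar> + 2) * 1 \<le> (x\<^sup>2 + \<bar>x\<bar> + 2) * (2 / (1 + l\<^sup>2))" by (intro mult_left_mono) auto
      then show ?thesis by simp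
    qed
    finally show ?thesis by (simp add: field_simps)
  next
    case False
    have l1: "1 < l\<^sup>2" using False by (metis abs_square_le_1 not_le)
    have "cmod (1 + w - exp z) \<le> cmod (1 + w) + cmod (exp z)" by (rule norm_triangle_ineq4)
    also have "cmod (1 + w) \<le> 1 + cmod w" using norm_triangle_ineq[of 1 w] by simp
    also have "cmod (exp z) = 1" by (simp add: z_def)
    also have "cmod w \<le> \<bar>x\<bar>"
    proof -
      have "cmod w = \<bar>l * x / (1 + l\<^sup>2)\<bar>" by (simp only: w_def norm_mult norm_ii norm_of_real mult_1)
      also have "\<dots> = \<bar>x\<bar> * (\<bar>l\<bar> / (1 + l\<^sup>2))" using l2 by (simp add: abs_mult)
      also have "\<dots> \<le> \<bar>x\<bar> * 1"
      proof (rule mult_left_mono)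
        have "\<bar>l\<bar> \<le> 1 + l\<^sup>2" using sum_squares_bound[of 1 "\<bar>l\<bar>"] by simp
        then show "\<bar>l\<bar> / (1 + l\<^sup>2) \<le> 1" using l2 by (simp add: divide_le_eq)
      qed simp
      finally show ?thesis by simp
    qed
    finally have n: "cmod (1 + w - exp z) \<le> x\<^sup>2 + \<bar>x\<bar> + 2" using zero_le_power2[of x] by linarith
    have "cmod (levy_integrand x l) \<le> (x\<^sup>2 + \<bar>x\<bar> + 2) * (1 / l\<^sup>2)"
      unfolding eq using n l by (simp add: divide_right_mono)
    also have "\<dots> \<le> (x\<^sup>2 + \<bar>x\<bar> + 2) * (2 / (1 + l\<^sup>2))"
      by (intro mult_left_mono) (use l1 l2 l in \<open>auto simp: field_simps\<close>)
    finally show ?thesis by (simp add: field_simps)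
  qed
qed

lemma levy_integrand_integrable:
  assumes "sets \<sigma> = sets borel" "integrable \<sigma> (\<lambda>l. 1 / (1 + l\<^sup>2))"
  shows "integrable \<sigma> (levy_integrand x)"
proof (rule Bochner_Integration.integrable_bound)
  show "integrable \<sigma> (\<lambda>l. 2 * (x\<^sup>2 + \<bar>x\<bar> + 2) * (1 / (1 + l\<^sup>2)))" using assms(2) by (rule integrable_mult_right)
  have "levy_integrand x \<in> borel_measurable borel" unfolding levy_integrand_def by measurable
  then show "levy_integrand x \<in> borel_measurable \<sigma>" by (simp add: measurable_cong_sets[OF assms(1)])
  show "AE l in \<sigma>. norm (levy_integrand x l) \<le> norm (2 * (x\<^sup>2 + \<bar>x\<bar> + 2) * (1 / (1 + l\<^sup>2)))"
    using levy_integrand_bound[of x] by (intro AE_I2) (smt (verit) real_norm_def)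
qed

lemma interval_integrable_accelerant:
  assumes "\<And>R. R > 0 \<Longrightarrow> L2_on {-R..R} H"
  shows "interval_lebesgue_integrable lborel (ereal 0) (ereal x) (\<lambda>s. of_real (x - s) * H s)"
proof -
  define R where "R = \<bar>x\<bar> + 1"
  have L: "L2_on {-R..R} H" by (rule assms) (simp add: R_def)
  have si: "set_integrable lborel S (\<lambda>s. of_real (x - s) * H s)" if S: "S \<subseteq> {-R..R}" "S \<in> sets borel" for S
  proof -
    have "sqi (\<lambda>s. indicator {-R..R} s * complex_of_real (x - s))"
      by (rule sqi_bounded_interval[where C = "\<bar>x\<bar> + R"]) (measurable, auto simp: norm_of_real simp del: of_real_diff)
    from sqi_integrable_mult[OF this L2_on_subset[OF L S, unfolded L2_on_iff_sqi]]
    have "integrable lborel (\<lambda>s. indicator {-R..R} s * complex_of_real (x - s) * (indicat_real S s *\<^sub>R H s))" .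
    also have "(\<lambda>s. indicator {-R..R} s * complex_of_real (x - s) * (indicat_real S s *\<^sub>R H s)) =
        (\<lambda>s. indicat_real S s *\<^sub>R (of_real (x - s) * H s))"
    proof (rule ext)
      fix s show "indicator {-R..R} s * complex_of_real (x - s) * (indicat_real S s *\<^sub>R H s) =
        indicat_real S s *\<^sub>R (of_real (x - s) * H s)"
        using S(1) by (cases "s \<in> S") auto
    qed
    finally show ?thesis by (simp add: set_integrable_def)
  qed
  show ?thesis
    unfolding interval_lebesgue_integrable_def einterval_eq
    by (cases "0 \<le> x") (auto simp: R_def zero_ereal_def simp del: of_real_diff intro!: si)
qed

theorem convex_spectral_measures: "convex_measures {\<sigma>. \<exists>A. L2_on {0..} A \<and> spectral_measure A \<sigma>}"
  unfolding convex_measures_def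
proof (intro ballI)
  fix \<sigma>1 \<sigma>2 and t :: real
  assume s1: "\<sigma>1 \<in> {\<sigma>. \<exists>A. L2_on {0..} A \<and> spectral_measure A \<sigma>}"
    and s2: "\<sigma>2 \<in> {\<sigma>. \<exists>A. L2_on {0..} A \<and> spectral_measure A \<sigma>}" and t: "t \<in> {0..1}"
  obtain A1 H1 \<beta>1 where 1: "L2_on {0..} A1" "accelerant_of A1 H1" "sets \<sigma>1 = sets borel" "integrable \<sigma>1 (\<lambda>l. 1 / (1 + l\<^sup>2))"
    and eq1: "\<And>x. of_real (\<bar>x\<bar> / 2) + interval_lebesgue_integral lborel (ereal 0) (ereal x) (\<lambda>s. of_real (x - s) * H1 s)
           = \<i> * of_real (\<beta>1 * x) + integral\<^sup>L \<sigma>1 (levy_integrand x)"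
    using s1 unfolding spectral_measure_def by blast
  obtain A2 H2 \<beta>2 where 2: "L2_on {0..} A2" "accelerant_of A2 H2" "sets \<sigma>2 = sets borel" "integrable \<sigma>2 (\<lambda>l. 1 / (1 + l\<^sup>2))"
    and eq2: "\<And>x. of_real (\<bar>x\<bar> / 2) + interval_lebesgue_integral lborel (ereal 0) (ereal x) (\<lambda>s. of_real (x - s) * H2 s)
           = \<i> * of_real (\<beta>2 * x) + integral\<^sup>L \<sigma>2 (levy_integrand x)"
    using s2 unfolding spectral_measure_def by blast
  obtain A where A: "accelerant_of A (mixH H1 H2 t)" "L2_on {0..} A"
    using accelerant_mix_L2[OF 1(2,1) 2(2,1) t] by blast
  have ss: "sets \<sigma>2 = sets \<sigma>1" using 1 2 by simp
  have "spectral_measure A (mix_measure t \<sigma>1 \<sigma>2)"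
    unfolding spectral_measure_def
  proof (intro conjI exI[of _ "mixH H1 H2 t"] exI[of _ "t * \<beta>1 + (1 - t) * \<beta>2"] allI A)
    show "sets (mix_measure t \<sigma>1 \<sigma>2) = sets borel" using 1 by simp
    show "integrable (mix_measure t \<sigma>1 \<sigma>2) (\<lambda>l. 1 / (1 + l\<^sup>2))" by (rule integrable_mix_measure[OF ss 1(4) 2(4)])
    fix x :: real
    have L: "\<And>R. R > 0 \<Longrightarrow> L2_on {-R..R} H1" "\<And>R. R > 0 \<Longrightarrow> L2_on {-R..R} H2"
      using 1 2 by (auto simp: accelerant_of_def accelerant_def)
    let ?I = "\<lambda>H. interval_lebesgue_integral lborel (ereal 0) (ereal x) (\<lambda>s. of_real (x - s) * H s)"
    have "?I (mixH H1 H2 t) = interval_lebesgue_integral lborel (ereal 0) (ereal x)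
        (\<lambda>s. of_real t * (of_real (x - s) * H1 s) + of_real (1 - t) * (of_real (x - s) * H2 s))"
      by (simp add: mixH_def algebra_simps)
    also have "\<dots> = interval_lebesgue_integral lborel (ereal 0) (ereal x) (\<lambda>s. of_real t * (of_real (x - s) * H1 s)) +
       interval_lebesgue_integral lborel (ereal 0) (ereal x) (\<lambda>s. of_real (1 - t) * (of_real (x - s) * H2 s))"
      by (rule interval_lebesgue_integral_add(2);
          rule interval_lebesgue_integrable_mult_right, rule interval_integrable_accelerant, erule L)
    also have "\<dots> = of_real t * ?I H1 + of_real (1 - t) * ?I H2"
      by (simp only: interval_lebesgue_integral_mult_right)
    finally have I: "?I (mixH H1 H2 t) = of_real t * ?I H1 + of_real (1 - t) * ?I H2" .
    have "complex_of_real (\<bar>x\<bar> / 2) + ?I (mixH H1 H2 t) =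
      of_real t * (of_real (\<bar>x\<bar> / 2) + ?I H1) + of_real (1 - t) * (of_real (\<bar>x\<bar> / 2) + ?I H2)"
    proof -
      have "z + (of_real t * a + of_real (1 - t) * b) = of_real t * (z + a) + of_real (1 - t) * (z + b)" for z a b :: complex
        by (simp add: algebra_simps)
      then show ?thesis unfolding I .
    qed
    also have "\<dots> = \<i> * of_real ((t * \<beta>1 + (1 - t) * \<beta>2) * x) + integral\<^sup>L (mix_measure t \<sigma>1 \<sigma>2) (levy_integrand x)"
      unfolding eq1 eq2 integral_mix_measure_complex[OF ss levy_integrand_integrable[OF 1(3,4)] levy_integrand_integrable[OF 2(3,4)] t]
      by (simp add: algebra_simps)
    finally show "complex_of_real (\<bar>x\<bar> / 2) + ?I (mixH H1 H2 t) =
       \<i> * of_real ((t * \<beta>1 + (1 - t) * \<beta>2) * x) + integral\<^sup>L (mix_measure t \<sigma>1 \<sigma>2) (levy_integrand x)" .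
  qed
  with A(2) show "mix_measure t \<sigma>1 \<sigma>2 \<in> {\<sigma>. \<exists>A. L2_on {0..} A \<and> spectral_measure A \<sigma>}" by blast
qed

section \<open>Krein systems as integral equations\<close>

text \<open>Integration by parts for indefinite integrals. Pointwise derivatives are avoided by
  applying Fubini to the product of the densities over the triangle below the diagonal.\<close>

lemma caratheodory_product:
  fixes u v \<phi> \<psi> :: "real \<Rightarrow> complex"
  assumes R: "R \<ge> 0" and i1: "set_integrable lborel {0..R} \<phi>" and i2: "set_integrable lborel {0..R} \<psi>"
    and u: "\<And>r. r \<in> {0..R} \<Longrightarrow> u r = u0 + set_lebesgue_integral lborel {0..r} \<phi>"
    and v: "\<And>r. r \<in> {0..R} \<Longrightarrow> v r = v0 + set_lebesgue_integral lborel {0..r} \<psi>"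
  shows "u R * v R = u0 * v0 + set_lebesgue_integral lborel {0..R} (\<lambda>s. \<phi> s * v s + u s * \<psi> s)"
proof -
  define f g where "f s = indicator {0..R} s * \<phi> s" and "g s = indicator {0..R} s * \<psi> s" for s
  have fi: "integrable lborel f" and gi: "integrable lborel g"
    using i1 i2 by (simp_all add: f_def[abs_def] g_def[abs_def] set_integrable_def indicat_scaleR)
  note [measurable] = borel_measurable_integrable[OF fi] borel_measurable_integrable[OF gi]
  have int_le: "set_lebesgue_integral lborel {0..s} \<phi> = (LINT t|lborel. indicator {..s} t * f t)"
    "set_lebesgue_integral lborel {0..s} \<psi> = (LINT t|lborel. indicator {..s} t * g t)" if "s \<in> {0..R}" for s
    unfolding set_lebesgue_integral_def f_def g_def using that
    by (auto intro!: Bochner_Integration.integral_cong simp: indicator_def)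
  define F where "F s = (LINT t|lborel. indicator {..s} t * f t)" for s
  define G where "G s = (LINT t|lborel. indicator {..s} t * g t)" for s
  have Fi: "integrable lborel (\<lambda>t. indicator {..s} t * f t)" and Gi: "integrable lborel (\<lambda>t. indicator {..s} t * g t)" for s :: real
    using integrable_mult_indicator[of "{..s}" lborel f] integrable_mult_indicator[of "{..s}" lborel g] fi gi
    by (simp_all add: indicat_scaleR)
  have Gb: "cmod (G s) \<le> (LINT t|lborel. cmod (g t))" and Fb: "cmod (F s) \<le> (LINT t|lborel. cmod (f t))" for s
  proof -
    have "cmod (G s) \<le> (LINT t|lborel. cmod (indicator {..s} t * g t))" unfolding G_def by (rule integral_norm_bound)
    also have "\<dots> \<le> (LINT t|lborel. cmod (g t))"
      by (rule integral_mono'[OF integrable_norm[OF gi]]) (auto simp: indicator_def)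
    finally show "cmod (G s) \<le> (LINT t|lborel. cmod (g t))" .
    have "cmod (F s) \<le> (LINT t|lborel. cmod (indicator {..s} t * f t))" unfolding F_def by (rule integral_norm_bound)
    also have "\<dots> \<le> (LINT t|lborel. cmod (f t))"
      by (rule integral_mono'[OF integrable_norm[OF fi]]) (auto simp: indicator_def)
    finally show "cmod (F s) \<le> (LINT t|lborel. cmod (f t))" .
  qed
  have iT: "indicator {..s} t = (if t \<le> s then 1 else (0::complex))" for s t :: real by simp
  have [measurable]: "F \<in> borel_measurable borel" "G \<in> borel_measurable borel"
    unfolding F_def[abs_def] G_def[abs_def] iT by measurable
  have fG: "integrable lborel (\<lambda>s. f s * G s)"
  proof (rule Bochner_Integration.integrable_bound)
    show "integrable lborel (\<lambda>s. cmod (f s) * (LINT t|lborel. cmod (g t)))" using fi by auto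
    show "AE s in lborel. norm (f s * G s) \<le> norm (cmod (f s) * (LINT t|lborel. cmod (g t)))"
      using Gb by (auto simp: norm_mult intro!: mult_left_mono)
  qed measurable
  have gF: "integrable lborel (\<lambda>s. g s * F s)"
  proof (rule Bochner_Integration.integrable_bound)
    show "integrable lborel (\<lambda>s. cmod (g s) * (LINT t|lborel. cmod (f t)))" using gi by auto
    show "AE s in lborel. norm (g s * F s) \<le> norm (cmod (g s) * (LINT t|lborel. cmod (f t)))"
      using Fb by (auto simp: norm_mult intro!: mult_left_mono)
  qed measurable
  have prod: "integrable (lborel \<Otimes>\<^sub>M lborel) (\<lambda>(s, t). (if s \<le> t then 1 else 0) * (f s * g t))"
  proof (rule lborel_pair.Fubini_integrable)
    show "(\<lambda>(s, t). (if s \<le> t then 1 else 0) * (f s * g t)) \<in> borel_measurable (lborel \<Otimes>\<^sub>M lborel)" by measurable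
    have b: "(LINT t|lborel. norm ((if s \<le> t then 1 else 0) * (f s * g t))) \<le> cmod (f s) * (LINT t|lborel. cmod (g t))" for s
    proof -
      have "(LINT t|lborel. norm ((if s \<le> t then 1 else 0) * (f s * g t))) \<le> (LINT t|lborel. cmod (f s) * cmod (g t))"
        by (rule integral_mono') (use gi in \<open>auto simp: norm_mult\<close>)
      then show ?thesis by simp
    qed
    have m: "(\<lambda>s. LINT t|lborel. norm ((if s \<le> t then 1 else 0) * (f s * g t))) \<in> borel_measurable lborel" by measurable
    have "integrable lborel (\<lambda>s. LINT t|lborel. norm ((if s \<le> t then 1 else 0) * (f s * g t)))"
    proof (rule Bochner_Integration.integrable_bound[OF _ m])
      show "integrable lborel (\<lambda>s. cmod (f s) * (LINT t|lborel. cmod (g t)))" using fi by auto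
      show "AE s in lborel. norm (LINT t|lborel. norm ((if s \<le> t then 1 else 0) * (f s * g t))) \<le> norm (cmod (f s) * (LINT t|lborel. cmod (g t)))"
      proof (rule AE_I2)
        fix s
        have "0 \<le> (LINT t|lborel. norm ((if s \<le> t then 1 else 0) * (f s * g t)))" by (rule integral_nonneg_AE) auto
        with b[of s] show "norm (LINT t|lborel. norm ((if s \<le> t then 1 else 0) * (f s * g t))) \<le> norm (cmod (f s) * (LINT t|lborel. cmod (g t)))"
          unfolding real_norm_def by linarith
      qed
    qed
    then show "integrable lborel (\<lambda>s. LINT t|lborel. norm (case (s, t) of (s, t) \<Rightarrow> (if s \<le> t then 1 else 0) * (f s * g t)))"
      by (simp only: prod.case)
    show "AE s in lborel. integrable lborel (\<lambda>t. case (s, t) of (s, t) \<Rightarrow> (if s \<le> t then 1 else 0) * (f s * g t))"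
    proof (rule AE_I2)
      fix s
      show "integrable lborel (\<lambda>t. case (s, t) of (s, t) \<Rightarrow> (if s \<le> t then 1 else 0) * (f s * g t))"
        by (rule Bochner_Integration.integrable_bound[of lborel "\<lambda>t. cmod (f s) * cmod (g t)"]) (use gi in \<open>auto simp: norm_mult\<close>)
    qed
  qed
  \<comment> \<open>Exchanging the order over the triangle turns the inner integral of
    \<open>f\<close> up to \<open>t\<close> into the integral of \<open>g\<close> beyond
    \<open>s\<close>, which is the total minus \<open>G s\<close> up to a null set.\<close>
  have "(LINT t|lborel. g t * F t) = (LINT t|lborel. LINT s|lborel. (if s \<le> t then 1 else 0) * (f s * g t))"
  proof (rule Bochner_Integration.integral_cong[OF HOL.refl])
    fix t
    have "g t * F t = (LINT s|lborel. g t * (indicator {..t} s * f s))" unfolding F_def by simp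
    also have "\<dots> = (LINT s|lborel. (if s \<le> t then 1 else 0) * (f s * g t))"
      by (rule Bochner_Integration.integral_cong) auto
    finally show "g t * F t = (LINT s|lborel. (if s \<le> t then 1 else 0) * (f s * g t))" .
  qed
  also have "\<dots> = (LINT s|lborel. LINT t|lborel. (if s \<le> t then 1 else 0) * (f s * g t))"
    using lborel_pair.Fubini_integral[OF prod] by simp
  also have "\<dots> = (LINT s|lborel. f s * ((LINT t|lborel. g t) - G s))"
  proof (rule Bochner_Integration.integral_cong[OF HOL.refl])
    fix s
    have "(LINT t|lborel. g t) - G s = (LINT t|lborel. g t - indicator {..s} t * g t)"
      unfolding G_def by (rule Bochner_Integration.integral_diff[OF gi Gi, symmetric])
    also have "\<dots> = (LINT t|lborel. (if s \<le> t then 1 else 0) * g t)"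
    proof (rule integral_cong_AE)
      show "AE t in lborel. g t - indicator {..s} t * g t = (if s \<le> t then 1 else 0) * g t"
        using AE_lborel_singleton[of s] by eventually_elim auto
    qed measurable
    finally have "f s * ((LINT t|lborel. g t) - G s) = (LINT t|lborel. f s * ((if s \<le> t then 1 else 0) * g t))" by simp
    also have "\<dots> = (LINT t|lborel. (if s \<le> t then 1 else 0) * (f s * g t))"
      by (rule Bochner_Integration.integral_cong) auto
    finally show "(LINT t|lborel. (if s \<le> t then 1 else 0) * (f s * g t)) = f s * ((LINT t|lborel. g t) - G s)" by simp
  qed
  also have "\<dots> = (LINT s|lborel. f s * (LINT t|lborel. g t)) - (LINT s|lborel. f s * G s)"
    unfolding right_diff_distrib by (rule Bochner_Integration.integral_diff) (use fi fG in auto)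
  finally have key: "(LINT t|lborel. g t * F t) + (LINT s|lborel. f s * G s) = (LINT s|lborel. f s) * (LINT t|lborel. g t)" by simp
  have "set_lebesgue_integral lborel {0..R} (\<lambda>s. \<phi> s * v s + u s * \<psi> s) =
    (LINT s|lborel. (v0 * f s + f s * G s) + (u0 * g s + g s * F s))"
    unfolding set_lebesgue_integral_def
  proof (rule Bochner_Integration.integral_cong[OF HOL.refl])
    fix s :: real
    show "indicat_real {0..R} s *\<^sub>R (\<phi> s * v s + u s * \<psi> s) = (v0 * f s + f s * G s) + (u0 * g s + g s * F s)"
    proof (cases "s \<in> {0..R}")
      case True
      then have "u s = u0 + F s" "v s = v0 + G s" using u v int_le by (simp_all add: F_def G_def)
      then show ?thesis using True by (simp add: f_def g_def algebra_simps)
    qed (simp add: f_def g_def)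
  qed
  also have "\<dots> = v0 * (LINT s|lborel. f s) + (LINT s|lborel. f s * G s) + (u0 * (LINT s|lborel. g s) + (LINT s|lborel. g s * F s))"
    using fi gi fG gF by (subst Bochner_Integration.integral_add | simp)+
  finally have S: "set_lebesgue_integral lborel {0..R} (\<lambda>s. \<phi> s * v s + u s * \<psi> s) =
     v0 * (LINT s|lborel. f s) + u0 * (LINT s|lborel. g s) + (LINT s|lborel. f s) * (LINT t|lborel. g t)"
    using key by (simp add: algebra_simps)
  have "set_lebesgue_integral lborel {0..R} \<phi> = (LINT s|lborel. f s)" "set_lebesgue_integral lborel {0..R} \<psi> = (LINT s|lborel. g s)"
    unfolding set_lebesgue_integral_def f_def g_def by (simp_all add: indicat_scaleR)
  then have "u R = u0 + (LINT s|lborel. f s)" "v R = v0 + (LINT s|lborel. g s)"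
    using u[of R] v[of R] R by auto
  then show ?thesis using S by (simp add: algebra_simps)
qed

lemma set_integrable_L2_continuous:
  assumes A: "L2_on {0..R} A" and y: "continuous_on {0..R} y"
  shows "set_integrable lborel {0..R} (\<lambda>s. A s * (y s :: complex))"
proof -
  have m: "(\<lambda>x. indicat_real {0..R} x *\<^sub>R y x) \<in> borel_measurable borel"
    by (rule borel_measurable_continuous_on_indicator[OF _ y]) simp
  have "\<exists>C. \<forall>x\<in>{0..R}. cmod (y x) \<le> C"
    using compact_imp_bounded[OF compact_continuous_image[OF y compact_Icc]] by (auto simp: bounded_iff)
  then obtain C where C: "\<And>x. x \<in> {0..R} \<Longrightarrow> cmod (y x) \<le> C" by blast
  have "sqi (\<lambda>x. indicator {0..R} x * (indicat_real {0..R} x *\<^sub>R y x))"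
    by (rule sqi_bounded_interval[OF m, of 0 R C]) (use C in auto)
  from sqi_integrable_mult[OF A[unfolded L2_on_iff_sqi] this]
  have "integrable lborel (\<lambda>x. (indicat_real {0..R} x *\<^sub>R A x) * (indicator {0..R} x * (indicat_real {0..R} x *\<^sub>R y x)))" .
  also have "(\<lambda>x. (indicat_real {0..R} x *\<^sub>R A x) * (indicator {0..R} x * (indicat_real {0..R} x *\<^sub>R y x))) =
    (\<lambda>x. indicat_real {0..R} x *\<^sub>R (A x * y x))" by (auto simp: indicator_def)
  finally show ?thesis by (simp add: set_integrable_def)
qed

lemma L2_on_cnj: "L2_on S A \<Longrightarrow> L2_on S (\<lambda>x. cnj (A x))"
  unfolding L2_on_iff_sqi by (drule sqi_cnj) simp

lemma set_integrable_continuous_Icc: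
  assumes "continuous_on {0..R} (y :: real \<Rightarrow> complex)" shows "set_integrable lborel {0..R} y"
  by (rule borel_integrable_compact[OF compact_Icc assms, unfolded set_integrable_def[symmetric]])

lemma continuous_on_indefinite:
  assumes "\<And>R. R \<ge> 0 \<Longrightarrow> set_integrable lborel {0..R} (\<phi> :: real \<Rightarrow> complex)"
  shows "continuous_on {0..} (\<lambda>r. set_lebesgue_integral lborel {0..r} \<phi>)"
  unfolding continuous_on_sequentially
proof (intro allI ballI impI, elim conjE)
  fix x :: real and r :: "nat \<Rightarrow> real"
  assume x: "x \<in> {0..}" and r: "\<forall>n. r n \<in> {0..}" "r \<longlonglongrightarrow> x"
  obtain R where R: "\<And>n. r n \<le> R" using convergent_imp_Bseq[OF convergentI[OF r(2)]] by (auto simp: Bseq_def intro: order_trans[OF abs_ge_self])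
  have xR: "x \<le> R" by (rule LIMSEQ_le_const2[OF r(2)]) (use R in auto)
  have "(\<lambda>n. LINT s|lborel. indicat_real {0..r n} s *\<^sub>R \<phi> s) \<longlonglongrightarrow> (LINT s|lborel. indicat_real {0..x} s *\<^sub>R \<phi> s)"
  proof (rule integral_dominated_convergence)
    have R0: "R \<ge> 0" using x xR by simp
    show "integrable lborel (\<lambda>s. cmod (indicat_real {0..R} s *\<^sub>R \<phi> s))"
      using assms[OF R0] by (intro integrable_norm) (simp add: set_integrable_def)
    show "(\<lambda>s. indicat_real {0..x} s *\<^sub>R \<phi> s) \<in> borel_measurable lborel"
      using assms[of x] x by (auto simp: set_integrable_def)
    show "(\<lambda>s. indicat_real {0..r n} s *\<^sub>R \<phi> s) \<in> borel_measurable lborel" for n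
      using assms[of "r n"] r(1) by (auto simp: set_integrable_def)
    show "AE s in lborel. norm (indicat_real {0..r n} s *\<^sub>R \<phi> s) \<le> cmod (indicat_real {0..R} s *\<^sub>R \<phi> s)" for n
      using order_trans[OF _ R[of n]] by (intro AE_I2) (auto simp: indicator_def)
    show "AE s in lborel. (\<lambda>n. indicat_real {0..r n} s *\<^sub>R \<phi> s) \<longlonglongrightarrow> indicat_real {0..x} s *\<^sub>R \<phi> s"
      using AE_lborel_singleton[of x]
    proof eventually_elim
      case (elim s)
      have "eventually (\<lambda>n. indicat_real {0..r n} s *\<^sub>R \<phi> s = indicat_real {0..x} s *\<^sub>R \<phi> s) sequentially"
      proof (cases "s < x")
        case True
        show ?thesis by (rule eventually_mono[OF order_tendstoD(1)[OF r(2) True]]) (use True in \<open>auto simp: indicator_def\<close>)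
      next
        case False
        with elim have "x < s" by simp
        then show ?thesis by (intro eventually_mono[OF order_tendstoD(2)[OF r(2)]]) (auto simp: indicator_def)
      qed
      then show ?case by (rule tendsto_eventually)
    qed
  qed
  then show "((\<lambda>r. set_lebesgue_integral lborel {0..r} \<phi>) \<circ> r) \<longlonglongrightarrow> set_lebesgue_integral lborel {0..x} \<phi>"
    by (simp add: set_lebesgue_integral_def o_def)
qed

lemma exp_indefinite:
  "exp (z * of_real r :: complex) = 1 + set_lebesgue_integral lborel {0..r} (\<lambda>s. z * exp (z * of_real s))" if "r \<ge> 0"
proof -
  have "((\<lambda>w. exp (z * w)) has_field_derivative (z * exp (z * of_real s))) (at (of_real s))" for s :: real
    by (auto intro!: derivative_eq_intros simp: mult.commute)
  from has_vector_derivative_real_field[OF this]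
  have "((\<lambda>s. exp (z * of_real s)) has_vector_derivative (z * exp (z * of_real s))) (at s within {0..r})" for s
    by blast
  then have "(LINT s|lborel. indicat_real {0..r} s *\<^sub>R (z * exp (z * of_real s))) = exp (z * of_real r) - exp (z * of_real 0)"
    by (intro integral_FTC_Icc[OF that]) (auto intro!: continuous_intros)
  then show ?thesis unfolding set_lebesgue_integral_def by (simp only: of_real_0 mult_zero_right exp_zero add_diff_cancel_left') simp

qed

lemma integrable_vec:
  fixes f :: "'a \<Rightarrow> ('b::{banach, second_countable_topology, euclidean_space})^'n"
  assumes "\<And>i. integrable M (\<lambda>x. f x $ i)"
  shows "integrable M f"
proof -
  have bl: "bounded_linear (axis i :: 'b \<Rightarrow> 'b^'n)" for i
  proof (rule bounded_linear_intro[where K = 1])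
    fix x :: 'b
    have "(norm (axis i x $ j))\<^sup>2 = (if j = i then (norm x)\<^sup>2 else 0)" for j by (simp add: axis_def)
    then show "norm (axis i x :: 'b^'n) \<le> norm x * 1" by (simp add: norm_vec_def L2_set_def)
  qed (simp_all add: axis_def vec_eq_iff)
  have "integrable M (\<lambda>x. \<Sum>i\<in>UNIV. axis i (f x $ i))"
    by (intro Bochner_Integration.integrable_sum integrable_bounded_linear[OF bl] assms)
  also have "(\<lambda>x. \<Sum>i\<in>UNIV. axis i (f x $ i)) = f"
    by (auto simp: vec_eq_iff axis_def if_distrib cong: if_cong)
  finally show ?thesis .
qed

section \<open>Krein systems entry by entry\<close>

text \<open>\<open>p\<close> and \<open>q\<close> are the top row of the matrix solution,
  \<open>s\<close> and \<open>w\<close> the bottom row, so \<open>s r / w r\<close> is the quotient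
  whose limit is the Schur function.\<close>

definition krein_comp :: "(real \<Rightarrow> complex) \<Rightarrow> complex \<Rightarrow> (real \<Rightarrow> complex) \<Rightarrow> (real \<Rightarrow> complex) \<Rightarrow> (real \<Rightarrow> complex) \<Rightarrow> (real \<Rightarrow> complex) \<Rightarrow> bool" where
  "krein_comp A l p q s w \<longleftrightarrow>
     continuous_on {0..} p \<and> continuous_on {0..} q \<and> continuous_on {0..} s \<and> continuous_on {0..} w \<and>
     (\<forall>r\<ge>0. p r = 1 + set_lebesgue_integral lborel {0..r} (\<lambda>t. \<i> * l * p t - cnj (A t) * s t) \<and>
             q r = set_lebesgue_integral lborel {0..r} (\<lambda>t. \<i> * l * q t - cnj (A t) * w t) \<and>
             s r = - set_lebesgue_integral lborel {0..r} (\<lambda>t. A t * p t) \<and>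
             w r = 1 - set_lebesgue_integral lborel {0..r} (\<lambda>t. A t * q t))"

lemma krein_matrix_mult:
  "(krein_matrix A l t ** X) $ 1 $ 1 = \<i> * l * X $ 1 $ 1 - cnj (A t) * X $ 2 $ 1"
  "(krein_matrix A l t ** X) $ 1 $ 2 = \<i> * l * X $ 1 $ 2 - cnj (A t) * X $ 2 $ 2"
  "(krein_matrix A l t ** X) $ 2 $ 1 = - (A t * X $ 1 $ 1)"
  "(krein_matrix A l t ** X) $ 2 $ 2 = - (A t * X $ 1 $ 2)"
  by (simp_all add: krein_matrix_def matrix_matrix_mult_def sum_2)

lemma vec22_eq_iff: "(M :: 'a^2^2) = N \<longleftrightarrow> M $ 1 $ 1 = N $ 1 $ 1 \<and> M $ 1 $ 2 = N $ 1 $ 2 \<and> M $ 2 $ 1 = N $ 2 $ 1 \<and> M $ 2 $ 2 = N $ 2 $ 2"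
  unfolding vec_eq_iff[of M N] vec_eq_iff[of "M $ _" "N $ _"] forall_2 by blast

lemma mat1_22: "(mat 1 :: complex^2^2) $ 1 $ 1 = 1" "(mat 1 :: complex^2^2) $ 1 $ 2 = 0"
      "(mat 1 :: complex^2^2) $ 2 $ 1 = 0" "(mat 1 :: complex^2^2) $ 2 $ 2 = 1" by (simp_all add: mat_def)

lemma eq_mat1_plus_iff: "(Z :: complex^2^2) = mat 1 + Y \<longleftrightarrow> Z $ 1 $ 1 = 1 + Y $ 1 $ 1 \<and> Z $ 1 $ 2 = Y $ 1 $ 2 \<and> Z $ 2 $ 1 = Y $ 2 $ 1 \<and> Z $ 2 $ 2 = 1 + Y $ 2 $ 2"
  unfolding vec22_eq_iff vector_add_component mat1_22 add_0_left ..

lemma krein_solution_iff: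
  assumes A: "L2_on {0..} A"
  shows "krein_solution A l X \<longleftrightarrow> krein_comp A l (\<lambda>r. X r $ 1 $ 1) (\<lambda>r. X r $ 1 $ 2) (\<lambda>r. X r $ 2 $ 1) (\<lambda>r. X r $ 2 $ 2)"
proof -
  have cont: "continuous_on {0..} X \<longleftrightarrow> continuous_on {0..} (\<lambda>r. X r $ 1 $ 1) \<and> continuous_on {0..} (\<lambda>r. X r $ 1 $ 2) \<and>
      continuous_on {0..} (\<lambda>r. X r $ 2 $ 1) \<and> continuous_on {0..} (\<lambda>r. X r $ 2 $ 2)"
  proof
    assume "continuous_on {0..} X"
    then show "continuous_on {0..} (\<lambda>r. X r $ 1 $ 1) \<and> continuous_on {0..} (\<lambda>r. X r $ 1 $ 2) \<and>
      continuous_on {0..} (\<lambda>r. X r $ 2 $ 1) \<and> continuous_on {0..} (\<lambda>r. X r $ 2 $ 2)"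
      by (intro conjI; rule continuous_on_component[OF continuous_on_component])
  next
    assume c: "continuous_on {0..} (\<lambda>r. X r $ 1 $ 1) \<and> continuous_on {0..} (\<lambda>r. X r $ 1 $ 2) \<and>
      continuous_on {0..} (\<lambda>r. X r $ 2 $ 1) \<and> continuous_on {0..} (\<lambda>r. X r $ 2 $ 2)"
    have "continuous_on {0..} (\<lambda>r. X r $ i $ j)" for i j :: 2
      using c exhaust_2[of i] exhaust_2[of j] by auto
    then have "continuous_on {0..} (\<lambda>r. \<chi> i. \<chi> j. X r $ i $ j)"
      by (intro continuous_on_vec_lambda) auto
    then show "continuous_on {0..} X" by simp
  qed
  show ?thesis
  proof (cases "continuous_on {0..} X")
    case False
    then show ?thesis using cont by (auto simp: krein_solution_def krein_comp_def)
  next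
    case True
    have c: "continuous_on {0..r} (\<lambda>r. X r $ i $ j)" for i j :: 2 and r
      by (rule continuous_on_component[OF continuous_on_component[OF continuous_on_subset[OF True]]]) auto
    have LA: "L2_on {0..r} A" for r by (rule L2_on_subset[OF A]) auto
    have i: "set_integrable lborel {0..r} (\<lambda>t. (krein_matrix A l t ** X t) $ i $ j)" for i j :: 2 and r
    proof -
      have 1: "set_integrable lborel {0..r} (\<lambda>t. \<i> * l * X t $ 1 $ j)" for j
        by (rule set_integrable_continuous_Icc[OF continuous_on_mult[OF continuous_on_const c]])
      have 2: "set_integrable lborel {0..r} (\<lambda>t. cnj (A t) * X t $ 2 $ j)" for j
        by (rule set_integrable_L2_continuous[OF L2_on_cnj[OF LA] c])
      have 3: "set_integrable lborel {0..r} (\<lambda>t. - (A t * X t $ 1 $ j))" for j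
        using set_integrable_L2_continuous[OF LA c[of r 1 j]] by (simp add: set_integrable_def)
      have 12: "set_integrable lborel {0..r} (\<lambda>t. \<i> * l * X t $ 1 $ j - cnj (A t) * X t $ 2 $ j)" for j
        by (rule set_integral_diff(1)[OF 1 2])
      show ?thesis
        using exhaust_2[of i] exhaust_2[of j] by (auto simp: krein_matrix_mult 12 3)
    qed
    \<comment> \<open>Integrability of the whole matrix must be known before entries are taken: a
      non-integrable vector function has integral 0 by default, whatever its components do.\<close>
    have I: "integrable lborel (\<lambda>t. indicat_real {0..r} t *\<^sub>R (krein_matrix A l t ** X t))" for r
      by (rule integrable_vec, rule integrable_vec) (simp only: vector_scaleR_component, rule i[unfolded set_integrable_def])
    have comp: "set_lebesgue_integral lborel {0..r} (\<lambda>t. krein_matrix A l t ** X t) $ i $ j =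
        set_lebesgue_integral lborel {0..r} (\<lambda>t. (krein_matrix A l t ** X t) $ i $ j)" for i j :: 2 and r
    proof -
      have bl: "bounded_linear (\<lambda>M :: complex^2^2. M $ i $ j)"
        by (rule bounded_linear_compose[OF bounded_linear_vec_nth bounded_linear_vec_nth])
      show ?thesis
        unfolding set_lebesgue_integral_def integral_bounded_linear[OF bl I, symmetric]
        by (simp only: vector_scaleR_component)
    qed
    have m: "set_lebesgue_integral lborel S (\<lambda>t. - g t) = - set_lebesgue_integral lborel S g" for S and g :: "real \<Rightarrow> complex"
      by (simp add: set_lebesgue_integral_def)
    show ?thesis
      unfolding krein_solution_def krein_comp_def eq_mat1_plus_iff comp krein_matrix_mult m
      using True cont by simp
  qed
qed

locale krein =
  fixes A l p q s w assumes A: "L2_on {0..} A" and kr: "krein_comp A l p q s w"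
begin

lemma cont: "continuous_on {0..r} p" "continuous_on {0..r} q" "continuous_on {0..r} s" "continuous_on {0..r} w"
  using kr unfolding krein_comp_def by (auto intro: continuous_on_subset)

lemma LA: "L2_on {0..r} A" by (rule L2_on_subset[OF A]) auto

lemma eqs:
  assumes "r \<ge> 0"
  shows "p r = 1 + set_lebesgue_integral lborel {0..r} (\<lambda>t. \<i> * l * p t - cnj (A t) * s t)"
    "q r = 0 + set_lebesgue_integral lborel {0..r} (\<lambda>t. \<i> * l * q t - cnj (A t) * w t)"
    "s r = 0 + set_lebesgue_integral lborel {0..r} (\<lambda>t. - (A t * p t))"
    "w r = 1 + set_lebesgue_integral lborel {0..r} (\<lambda>t. - (A t * q t))"
  using kr assms unfolding krein_comp_def by (auto simp: set_lebesgue_integral_def)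

lemma int_A: "continuous_on {0..r} y \<Longrightarrow> set_integrable lborel {0..r} (\<lambda>t. A t * y t)"
    "continuous_on {0..r} y \<Longrightarrow> set_integrable lborel {0..r} (\<lambda>t. cnj (A t) * y t)"
  by (rule set_integrable_L2_continuous[OF LA] set_integrable_L2_continuous[OF L2_on_cnj[OF LA]]; assumption)+

lemma ints:
  "set_integrable lborel {0..r} (\<lambda>t. \<i> * l * p t - cnj (A t) * s t)"
  "set_integrable lborel {0..r} (\<lambda>t. \<i> * l * q t - cnj (A t) * w t)"
  "set_integrable lborel {0..r} (\<lambda>t. - (A t * p t))"
  "set_integrable lborel {0..r} (\<lambda>t. - (A t * q t))"
proof -
  show "set_integrable lborel {0..r} (\<lambda>t. \<i> * l * p t - cnj (A t) * s t)"
    by (intro set_integral_diff(1) int_A cont set_integrable_continuous_Icc continuous_intros)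
  show "set_integrable lborel {0..r} (\<lambda>t. \<i> * l * q t - cnj (A t) * w t)"
    by (intro set_integral_diff(1) int_A cont set_integrable_continuous_Icc continuous_intros)
  show "set_integrable lborel {0..r} (\<lambda>t. - (A t * p t))" "set_integrable lborel {0..r} (\<lambda>t. - (A t * q t))"
    using int_A(1)[OF cont(1)] int_A(1)[OF cont(2)] by (simp_all add: set_integrable_def)
qed

end

section \<open>Calculus of indefinite integrals\<close>

text \<open>Local absolute continuity together with a chosen density. The relation is closed under
  sums, products and conjugation, so identities for Krein solutions reduce to algebra between
  densities.\<close>

definition indef :: "(real \<Rightarrow> complex) \<Rightarrow> (real \<Rightarrow> complex) \<Rightarrow> bool" where
  "indef u \<phi> \<longleftrightarrow> (\<forall>r\<ge>0. set_integrable lborel {0..r} \<phi> \<and> u r = u 0 + set_lebesgue_integral lborel {0..r} \<phi>)"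

lemma set_integral_singleton [simp]: "set_lebesgue_integral lborel {x::real} f = (0 :: complex)"
proof -
  have "(LINT y|lborel. indicat_real {x} y *\<^sub>R f y) = 0"
    by (rule integral_eq_zero_AE) (use AE_lborel_singleton[of x] in \<open>eventually_elim, simp\<close>)
  then show ?thesis by (simp add: set_lebesgue_integral_def)
qed

lemma indefI:
  assumes "\<And>r. r \<ge> 0 \<Longrightarrow> set_integrable lborel {0..r} \<phi>" "\<And>r. r \<ge> 0 \<Longrightarrow> u r = c + set_lebesgue_integral lborel {0..r} \<phi>"
  shows "indef u \<phi>"
proof -
  have "u 0 = c" using assms(2)[of 0] by simp
  then show ?thesis unfolding indef_def using assms by blast
qed

lemma indef_int: "indef u \<phi> \<Longrightarrow> r \<ge> 0 \<Longrightarrow> set_integrable lborel {0..r} \<phi>"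
  and indef_eq: "indef u \<phi> \<Longrightarrow> r \<ge> 0 \<Longrightarrow> u r = u 0 + set_lebesgue_integral lborel {0..r} \<phi>"
  unfolding indef_def by blast+

lemma indef_continuous: assumes "indef u \<phi>" shows "continuous_on {0..} u"
proof -
  have "continuous_on {0..} (\<lambda>r. u 0 + set_lebesgue_integral lborel {0..r} \<phi>)"
    by (rule continuous_on_add[OF continuous_on_const continuous_on_indefinite[OF indef_int[OF assms]]])
  then show ?thesis
    by (rule continuous_on_eq) (simp add: indef_eq[OF assms, symmetric])
qed

lemma indef_continuous_Icc: "indef u \<phi> \<Longrightarrow> continuous_on {0..r} u"
  by (rule continuous_on_subset[OF indef_continuous]) auto

lemma indef_const: "indef (\<lambda>_. c) (\<lambda>_. 0)"
  by (simp add: indef_def set_integrable_def set_lebesgue_integral_def)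

lemma indef_cmult: assumes "indef u \<phi>" shows "indef (\<lambda>r. c * u r) (\<lambda>s. c * \<phi> s)"
proof (rule indefI)
  fix r :: real assume r: "r \<ge> 0"
  show "set_integrable lborel {0..r} (\<lambda>s. c * \<phi> s)" using indef_int[OF assms r] by (rule set_integrable_mult_right)
  show "c * u r = c * u 0 + set_lebesgue_integral lborel {0..r} (\<lambda>s. c * \<phi> s)"
    unfolding set_integral_mult_right distrib_left[symmetric] indef_eq[OF assms r, symmetric] ..
qed

lemma indef_add: assumes "indef u \<phi>" "indef v \<psi>" shows "indef (\<lambda>r. u r + v r) (\<lambda>s. \<phi> s + \<psi> s)"
proof (rule indefI)
  fix r :: real assume r: "r \<ge> 0"
  show "set_integrable lborel {0..r} (\<lambda>s. \<phi> s + \<psi> s)"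
    by (rule set_integral_add(1)[OF indef_int[OF assms(1) r] indef_int[OF assms(2) r]])
  show "u r + v r = (u 0 + v 0) + set_lebesgue_integral lborel {0..r} (\<lambda>s. \<phi> s + \<psi> s)"
    by (subst indef_eq[OF assms(1) r], subst indef_eq[OF assms(2) r])
       (simp add: set_integral_add(2)[OF indef_int[OF assms(1) r] indef_int[OF assms(2) r]])
qed

lemma indef_diff: assumes "indef u \<phi>" "indef v \<psi>" shows "indef (\<lambda>r. u r - v r) (\<lambda>s. \<phi> s - \<psi> s)"
  using indef_add[OF assms(1) indef_cmult[OF assms(2), of "- 1"]] by simp

lemma indef_cnj: assumes "indef u \<phi>" shows "indef (\<lambda>r. cnj (u r)) (\<lambda>s. cnj (\<phi> s))"
proof (rule indefI)
  fix r :: real assume r: "r \<ge> 0"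
  have i: "integrable lborel (\<lambda>s. indicat_real {0..r} s *\<^sub>R \<phi> s)" using indef_int[OF assms r] by (simp add: set_integrable_def)
  have e: "cnj (indicat_real {0..r} s *\<^sub>R \<phi> s) = indicat_real {0..r} s *\<^sub>R cnj (\<phi> s)" for s by simp
  show "set_integrable lborel {0..r} (\<lambda>s. cnj (\<phi> s))"
    using integrable_bounded_linear[OF bounded_linear_cnj i] unfolding set_integrable_def e .
  show "cnj (u r) = cnj (u 0) + set_lebesgue_integral lborel {0..r} (\<lambda>s. cnj (\<phi> s))"
    using integral_bounded_linear[OF bounded_linear_cnj i] unfolding e
    by (subst indef_eq[OF assms r]) (simp add: set_lebesgue_integral_def)
qed

lemma set_integrable_mult_continuous:
  fixes r :: real
  assumes "set_integrable lborel {0..r} \<phi>" "continuous_on {0..r} v"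
  shows "set_integrable lborel {0..r} (\<lambda>s. \<phi> s * (v s :: complex))"
proof -
  have m: "(\<lambda>x. indicat_real {0..r} x *\<^sub>R v x) \<in> borel_measurable borel"
    by (rule borel_measurable_continuous_on_indicator[OF _ assms(2)]) simp
  have p: "integrable lborel (\<lambda>x. indicat_real {0..r} x *\<^sub>R \<phi> x)" using assms(1) by (simp add: set_integrable_def)
  have "\<exists>C. \<forall>x\<in>{0..r}. cmod (v x) \<le> C"
    using compact_imp_bounded[OF compact_continuous_image[OF assms(2) compact_Icc]] by (auto simp: bounded_iff)
  then obtain C where C: "\<forall>x\<in>{0..r}. cmod (v x) \<le> C" by blast
  have "integrable lborel (\<lambda>x. (indicat_real {0..r} x *\<^sub>R \<phi> x) * (indicat_real {0..r} x *\<^sub>R v x))"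
  proof (rule Bochner_Integration.integrable_bound)
    show "integrable lborel (\<lambda>x. \<bar>C\<bar> * cmod (indicat_real {0..r} x *\<^sub>R \<phi> x))"
      by (rule integrable_mult_right[OF integrable_norm[OF p]])
    show "(\<lambda>x. (indicat_real {0..r} x *\<^sub>R \<phi> x) * (indicat_real {0..r} x *\<^sub>R v x)) \<in> borel_measurable lborel"
      using borel_measurable_integrable[OF p] m by measurable
    show "AE x in lborel. norm ((indicat_real {0..r} x *\<^sub>R \<phi> x) * (indicat_real {0..r} x *\<^sub>R v x)) \<le> norm (\<bar>C\<bar> * cmod (indicat_real {0..r} x *\<^sub>R \<phi> x))"
    proof (rule AE_I2)
      fix x
      show "norm ((indicat_real {0..r} x *\<^sub>R \<phi> x) * (indicat_real {0..r} x *\<^sub>R v x)) \<le> norm (\<bar>C\<bar> * cmod (indicat_real {0..r} x *\<^sub>R \<phi> x))"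
      proof (cases "x \<in> {0..r}")
        case True
        then have "cmod (v x) \<le> \<bar>C\<bar>" using C by force
        then have "cmod (v x) * cmod (\<phi> x) \<le> \<bar>C\<bar> * cmod (\<phi> x)" by (rule mult_right_mono) simp
        then show ?thesis using True by (simp add: norm_mult mult.commute)
      qed simp
    qed
  qed
  also have "(\<lambda>x. (indicat_real {0..r} x *\<^sub>R \<phi> x) * (indicat_real {0..r} x *\<^sub>R v x)) = (\<lambda>x. indicat_real {0..r} x *\<^sub>R (\<phi> x * v x))"
    by (auto simp: indicator_def)
  finally show ?thesis by (simp add: set_integrable_def)
qed

lemma indef_mult: assumes u: "indef u \<phi>" and v: "indef v \<psi>"
  shows "indef (\<lambda>r. u r * v r) (\<lambda>s. \<phi> s * v s + u s * \<psi> s)"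
proof (rule indefI)
  fix r :: real assume r: "r \<ge> 0"
  have "set_integrable lborel {0..r} (\<lambda>s. \<phi> s * v s)"
    by (rule set_integrable_mult_continuous[OF indef_int[OF u r] indef_continuous_Icc[OF v]])
  moreover have "set_integrable lborel {0..r} (\<lambda>s. u s * \<psi> s)"
    using set_integrable_mult_continuous[OF indef_int[OF v r] indef_continuous_Icc[OF u]] by (simp add: mult.commute)
  ultimately show "set_integrable lborel {0..r} (\<lambda>s. \<phi> s * v s + u s * \<psi> s)" by (rule set_integral_add(1))
  show "u r * v r = u 0 * v 0 + set_lebesgue_integral lborel {0..r} (\<lambda>s. \<phi> s * v s + u s * \<psi> s)"
    by (rule caratheodory_product[OF r indef_int[OF u r] indef_int[OF v r]], rule indef_eq[OF u], simp, rule indef_eq[OF v], simp)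
qed

lemma indef_exp: "indef (\<lambda>r. exp (z * of_real r)) (\<lambda>s. z * exp (z * of_real s))"
proof (rule indefI)
  fix r :: real assume r: "r \<ge> 0"
  show "set_integrable lborel {0..r} (\<lambda>s. z * exp (z * of_real s))"
    by (intro set_integrable_continuous_Icc continuous_intros)
  show "exp (z * of_real r) = 1 + set_lebesgue_integral lborel {0..r} (\<lambda>s. z * exp (z * of_real s))"
    by (rule exp_indefinite[OF r])
qed

lemma indef_cong:
  assumes "indef u \<phi>" "\<And>r. u r = v r" "\<And>r. \<phi> r = \<psi> r" shows "indef v \<psi>"
proof -
  have "u = v" "\<phi> = \<psi>" by (rule ext, rule assms)+
  with assms(1) show ?thesis by simp
qed

text \<open>The integrating factor \<open>exp (- z * of_real r)\<close> turns the density into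
  0.\<close>

lemma indef_exp_unique:
  assumes "indef y (\<lambda>s. z * y s)" "r \<ge> 0" shows "y r = y 0 * exp (z * of_real r)"
proof -
  have "indef (\<lambda>r. y r * exp (- z * of_real r)) (\<lambda>_. 0)"
    by (rule indef_cong[OF indef_mult[OF assms(1) indef_exp[of "- z"]]]) (auto simp: algebra_simps)
  from indef_eq[OF this assms(2)] have "y r * exp (- z * of_real r) = y 0" by (simp add: set_lebesgue_integral_def)
  then have "y r * exp (- z * of_real r) * exp (z * of_real r) = y 0 * exp (z * of_real r)" by simp
  then show ?thesis by (simp add: mult.assoc flip: exp_add)
qed

context krein
begin

lemma indefs:
  "indef p (\<lambda>t. \<i> * l * p t - cnj (A t) * s t)" "indef q (\<lambda>t. \<i> * l * q t - cnj (A t) * w t)"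
  "indef s (\<lambda>t. - (A t * p t))" "indef w (\<lambda>t. - (A t * q t))"
  using ints eqs by (auto intro!: indefI)

lemma init: "p 0 = 1" "q 0 = 0" "s 0 = 0" "w 0 = 1"
  using eqs[of 0] by auto

text \<open>Liouville's formula: the trace of the Krein matrix is \<open>\<i> * l\<close>.\<close>

lemma det: "r \<ge> 0 \<Longrightarrow> p r * w r - q r * s r = exp (\<i> * l * of_real r)"
proof -
  assume r: "r \<ge> 0"
  have "indef (\<lambda>r. p r * w r - q r * s r) (\<lambda>t. (\<i> * l) * (p t * w t - q t * s t))"
    by (rule indef_cong[OF indef_diff[OF indef_mult[OF indefs(1,4)] indef_mult[OF indefs(2,3)]]]) (auto simp: algebra_simps)
  from indef_exp_unique[OF this r] show ?thesis by (simp add: init)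
qed

text \<open>The difference of the squared moduli of \<open>w\<close> and \<open>q\<close> has the
  density \<open>2 * Im l * (cmod (q t))\<^sup>2\<close>, the coefficient terms cancelling. It
  starts at 1 and cannot decrease in the closed upper half-plane; in particular \<open>w\<close> has
  no zeros there.\<close>

lemma energy:
  assumes "r \<ge> 0" "Im l \<ge> 0" shows "(cmod (w r))\<^sup>2 \<ge> 1 + (cmod (q r))\<^sup>2"
proof -
  have i: "indef (\<lambda>r. w r * cnj (w r) - q r * cnj (q r)) (\<lambda>t. of_real (2 * Im l * (cmod (q t))\<^sup>2))"
  proof (rule indef_cong[OF indef_diff[OF indef_mult[OF indefs(4) indef_cnj[OF indefs(4)]] indef_mult[OF indefs(2) indef_cnj[OF indefs(2)]]]])
    fix t
    have "- \<i> * (l - cnj l) = of_real (2 * Im l)" by (simp add: complex_eq_iff)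
    moreover have "of_real (2 * Im l * (cmod (q t))\<^sup>2) = of_real (2 * Im l) * (q t * cnj (q t))"
      by (simp add: complex_norm_square[symmetric])
    ultimately have e: "of_real (2 * Im l * (cmod (q t))\<^sup>2) = - \<i> * (l - cnj l) * (q t * cnj (q t))" by simp
    show "- (A t * q t) * cnj (w t) + w t * cnj (- (A t * q t)) -
        ((\<i> * l * q t - cnj (A t) * w t) * cnj (q t) + q t * cnj (\<i> * l * q t - cnj (A t) * w t)) = of_real (2 * Im l * (cmod (q t))\<^sup>2)"
      unfolding e by (simp add: algebra_simps)
  qed simp
  have "w r * cnj (w r) - q r * cnj (q r) = 1 + set_lebesgue_integral lborel {0..r} (\<lambda>t. of_real (2 * Im l * (cmod (q t))\<^sup>2))"
    using indef_eq[OF i assms(1)] by (simp add: init)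
  also have "set_lebesgue_integral lborel {0..r} (\<lambda>t. complex_of_real (2 * Im l * (cmod (q t))\<^sup>2)) =
      of_real (set_lebesgue_integral lborel {0..r} (\<lambda>t. 2 * Im l * (cmod (q t))\<^sup>2))"
    by (rule set_integral_complex_of_real)
  finally have "complex_of_real ((cmod (w r))\<^sup>2 - (cmod (q r))\<^sup>2) = of_real (1 + set_lebesgue_integral lborel {0..r} (\<lambda>t. 2 * Im l * (cmod (q t))\<^sup>2))"
    by (simp only: of_real_diff of_real_add of_real_1 complex_norm_square)
  then have "(cmod (w r))\<^sup>2 - (cmod (q r))\<^sup>2 = 1 + set_lebesgue_integral lborel {0..r} (\<lambda>t. 2 * Im l * (cmod (q t))\<^sup>2)"
    by (simp only: of_real_eq_iff)
  moreover have "0 \<le> set_lebesgue_integral lborel {0..r} (\<lambda>t. 2 * Im l * (cmod (q t))\<^sup>2)"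
    unfolding set_lebesgue_integral_def using assms(2) by (intro integral_nonneg_AE AE_I2) (simp add: indicator_def)
  ultimately show ?thesis by simp
qed

lemma w_ge_1: assumes "r \<ge> 0" "Im l \<ge> 0" shows "cmod (w r) \<ge> 1"
proof -
  have "1\<^sup>2 \<le> (cmod (w r))\<^sup>2" using energy[OF assms] zero_le_power2[of "cmod (q r)"] unfolding power_one by linarith
  then show ?thesis by (rule power2_le_imp_le) simp
qed

text \<open>The pair \<open>(y2 a, - y1 a)\<close> is the Krein solution applied to \<open>(1, - a)\<close>; for \<open>a = s r / w r\<close> its second component vanishes at \<open>r\<close>.\<close>

definition y1 :: "complex \<Rightarrow> real \<Rightarrow> complex" where "y1 a t = a * w t - s t"

definition y2 :: "complex \<Rightarrow> real \<Rightarrow> complex" where "y2 a t = p t - a * q t"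

lemma indef_y: "indef (y1 a) (\<lambda>t. A t * y2 a t)" "indef (y2 a) (\<lambda>t. \<i> * l * y2 a t + cnj (A t) * y1 a t)"
proof -
  show "indef (y1 a) (\<lambda>t. A t * y2 a t)"
    by (rule indef_cong[OF indef_diff[OF indef_cmult[OF indefs(4), of a] indefs(3)]]) (auto simp: y1_def y2_def algebra_simps)
  show "indef (y2 a) (\<lambda>t. \<i> * l * y2 a t + cnj (A t) * y1 a t)"
    by (rule indef_cong[OF indef_diff[OF indefs(1) indef_cmult[OF indefs(2), of a]]]) (auto simp: y1_def y2_def algebra_simps)
qed

lemma y_init: "y1 a 0 = a" "y2 a 0 = 1"
  by (simp_all add: y1_def y2_def init)

lemma y_end:
  assumes "r \<ge> 0" "Im l \<ge> 0"
  shows "y1 (s r / w r) r = 0" "y2 (s r / w r) r = exp (\<i> * l * of_real r) / w r" "cmod (y2 (s r / w r) r) \<le> exp (- (Im l * r))"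
proof -
  have w0: "w r \<noteq> 0" using w_ge_1[OF assms] by auto
  show "y1 (s r / w r) r = 0" using w0 by (simp add: y1_def)
  show e: "y2 (s r / w r) r = exp (\<i> * l * of_real r) / w r"
  proof -
    have "y2 (s r / w r) r = (p r * w r - q r * s r) / w r" using w0 by (simp add: y2_def field_simps)
    then show ?thesis unfolding det[OF assms(1)] .
  qed
  have "cmod (y2 (s r / w r) r) = exp (- (Im l * r)) / cmod (w r)" by (simp add: e norm_divide)
  also have "\<dots> \<le> exp (- (Im l * r)) / 1" using w_ge_1[OF assms] by (intro divide_left_mono) auto
  finally show "cmod (y2 (s r / w r) r) \<le> exp (- (Im l * r))" by simp
qed

end

text \<open>A Christoffel-Darboux identity. The difference of \<open>y2\<close> products and
  \<open>y1\<close> products has density \<open>\<i> * (l - cnj m)\<close> times the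
  \<open>y2\<close> product; it equals \<open>1 - a * cnj b\<close> at 0, and the \<open>y1\<close>
  part vanishes at \<open>r\<close> by the choice of \<open>a\<close> and \<open>b\<close>. Division
  brings out the Szego kernel of the half-plane.\<close>

lemma krein_pair:
  assumes k1: "krein A l p q s w" and k2: "krein A m p' q' s' w'" and r: "r \<ge> 0" and lm: "Im l > 0" "Im m > 0"
  defines "a \<equiv> s r / w r" and "b \<equiv> s' r / w' r"
  shows "(1 - a * cnj b) * (\<i> / (l - cnj m)) =
    set_lebesgue_integral lborel {0..r} (\<lambda>t. krein.y2 p q a t * cnj (krein.y2 p' q' b t)) +
    (\<i> / (l - cnj m)) * (krein.y2 p q a r * cnj (krein.y2 p' q' b r))"
proof -
  interpret k1: krein A l p q s w by fact
  interpret k2: krein A m p' q' s' w' by fact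
  define d where "d = l - cnj m"
  have d: "d \<noteq> 0" using lm by (auto simp: d_def complex_eq_iff)
  have "indef (\<lambda>t. k1.y2 a t * cnj (k2.y2 b t) - k1.y1 a t * cnj (k2.y1 b t)) (\<lambda>t. (\<i> * d) * (k1.y2 a t * cnj (k2.y2 b t)))"
    by (rule indef_cong[OF indef_diff[OF indef_mult[OF k1.indef_y(2) indef_cnj[OF k2.indef_y(2)]] indef_mult[OF k1.indef_y(1) indef_cnj[OF k2.indef_y(1)]]]])
       (auto simp: d_def algebra_simps)
  from indef_eq[OF this r]
  have "k1.y2 a r * cnj (k2.y2 b r) = (1 - a * cnj b) + (\<i> * d) * set_lebesgue_integral lborel {0..r} (\<lambda>t. k1.y2 a t * cnj (k2.y2 b t))"
    using k1.y_end(1)[OF r] k2.y_end(1)[OF r] lm by (simp add: k1.y_init k2.y_init a_def b_def)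
  then have e: "1 - a * cnj b = k1.y2 a r * cnj (k2.y2 b r) - (\<i> * d) * set_lebesgue_integral lborel {0..r} (\<lambda>t. k1.y2 a t * cnj (k2.y2 b t))"
    by (simp add: algebra_simps)
  show ?thesis unfolding d_def[symmetric] e using d by (simp add: field_simps)
qed

section \<open>The kernel inequality for Schur functions\<close>

text \<open>With this conjugation \<open>cin k (ex l)\<close> is the integral of
  \<open>k x * exp (\<i> * l * of_real x)\<close> over the half-line. After Fourier transform
  \<open>ex l\<close> is thus the reproducing kernel of the Hardy space, and \<open>cin_ex\<close>
  is the Szego kernel.\<close>

definition ex :: "complex \<Rightarrow> ltwo" where
  "ex l = mk (\<lambda>x. indicator {0..} x * cnj (exp (\<i> * l * of_real x)))"

lemma exp_integral_atLeast:
  assumes "Re z < 0"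
  shows "integrable lborel (\<lambda>x. indicator {0..} x * exp (z * of_real x))"
    and "(LINT x|lborel. indicator {0..} x * exp (z * of_real x)) = - 1 / z"
proof -
  have "(\<integral>\<^sup>+x. ennreal (exp (Re z * x)) * indicator {0..} x \<partial>lborel) = ennreal (0 - exp (Re z * 0) / Re z)"
  proof (rule nn_integral_FTC_atLeast)
    show "((\<lambda>x. exp (Re z * x) / Re z) \<longlongrightarrow> 0) at_top"
      using assms by real_asymp
  qed (use assms in \<open>auto intro!: derivative_eq_intros\<close>)
  then have fin: "(\<integral>\<^sup>+x. ennreal (exp (Re z * x)) * indicator {0..} x \<partial>lborel) < \<infinity>" by simp
  show i: "integrable lborel (\<lambda>x. indicator {0..} x * exp (z * of_real x))"
  proof (rule integrableI_bounded)
    have "ennreal (norm (indicator {0..} x * exp (z * of_real x))) = ennreal (exp (Re z * x)) * indicator {0..} x" for x :: real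
      by (simp add: norm_mult indicator_def)
    then show "(\<integral>\<^sup>+x. ennreal (norm (indicator {0..} x * exp (z * of_real x))) \<partial>lborel) < \<infinity>"
      using fin by (simp only:)
  qed measurable
  have z: "z \<noteq> 0" using assms by auto
  have "(\<lambda>n. LINT x|lborel. indicator {0..real n} x * exp (z * of_real x)) \<longlonglongrightarrow> (LINT x|lborel. indicator {0..} x * exp (z * of_real x))"
  proof (rule integral_dominated_convergence)
    show "integrable lborel (\<lambda>x. cmod (indicator {0..} x * exp (z * of_real x)))" by (rule integrable_norm[OF i])
    show "AE x in lborel. (\<lambda>n. indicator {0..real n} x * exp (z * of_real x)) \<longlonglongrightarrow> indicator {0..} x * exp (z * of_real x)"
    proof (rule AE_I2, rule tendsto_eventually)
      fix x :: real
      obtain n0 where "x \<le> real n0" using real_arch_simple by blast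
      then show "\<forall>\<^sub>F n in sequentially. indicator {0..real n} x * exp (z * of_real x) = indicator {0..} x * exp (z * of_real x)"
        by (intro eventually_mono[OF eventually_ge_at_top[of n0]]) (auto simp: indicator_def)
    qed
  qed (auto simp: norm_mult indicator_def)
  moreover have "(LINT x|lborel. indicator {0..real n} x * exp (z * of_real x)) = (exp (z * of_real n) - 1) / z" for n
  proof -
    have "exp (z * of_real (real n)) = 1 + z * (LINT x|lborel. indicator {0..real n} x * exp (z * of_real x))"
      using exp_indefinite[of "real n" z] by (simp add: set_lebesgue_integral_def indicat_scaleR mult.left_commute)
    then show ?thesis using z by (simp add: field_simps)
  qed
  moreover have "(\<lambda>n. (exp (z * of_real n) - 1) / z) \<longlonglongrightarrow> (0 - 1) / z"
  proof (intro tendsto_divide tendsto_diff tendsto_const z)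
    have "(\<lambda>n::nat. exp (Re z * real n)) \<longlonglongrightarrow> 0" using assms by real_asymp
    then show "(\<lambda>n. exp (z * of_real n)) \<longlonglongrightarrow> 0"
      by (subst tendsto_norm_zero_iff[symmetric]) simp
  qed
  ultimately show "(LINT x|lborel. indicator {0..} x * exp (z * of_real x)) = - 1 / z"
    using LIMSEQ_unique by auto
qed

lemma sqi_ex: assumes "Im l > 0" shows "sqi (\<lambda>x. indicator {0..} x * cnj (exp (\<i> * l * of_real x)))"
proof -
  define z where "z = complex_of_real (- 2 * Im l)"
  have "Re z < 0" using assms by (simp add: z_def)
  from integrable_norm[OF exp_integral_atLeast(1)[OF this]]
  have "integrable lborel (\<lambda>x. cmod (indicator {0..} x * exp (z * of_real x)))" .
  moreover have "(cmod (indicator {0..} x * cnj (exp (\<i> * l * of_real x))))\<^sup>2 = cmod (indicator {0..} x * exp (z * of_real x))" for x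
    by (simp add: norm_mult indicator_def z_def exp_double[symmetric] del: exp_double)
  ultimately show ?thesis by (simp add: sqi_def)
qed

lemma rep_ex: "Im l > 0 \<Longrightarrow> AE x in lborel. rep (ex l) x = indicator {0..} x * cnj (exp (\<i> * l * of_real x))"
  unfolding ex_def by (rule rep_mk[OF sqi_ex])

lemma cin_ex: assumes "Im l > 0" "Im m > 0" shows "cin (ex m) (ex l) = \<i> / (l - cnj m)"
proof -
  define z where "z = \<i> * (l - cnj m)"
  have z: "Re z < 0" using assms by (simp add: z_def)
  have "cin (ex m) (ex l) = (LINT x|lborel. indicator {0..} x * exp (z * of_real x))"
    unfolding ex_def cin_mk[OF sqi_ex[OF assms(2)] sqi_ex[OF assms(1)]]
    by (rule Bochner_Integration.integral_cong) (auto simp: indicator_def exp_cnj z_def algebra_simps simp flip: exp_add)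
  also have "\<dots> = - 1 / z" by (rule exp_integral_atLeast(2)[OF z])
  also have "\<dots> = \<i> / (l - cnj m)" by (simp add: z_def divide_simps)
  finally show ?thesis .
qed

text \<open>This is the variational formula for the squared norm of the coefficient, restricted to trial functions that are
  combinations of exponentials; only values of \<open>f\<close> remain in it.\<close>

definition schur_bound :: "real \<Rightarrow> (complex \<Rightarrow> complex) \<Rightarrow> bool" where
  "schur_bound M f \<longleftrightarrow> (\<forall>\<Lambda> c. finite \<Lambda> \<longrightarrow> (\<forall>l\<in>\<Lambda>. Im l > 0) \<longrightarrow>
     2 * Re (\<Sum>l\<in>\<Lambda>. cnj (c l) * f l) - (norm (\<Sum>l\<in>\<Lambda>. c l \<cdot> ex l))\<^sup>2 + (norm (\<Sum>l\<in>\<Lambda>. (c l * cnj (f l)) \<cdot> ex l))\<^sup>2 \<le> M)"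

lemma cin_sum_ex:
  assumes "\<forall>l\<in>\<Lambda>. Im l > 0"
  shows "cin (\<Sum>m\<in>\<Lambda>. c m \<cdot> ex m) (\<Sum>l\<in>\<Lambda>. d l \<cdot> ex l) = (\<Sum>m\<in>\<Lambda>. \<Sum>l\<in>\<Lambda>. c m * cnj (d l) * (\<i> / (l - cnj m)))"
  unfolding cin_sum_left unfolding cin_sum_right cin_cscale_left cin_cscale_right
  using assms by (intro sum.cong HOL.refl) (simp add: cin_ex)

text \<open>For \<open>V\<close>, the combination of the functions \<open>Y l\<close>, the linear
  term is minus the integral of \<open>A t * V t\<close>, and by \<open>krein_pair\<close> the
  difference of the two squared norms is the integral of the squared modulus of \<open>V\<close>
  plus a nonnegative remainder. What remains is nonnegativity of the integral of the squared modulus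
  of \<open>cnj (A t) + V t\<close>.\<close>

lemma krein_schur_bound_finite:
  fixes P Q S W :: "complex \<Rightarrow> real \<Rightarrow> complex"
  assumes k: "\<And>l. Im l > 0 \<Longrightarrow> krein A l (P l) (Q l) (S l) (W l)" and r: "r \<ge> 0" and \<Lambda>: "finite \<Lambda>" "\<forall>l\<in>\<Lambda>. Im l > 0"
  defines "a \<equiv> \<lambda>l. S l r / W l r"
  shows "2 * Re (\<Sum>l\<in>\<Lambda>. cnj (c l) * a l) - (norm (\<Sum>l\<in>\<Lambda>. c l \<cdot> ex l))\<^sup>2 + (norm (\<Sum>l\<in>\<Lambda>. (c l * cnj (a l)) \<cdot> ex l))\<^sup>2
     \<le> set_lebesgue_integral lborel {0..r} (\<lambda>x. (cmod (A x))\<^sup>2)"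
proof -
  define Y where "Y l t = krein.y2 (P l) (Q l) (a l) t" for l t
  define V where "V t = (\<Sum>l\<in>\<Lambda>. cnj (c l) * Y l t)" for t
  have Yc: "continuous_on {0..r} (Y l)" if "Im l > 0" for l
    unfolding Y_def[abs_def] by (rule indef_continuous_Icc[OF krein.indef_y(2)[OF k[OF that]]])
  have Vc: "continuous_on {0..r} V"
    unfolding V_def[abs_def] using \<Lambda>(2) by (intro continuous_on_sum continuous_on_mult continuous_on_const Yc) auto
  have AL: "L2_on {0..} A" using krein.A[OF k[of \<i>]] by simp
  then have A: "L2_on {0..r} A" by (rule L2_on_subset) auto
  have AY: "set_integrable lborel {0..r} (\<lambda>t. A t * Y l t)" if "Im l > 0" for l
    by (rule set_integrable_L2_continuous[OF A Yc[OF that]])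
  have aY: "a l = - set_lebesgue_integral lborel {0..r} (\<lambda>t. A t * Y l t)" if "Im l > 0" for l
  proof -
    interpret krein A l "P l" "Q l" "S l" "W l" by (rule k[OF that])
    have "0 = a l + set_lebesgue_integral lborel {0..r} (\<lambda>t. A t * y2 (a l) t)"
      using indef_eq[OF indef_y(1)[of "a l"] r] y_end(1)[OF r] that by (simp add: y_init a_def)
    then show ?thesis by (simp add: Y_def eq_neg_iff_add_eq_0)
  qed
  have "(\<Sum>l\<in>\<Lambda>. cnj (c l) * a l) = - (\<Sum>l\<in>\<Lambda>. set_lebesgue_integral lborel {0..r} (\<lambda>t. cnj (c l) * (A t * Y l t)))"
    unfolding sum_negf[symmetric] using \<Lambda>(2) by (intro sum.cong HOL.refl) (simp add: aY)
  also have "(\<Sum>l\<in>\<Lambda>. set_lebesgue_integral lborel {0..r} (\<lambda>t. cnj (c l) * (A t * Y l t))) =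
      (LINT t|lborel. (\<Sum>l\<in>\<Lambda>. indicat_real {0..r} t *\<^sub>R (cnj (c l) * (A t * Y l t))))"
    unfolding set_lebesgue_integral_def
    using AY \<Lambda>(2) by (intro Bochner_Integration.integral_sum[symmetric]) (auto simp flip: set_integrable_def)
  also have "\<dots> = set_lebesgue_integral lborel {0..r} (\<lambda>t. A t * V t)"
    unfolding set_lebesgue_integral_def V_def
    by (rule Bochner_Integration.integral_cong) (auto simp: sum_distrib_left scaleR_sum_right algebra_simps)
  finally have lin: "(\<Sum>l\<in>\<Lambda>. cnj (c l) * a l) = - set_lebesgue_integral lborel {0..r} (\<lambda>t. A t * V t)" .
  let ?N = "\<lambda>d. cin (\<Sum>l\<in>\<Lambda>. d l \<cdot> ex l) (\<Sum>l\<in>\<Lambda>. d l \<cdot> ex l)"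
  have pair: "(1 - a l * cnj (a m)) * (\<i> / (l - cnj m)) = set_lebesgue_integral lborel {0..r} (\<lambda>t. Y l t * cnj (Y m t)) + (\<i> / (l - cnj m)) * (Y l r * cnj (Y m r))"
    if "Im l > 0" "Im m > 0" for l m
    unfolding Y_def a_def by (rule krein_pair[OF k[OF that(1)] k[OF that(2)] r that])
  have YY: "set_integrable lborel {0..r} (\<lambda>t. Y l t * cnj (Y m t))" if "Im l > 0" "Im m > 0" for l m
    by (intro set_integrable_continuous_Icc continuous_on_mult continuous_on_cnj Yc that)
  have "?N c - ?N (\<lambda>l. c l * cnj (a l)) = (\<Sum>m\<in>\<Lambda>. \<Sum>l\<in>\<Lambda>. c m * cnj (c l) * ((1 - a l * cnj (a m)) * (\<i> / (l - cnj m))))"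
    unfolding cin_sum_ex[OF \<Lambda>(2)] sum_subtractf[symmetric] by (intro sum.cong HOL.refl) (simp add: algebra_simps)
  also have "\<dots> = (\<Sum>m\<in>\<Lambda>. \<Sum>l\<in>\<Lambda>. c m * cnj (c l) * set_lebesgue_integral lborel {0..r} (\<lambda>t. Y l t * cnj (Y m t))) + ?N (\<lambda>l. c l * cnj (Y l r))"
    unfolding cin_sum_ex[OF \<Lambda>(2)] sum.distrib[symmetric]
    using \<Lambda>(2) by (intro sum.cong HOL.refl) (subst pair, auto simp: algebra_simps)
  also have "(\<Sum>m\<in>\<Lambda>. \<Sum>l\<in>\<Lambda>. c m * cnj (c l) * set_lebesgue_integral lborel {0..r} (\<lambda>t. Y l t * cnj (Y m t))) =
     (\<Sum>m\<in>\<Lambda>. \<Sum>l\<in>\<Lambda>. set_lebesgue_integral lborel {0..r} (\<lambda>t. c m * cnj (c l) * (Y l t * cnj (Y m t))))"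
    by simp
  also have "\<dots> = (LINT t|lborel. (\<Sum>m\<in>\<Lambda>. \<Sum>l\<in>\<Lambda>. indicat_real {0..r} t *\<^sub>R (c m * cnj (c l) * (Y l t * cnj (Y m t)))))"
  proof -
    have i: "integrable lborel (\<lambda>t. indicat_real {0..r} t *\<^sub>R (c m * cnj (c l) * (Y l t * cnj (Y m t))))" if "m \<in> \<Lambda>" "l \<in> \<Lambda>" for l m
      using set_integrable_mult_right[of "c m * cnj (c l)" lborel "{0..r}" "\<lambda>t. Y l t * cnj (Y m t)"] YY[of l m] that \<Lambda>(2)
      unfolding set_integrable_def by blast
    have "(LINT t|lborel. (\<Sum>m\<in>\<Lambda>. \<Sum>l\<in>\<Lambda>. indicat_real {0..r} t *\<^sub>R (c m * cnj (c l) * (Y l t * cnj (Y m t))))) =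
      (\<Sum>m\<in>\<Lambda>. LINT t|lborel. (\<Sum>l\<in>\<Lambda>. indicat_real {0..r} t *\<^sub>R (c m * cnj (c l) * (Y l t * cnj (Y m t)))))"
      by (rule Bochner_Integration.integral_sum) (use i in auto)
    also have "\<dots> = (\<Sum>m\<in>\<Lambda>. \<Sum>l\<in>\<Lambda>. LINT t|lborel. indicat_real {0..r} t *\<^sub>R (c m * cnj (c l) * (Y l t * cnj (Y m t))))"
      by (intro sum.cong HOL.refl Bochner_Integration.integral_sum) (use i in auto)
    finally show ?thesis unfolding set_lebesgue_integral_def by simp
  qed
  also have "\<dots> = set_lebesgue_integral lborel {0..r} (\<lambda>t. V t * cnj (V t))"
    unfolding set_lebesgue_integral_def
  proof (rule Bochner_Integration.integral_cong[OF HOL.refl])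
    fix t
    have "V t * cnj (V t) = (\<Sum>l\<in>\<Lambda>. \<Sum>m\<in>\<Lambda>. (cnj (c l) * Y l t) * cnj (cnj (c m) * Y m t))"
      by (simp only: V_def cnj_sum sum_product)
    also have "\<dots> = (\<Sum>m\<in>\<Lambda>. \<Sum>l\<in>\<Lambda>. c m * cnj (c l) * (Y l t * cnj (Y m t)))"
      by (subst sum.swap, intro sum.cong HOL.refl) simp
    finally show "(\<Sum>m\<in>\<Lambda>. \<Sum>l\<in>\<Lambda>. indicat_real {0..r} t *\<^sub>R (c m * cnj (c l) * (Y l t * cnj (Y m t)))) = indicat_real {0..r} t *\<^sub>R (V t * cnj (V t))"
      by (simp only: scaleR_sum_right)
  qed
  finally have quad: "?N c - ?N (\<lambda>l. c l * cnj (a l)) = set_lebesgue_integral lborel {0..r} (\<lambda>t. V t * cnj (V t)) + ?N (\<lambda>l. c l * cnj (Y l r))" .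
  have N: "Re (?N d) = (norm (\<Sum>l\<in>\<Lambda>. d l \<cdot> ex l))\<^sup>2" for d by (simp add: cin_self_norm)
  have AV: "integrable lborel (\<lambda>t. indicat_real {0..r} t *\<^sub>R (A t * V t))"
    using set_integrable_L2_continuous[OF A Vc] by (simp add: set_integrable_def)
  have VV: "integrable lborel (\<lambda>t. indicat_real {0..r} t *\<^sub>R (V t * cnj (V t)))"
    using set_integrable_continuous_Icc[OF continuous_on_mult[OF Vc continuous_on_cnj[OF Vc]]] by (simp add: set_integrable_def)
  have AA: "integrable lborel (\<lambda>t. indicat_real {0..r} t *\<^sub>R (cmod (A t))\<^sup>2)"
    using A by (simp add: L2_on_def set_integrable_def)
  have "0 \<le> (LINT t|lborel. indicat_real {0..r} t *\<^sub>R (cmod (A t))\<^sup>2 + 2 * Re (indicat_real {0..r} t *\<^sub>R (A t * V t)) + Re (indicat_real {0..r} t *\<^sub>R (V t * cnj (V t))))"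
  proof (intro integral_nonneg_AE AE_I2)
    fix t
    have "(cmod (A t))\<^sup>2 + 2 * Re (A t * V t) + Re (V t * cnj (V t)) = (cmod (cnj (A t) + V t))\<^sup>2"
      unfolding cmod_power2 by (simp add: power2_eq_square algebra_simps)
    then show "0 \<le> indicat_real {0..r} t *\<^sub>R (cmod (A t))\<^sup>2 + 2 * Re (indicat_real {0..r} t *\<^sub>R (A t * V t)) + Re (indicat_real {0..r} t *\<^sub>R (V t * cnj (V t)))"
    proof (cases "t \<in> {0..r}")
      case True
      then have 1: "indicat_real {0..r} t = 1" by simp
      show ?thesis unfolding 1 scaleR_one \<open>(cmod (A t))\<^sup>2 + 2 * Re (A t * V t) + Re (V t * cnj (V t)) = _\<close> by simp
    qed simp
  qed
  also have "\<dots> = set_lebesgue_integral lborel {0..r} (\<lambda>x. (cmod (A x))\<^sup>2) + 2 * Re (set_lebesgue_integral lborel {0..r} (\<lambda>t. A t * V t))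
      + Re (set_lebesgue_integral lborel {0..r} (\<lambda>t. V t * cnj (V t)))"
    unfolding set_lebesgue_integral_def integral_Re[OF AV, symmetric] integral_Re[OF VV, symmetric]
    using AA integrable_Re[OF AV] integrable_Re[OF VV]
    by (subst Bochner_Integration.integral_add | simp)+
  finally have "0 \<le> set_lebesgue_integral lborel {0..r} (\<lambda>x. (cmod (A x))\<^sup>2) - 2 * Re (\<Sum>l\<in>\<Lambda>. cnj (c l) * a l) + Re (set_lebesgue_integral lborel {0..r} (\<lambda>t. V t * cnj (V t)))"
    unfolding lin by simp
  moreover have "Re (set_lebesgue_integral lborel {0..r} (\<lambda>t. V t * cnj (V t))) \<le> (norm (\<Sum>l\<in>\<Lambda>. c l \<cdot> ex l))\<^sup>2 - (norm (\<Sum>l\<in>\<Lambda>. (c l * cnj (a l)) \<cdot> ex l))\<^sup>2"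
  proof -
    have "Re (?N c) - Re (?N (\<lambda>l. c l * cnj (a l))) = Re (set_lebesgue_integral lborel {0..r} (\<lambda>t. V t * cnj (V t))) + Re (?N (\<lambda>l. c l * cnj (Y l r)))"
      using quad by (metis minus_complex.simps(1) plus_complex.simps(1))
    then show ?thesis unfolding N by (simp add: algebra_simps)
  qed
  ultimately show ?thesis by linarith
qed

lemma tendsto_cscale:
  assumes "(z \<longlongrightarrow> z0) F" shows "((\<lambda>r. z r \<cdot> u) \<longlongrightarrow> z0 \<cdot> u) F"
proof (rule LIM_zero_cancel, rule tendsto_norm_zero_cancel)
  have e: "norm (z r \<cdot> u - z0 \<cdot> u) = cmod (z r - z0) * norm u" for r
    by (metis norm_cscale cscale_add_left diff_add_cancel add_diff_cancel_right')
  have "((\<lambda>r. cmod (z r - z0) * norm u) \<longlongrightarrow> cmod (z0 - z0) * norm u) F"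
    by (intro tendsto_mult tendsto_norm tendsto_diff assms tendsto_const)
  then show "((\<lambda>r. norm (z r \<cdot> u - z0 \<cdot> u)) \<longlongrightarrow> 0) F" by (simp add: e)
qed

section \<open>Pick's inequality in the disc and in the half-plane\<close>

text \<open>Cauchy's formula with respect to normalised arc length: the derivative of the
  parametrisation contributes the extra factor in the numerator.\<close>

lemma circle_Cauchy:
  assumes G: "continuous_on (cball 0 1) G" "G holomorphic_on ball 0 1" and w: "cmod w < 1"
  shows "((\<lambda>t. G (exp (2 * of_real pi * \<i> * of_real t)) * (exp (2 * of_real pi * \<i> * of_real t) / (exp (2 * of_real pi * \<i> * of_real t) - w))) has_integral G w) {0..1}"
proof -
  have "((\<lambda>u. G u / (u - w)) has_contour_integral (2 * of_real pi * \<i> * G w)) (circlepath 0 1)"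
    by (rule Cauchy_integral_circlepath[OF G]) (use w in simp)
  then have "((\<lambda>t. G (exp (2 * of_real pi * \<i> * of_real t)) / (exp (2 * of_real pi * \<i> * of_real t) - w) *
      (2 * of_real pi * \<i> * exp (2 * of_real pi * \<i> * of_real t))) has_integral (2 * of_real pi * \<i> * G w)) {0..1}"
    unfolding has_contour_integral_def circlepath
    by (rule has_integral_eq[rotated]) (use vector_derivative_circlepath01[of _ 0 1, unfolded circlepath] in auto)
  from has_integral_mult_right[OF this, of "1 / (2 * of_real pi * \<i>)"] show ?thesis
    by (rule has_integral_eq_rhs[OF has_integral_eq[rotated]]) (auto simp: field_simps)
qed

text \<open>\<open>h d\<close> is a combination of Szego kernels of the disc, and \<open>mm\<close>
  is its image under the adjoint of multiplication by \<open>\<phi>\<close>, which multiplies the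
  kernel at \<open>w m\<close> by \<open>cnj (\<phi> (w m))\<close>. Both the squared norm of
  \<open>mm\<close> and its pairing after multiplication by \<open>\<phi>\<close> with
  \<open>h d\<close> equal \<open>T2\<close>; nonnegativity of the squared distance of
  \<open>cnj \<phi>\<close> times \<open>h d\<close> from \<open>mm\<close> on the circle compares
  \<open>T2\<close> with \<open>T1\<close>.\<close>

lemma pick_disc_core:
  fixes w d \<gamma> :: "'i \<Rightarrow> complex"
  assumes \<phi>: "continuous_on (cball 0 1) \<phi>" "\<phi> holomorphic_on ball 0 1" "\<And>z. cmod z = 1 \<Longrightarrow> cmod (\<phi> z) \<le> 1"
    and \<Lambda>: "finite \<Lambda>" and w: "\<And>l. l \<in> \<Lambda> \<Longrightarrow> cmod (w l) < 1"
  defines "\<gamma> \<equiv> \<lambda>l. \<phi> (w l)"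
  shows "Re (\<Sum>m\<in>\<Lambda>. \<Sum>l\<in>\<Lambda>. (d m * cnj (\<gamma> m)) * cnj (d l * cnj (\<gamma> l)) / (1 - w l * cnj (w m))) \<le>
     Re (\<Sum>m\<in>\<Lambda>. \<Sum>l\<in>\<Lambda>. d m * cnj (d l) / (1 - w l * cnj (w m)))"
proof -
  define h where "h b z = (\<Sum>m\<in>\<Lambda>. b m / (1 - z * cnj (w m)))" for b :: "'i \<Rightarrow> complex" and z
  define e where "e t = exp (2 * of_real pi * \<i> * of_real t :: complex)" for t :: real
  define mm where "mm = h (\<lambda>m. d m * cnj (\<gamma> m))"
  have ne: "1 - z * cnj (w m) \<noteq> 0" if "m \<in> \<Lambda>" "cmod z \<le> 1" for z m
  proof
    assume "1 - z * cnj (w m) = 0"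
    then have "cmod (z * cnj (w m)) = 1" by (metis eq_iff_diff_eq_0 norm_one)
    moreover have "cmod z * cmod (w m) \<le> 1 * cmod (w m)" using that by (intro mult_right_mono) auto
    ultimately show False using w[OF that(1)] by (simp add: norm_mult)
  qed
  have hc: "continuous_on (cball 0 1) (h b)" "h b holomorphic_on ball 0 1" for b
    unfolding h_def[abs_def] using ne by (auto intro!: continuous_intros holomorphic_intros)
  have e1: "cmod (e t) = 1" for t by (simp add: e_def)
  \<comment> \<open>On the unit circle conjugation is inversion, so a conjugated Szego kernel
    becomes a Cauchy kernel and integrates to a point evaluation.\<close>
  have cnjh: "cnj (h b (e t)) = (\<Sum>l\<in>\<Lambda>. cnj (b l) * (e t / (e t - w l)))" for b t
    unfolding h_def cnj_sum
  proof (rule sum.cong[OF HOL.refl])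
    fix l assume l: "l \<in> \<Lambda>"
    have ee: "e t * cnj (e t) = 1" using e1[of t] by (simp add: complex_norm_square[symmetric])
    have "e t \<noteq> 0" using e1[of t] by auto
    have "e t - w l \<noteq> 0" using e1[of t] w[OF l] by auto
    have "e t * (1 - cnj (e t) * w l) = e t - w l" using ee by (simp add: algebra_simps)
    then have "1 - cnj (e t) * w l = (e t - w l) / e t" using \<open>e t \<noteq> 0\<close> by (simp add: field_simps)
    then show "cnj (b l / (1 - e t * cnj (w l))) = cnj (b l) * (e t / (e t - w l))" by simp
  qed
  have I: "((\<lambda>t. G (e t) * cnj (h b (e t))) has_integral (\<Sum>l\<in>\<Lambda>. cnj (b l) * G (w l))) {0..1}"
    if G: "continuous_on (cball 0 1) G" "G holomorphic_on ball 0 1" for G b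
  proof -
    have "((\<lambda>t. \<Sum>l\<in>\<Lambda>. cnj (b l) * (G (e t) * (e t / (e t - w l)))) has_integral (\<Sum>l\<in>\<Lambda>. cnj (b l) * G (w l))) {0..1}"
      unfolding e_def by (intro has_integral_sum \<Lambda> has_integral_mult_right circle_Cauchy G w)
    then show ?thesis by (rule has_integral_eq[rotated]) (simp add: cnjh sum_distrib_left algebra_simps)
  qed
  define T1 where "T1 = (\<Sum>l\<in>\<Lambda>. cnj (d l) * h d (w l))"
  define T2 where "T2 = (\<Sum>l\<in>\<Lambda>. cnj (d l) * (\<phi> (w l) * mm (w l)))"
  have i1: "((\<lambda>t. h d (e t) * cnj (h d (e t))) has_integral T1) {0..1}"
    unfolding T1_def by (rule I[OF hc])
  have i2: "((\<lambda>t. (\<phi> (e t) * mm (e t)) * cnj (h d (e t))) has_integral T2) {0..1}"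
    unfolding T2_def by (rule I) (use hc \<phi> in \<open>auto simp: mm_def intro!: continuous_intros holomorphic_intros\<close>)
  have i3: "((\<lambda>t. mm (e t) * cnj (mm (e t))) has_integral T2) {0..1}"
  proof -
    have "((\<lambda>t. mm (e t) * cnj (mm (e t))) has_integral (\<Sum>l\<in>\<Lambda>. cnj (d l * cnj (\<gamma> l)) * mm (w l))) {0..1}"
      unfolding mm_def by (rule I[OF hc])
    then show ?thesis by (simp add: T2_def \<gamma>_def mult.assoc)
  qed
  have lin: "linear Re" by (simp add: bounded_linear.linear bounded_linear_Re)
  have "((\<lambda>t. Re (h d (e t) * cnj (h d (e t))) - 2 * Re ((\<phi> (e t) * mm (e t)) * cnj (h d (e t))) + Re (mm (e t) * cnj (mm (e t)))) has_integral
      (Re T1 - 2 * Re T2 + Re T2)) {0..1}"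
    by (intro has_integral_add has_integral_diff has_integral_mult_right has_integral_linear[OF _ bounded_linear_Re, unfolded o_def] i1 i2 i3)
  then have "0 \<le> Re T1 - 2 * Re T2 + Re T2"
  proof (rule has_integral_nonneg)
    fix t :: real
    let ?h = "h d (e t)" and ?m = "mm (e t)" and ?f = "\<phi> (e t)"
    have "(cmod (cnj ?f * ?h - ?m))\<^sup>2 = (cmod ?f)\<^sup>2 * (cmod ?h)\<^sup>2 - 2 * Re (?f * ?m * cnj ?h) + (cmod ?m)\<^sup>2"
    proof -
      have "(cmod (x - y))\<^sup>2 = (cmod x)\<^sup>2 - 2 * Re (y * cnj x) + (cmod y)\<^sup>2" for x y
        unfolding cmod_power2 by (simp add: power2_eq_square algebra_simps)
      from this[of "cnj ?f * ?h" ?m] show ?thesis by (simp add: norm_mult power_mult_distrib mult_ac)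
    qed
    moreover have "(cmod ?f)\<^sup>2 * (cmod ?h)\<^sup>2 \<le> 1 * (cmod ?h)\<^sup>2"
      using \<phi>(3)[OF e1[of t]] by (intro mult_right_mono) (auto simp: power_le_one)
    moreover have "Re (?h * cnj ?h) = (cmod ?h)\<^sup>2" "Re (?m * cnj ?m) = (cmod ?m)\<^sup>2"
      by (simp_all add: complex_norm_square[symmetric])
    moreover have "0 \<le> (cmod (cnj ?f * ?h - ?m))\<^sup>2" by simp
    ultimately show "0 \<le> Re (?h * cnj ?h) - 2 * Re (?f * ?m * cnj ?h) + Re (?m * cnj ?m)" by linarith
  qed
  then have "Re T2 \<le> Re T1" by simp
  moreover have "T1 = (\<Sum>m\<in>\<Lambda>. \<Sum>l\<in>\<Lambda>. d m * cnj (d l) / (1 - w l * cnj (w m)))"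
    unfolding T1_def h_def sum_distrib_left by (subst sum.swap) (intro sum.cong HOL.refl, simp)
  moreover have "T2 = (\<Sum>m\<in>\<Lambda>. \<Sum>l\<in>\<Lambda>. (d m * cnj (\<gamma> m)) * cnj (d l * cnj (\<gamma> l)) / (1 - w l * cnj (w m)))"
    unfolding T2_def mm_def h_def sum_distrib_left by (subst sum.swap) (intro sum.cong HOL.refl, simp add: \<gamma>_def algebra_simps)
  ultimately show ?thesis by simp
qed

text \<open>\<open>\<phi>\<close> may have no boundary values on the circle. Its dilates
  \<open>\<phi> (\<rho> n * z)\<close> are continuous on the closed disc, and the inequality
  involves only finitely many interior points, where they converge.\<close>

lemma pick_disc:
  fixes w d :: "'i \<Rightarrow> complex"
  assumes \<phi>: "\<phi> holomorphic_on ball 0 1" "\<And>z. cmod z < 1 \<Longrightarrow> cmod (\<phi> z) \<le> 1"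
    and \<Lambda>: "finite \<Lambda>" and w: "\<And>l. l \<in> \<Lambda> \<Longrightarrow> cmod (w l) < 1"
  shows "Re (\<Sum>m\<in>\<Lambda>. \<Sum>l\<in>\<Lambda>. (d m * cnj (\<phi> (w m))) * cnj (d l * cnj (\<phi> (w l))) / (1 - w l * cnj (w m))) \<le>
     Re (\<Sum>m\<in>\<Lambda>. \<Sum>l\<in>\<Lambda>. d m * cnj (d l) / (1 - w l * cnj (w m)))" (is "?L \<phi> \<le> ?R")
proof (rule LIMSEQ_le_const2)
  define \<rho> where "\<rho> n = 1 - inverse (real (n + 2))" for n
  have \<rho>: "0 \<le> \<rho> n" "\<rho> n < 1" for n by (auto simp: \<rho>_def field_simps)
  have "\<rho> \<longlonglongrightarrow> 1 - 0"
    unfolding \<rho>_def[abs_def] by (intro tendsto_diff tendsto_const LIMSEQ_ignore_initial_segment[OF LIMSEQ_inverse_real_of_nat[THEN filterlim_compose], THEN tendsto_eq_rhs]) real_asymp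
  then have \<rho>lim: "\<rho> \<longlonglongrightarrow> 1" by simp
  define \<phi>' where "\<phi>' n z = \<phi> (of_real (\<rho> n) * z)" for n z
  have in_ball: "cmod (of_real (\<rho> n) * z) < 1" if "cmod z \<le> 1" for n z
  proof -
    have "cmod (of_real (\<rho> n) * z) = \<rho> n * cmod z" using \<rho>(1)[of n] by (simp add: norm_mult)
    also have "\<dots> \<le> \<rho> n * 1" using that \<rho>(1)[of n] by (intro mult_left_mono) auto
    finally show ?thesis using \<rho>(2)[of n] by simp
  qed
  have cont: "continuous_on (ball 0 1) \<phi>" by (rule holomorphic_on_imp_continuous_on[OF \<phi>(1)])
  have "?L (\<phi>' n) \<le> ?R" for n
  proof (rule pick_disc_core[OF _ _ _ \<Lambda> w])
    show "continuous_on (cball 0 1) (\<phi>' n)"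
      unfolding \<phi>'_def[abs_def]
      by (rule continuous_on_compose2[OF cont]) (use in_ball in \<open>auto intro!: continuous_intros\<close>)
    show "\<phi>' n holomorphic_on ball 0 1"
      unfolding \<phi>'_def[abs_def]
      by (rule holomorphic_on_compose_gen[OF _ \<phi>(1), unfolded o_def]) (use in_ball in \<open>auto intro!: holomorphic_intros\<close>)
    show "cmod (\<phi>' n z) \<le> 1" if "cmod z = 1" for z
      unfolding \<phi>'_def by (rule \<phi>(2)[OF in_ball]) (use that in simp)
  qed
  then show "\<exists>N. \<forall>n\<ge>N. ?L (\<phi>' n) \<le> ?R" by blast
  have "(\<lambda>n. \<phi>' n (w l)) \<longlonglongrightarrow> \<phi> (w l)" if "l \<in> \<Lambda>" for l
  proof -
    have "isCont \<phi> (w l)"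
      using cont w[OF that] by (simp add: continuous_on_eq_continuous_at)
    moreover have "(\<lambda>n. of_real (\<rho> n) * w l) \<longlonglongrightarrow> of_real 1 * w l"
      by (intro tendsto_mult tendsto_of_real \<rho>lim tendsto_const)
    ultimately show ?thesis unfolding \<phi>'_def by (intro isCont_tendsto_compose[of _ \<phi>]) simp_all
  qed
  moreover have "w l * cnj (w m) \<noteq> 1" if "l \<in> \<Lambda>" "m \<in> \<Lambda>" for l m
  proof -
    have "cmod (w l) * cmod (w m) < 1 * 1" using w that by (intro mult_strict_mono') auto
    then show ?thesis by (metis complex_mod_cnj mult_1 norm_mult norm_one order_less_irrefl)
  qed
  ultimately show "(\<lambda>n. ?L (\<phi>' n)) \<longlonglongrightarrow> ?L \<phi>"
    by (intro tendsto_Re tendsto_sum tendsto_mult tendsto_divide tendsto_cnj tendsto_const)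
       (auto simp: divide_inverse intro!: tendsto_mult tendsto_cnj)
qed

text \<open>The Cayley transform moves the points into the disc; in terms of exponentials the lemma
  says that the adjoint of multiplication by \<open>g\<close> is a contraction.\<close>

lemma pick_ex:
  assumes g: "g holomorphic_on {z. Im z > 0}" "\<And>z. Im z > 0 \<Longrightarrow> cmod (g z) \<le> 1"
    and \<Lambda>: "finite \<Lambda>" "\<forall>l\<in>\<Lambda>. Im l > 0"
  shows "norm (\<Sum>l\<in>\<Lambda>. (c l * cnj (g l)) \<cdot> ex l) \<le> norm (\<Sum>l\<in>\<Lambda>. c l \<cdot> ex l)"
proof -
  define w where "w l = (l - \<i>) / (l + \<i>)" for l
  define \<psi> where "\<psi> z = \<i> * (1 + z) / (1 - z)" for z
  define \<phi> where "\<phi> z = g (\<psi> z)" for z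
  have li: "l + \<i> \<noteq> 0" if "Im l > 0" for l using that by (auto simp: complex_eq_iff)
  have w1: "cmod (w l) < 1" if "Im l > 0" for l
  proof -
    have "(cmod (l - \<i>))\<^sup>2 < (cmod (l + \<i>))\<^sup>2"
      using that unfolding cmod_power2 by (simp add: power2_eq_square algebra_simps)
    then have "cmod (l - \<i>) < cmod (l + \<i>)" by (rule power2_less_imp_less) simp
    then show ?thesis using li[OF that] by (simp add: w_def norm_divide)
  qed
  have z1: "1 - z \<noteq> 0" if "cmod z < 1" for z :: complex using that by auto
  have \<psi>: "Im (\<psi> z) > 0" if "cmod z < 1" for z
  proof -
    have "\<psi> z = \<i> * ((1 + z) * cnj (1 - z)) / of_real ((cmod (1 - z))\<^sup>2)"
    proof -
      have "cnj (1 - z) \<noteq> 0" using z1[OF that] by (metis complex_cnj_zero_iff)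
      then have "(\<i> * (1 + z)) * cnj (1 - z) / ((1 - z) * cnj (1 - z)) = \<psi> z"
        unfolding \<psi>_def by (rule nonzero_mult_divide_mult_cancel_right)
      then show ?thesis unfolding complex_norm_square by (simp only: mult.assoc)
    qed
    then have "Im (\<psi> z) = Re ((1 + z) * cnj (1 - z)) / (cmod (1 - z))\<^sup>2" by simp
    also have "Re ((1 + z) * cnj (1 - z)) = 1 - (cmod z)\<^sup>2" unfolding cmod_power2 by (simp add: power2_eq_square algebra_simps)
    finally show ?thesis using that z1[OF that] by (simp add: abs_square_less_1)
  qed
  have \<psi>w: "\<psi> (w l) = l" if "Im l > 0" for l
  proof -
    have "1 + w l = 2 * l / (l + \<i>)" "1 - w l = 2 * \<i> / (l + \<i>)" using li[OF that] by (simp_all add: w_def field_simps)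
    then show ?thesis using li[OF that] by (simp add: \<psi>_def)
  qed
  \<comment> \<open>The weight is the factor by which the Cayley transform changes the Szego kernel;
    the identity \<open>key\<close> makes both Gram matrices agree.\<close>
  define d where "d b m = b m * of_real (sqrt 2) / cnj (m + \<i>)" for b :: "complex \<Rightarrow> complex" and m
  have key: "d b m * cnj (d b' l) / (1 - w l * cnj (w m)) = b m * cnj (b' l) * (\<i> / (l - cnj m))"
    if "Im l > 0" "Im m > 0" for b b' l m
  proof -
    have n: "l + \<i> \<noteq> 0" "cnj (m + \<i>) \<noteq> 0" "l - cnj m \<noteq> 0"
      using li that by (auto simp: complex_eq_iff)
    have "(l + \<i>) * cnj (m + \<i>) * (1 - w l * cnj (w m)) = (l + \<i>) * cnj (m + \<i>) - (l - \<i>) * cnj (m - \<i>)"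
    proof -
      have "w l * (l + \<i>) = l - \<i>" "cnj (w m) * cnj (m + \<i>) = cnj (m - \<i>)"
        using n li[OF that(2)] by (simp_all add: w_def)
      moreover have "a * b * (1 - x * y) = a * b - (x * a) * (y * b)" for a b x y :: complex
        by (simp add: algebra_simps)
      ultimately show ?thesis by metis
    qed
    also have "\<dots> = - (2 * \<i>) * (l - cnj m)" by (simp add: algebra_simps)
    finally have e: "(l + \<i>) * cnj (m + \<i>) * (1 - w l * cnj (w m)) = - (2 * \<i>) * (l - cnj m)" .
    have s2: "complex_of_real (sqrt 2) * of_real (sqrt 2) = 2" by (simp flip: of_real_mult)
    have "d b m * cnj (d b' l) / (1 - w l * cnj (w m)) = b m * cnj (b' l) * (of_real (sqrt 2) * of_real (sqrt 2)) / ((l + \<i>) * cnj (m + \<i>) * (1 - w l * cnj (w m)))"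
      by (simp add: d_def mult_ac)
    also have "\<dots> = b m * cnj (b' l) * (\<i> / (l - cnj m))"
      unfolding e s2 using n(3) by (simp add: field_simps)
    finally show ?thesis .
  qed
  have N: "(norm (\<Sum>l\<in>\<Lambda>. b l \<cdot> ex l))\<^sup>2 = Re (\<Sum>m\<in>\<Lambda>. \<Sum>l\<in>\<Lambda>. d b m * cnj (d b l) / (1 - w l * cnj (w m)))" for b
  proof -
    have "(norm (\<Sum>l\<in>\<Lambda>. b l \<cdot> ex l))\<^sup>2 = Re (\<Sum>m\<in>\<Lambda>. \<Sum>l\<in>\<Lambda>. b m * cnj (b l) * (\<i> / (l - cnj m)))"
      unfolding cin_sum_ex[OF \<Lambda>(2), symmetric] by (simp add: cin_self_norm)
    also have "(\<Sum>m\<in>\<Lambda>. \<Sum>l\<in>\<Lambda>. b m * cnj (b l) * (\<i> / (l - cnj m))) = (\<Sum>m\<in>\<Lambda>. \<Sum>l\<in>\<Lambda>. d b m * cnj (d b l) / (1 - w l * cnj (w m)))"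
      using \<Lambda>(2) by (intro sum.cong HOL.refl key[symmetric]) auto
    finally show ?thesis .
  qed
  have dg: "d (\<lambda>l. c l * cnj (g l)) m = d c m * cnj (\<phi> (w m))" if "m \<in> \<Lambda>" for m
    using \<psi>w[of m] \<Lambda>(2) that by (simp add: d_def \<phi>_def)
  have "(norm (\<Sum>l\<in>\<Lambda>. (c l * cnj (g l)) \<cdot> ex l))\<^sup>2 \<le> (norm (\<Sum>l\<in>\<Lambda>. c l \<cdot> ex l))\<^sup>2"
  proof -
    have "(\<Sum>m\<in>\<Lambda>. \<Sum>l\<in>\<Lambda>. d (\<lambda>l. c l * cnj (g l)) m * cnj (d (\<lambda>l. c l * cnj (g l)) l) / (1 - w l * cnj (w m))) =
      (\<Sum>m\<in>\<Lambda>. \<Sum>l\<in>\<Lambda>. (d c m * cnj (\<phi> (w m))) * cnj (d c l * cnj (\<phi> (w l))) / (1 - w l * cnj (w m)))"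
      by (intro sum.cong HOL.refl) (simp add: dg)
    moreover have "Re (\<Sum>m\<in>\<Lambda>. \<Sum>l\<in>\<Lambda>. (d c m * cnj (\<phi> (w m))) * cnj (d c l * cnj (\<phi> (w l))) / (1 - w l * cnj (w m)))
       \<le> Re (\<Sum>m\<in>\<Lambda>. \<Sum>l\<in>\<Lambda>. d c m * cnj (d c l) / (1 - w l * cnj (w m)))"
    proof (rule pick_disc)
      show "\<phi> holomorphic_on ball 0 1"
        unfolding \<phi>_def[abs_def]
      proof (rule holomorphic_on_compose_gen[OF _ g(1), unfolded o_def])
        show "\<psi> holomorphic_on ball 0 1" unfolding \<psi>_def[abs_def] using z1 by (intro holomorphic_intros) auto
      qed (use \<psi> in auto)
    qed (use \<psi> g(2) \<Lambda> w1 in \<open>auto simp: \<phi>_def\<close>)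
    ultimately show ?thesis unfolding N by simp
  qed
  then show ?thesis by (rule power2_le_imp_le) simp
qed

text \<open>In the inequality for \<open>f\<close>, the coefficients \<open>c l * cnj (g l)\<close>
  already produce the linear and the last term belonging to the product. Only the subtracted middle
  norm differs, and enlarging it by Pick's inequality preserves the bound.\<close>

lemma schur_bound_mult:
  assumes f: "schur_bound M f" and g: "g holomorphic_on {z. Im z > 0}" "\<And>z. Im z > 0 \<Longrightarrow> cmod (g z) \<le> 1"
  shows "schur_bound M (\<lambda>z. g z * f z)"
  unfolding schur_bound_def
proof (intro allI impI)
  fix \<Lambda> :: "complex set" and c assume \<Lambda>: "finite \<Lambda>" "\<forall>l\<in>\<Lambda>. Im l > 0"
  have "2 * Re (\<Sum>l\<in>\<Lambda>. cnj (c l * cnj (g l)) * f l) - (norm (\<Sum>l\<in>\<Lambda>. (c l * cnj (g l)) \<cdot> ex l))\<^sup>2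
     + (norm (\<Sum>l\<in>\<Lambda>. (c l * cnj (g l) * cnj (f l)) \<cdot> ex l))\<^sup>2 \<le> M"
    using f[unfolded schur_bound_def, rule_format, of \<Lambda> "\<lambda>l. c l * cnj (g l)"] \<Lambda> by blast
  moreover have "(norm (\<Sum>l\<in>\<Lambda>. (c l * cnj (g l)) \<cdot> ex l))\<^sup>2 \<le> (norm (\<Sum>l\<in>\<Lambda>. c l \<cdot> ex l))\<^sup>2"
    by (rule power_mono[OF pick_ex[OF g \<Lambda>] norm_ge_zero])
  moreover have "cnj (c l * cnj (g l)) * f l = cnj (c l) * (g l * f l)" "c l * cnj (g l) * cnj (f l) = c l * cnj (g l * f l)" for l
    by simp_all
  ultimately show "2 * Re (\<Sum>l\<in>\<Lambda>. cnj (c l) * (g l * f l)) - (norm (\<Sum>l\<in>\<Lambda>. c l \<cdot> ex l))\<^sup>2 + (norm (\<Sum>l\<in>\<Lambda>. (c l * cnj (g l * f l)) \<cdot> ex l))\<^sup>2 \<le> M"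
    by (simp only:)
qed

lemma krein_schur_bound:
  assumes A: "L2_on {0..} A" and f: "schur_function A f"
  shows "schur_bound ((L2_norm_on {0..} A)\<^sup>2) f"
  unfolding schur_bound_def
proof (intro allI impI)
  fix \<Lambda> :: "complex set" and c assume \<Lambda>: "finite \<Lambda>" "\<forall>l\<in>\<Lambda>. Im l > 0"
  have "\<forall>l. \<exists>X. Im l > 0 \<longrightarrow> krein_solution A l X \<and> ((\<lambda>r. X r $ 2 $ 1 / X r $ 2 $ 2) \<longlongrightarrow> f l) at_top"
    using f unfolding schur_function_def by blast
  from choice[OF this] obtain X where
    X0: "\<And>l. Im l > 0 \<longrightarrow> krein_solution A l (X l) \<and> ((\<lambda>r. X l r $ 2 $ 1 / X l r $ 2 $ 2) \<longlongrightarrow> f l) at_top"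
    by blast
  note X = conjunct1[OF mp[OF X0]] conjunct2[OF mp[OF X0]]
  define M where "M = (L2_norm_on {0..} A)\<^sup>2"
  have AA: "integrable lborel (\<lambda>x. indicat_real {0..} x *\<^sub>R (cmod (A x))\<^sup>2)" using A by (simp add: L2_on_def set_integrable_def)
  have M: "M = set_lebesgue_integral lborel {0..} (\<lambda>x. (cmod (A x))\<^sup>2)"
  proof -
    have "0 \<le> set_lebesgue_integral lborel {0..} (\<lambda>x. (cmod (A x))\<^sup>2)"
      unfolding set_lebesgue_integral_def by (intro integral_nonneg_AE AE_I2) simp
    then show ?thesis by (simp add: M_def L2_norm_on_def)
  qed
  define S W where "S l r = X l r $ 2 $ 1" and "W l r = X l r $ 2 $ 2" for l r
  have k: "krein A l (\<lambda>r. X l r $ 1 $ 1) (\<lambda>r. X l r $ 1 $ 2) (S l) (W l)" if "Im l > 0" for l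
    unfolding S_def[abs_def] W_def[abs_def] using X(1)[OF that] A krein_solution_iff[OF A] by (simp add: krein_def)
  let ?T = "\<lambda>a. 2 * Re (\<Sum>l\<in>\<Lambda>. cnj (c l) * a l) - (norm (\<Sum>l\<in>\<Lambda>. c l \<cdot> ex l))\<^sup>2 + (norm (\<Sum>l\<in>\<Lambda>. (c l * cnj (a l)) \<cdot> ex l))\<^sup>2"
  have "?T f \<le> M"
  proof (rule tendsto_upperbound)
    have lim: "((\<lambda>r. S l r / W l r) \<longlongrightarrow> f l) at_top" if "l \<in> \<Lambda>" for l
      using X(2)[of l] \<Lambda>(2) that by (simp add: S_def W_def)
    show "((\<lambda>r. ?T (\<lambda>l. S l r / W l r)) \<longlongrightarrow> ?T f) at_top"
      by (intro tendsto_add tendsto_diff tendsto_mult tendsto_const tendsto_Re tendsto_sum tendsto_power tendsto_norm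
          tendsto_cscale tendsto_cnj lim)
    show "eventually (\<lambda>r. ?T (\<lambda>l. S l r / W l r) \<le> M) at_top"
      using eventually_ge_at_top[of "0::real"]
    proof eventually_elim
      case (elim r)
      have "?T (\<lambda>l. S l r / W l r) \<le> set_lebesgue_integral lborel {0..r} (\<lambda>x. (cmod (A x))\<^sup>2)"
        by (rule krein_schur_bound_finite[OF k elim \<Lambda>])
      also have "\<dots> \<le> M"
        unfolding M set_lebesgue_integral_def by (rule integral_mono'[OF AA]) (auto simp: indicator_def)
      finally show ?case .
    qed
  qed simp
  then show "?T f \<le> (L2_norm_on {0..} A)\<^sup>2" by (simp add: M_def)
qed

section \<open>Reconstruction of the coefficient\<close>

text \<open>Trial functions paired with the prospective value of the functional. A relation is used
  because the second entry is given through the coefficients; that it depends on the sum alone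
  follows from the bound in \<open>Riesz_span\<close>.\<close>

definition ex_span :: "(complex \<Rightarrow> complex) \<Rightarrow> (ltwo \<times> real) set" where
  "ex_span f = {(\<Sum>l\<in>\<Lambda>. c l \<cdot> ex l, Re (\<Sum>l\<in>\<Lambda>. cnj (c l) * f l)) | \<Lambda> c. finite \<Lambda> \<and> (\<forall>l\<in>\<Lambda>. Im l > 0)}"

lemma ex_spanI:
  "finite \<Lambda> \<Longrightarrow> \<forall>l\<in>\<Lambda>. Im l > 0 \<Longrightarrow> (\<Sum>l\<in>\<Lambda>. c l \<cdot> ex l, Re (\<Sum>l\<in>\<Lambda>. cnj (c l) * f l)) \<in> ex_span f"
  unfolding ex_span_def by blast

lemma subspace_ex_span: "subspace (ex_span f)"
proof (rule subspaceI)
  show "0 \<in> ex_span f" using ex_spanI[of "{}" undefined f] by (simp add: zero_prod_def)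
  fix x y assume "x \<in> ex_span f" "y \<in> ex_span f"
  then obtain \<Lambda> c \<Lambda>' c' where x: "x = (\<Sum>l\<in>\<Lambda>. c l \<cdot> ex l, Re (\<Sum>l\<in>\<Lambda>. cnj (c l) * f l))" "finite \<Lambda>" "\<forall>l\<in>\<Lambda>. Im l > 0"
    and y: "y = (\<Sum>l\<in>\<Lambda>'. c' l \<cdot> ex l, Re (\<Sum>l\<in>\<Lambda>'. cnj (c' l) * f l))" "finite \<Lambda>'" "\<forall>l\<in>\<Lambda>'. Im l > 0"
    unfolding ex_span_def by blast
  define b where "b l = (if l \<in> \<Lambda> then c l else 0)" for l
  define b' where "b' l = (if l \<in> \<Lambda>' then c' l else 0)" for l
  have "(\<Sum>l\<in>\<Lambda>. c l \<cdot> ex l) = (\<Sum>l\<in>\<Lambda> \<union> \<Lambda>'. b l \<cdot> ex l)" "(\<Sum>l\<in>\<Lambda>. cnj (c l) * f l) = (\<Sum>l\<in>\<Lambda> \<union> \<Lambda>'. cnj (b l) * f l)"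
    "(\<Sum>l\<in>\<Lambda>'. c' l \<cdot> ex l) = (\<Sum>l\<in>\<Lambda> \<union> \<Lambda>'. b' l \<cdot> ex l)" "(\<Sum>l\<in>\<Lambda>'. cnj (c' l) * f l) = (\<Sum>l\<in>\<Lambda> \<union> \<Lambda>'. cnj (b' l) * f l)"
    using x(2) y(2) by (intro sum.mono_neutral_cong_left; auto simp: b_def b'_def)+
  then have "x + y = (\<Sum>l\<in>\<Lambda> \<union> \<Lambda>'. (b l + b' l) \<cdot> ex l, Re (\<Sum>l\<in>\<Lambda> \<union> \<Lambda>'. cnj (b l + b' l) * f l))"
    unfolding x y by (simp add: sum.distrib cscale_add_left distrib_right)
  then show "x + y \<in> ex_span f" using ex_spanI[of "\<Lambda> \<union> \<Lambda>'" "\<lambda>l. b l + b' l" f] x y by auto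
next
  fix a :: real and x assume "x \<in> ex_span f"
  then obtain \<Lambda> c where x: "x = (\<Sum>l\<in>\<Lambda>. c l \<cdot> ex l, Re (\<Sum>l\<in>\<Lambda>. cnj (c l) * f l))" "finite \<Lambda>" "\<forall>l\<in>\<Lambda>. Im l > 0"
    unfolding ex_span_def by blast
  have "a *\<^sub>R x = (\<Sum>l\<in>\<Lambda>. (of_real a * c l) \<cdot> ex l, Re (\<Sum>l\<in>\<Lambda>. cnj (of_real a * c l) * f l))"
  proof -
    have "a *\<^sub>R (\<Sum>l\<in>\<Lambda>. c l \<cdot> ex l) = (\<Sum>l\<in>\<Lambda>. (of_real a * c l) \<cdot> ex l)"
      by (simp add: scaleR_cscale cscale_sum_right cscale_cscale)
    moreover have "a * Re (\<Sum>l\<in>\<Lambda>. cnj (c l) * f l) = Re (\<Sum>l\<in>\<Lambda>. cnj (of_real a * c l) * f l)"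
    proof -
      have "(\<Sum>l\<in>\<Lambda>. cnj (of_real a * c l) * f l) = of_real a * (\<Sum>l\<in>\<Lambda>. cnj (c l) * f l)"
        by (simp add: sum_distrib_left mult.assoc)
      then show ?thesis by simp
    qed
    ultimately show ?thesis unfolding x by simp
  qed
  then show "a *\<^sub>R x \<in> ex_span f" by (simp only: ex_spanI[OF x(2,3)])
qed

lemma ex_Riesz:
  assumes "\<And>\<Lambda> c. finite \<Lambda> \<Longrightarrow> \<forall>l\<in>\<Lambda>. Im l > 0 \<Longrightarrow> 2 * Re (\<Sum>l\<in>\<Lambda>. cnj (c l) * f l) - (norm (\<Sum>l\<in>\<Lambda>. c l \<cdot> ex l))\<^sup>2 \<le> M"
  shows "\<exists>k. (\<forall>l. Im l > 0 \<longrightarrow> cin k (ex l) = f l) \<and> k \<in> closure (fst ` ex_span f)"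
proof -
  have "2 * s - (norm u)\<^sup>2 \<le> M" if "(u, s) \<in> ex_span f" for u s
    using that assms unfolding ex_span_def by blast
  from Riesz_span[OF subspace_ex_span this]
  obtain k where k: "\<And>u s. (u, s) \<in> ex_span f \<Longrightarrow> inner k u = s" "k \<in> closure (fst ` ex_span f)" by blast
  have "cin k (ex l) = f l" if l: "Im l > 0" for l
  proof (rule complex_eqI)
    have "(1 \<cdot> ex l, Re (f l)) \<in> ex_span f" using ex_spanI[of "{l}" "\<lambda>_. 1" f] l by simp
    from k(1)[OF this] show "Re (cin k (ex l)) = Re (f l)" by (simp add: inner_ltwo_def)
    have "(\<i> \<cdot> ex l, Re (- \<i> * f l)) \<in> ex_span f" using ex_spanI[of "{l}" "\<lambda>_. \<i>" f] l by simp
    from k(1)[OF this] show "Im (cin k (ex l)) = Im (f l)" by (simp add: inner_ltwo_def cin_cscale_right)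
  qed
  with k(2) show ?thesis by blast
qed

lemma cut_ex: assumes "Im l > 0" shows "cut {0..} (ex l) = ex l"
  by (rule cut_eq_selfI) (simp, use rep_ex[OF assms] in eventually_elim, simp)

lemma cut_sum: "S \<in> sets borel \<Longrightarrow> cut S (\<Sum>i\<in>I. u i) = (\<Sum>i\<in>I. cut S (u i))"
  by (induction I rule: infinite_finite_induct) (simp_all add: cut_add)

lemma cut_ex_span:
  assumes "u \<in> fst ` ex_span f" shows "cut {0..} u = u"
proof -
  obtain \<Lambda> c where u: "u = (\<Sum>l\<in>\<Lambda>. c l \<cdot> ex l)" "\<forall>l\<in>\<Lambda>. Im l > 0"
    using assms unfolding ex_span_def by auto
  then show ?thesis by (simp add: cut_sum cut_cscale cut_ex cong: sum.cong)
qed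

lemma cut_closure_ex_span:
  assumes "u \<in> closure (fst ` ex_span f)" shows "cut {0..} u = u"
proof -
  obtain v where v: "\<And>n. v n \<in> fst ` ex_span f" "v \<longlonglongrightarrow> u" using assms unfolding closure_sequential by blast
  have "(\<lambda>n. cut {0..} (v n)) \<longlonglongrightarrow> cut {0..} u"
    by (rule bounded_linear.tendsto[OF bounded_linear_cut v(2)]) simp
  then show ?thesis using v(2) cut_ex_span[OF v(1)] LIMSEQ_unique by fastforce
qed

section \<open>Totality of the decaying exponentials\<close>

lemma zero_of_rays:
  fixes \<psi> :: "real \<Rightarrow> real"
  assumes \<psi>: "integrable lborel \<psi>" and z: "\<And>a. (LINT x|lborel. indicator {..<a} x * \<psi> x) = 0"
  shows "AE x in lborel. \<psi> x = 0"
proof -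
  note [measurable] = borel_measurable_integrable[OF \<psi>]
  have ii: "integrable lborel (\<lambda>x. indicator A x * \<psi> x)" if "A \<in> sets borel" for A
    using integrable_mult_indicator[of A lborel \<psi>] \<psi> that by simp
  have tot: "(LINT x|lborel. \<psi> x) = 0"
  proof -
    have "(\<lambda>n. LINT x|lborel. indicator {..<real n} x * \<psi> x) \<longlonglongrightarrow> (LINT x|lborel. \<psi> x)"
    proof (rule integral_dominated_convergence)
      show "integrable lborel (\<lambda>x. \<bar>\<psi> x\<bar>)" using \<psi> by (rule integrable_abs)
      show "AE x in lborel. (\<lambda>n. indicator {..<real n} x * \<psi> x) \<longlonglongrightarrow> \<psi> x"
      proof (rule AE_I2, rule tendsto_eventually)
        fix x :: real
        obtain n0 where "x < real n0" using reals_Archimedean2 by blast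
        then show "\<forall>\<^sub>F n in sequentially. indicator {..<real n} x * \<psi> x = \<psi> x"
          by (intro eventually_mono[OF eventually_ge_at_top[of n0]]) (auto simp: indicator_def)
      qed
    qed (auto simp: indicator_def)
    then show ?thesis using z LIMSEQ_unique[OF _ tendsto_const] by simp
  qed
  have all: "(LINT x|lborel. indicator A x * \<psi> x) = 0" if A: "A \<in> sets borel" for A
  proof -
    have "Int_stable (range (\<lambda>a. {..<a::real}))"
    proof -
      have "{..<a} \<inter> {..<b} = {..<min a b}" for a b :: real by auto
      then show ?thesis by (auto simp: Int_stable_def)
    qed
    moreover have "range (\<lambda>a. {..<a::real}) \<subseteq> Pow UNIV" by simp
    moreover have "A \<in> sigma_sets UNIV (range (\<lambda>a. {..<a::real}))"
      using A unfolding borel_Iio by (simp add: sets_measure_of)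
    ultimately show ?thesis
    proof (induction rule: sigma_sets_induct_disjoint[consumes 3, case_names basic empty compl union])
      case (basic A) then show ?case using z by auto
    next
      case empty then show ?case by simp
    next
      case (compl A)
      have A: "A \<in> sets borel" using compl(1) unfolding borel_Iio by (simp add: sets_measure_of)
      have "(LINT x|lborel. indicator (UNIV - A) x * \<psi> x) = (LINT x|lborel. \<psi> x - indicator A x * \<psi> x)"
        by (rule Bochner_Integration.integral_cong) (auto simp: indicator_def)
      also have "\<dots> = 0" using ii[OF A] \<psi> tot compl(2) by simp
      finally show ?case .
    next
      case (union A)
      have A: "A i \<in> sets borel" for i using union(2) unfolding borel_Iio by (auto simp: sets_measure_of)
      have "(\<lambda>n. LINT x|lborel. indicator (\<Union>i<n. A i) x * \<psi> x) \<longlonglongrightarrow> (LINT x|lborel. indicator (\<Union>i. A i) x * \<psi> x)"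
      proof (rule integral_dominated_convergence)
        show "integrable lborel (\<lambda>x. \<bar>\<psi> x\<bar>)" using \<psi> by (rule integrable_abs)
        show "(\<lambda>x. indicator (\<Union>i. A i) x * \<psi> x) \<in> borel_measurable lborel" "(\<lambda>x. indicator (\<Union>i<n. A i) x * \<psi> x) \<in> borel_measurable lborel" for n
          using A by (auto intro!: borel_measurable_times)
        show "AE x in lborel. (\<lambda>n. indicator (\<Union>i<n. A i) x * \<psi> x) \<longlonglongrightarrow> indicator (\<Union>i. A i) x * \<psi> x"
          by (intro AE_I2 tendsto_mult tendsto_const LIMSEQ_indicator_UN)
        show "AE x in lborel. norm (indicator (\<Union>i<n. A i) x * \<psi> x) \<le> \<bar>\<psi> x\<bar>" for n
        proof (rule AE_I2)
          fix x show "norm (indicator (\<Union>i<n. A i) x * \<psi> x) \<le> \<bar>\<psi> x\<bar>"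
            by (cases "x \<in> (\<Union>i<n. A i)") (simp_all del: UN_iff)
        qed
      qed
      moreover have "(LINT x|lborel. indicator (\<Union>i<n. A i) x * \<psi> x) = 0" for n
      proof -
        have "(LINT x|lborel. indicator (\<Union>i<n. A i) x * \<psi> x) = (LINT x|lborel. (\<Sum>i<n. indicator (A i) x * \<psi> x))"
        proof (rule Bochner_Integration.integral_cong[OF HOL.refl])
          fix x
          have "disjoint_family_on A {..<n}" by (rule disjoint_family_on_mono[OF _ union(1)]) simp
          then show "indicator (\<Union>i<n. A i) x * \<psi> x = (\<Sum>i<n. indicator (A i) x * \<psi> x)"
            by (simp only: indicator_UN_disjoint[OF finite_lessThan] sum_distrib_right)
        qed
        also have "\<dots> = (\<Sum>i<n. LINT x|lborel. indicator (A i) x * \<psi> x)"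
          by (rule Bochner_Integration.integral_sum) (rule ii[OF A])
        also have "\<dots> = 0" by (simp only: union(3) sum.neutral_const)
        finally show ?thesis .
      qed
      ultimately show ?case using LIMSEQ_unique[OF _ tendsto_const] by simp
    qed
  qed
  have "AE x in lborel. \<psi> x = (\<lambda>_. 0) x"
    by (rule density_unique_real[OF \<psi>]) (use all in \<open>simp_all add: set_lebesgue_integral_def\<close>)
  then show ?thesis by simp
qed

text \<open>The substitution of \<open>exp (- x)\<close> turns the hypothesis into vanishing moments
  on [0,1]. Weierstrass approximation passes from polynomials to continuous functions of
  \<open>exp (- x)\<close>, and those approximate indicators of rays.\<close>

lemma exp_neg_orthogonal_zero:
  fixes \<psi> :: "real \<Rightarrow> real"
  assumes \<psi>: "integrable lborel \<psi>" and supp: "\<And>x. x < 0 \<Longrightarrow> \<psi> x = 0"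
    and orth: "\<And>n::nat. (LINT x|lborel. \<psi> x * exp (- x) ^ n) = 0"
  shows "AE x in lborel. \<psi> x = 0"
proof (rule zero_of_rays[OF \<psi>])
  note [measurable] = borel_measurable_integrable[OF \<psi>]
  have bnd: "integrable lborel (\<lambda>x. \<psi> x * q (exp (- x)))"
    if q: "q \<in> borel_measurable borel" "\<And>t. t \<in> {0..1} \<Longrightarrow> \<bar>q t\<bar> \<le> B" for q B
  proof (rule Bochner_Integration.integrable_bound)
    show "integrable lborel (\<lambda>x. B * \<psi> x)" using \<psi> by simp
    show "AE x in lborel. norm (\<psi> x * q (exp (- x))) \<le> norm (B * \<psi> x)"
    proof (rule AE_I2)
      fix x show "norm (\<psi> x * q (exp (- x))) \<le> norm (B * \<psi> x)"
      proof (cases "x < 0")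
        case False
        then have "\<bar>q (exp (- x))\<bar> \<le> \<bar>B\<bar>" using q(2)[of "exp (- x)"] by simp
        then have "\<bar>q (exp (- x))\<bar> * \<bar>\<psi> x\<bar> \<le> \<bar>B\<bar> * \<bar>\<psi> x\<bar>" by (rule mult_right_mono) simp
        then show ?thesis by (simp add: abs_mult mult.commute)
      qed (simp add: supp)
    qed
    show "(\<lambda>x. \<psi> x * q (exp (- x))) \<in> borel_measurable lborel" using q(1) by measurable
  qed
  have pol: "(LINT x|lborel. \<psi> x * (\<Sum>i\<le>n. a i * exp (- x) ^ i)) = 0" for a :: "nat \<Rightarrow> real" and n
  proof -
    have i: "integrable lborel (\<lambda>x. a i * (\<psi> x * exp (- x) ^ i))" for i
      using bnd[of "\<lambda>t. t ^ i" 1] by (intro integrable_mult_right) (auto simp: power_le_one)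
    have "(LINT x|lborel. \<psi> x * (\<Sum>i\<le>n. a i * exp (- x) ^ i)) = (LINT x|lborel. (\<Sum>i\<le>n. a i * (\<psi> x * exp (- x) ^ i)))"
      by (rule Bochner_Integration.integral_cong) (auto simp: sum_distrib_left mult_ac)
    also have "\<dots> = (\<Sum>i\<le>n. LINT x|lborel. a i * (\<psi> x * exp (- x) ^ i))"
      by (rule Bochner_Integration.integral_sum) (rule i)
    also have "\<dots> = 0" by (simp add: orth)
    finally show ?thesis .
  qed
  have cont: "(LINT x|lborel. \<psi> x * q (exp (- x))) = 0" if q: "continuous_on UNIV q" for q :: "real \<Rightarrow> real"
  proof -
    have qm: "q \<in> borel_measurable borel" by (rule borel_measurable_continuous_onI[OF q])
    have qc: "continuous_on {0..1} q" by (rule continuous_on_subset[OF q]) simp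
    have "\<exists>B. \<forall>t\<in>{0..1}. \<bar>q t\<bar> \<le> B"
      using compact_imp_bounded[OF compact_continuous_image[OF qc compact_Icc]] by (auto simp: bounded_iff)
    then obtain B where B: "\<And>t. t \<in> {0..1} \<Longrightarrow> \<bar>q t\<bar> \<le> B" by blast
    define I where "I = (LINT x|lborel. \<bar>\<psi> x\<bar>)"
    have small: "\<bar>LINT x|lborel. \<psi> x * q (exp (- x))\<bar> \<le> e * I" if e: "e > 0" for e
    proof -
      obtain g where g: "real_polynomial_function g" "\<And>t. t \<in> {0..1} \<Longrightarrow> \<bar>q t - g t\<bar> < e"
        using Stone_Weierstrass_real_polynomial_function[OF compact_Icc qc e] by auto
      obtain a n where gs: "g = (\<lambda>x. \<Sum>i\<le>n. a i * x ^ i)" using g(1) real_polynomial_function_iff_sum by blast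
      have gc: "continuous_on UNIV g" unfolding gs by (intro continuous_intros)
      have gm: "g \<in> borel_measurable borel" by (rule borel_measurable_continuous_onI[OF gc])
      have gB: "\<bar>g t\<bar> \<le> B + e" if "t \<in> {0..1}" for t using g(2)[OF that] B[OF that] by linarith
      have "(LINT x|lborel. \<psi> x * q (exp (- x))) = (LINT x|lborel. \<psi> x * q (exp (- x))) - (LINT x|lborel. \<psi> x * g (exp (- x)))"
        using pol[of a n] by (simp add: gs)
      also have "\<dots> = (LINT x|lborel. \<psi> x * q (exp (- x)) - \<psi> x * g (exp (- x)))"
        by (rule Bochner_Integration.integral_diff[symmetric]) (use bnd[OF qm B] bnd[OF gm gB] in auto)
      also have "\<bar>\<dots>\<bar> \<le> (LINT x|lborel. \<bar>\<psi> x * q (exp (- x)) - \<psi> x * g (exp (- x))\<bar>)"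
        by (rule integral_abs_bound)
      also have "\<dots> \<le> (LINT x|lborel. e * \<bar>\<psi> x\<bar>)"
      proof (rule integral_mono')
        show "integrable lborel (\<lambda>x. e * \<bar>\<psi> x\<bar>)" using \<psi> by auto
        fix x
        show "\<bar>\<psi> x * q (exp (- x)) - \<psi> x * g (exp (- x))\<bar> \<le> e * \<bar>\<psi> x\<bar>"
        proof (cases "x < 0")
          case False
          then have "\<bar>q (exp (- x)) - g (exp (- x))\<bar> \<le> e" using g(2)[of "exp (- x)"] by simp
          then have "\<bar>\<psi> x\<bar> * \<bar>q (exp (- x)) - g (exp (- x))\<bar> \<le> \<bar>\<psi> x\<bar> * e" by (rule mult_left_mono) simp
          then show ?thesis by (simp add: abs_mult right_diff_distrib[symmetric] mult.commute)
        qed (simp add: supp)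
      qed (use e in simp)
      also have "\<dots> = e * I" by (simp add: I_def)
      finally show ?thesis .
    qed
    have I0: "I \<ge> 0" unfolding I_def by (intro integral_nonneg_AE) simp
    show ?thesis
    proof (rule ccontr)
      define d where "d = \<bar>LINT x|lborel. \<psi> x * q (exp (- x))\<bar>"
      assume "(LINT x|lborel. \<psi> x * q (exp (- x))) \<noteq> 0"
      then have d: "d > 0" by (simp add: d_def)
      have "d \<le> (d / (2 * (I + 1))) * I" unfolding d_def[symmetric] using small[of "d / (2 * (I + 1))"] d I0 by (simp add: d_def)
      also have "\<dots> = d * (I / (2 * (I + 1)))" by simp
      also have "\<dots> \<le> d * (1/2)" using d I0 by (intro mult_left_mono) (auto simp: field_simps)
      finally show False using d by simp
    qed
  qed
  fix a :: real
  show "(LINT x|lborel. indicator {..<a} x * \<psi> x) = 0"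
  proof (cases "a \<le> 0")
    case True
    then have "(\<lambda>x. indicator {..<a} x * \<psi> x) = (\<lambda>_. 0)" using supp by (auto simp: indicator_def)
    then show ?thesis by (simp only: integral_zero)
  next
    case False
    define s where "s = exp (- a)"
    \<comment> \<open>Ramps converging to the indicator of values above \<open>s\<close>; since
      \<open>exp (- x)\<close> decreases, this is the ray below \<open>a\<close>.\<close>
    define q where "q n t = min 1 (max 0 (real n * (t - s)))" for n t
    have qc: "continuous_on UNIV (q n)" for n unfolding q_def[abs_def] by (intro continuous_intros)
    have "(\<lambda>n. LINT x|lborel. \<psi> x * q n (exp (- x))) \<longlonglongrightarrow> (LINT x|lborel. indicator {..<a} x * \<psi> x)"
    proof (rule integral_dominated_convergence)
      show "integrable lborel (\<lambda>x. \<bar>\<psi> x\<bar>)" using \<psi> by (rule integrable_abs)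
      show "(\<lambda>x. \<psi> x * q n (exp (- x))) \<in> borel_measurable lborel" for n
        using borel_measurable_continuous_onI[OF qc[of n]] by measurable
      show "AE x in lborel. norm (\<psi> x * q n (exp (- x))) \<le> \<bar>\<psi> x\<bar>" for n
        by (intro AE_I2) (auto simp: abs_mult q_def intro!: mult_left_le)
      show "AE x in lborel. (\<lambda>n. \<psi> x * q n (exp (- x))) \<longlonglongrightarrow> indicator {..<a} x * \<psi> x"
      proof (rule AE_I2, rule tendsto_eventually)
        fix x :: real
        show "\<forall>\<^sub>F n in sequentially. \<psi> x * q n (exp (- x)) = indicator {..<a} x * \<psi> x"
        proof (cases "x < a")
          case True
          then have d: "exp (- x) - s > 0" by (simp add: s_def)
          obtain n0 where n0: "1 / (exp (- x) - s) \<le> real n0" using real_arch_simple by blast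
          show ?thesis
          proof (rule eventually_mono[OF eventually_ge_at_top[of n0]])
            fix n assume "n0 \<le> n"
            then have "1 / (exp (- x) - s) \<le> real n" using n0 by linarith
            then have "1 \<le> real n * (exp (- x) - s)" using d by (simp add: divide_le_eq)
            then have "q n (exp (- x)) = 1" by (simp add: q_def)
            then show "\<psi> x * q n (exp (- x)) = indicator {..<a} x * \<psi> x" using True by simp
          qed
        next
          case False
          then have "exp (- x) - s \<le> 0" by (simp add: s_def)
          then have "q n (exp (- x)) = 0" for n by (simp add: q_def mult_nonneg_nonpos)
          then show ?thesis using False by simp
        qed
      qed
    qed measurable
    then show ?thesis using cont[OF qc] LIMSEQ_unique[OF _ tendsto_const] by simp
  qed
qed

lemma cnj_indicator [simp]: "cnj (indicator S x) = indicator S x"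
  by (simp add: indicator_def)

text \<open>The points \<open>of_nat (Suc n) * \<i>\<close> suffice. One factor
  \<open>exp (- x)\<close> is absorbed into \<open>\<psi>\<close>, which makes it integrable, and
  the other factors are powers of \<open>exp (- x)\<close>.\<close>

lemma ex_orthogonal_zero:
  assumes v: "cut {0..} v = v" and orth: "\<And>l. Im l > 0 \<Longrightarrow> cin v (ex l) = 0"
  shows "v = 0"
proof -
  have i1: "Im \<i> > 0" by simp
  define \<psi> where "\<psi> x = rep v x * (indicator {0..} x * exp (\<i> * \<i> * of_real x))" for x
  have sx: "sqi (\<lambda>x. indicator {0..} x * exp (\<i> * (of_nat (Suc n) * \<i>) * of_real x))" for n
    using sqi_cnj[OF sqi_ex[of "of_nat (Suc n) * \<i>"]] by (simp add: exp_cnj)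
  have \<psi>i: "integrable lborel \<psi>"
    unfolding \<psi>_def using sqi_integrable_mult[OF sqi_rep sx[of 0], of v] by simp
  have \<psi>0: "\<psi> x = 0" if "x < 0" for x using that by (simp add: \<psi>_def)
  have int: "(LINT x|lborel. \<psi> x * of_real (exp (- x) ^ n)) = 0" for n
  proof -
    have "cin v (ex (of_nat (Suc n) * \<i>)) = (LINT x|lborel. rep v x * cnj (indicator {0..} x * cnj (exp (\<i> * (of_nat (Suc n) * \<i>) * of_real x))))"
      unfolding ex_def by (rule cin_mk_right[OF sqi_ex]) simp
    also have "\<dots> = (LINT x|lborel. \<psi> x * of_real (exp (- x) ^ n))"
    proof (rule Bochner_Integration.integral_cong[OF HOL.refl])
      fix x :: real
      have "exp (\<i> * (of_nat (Suc n) * \<i>) * of_real x) = exp (\<i> * \<i> * of_real x) * of_real (exp (- x) ^ n)"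
      proof -
        have "complex_of_real (exp (- x) ^ n) = exp (of_nat n * (- of_real x))"
          by (simp add: exp_of_nat_mult exp_of_real flip: of_real_minus)
        then show ?thesis by (simp add: exp_add[symmetric] algebra_simps)
      qed
      then show "rep v x * cnj (indicator {0..} x * cnj (exp (\<i> * (of_nat (Suc n) * \<i>) * of_real x))) = \<psi> x * of_real (exp (- x) ^ n)"
        by (simp add: \<psi>_def indicator_def)
    qed
    finally show ?thesis using orth[of "of_nat (Suc n) * \<i>"] by simp
  qed
  have ii: "integrable lborel (\<lambda>x. \<psi> x * of_real (exp (- x) ^ n))" for n
  proof (rule Bochner_Integration.integrable_bound[OF \<psi>i])
    show "(\<lambda>x. \<psi> x * of_real (exp (- x) ^ n)) \<in> borel_measurable lborel"
      using borel_measurable_integrable[OF \<psi>i] by measurable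
    show "AE x in lborel. norm (\<psi> x * of_real (exp (- x) ^ n)) \<le> norm (\<psi> x)"
    proof (rule AE_I2)
      fix x show "norm (\<psi> x * of_real (exp (- x) ^ n)) \<le> norm (\<psi> x)"
      proof (cases "x < 0")
        case False
        then have "\<bar>exp (- x) ^ n\<bar> \<le> 1" by (simp add: power_le_one)
        then have "cmod (\<psi> x) * \<bar>exp (- x) ^ n\<bar> \<le> cmod (\<psi> x) * 1" by (rule mult_left_mono) simp
        then show ?thesis by (simp only: norm_mult norm_of_real mult_1_right)
      qed (simp add: \<psi>0)
    qed
  qed
  have R: "(LINT x|lborel. Re (\<psi> x) * exp (- x) ^ n) = 0" and I: "(LINT x|lborel. Im (\<psi> x) * exp (- x) ^ n) = 0" for n
  proof -
    have ri: "Re (z * of_real a) = Re z * a" "Im (z * of_real a) = Im z * a" for z a by simp_all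
    show "(LINT x|lborel. Re (\<psi> x) * exp (- x) ^ n) = 0" "(LINT x|lborel. Im (\<psi> x) * exp (- x) ^ n) = 0"
      using integral_Re[OF ii[of n], symmetric] integral_Im[OF ii[of n], symmetric] unfolding int[of n] ri by (simp_all only: zero_complex.sel)
  qed
  have "AE x in lborel. Re (\<psi> x) = 0"
    by (rule exp_neg_orthogonal_zero[OF integrable_Re[OF \<psi>i] _ R]) (simp add: \<psi>0)
  moreover have "AE x in lborel. Im (\<psi> x) = 0"
    by (rule exp_neg_orthogonal_zero[OF integrable_Im[OF \<psi>i] _ I]) (simp add: \<psi>0)
  ultimately have "AE x in lborel. \<psi> x = 0" by eventually_elim (simp add: complex_eq_iff)
  moreover have "AE x in lborel. x \<notin> {0..} \<longrightarrow> rep v x = 0" by (rule cut_eq_selfD[OF _ v]) simp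
  ultimately have "AE x in lborel. rep v x = rep 0 x"
    using rep_zero by eventually_elim (auto simp: \<psi>_def indicator_def split: if_splits)
  then show ?thesis by (rule ltwo_eqI)
qed

text \<open>Representing the functional induced by \<open>u\<close> itself gives some
  \<open>k\<close> in the closure with the same pairings, and totality forces \<open>k = u\<close>.
  The first components of \<open>ex_span\<close> do not depend on the function, so the closure is
  the same for every \<open>f\<close>.\<close>

lemma ex_span_dense:
  assumes u: "cut {0..} u = u" shows "u \<in> closure (fst ` ex_span f)"
proof -
  have "2 * Re (\<Sum>l\<in>\<Lambda>. cnj (c l) * cin u (ex l)) - (norm (\<Sum>l\<in>\<Lambda>. c l \<cdot> ex l))\<^sup>2 \<le> (norm u)\<^sup>2" for \<Lambda> c
  proof -
    define U where "U = (\<Sum>l\<in>\<Lambda>. c l \<cdot> ex l)"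
    have "(\<Sum>l\<in>\<Lambda>. cnj (c l) * cin u (ex l)) = cin u U" by (simp add: U_def cin_sum_right cin_cscale_right)
    moreover have "0 \<le> (norm (u - U))\<^sup>2" by simp
    moreover have "(norm (u - U))\<^sup>2 = (norm u)\<^sup>2 - 2 * inner u U + (norm U)\<^sup>2"
      unfolding power2_norm_eq_inner by (simp add: inner_diff_left inner_diff_right inner_commute)
    ultimately show ?thesis by (simp add: U_def[symmetric] inner_ltwo_def)
  qed
  from ex_Riesz[of "\<lambda>l. cin u (ex l)", OF this]
  obtain k where k: "\<And>l. Im l > 0 \<Longrightarrow> cin k (ex l) = cin u (ex l)" "k \<in> closure (fst ` ex_span (\<lambda>l. cin u (ex l)))" by blast
  have "u - k = 0"
    by (rule ex_orthogonal_zero) (simp_all add: cut_diff u cut_closure_ex_span[OF k(2)] cin_diff_left k(1))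
  moreover have "fst ` ex_span (\<lambda>l. cin u (ex l)) = fst ` ex_span f"
    unfolding ex_span_def by (auto simp: image_iff) blast+
  ultimately show ?thesis using k(2) by simp
qed

section \<open>The variational inequality for the convolution kernel\<close>

lemma measurable_cin_shift [measurable]: "(\<lambda>t. cin u (shift t k)) \<in> borel_measurable borel"
proof -
  have "cin u (shift t k) = (LINT x|lborel. rep u x * cnj (rep k (x - t)))" for t
    unfolding shift_def by (rule cin_mk_right[OF sqi_shift[OF sqi_rep]])
  then show ?thesis by simp
qed

lemma cin_shift_bound: "cmod (cin u (shift t k)) \<le> norm u * norm k"
  using norm_cin_le[of u "shift t k"] by simp

lemma cut_shift_ge:
  assumes "cut {0..} k = k" "s \<le> t" shows "cut {s..} (shift t k) = shift t k"
proof -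
  have "shift t k = shift t (cut {0..} k)" by (simp add: assms(1))
  also have "\<dots> = cut ((\<lambda>x. x - t) -` {0..}) (shift t k)" by (rule shift_cut) simp
  also have "(\<lambda>x. x - t) -` {0..} = {t..}" by auto
  finally have e: "shift t k = cut {t..} (shift t k)" .
  have "cut {s..} (shift t k) = cut {s..} (cut {t..} (shift t k))" using e by simp
  also have "\<dots> = cut ({s..} \<inter> {t..}) (shift t k)" by (rule cut_cut) simp_all
  also have "{s..} \<inter> {t..} = {t..}" using assms(2) by auto
  finally show ?thesis using e by simp
qed

text \<open>For \<open>u\<close> supported in \<open>[0,\<rho>]\<close> this is the squared norm of the adjoint of truncated convolution with \<open>k\<close>, applied to \<open>u\<close>.\<close>

definition corr :: "ltwo \<Rightarrow> real \<Rightarrow> ltwo \<Rightarrow> real" where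
  "corr k \<rho> u = (LINT t|lborel. indicator {0..\<rho>} t * (cmod (cin u (shift t k)))\<^sup>2)"

lemma corr_integrable: "integrable lborel (\<lambda>t. indicator {a..b} t * (cmod (cin u (shift t k)))\<^sup>2)"
proof (rule Bochner_Integration.integrable_bound)
  show "integrable lborel (\<lambda>t. (norm u * norm k)\<^sup>2 * indicat_real {a..b} t)" by (rule integrable_mult_right) simp
  show "AE t in lborel. norm (indicator {a..b} t * (cmod (cin u (shift t k)))\<^sup>2) \<le> norm ((norm u * norm k)\<^sup>2 * indicat_real {a..b} t)"
    by (rule AE_I2) (auto simp: indicator_def intro!: power_mono cin_shift_bound)
qed measurable

text \<open>A backward translate of \<open>ex l\<close>, cut back to the half-line, is a multiple of
  \<open>ex l\<close>. So exponentials are eigenvectors of the adjoint of convolution with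
  \<open>k\<close>, with eigenvalue \<open>cnj (cin k (ex l))\<close>.\<close>

lemma cin_ex_shift:
  assumes k: "cut {0..} k = k" and l: "Im l > 0" and t: "t \<ge> 0"
  shows "cin (ex l) (shift t k) = cnj (exp (\<i> * l * of_real t)) * cnj (cin k (ex l))"
proof -
  have "cut {0..} (shift (- t) (ex l)) = cnj (exp (\<i> * l * of_real t)) \<cdot> ex l"
  proof (rule ltwo_eqI)
    show "AE x in lborel. rep (cut {0..} (shift (- t) (ex l))) x = rep (cnj (exp (\<i> * l * of_real t)) \<cdot> ex l) x"
      using rep_cut[of "{0..}" "shift (- t) (ex l)", simplified] rep_shift[of "- t" "ex l"] AE_lborel_shift[OF rep_ex[OF l], of "- t"]
        rep_ex[OF l] rep_cscale[of "cnj (exp (\<i> * l * of_real t))" "ex l"]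
    proof eventually_elim
      case (elim x)
      have "exp (\<i> * l * of_real (x + t)) = exp (\<i> * l * of_real t) * exp (\<i> * l * of_real x)"
        by (simp add: exp_add[symmetric] algebra_simps)
      then show ?case using elim t by (simp add: indicator_def)
    qed
  qed
  then have "cin (shift (- t) (ex l)) (cut {0..} k) = cnj (exp (\<i> * l * of_real t)) * cin (ex l) k"
    by (simp add: cin_cut[symmetric] cin_cscale_left)
  then show ?thesis by (simp add: cin_shift_right k cnj_cin)
qed

text \<open>On the span the eigenvector relation identifies \<open>corr k \<rho> U\<close> with the
  squared norm of a truncation of the last sum in \<open>schur_bound\<close>. Density extends the
  inequality; the truncation to [0,\<rho>] provides the integrable majorant for that limit.\<close>

lemma star_ineq:
  assumes f: "schur_bound M f" and k: "cut {0..} k = k" "\<And>l. Im l > 0 \<Longrightarrow> cin k (ex l) = f l"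
    and u: "cut {0..} u = u"
  shows "2 * inner k u - (norm u)\<^sup>2 + corr k \<rho> u \<le> M"
proof -
  have span: "2 * inner k U - (norm U)\<^sup>2 + corr k \<rho> U \<le> M" if US: "U \<in> fst ` ex_span f" for U
  proof -
    obtain \<Lambda> c where U: "U = (\<Sum>l\<in>\<Lambda>. c l \<cdot> ex l)" and \<Lambda>: "finite \<Lambda>" "\<forall>l\<in>\<Lambda>. Im l > 0"
      using US unfolding ex_span_def by auto
    define V where "V = (\<Sum>l\<in>\<Lambda>. (c l * cnj (f l)) \<cdot> ex l)"
    have "cin k U = (\<Sum>l\<in>\<Lambda>. cnj (c l) * f l)"
      unfolding U cin_sum_right cin_cscale_right using \<Lambda> k(2) by (intro sum.cong) auto
    then have lin: "inner k U = Re (\<Sum>l\<in>\<Lambda>. cnj (c l) * f l)" by (simp add: inner_ltwo_def)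
    have Vrep: "AE t in lborel. rep V t = (\<Sum>l\<in>\<Lambda>. (c l * cnj (f l)) * (indicator {0..} t * cnj (exp (\<i> * l * of_real t))))"
      unfolding V_def using \<Lambda>
    proof (induction \<Lambda> rule: finite_induct)
      case empty show ?case using rep_zero by simp
    next
      case (insert l \<Lambda>)
      have l: "Im l > 0" and IH: "AE t in lborel. rep (\<Sum>l\<in>\<Lambda>. (c l * cnj (f l)) \<cdot> ex l) t = (\<Sum>l\<in>\<Lambda>. (c l * cnj (f l)) * (indicator {0..} t * cnj (exp (\<i> * l * of_real t))))"
        using insert by auto
      show ?case
        unfolding sum.insert[OF insert.hyps]
        using IH rep_plus[of "(c l * cnj (f l)) \<cdot> ex l" "\<Sum>l\<in>\<Lambda>. (c l * cnj (f l)) \<cdot> ex l"] rep_cscale[of "c l * cnj (f l)" "ex l"] rep_ex[OF l]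
        by eventually_elim simp
    qed
    have "cin U (shift t k) = (\<Sum>l\<in>\<Lambda>. (c l * cnj (f l)) * (indicator {0..} t * cnj (exp (\<i> * l * of_real t))))" if "t \<ge> 0" for t
      unfolding U cin_sum_left cin_cscale_left using \<Lambda> that
      by (intro sum.cong HOL.refl) (simp add: cin_ex_shift[OF k(1)] k(2))
    with Vrep have "AE t in lborel. indicator {0..\<rho>} t * (cmod (cin U (shift t k)))\<^sup>2 = indicator {0..\<rho>} t * (cmod (rep V t))\<^sup>2"
      by (auto elim!: eventually_mono simp: indicator_def)
    then have "corr k \<rho> U = (norm (cut {0..\<rho>} V))\<^sup>2"
      unfolding corr_def norm_cut_sq[of "{0..\<rho>}" V, simplified] by (intro integral_cong_AE) measurable
    also have "\<dots> \<le> (norm V)\<^sup>2" by (intro power_mono norm_cut_le) simp_all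
    finally have "corr k \<rho> U \<le> (norm V)\<^sup>2" .
    moreover have "2 * Re (\<Sum>l\<in>\<Lambda>. cnj (c l) * f l) - (norm U)\<^sup>2 + (norm V)\<^sup>2 \<le> M"
      using f \<Lambda> unfolding schur_bound_def U V_def by blast
    ultimately show ?thesis unfolding lin by linarith
  qed
  obtain v where v: "\<And>n. v n \<in> fst ` ex_span f" "v \<longlonglongrightarrow> u"
    using ex_span_dense[OF u, of f] unfolding closure_sequential by blast
  show ?thesis
  proof (rule LIMSEQ_le_const2)
    obtain B where B: "\<And>n. norm (v n) \<le> B" using convergent_imp_Bseq[OF convergentI[OF v(2)]] by (auto simp: Bseq_def)
    have ptw: "(\<lambda>n. cin (v n) (shift t k)) \<longlonglongrightarrow> cin u (shift t k)" for t
    proof (rule LIM_zero_cancel, rule Lim_null_comparison)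
      show "\<forall>\<^sub>F n in sequentially. norm (cin (v n) (shift t k) - cin u (shift t k)) \<le> norm (v n - u) * norm k"
        using cin_shift_bound[of "v _ - u" t k] by (simp add: cin_diff_left)
      have "(\<lambda>n. norm (v n - u) * norm k) \<longlonglongrightarrow> norm (u - u) * norm k"
        by (intro tendsto_mult tendsto_norm tendsto_diff v(2) tendsto_const)
      then show "(\<lambda>n. norm (v n - u) * norm k) \<longlonglongrightarrow> 0" by simp
    qed
    have "(\<lambda>n. corr k \<rho> (v n)) \<longlonglongrightarrow> corr k \<rho> u"
      unfolding corr_def
    proof (rule integral_dominated_convergence)
      show "integrable lborel (\<lambda>t. (B * norm k)\<^sup>2 * indicat_real {0..\<rho>} t)" by (rule integrable_mult_right) simp
      show "AE t in lborel. (\<lambda>n. indicator {0..\<rho>} t * (cmod (cin (v n) (shift t k)))\<^sup>2) \<longlonglongrightarrow> indicator {0..\<rho>} t * (cmod (cin u (shift t k)))\<^sup>2"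
        by (intro AE_I2 tendsto_mult tendsto_const tendsto_power tendsto_norm ptw)
      show "AE t in lborel. norm (indicator {0..\<rho>} t * (cmod (cin (v n) (shift t k)))\<^sup>2) \<le> (B * norm k)\<^sup>2 * indicat_real {0..\<rho>} t" for n
      proof (rule AE_I2)
        fix t
        have "cmod (cin (v n) (shift t k)) \<le> B * norm k"
          by (rule order_trans[OF cin_shift_bound mult_right_mono[OF B]]) simp
        then show "norm (indicator {0..\<rho>} t * (cmod (cin (v n) (shift t k)))\<^sup>2) \<le> (B * norm k)\<^sup>2 * indicat_real {0..\<rho>} t"
          by (auto simp: indicator_def power_mono)
      qed
    qed measurable
    then show "(\<lambda>n. 2 * inner k (v n) - (norm (v n))\<^sup>2 + corr k \<rho> (v n)) \<longlonglongrightarrow> 2 * inner k u - (norm u)\<^sup>2 + corr k \<rho> u"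
      by (intro tendsto_add tendsto_diff tendsto_mult tendsto_inner tendsto_power tendsto_norm v(2) tendsto_const)
    show "\<exists>N. \<forall>n\<ge>N. 2 * inner k (v n) - (norm (v n))\<^sup>2 + corr k \<rho> (v n) \<le> M" using span[OF v(1)] by blast
  qed
qed

section \<open>Quantitative contractivity of convolution with k\<close>

locale inverse_schur =
  fixes k :: ltwo and M :: real
  assumes k_supp: "cut {0..} k = k"
    and SI: "\<And>u \<rho>. cut {0..} u = u \<Longrightarrow> 2 * inner k u - (norm u)\<^sup>2 + corr k \<rho> u \<le> M"
begin

lemma M_nonneg: "M \<ge> 0"
  using SI[of 0 0] by (simp add: corr_def)

lemma corr_cscale: "corr k \<rho> (z \<cdot> u) = (cmod z)\<^sup>2 * corr k \<rho> u"
proof -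
  have "corr k \<rho> (z \<cdot> u) = (LINT t|lborel. (cmod z)\<^sup>2 * (indicator {0..\<rho>} t * (cmod (cin u (shift t k)))\<^sup>2))"
    unfolding corr_def by (rule Bochner_Integration.integral_cong) (auto simp: cin_cscale_left norm_mult power_mult_distrib)
  then show ?thesis by (simp add: corr_def)
qed

text \<open>The inequality \<open>SI\<close> is not homogeneous. Inserting the multiples
  \<open>of_real s * cin k u\<close> of \<open>u\<close> and optimising over \<open>s\<close>, with
  optimum \<open>1 / B\<close>, gives its homogeneous form.\<close>

lemma cin_k_le:
  assumes u: "cut {0..} u = u" shows "(cmod (cin k u))\<^sup>2 \<le> M * ((norm u)\<^sup>2 - corr k \<rho> u)"
proof -
  define a where "a = (cmod (cin k u))\<^sup>2"
  define B where "B = (norm u)\<^sup>2 - corr k \<rho> u"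
  have *: "2 * s * a - s\<^sup>2 * a * B \<le> M" for s
  proof -
    define z where "z = of_real s * cin k u"
    have "2 * inner k (z \<cdot> u) - (norm (z \<cdot> u))\<^sup>2 + corr k \<rho> (z \<cdot> u) \<le> M"
      by (rule SI) (simp add: cut_cscale u)
    moreover have "inner k (z \<cdot> u) = s * a"
    proof -
      have "cin k (z \<cdot> u) = of_real s * (cin k u * cnj (cin k u))" by (simp add: cin_cscale_right z_def)
      also have "\<dots> = of_real (s * a)" by (simp add: a_def complex_norm_square[symmetric])
      finally show ?thesis by (simp add: inner_ltwo_def)
    qed
    moreover have "(cmod z)\<^sup>2 = s\<^sup>2 * a" by (simp add: z_def norm_mult power_mult_distrib a_def)
    ultimately show ?thesis by (simp add: norm_cscale power_mult_distrib corr_cscale B_def algebra_simps)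
  qed
  have **: "- (s\<^sup>2) * B + 2 * s * inner k u \<le> M" for s
  proof -
    have "2 * inner k (of_real s \<cdot> u) - (norm (of_real s \<cdot> u))\<^sup>2 + corr k \<rho> (of_real s \<cdot> u) \<le> M"
      by (rule SI) (simp add: cut_cscale u)
    then show ?thesis by (simp add: inner_ltwo_def cin_cscale_right norm_cscale power_mult_distrib corr_cscale B_def algebra_simps)
  qed
  \<comment> \<open>If \<open>B\<close> were negative, the quadratic part would grow without bound
    along multiples of \<open>u\<close>; averaging over \<open>s\<close> and \<open>- s\<close>
    removes the linear term.\<close>
  have B0: "B \<ge> 0"
  proof (rule ccontr)
    assume "\<not> B \<ge> 0"
    then have B: "B < 0" by simp
    have le: "s\<^sup>2 * (- B) \<le> M" for s
    proof -
      have "2 * (s\<^sup>2 * (- B)) = (- (s\<^sup>2) * B + 2 * s * inner k u) + (- ((- s)\<^sup>2) * B + 2 * (- s) * inner k u)" by simp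
      then show ?thesis using **[of s] **[of "- s"] by linarith
    qed
    have "(sqrt ((M + 1) / (- B)))\<^sup>2 = (M + 1) / (- B)" using B M_nonneg by (intro real_sqrt_pow2) (auto simp: field_simps)
    then have "(sqrt ((M + 1) / (- B)))\<^sup>2 * (- B) = M + 1" using B by simp
    then show False using le[of "sqrt ((M + 1) / (- B))"] by linarith
  qed
  have a0: "a \<ge> 0" by (simp add: a_def)
  show ?thesis
  proof (cases "B = 0")
    case True
    have "a = 0"
    proof (rule ccontr)
      assume "a \<noteq> 0"
      then have "2 * ((M + 1) / a) * a = 2 * (M + 1)" by simp
      then show False using *[of "(M + 1) / a"] True M_nonneg by simp
    qed
    then show ?thesis using True by (simp add: a_def B_def)
  next
    case False
    then have B: "B > 0" using B0 by simp
    have "2 * (1 / B) * a - (1 / B)\<^sup>2 * a * B = a / B" using B by (simp add: power2_eq_square field_simps)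
    then have "a / B \<le> M" using *[of "1 / B"] by simp
    then show ?thesis using B by (simp add: a_def B_def divide_le_eq)
  qed
qed

end

context inverse_schur
begin

lemma corr_le: assumes "cut {0..} u = u" shows "corr k \<rho> u \<le> (norm u)\<^sup>2"
proof (cases "M = 0")
  case True
  have "inner k u = 0" if "cut {0..} u = u" for u
  proof -
    have "(cmod (cin k u))\<^sup>2 \<le> 0" using cin_k_le[OF that, of 0] True by simp
    then show ?thesis by (simp add: inner_ltwo_def)
  qed
  then show ?thesis using SI[OF assms, of \<rho>] True assms by simp
next
  case False
  then have "M > 0" using M_nonneg by simp
  moreover have "0 \<le> M * ((norm u)\<^sup>2 - corr k \<rho> u)" by (rule order_trans[OF _ cin_k_le[OF assms]]) simp
  ultimately show ?thesis by (simp add: zero_le_mult_iff)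
qed

text \<open>Truncating \<open>u\<close> from the left at \<open>t\<close> and translating back to \<open>0\<close> turns the estimate of \<open>cin k u\<close> into a
  differential inequality in \<open>t\<close> for the energy left after \<open>t\<close>.\<close>

lemma strict:
  assumes r: "r \<ge> 0" and u: "cut {0..r} u = u"
  shows "exp (- M * r) * (norm u)\<^sup>2 \<le> (norm u)\<^sup>2 - corr k r u"
proof -
  define \<phi> where "\<phi> s = (cmod (rep u s))\<^sup>2 - (cmod (cin u (shift s k)))\<^sup>2" for s
  define b where "b t = (norm (cut {t..} u))\<^sup>2 - (LINT s|lborel. indicator {t..r} s * (cmod (cin u (shift s k)))\<^sup>2)" for t
  define \<phi>' where "\<phi>' s = complex_of_real (\<phi> s)" for s
  have pint: "integrable lborel (\<lambda>s. indicator S s * (cmod (rep u s))\<^sup>2)" if "S \<in> sets borel" for S :: "real set"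
    using integrable_mult_indicator[of S lborel "\<lambda>s. (cmod (rep u s))\<^sup>2"] sqi_rep[of u] that by (simp add: sqi_def)
  have u_supp: "AE x in lborel. x \<notin> {0..r} \<longrightarrow> rep u x = 0" by (rule cut_eq_selfD[OF _ u]) simp
  have cut_r: "(norm (cut {t..} u))\<^sup>2 = (LINT s|lborel. indicator {t..r} s * (cmod (rep u s))\<^sup>2)" for t
    unfolding norm_cut_sq[of "{t..}" u, simplified]
    by (rule integral_cong_AE) (use u_supp in \<open>auto elim!: eventually_mono simp: indicator_def\<close>)
  have phi_int: "integrable lborel (\<lambda>s. indicator {a..b} s * \<phi> s)" for a b
    using Bochner_Integration.integrable_diff[OF pint[of "{a..b}"] corr_integrable[of a b u k]] by (simp add: \<phi>_def right_diff_distrib)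
  have b_eq: "b t = (LINT s|lborel. indicator {t..r} s * \<phi> s)" for t
    unfolding b_def cut_r using pint[of "{t..r}"] corr_integrable[of t r u k]
    by (simp add: \<phi>_def right_diff_distrib)
  have set_phi': "set_integrable lborel {0..t} \<phi>'" for t
  proof -
    have "indicat_real {0..t} s *\<^sub>R \<phi>' s = complex_of_real (indicator {0..t} s * \<phi> s)" for s
      by (simp add: \<phi>'_def scaleR_conv_of_real)
    then show ?thesis using integrable_of_real[OF phi_int[of 0 t], where 'a = complex] by (simp only: set_integrable_def)
  qed
  define N where "N t = set_lebesgue_integral lborel {0..t} \<phi>'" for t
  have N_re: "N t = of_real (LINT s|lborel. indicator {0..t} s * \<phi> s)" for t
  proof -
    have "N t = (LINT s|lborel. of_real (indicator {0..t} s * \<phi> s))"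
      unfolding N_def set_lebesgue_integral_def by (rule Bochner_Integration.integral_cong) (auto simp: \<phi>'_def indicator_def)
    then show ?thesis by (simp only: integral_complex_of_real)
  qed
  have split: "of_real (b t) = N r - N t" if t: "t \<in> {0..r}" for t
  proof -
    have "(LINT s|lborel. indicator {0..r} s * \<phi> s) = (LINT s|lborel. indicator {0..t} s * \<phi> s + indicator {t..r} s * \<phi> s)"
      by (rule integral_cong_AE)
         (use AE_lborel_singleton[of t] t in \<open>auto elim!: eventually_mono simp: indicator_def \<phi>_def[abs_def]\<close>)
    also have "\<dots> = (LINT s|lborel. indicator {0..t} s * \<phi> s) + b t"
      unfolding b_eq by (rule Bochner_Integration.integral_add[OF phi_int phi_int])
    finally show ?thesis unfolding N_re by simp
  qed
  have ind: "indef N \<phi>'"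
    by (rule indefI[where c = 0]) (use set_phi' in \<open>simp_all add: N_def\<close>)
  \<comment> \<open>The translate \<open>v\<close> of the part of \<open>u\<close> after
    \<open>t\<close> pairs with translates of \<open>k\<close> exactly as \<open>u\<close> does with
    translates shifted further by \<open>t\<close>, so its deficit in \<open>cin_k_le\<close> is the
    remaining energy \<open>b t\<close>.\<close>
  have gron: "(cmod (cin u (shift t k)))\<^sup>2 \<le> M * b t" if t: "t \<in> {0..r}" for t
  proof -
    define v where "v = shift (- t) (cut {t..} u)"
    have e: "(\<lambda>x. x + t) -` {t..} = {0..}" by auto
    have v: "cut {0..} v = v"
      unfolding v_def using shift_cut[of "{t..}" "- t" "cut {t..} u"] by (simp add: e)
    have cv: "cin v (shift s k) = cin u (shift (t + s) k)" if "s \<ge> 0" for s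
    proof -
      have "cin v (shift s k) = cin (cut {t..} u) (shift t (shift s k))"
        unfolding v_def by (rule cin_shift_right[symmetric])
      also have "\<dots> = cin u (shift (t + s) k)"
        unfolding shift_shift by (subst cin_cut) (simp_all add: cut_shift_ge[OF k_supp] that)
      finally show ?thesis .
    qed
    have "corr k (r - t) v = (LINT s|lborel. indicator {t..r} (t + 1 * s) * (cmod (cin u (shift (t + 1 * s) k)))\<^sup>2)"
      unfolding corr_def by (rule Bochner_Integration.integral_cong) (auto simp: indicator_def cv)
    also have "\<dots> = (LINT s|lborel. indicator {t..r} s * (cmod (cin u (shift s k)))\<^sup>2)"
      by (subst lborel_integral_real_affine[of 1 _ t]) simp_all
    finally have "corr k (r - t) v = \<dots>" .
    moreover have "cin u (shift t k) = cnj (cin k v)"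
    proof -
      have "shift 0 k = k" by (rule ltwo_eqI) (use rep_shift[of 0 k] in \<open>eventually_elim, simp\<close>)
      then show ?thesis using cv[of 0] by (simp add: cnj_cin)
    qed
    ultimately show ?thesis
      using cin_k_le[OF v, of "r - t"] by (simp add: b_def v_def)
  qed
  \<comment> \<open>This is minus the density of \<open>exp (- M * t) * b t\<close>. That function
    vanishes at \<open>r\<close>, so the integral of \<open>\<psi>\<close> over [0,r] is
    \<open>b 0\<close>, the quantity to be bounded below.\<close>
  define \<psi> where "\<psi> s = exp (- M * s) * (M * b s + \<phi> s)" for s
  have prod: "indef (\<lambda>t. exp (of_real (- M) * of_real t) * (N r - N t))
     (\<lambda>s. of_real (- M) * exp (of_real (- M) * of_real s) * (N r - N s) + exp (of_real (- M) * of_real s) * (0 - \<phi>' s))"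
    by (rule indef_mult[OF indef_exp indef_diff[OF indef_const ind]])
  have "0 = N r + set_lebesgue_integral lborel {0..r}
     (\<lambda>s. of_real (- M) * exp (of_real (- M) * of_real s) * (N r - N s) + exp (of_real (- M) * of_real s) * (0 - \<phi>' s))"
    using indef_eq[OF prod r] by (simp add: N_def)
  also have "set_lebesgue_integral lborel {0..r}
     (\<lambda>s. of_real (- M) * exp (of_real (- M) * of_real s) * (N r - N s) + exp (of_real (- M) * of_real s) * (0 - \<phi>' s)) =
     (LINT s|lborel. of_real (- (indicator {0..r} s * \<psi> s)))"
    unfolding set_lebesgue_integral_def
  proof (rule Bochner_Integration.integral_cong[OF HOL.refl])
    fix s
    show "indicat_real {0..r} s *\<^sub>R (of_real (- M) * exp (of_real (- M) * of_real s) * (N r - N s) + exp (of_real (- M) * of_real s) * (0 - \<phi>' s)) =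
      complex_of_real (- (indicator {0..r} s * \<psi> s))"
    proof (cases "s \<in> {0..r}")
      case True
      have x: "exp (complex_of_real (- M) * of_real s) = of_real (exp (- M * s))" by (simp add: exp_of_real[symmetric])
      show ?thesis unfolding x split[OF True, symmetric] \<phi>'_def \<psi>_def using True by (simp add: algebra_simps)
    qed simp
  qed
  also have "\<dots> = of_real (- (LINT s|lborel. indicator {0..r} s * \<psi> s))" by (simp only: integral_complex_of_real Bochner_Integration.integral_minus)
  finally have N_psi: "N r = of_real (LINT s|lborel. indicator {0..r} s * \<psi> s)" by simp
  have psi_int: "integrable lborel (\<lambda>s. indicator {0..r} s * \<psi> s)"
  proof -
    have "set_integrable lborel {0..r} (\<lambda>s. of_real (- M) * exp (of_real (- M) * of_real s) * (N r - N s) + exp (of_real (- M) * of_real s) * (0 - \<phi>' s))"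
      by (rule indef_int[OF prod r])
    then have "integrable lborel (\<lambda>s. Re (indicat_real {0..r} s *\<^sub>R (of_real (- M) * exp (of_real (- M) * of_real s) * (N r - N s) + exp (of_real (- M) * of_real s) * (0 - \<phi>' s))))"
      unfolding set_integrable_def by (rule integrable_Re)
    moreover have "Re (indicat_real {0..r} s *\<^sub>R (of_real (- M) * exp (of_real (- M) * of_real s) * (N r - N s) + exp (of_real (- M) * of_real s) * (0 - \<phi>' s))) = - (indicator {0..r} s * \<psi> s)" for s
    proof (cases "s \<in> {0..r}")
      case True
      have x: "exp (complex_of_real (- M) * of_real s) = of_real (exp (- M * s))" by (simp add: exp_of_real[symmetric])
      show ?thesis unfolding x split[OF True, symmetric] \<phi>'_def \<psi>_def using True by (simp add: algebra_simps)
    qed simp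
    ultimately show ?thesis by (simp only:) (use integrable_minus in fastforce)
  qed
  have "exp (- M * r) * (norm u)\<^sup>2 = exp (- M * r) * (LINT s|lborel. indicator {0..r} s * (cmod (rep u s))\<^sup>2)"
    using norm_cut_sq[of "{0..r}" u] u by simp
  also have "\<dots> = (LINT s|lborel. exp (- M * r) * (indicator {0..r} s * (cmod (rep u s))\<^sup>2))" by simp
  also have "\<dots> \<le> (LINT s|lborel. indicator {0..r} s * \<psi> s)"
  proof (rule integral_mono[OF integrable_mult_right[OF pint] psi_int])
    fix s
    show "exp (- M * r) * (indicator {0..r} s * (cmod (rep u s))\<^sup>2) \<le> indicator {0..r} s * \<psi> s"
    proof (cases "s \<in> {0..r}")
      case True
      then have "- M * r \<le> - M * s" using M_nonneg by (simp add: mult_left_mono)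
      then have "exp (- M * r) * (cmod (rep u s))\<^sup>2 \<le> exp (- M * s) * (cmod (rep u s))\<^sup>2" by (intro mult_right_mono) simp_all
      \<comment> \<open>The Gronwall term \<open>M * b s\<close> absorbs the negative part of
        \<open>\<phi> s\<close>, leaving at least the squared modulus of \<open>u\<close>.\<close>
      also have "\<dots> \<le> \<psi> s" unfolding \<psi>_def \<phi>_def using gron[OF True] by (intro mult_left_mono) simp_all
      finally show ?thesis using True by simp
    qed simp
  qed simp
  also have "\<dots> = b 0"
  proof -
    have "complex_of_real (b 0) = of_real (LINT s|lborel. indicator {0..r} s * \<psi> s)"
      using split[of 0] r N_psi by (simp add: N_def)
    then show ?thesis by (simp only: of_real_eq_iff)
  qed
  also have "b 0 = (norm u)\<^sup>2 - corr k r u"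
  proof -
    have "(norm (cut {0..} u))\<^sup>2 = (norm (cut {0..r} u))\<^sup>2" unfolding cut_r norm_cut_sq[of "{0..r}" u, simplified] ..
    then show ?thesis by (simp add: b_def corr_def u)
  qed
  finally show ?thesis .
qed

end

section \<open>Causality and reversal of truncated convolutions\<close>

lemma star_star [simp]: "star (star m) = m"
proof (rule ltwo_eqI)
  show "AE x in lborel. rep (star (star m)) x = rep m x"
    using rep_star[of "star m"] AE_lborel_reflect[OF rep_star[of m], of 0] by eventually_elim simp
qed

lemma refl_row_star: "refl r (row (star m) r x) = row m r (r - x)"
proof (rule ltwo_eqI)
  show "AE t in lborel. rep (refl r (row (star m) r x)) t = rep (row m r (r - x)) t"
    using rep_refl[of r "shift x m"] AE_lborel_reflect[OF rep_shift[of x m], of r] rep_row[of m r "r - x"]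
    unfolding row_star refl_cut by eventually_elim (simp add: algebra_simps)
qed

text \<open>Reversing both variables replaces \<open>x - t\<close> by \<open>t - x\<close>, and with
  the conjugation this is the adjoint kernel.\<close>

lemma refl_conv: "refl r (conv m r u) = conv (star m) r (refl r u)"
proof (rule ltwo_eqI)
  have e: "cin (refl r u) (row (star m) r x) = cnj (cin u (row m r (r - x)))" for x
    by (simp add: cin_refl[of r u] refl_row_star cnj_cin)
  show "AE x in lborel. rep (refl r (conv m r u)) x = rep (conv (star m) r (refl r u)) x"
    using rep_refl[of r "conv m r u"] AE_lborel_reflect[OF rep_conv[of m r u], of r] rep_conv[of "star m" r "refl r u"]
    by eventually_elim (simp add: indicator_def e)
qed

text \<open>A kernel supported on the half-line does not reach beyond \<open>x\<close>, so the row
  at \<open>x\<close> no longer depends on \<open>R\<close>.\<close>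

lemma row_causal:
  assumes k: "cut {0..} k = k" and x: "x \<le> R" shows "row k R x = refl x k"
proof (rule ltwo_eqI)
  have "AE t in lborel. t \<notin> {0..} \<longrightarrow> rep k t = 0" by (rule cut_eq_selfD[OF _ k]) simp
  from AE_lborel_reflect[OF this, of x] rep_row[of k R x] rep_refl[of x k]
  show "AE t in lborel. rep (row k R x) t = rep (refl x k) t"
    by eventually_elim (use x in \<open>auto simp: indicator_def\<close>)
qed

lemma cut_conv_causal:
  assumes k: "cut {0..} k = k" and r: "r \<le> R" shows "cut {0..r} (conv k R u) = conv k r u"
proof (rule ltwo_eqI)
  show "AE x in lborel. rep (cut {0..r} (conv k R u)) x = rep (conv k r u) x"
    using rep_cut[of "{0..r}" "conv k R u", simplified] rep_conv[of k R u] rep_conv[of k r u]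
    by eventually_elim (use r in \<open>auto simp: indicator_def row_causal[OF k]\<close>)
qed

lemma cin_shift_disjoint:
  assumes k: "cut {0..} k = k" and u: "cut {0..r} u = u" and x: "x > r" shows "cin u (shift x k) = 0"
proof -
  have "{0..r} \<inter> {x..} = {}" using x by auto
  have "cin u (shift x k) = cin (cut {0..r} u) (cut {x..} (shift x k))" by (simp add: u cut_shift_ge[OF k])
  also have "\<dots> = cin u (cut ({0..r} \<inter> {x..}) (shift x k))" by (simp add: cin_cut cut_cut)
  also have "cut ({0..r} \<inter> {x..}) (shift x k) = 0"
    unfolding \<open>{0..r} \<inter> {x..} = {}\<close> by (rule ltwo_eqI) (use rep_cut[of "{}" "shift x k", simplified] rep_zero in eventually_elim, simp)
  finally show ?thesis by simp
qed

lemma rep_conv_star: "AE x in lborel. rep (conv (star k) R u) x = indicator {0..R} x * cin (cut {0..R} u) (shift x k)"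
  using rep_conv[of "star k" R u] by eventually_elim (simp add: row_star cin_cut)

text \<open>The adjoint looks only to the right, so its values beyond the support of
  \<open>u\<close> vanish. With \<open>cut_conv_causal\<close> this makes the compression of
  \<open>T R\<close> times its adjoint to [0,r] equal to \<open>T r\<close> times its adjoint, and
  one chain on [0,R] covers all shorter intervals.\<close>

lemma conv_star_causal:
  assumes k: "cut {0..} k = k" and r: "r \<le> R" and u: "cut {0..r} u = u"
  shows "conv (star k) R u = conv (star k) r u"
proof (rule ltwo_eqI)
  have "cut {0..R} u = cut {0..R} (cut {0..r} u)" by (simp add: u)
  also have "\<dots> = u" using r u by (subst cut_cut) (simp_all add: Int_absorb1)
  finally have uR: "cut {0..R} u = u" .
  show "AE x in lborel. rep (conv (star k) R u) x = rep (conv (star k) r u) x"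
    using rep_conv_star[of k R u] rep_conv_star[of k r u]
    unfolding uR u by eventually_elim (use r in \<open>auto simp: indicator_def cin_shift_disjoint[OF k u]\<close>)
qed

lemma norm_conv_star: assumes "cut {0..R} u = u" shows "(norm (conv (star k) R u))\<^sup>2 = corr k R u"
proof -
  have "cin u (row (star k) R x) = cin u (shift x k)" for x
    unfolding row_star using cin_cut[of "{0..R}" u "shift x k"] assms by simp
  then show ?thesis unfolding norm_conv_sq corr_def by simp
qed

lemma cin_conv_star: "cin (conv (star m) R u) v = cin u (conv m R v)"
  using cin_conv[of "star m" R u v] by simp

context inverse_schur
begin

abbreviation T :: "real \<Rightarrow> ltwo \<Rightarrow> ltwo" where "T \<equiv> conv k"
abbreviation T' :: "real \<Rightarrow> ltwo \<Rightarrow> ltwo" where "T' \<equiv> conv (star k)"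

text \<open>The coercivity constant comes from \<open>strict\<close>. Rows of the composed operator
  are images under \<open>T R\<close> of rows of \<open>k\<close>, bounded by the operator bound of
  \<open>norm_conv_le\<close>.\<close>

lemma chain_T:
  assumes R: "R \<ge> 0"
  shows "chain R (\<lambda>u. - T R (T' R u)) (\<lambda>x. - T R (row k R x)) (exp (- M * R)) (norm k * (sqrt \<bar>R\<bar> * norm k))"
proof (rule chain.intro)
  show "bounded_linear (\<lambda>u. - T R (T' R u))"
    by (rule bounded_linear_minus[OF bounded_linear_compose[OF bounded_linear_conv bounded_linear_conv]])
  show "cin (- T R (T' R u)) v = cin u (- T R (T' R v))" for u v
    by (simp add: cin_minus_left cin_minus_right cin_conv cin_conv_star)
  show "AE x in lborel. x \<in> {0..R} \<longrightarrow> rep (- T R (T' R u)) x = cin u (- T R (row k R x))" for u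
    using rep_uminus[of "T R (T' R u)"] rep_conv[of k R "T' R u"]
    by eventually_elim (simp add: cin_minus_right cin_conv_star)
  show "norm (- T R (row k R x)) \<le> norm k * (sqrt \<bar>R\<bar> * norm k)" for x
    unfolding norm_minus_cancel
    by (rule order_trans[OF norm_conv_le mult_right_mono[OF norm_row_le]]) simp
  have "cin u (- T R (row k R x)) = - cin (T' R u) (row k R x)" for u x
    by (simp add: cin_minus_right cin_conv_star)
  then show "(\<lambda>x. cin u (- T R (row k R x))) \<in> borel_measurable borel" for u by simp
  show "exp (- M * R) * (norm u)\<^sup>2 \<le> inner (u + - T R (T' R u)) u" if u: "cut {0..R} u = u" for u
  proof -
    have "inner (u + - T R (T' R u)) u = (norm u)\<^sup>2 - (norm (T' R u))\<^sup>2"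
      by (simp add: inner_ltwo_def cin_diff_left cin_conv cin_self_norm)
    then show ?thesis using strict[OF R u] norm_conv_star[OF u, of k] by simp
  qed
qed simp_all

text \<open>With \<open>T = T r\<close>, the function \<open>eta r\<close> is \<open>(I - T T\<^sup>*)\<close> inverse applied to \<open>k\<close> on \<open>[0,r]\<close>. Paired with exponentials, \<open>eta r\<close> and
  \<open>alpha r\<close> turn out to be the second row of the Krein solution.\<close>

definition eta :: "real \<Rightarrow> ltwo" where
  "eta r = (SOME a. cut {0..r} a = a \<and> a - T r (T' r a) = cut {0..r} k)"

definition alpha :: "real \<Rightarrow> ltwo" where "alpha r = T' r (eta r)"

text \<open>On (0,R] this is minus the diagonal residual \<open>D k\<close> of the chain on [0,R]
  (\<open>D_k\<close>), written without reference to \<open>R\<close> so that all intervals share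
  one coefficient.\<close>

definition coeff :: "real \<Rightarrow> complex" where
  "coeff x = (if x > 0 then - (rep k x + cin k (refl x (alpha x))) else 0)"

end

locale inverse_schur_at = inverse_schur +
  fixes R :: real assumes R_pos: "R > 0"
begin

sublocale chain R "\<lambda>u. - T R (T' R u)" "\<lambda>x. - T R (row k R x)" "exp (- M * R)" "norm k * (sqrt \<bar>R\<bar> * norm k)"
  by (rule chain_T) (use R_pos in simp)

lemma sol_of_iff:
  assumes "r \<le> R"
  shows "sol_of h r a \<longleftrightarrow> cut {0..r} a = a \<and> a - T r (T' r a) = cut {0..r} h"
proof -
  have "cut {0..r} (a + - T R (T' R a)) = a - T r (T' r a)" if a: "cut {0..r} a = a"
    using conv_star_causal[OF k_supp assms a] cut_conv_causal[OF k_supp assms]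
    by (simp add: cut_diff a)
  then show ?thesis unfolding sol_of_def by auto
qed

lemma sol_k: assumes "r \<le> R" shows "sol k r = eta r"
proof -
  have "cut {0..r} (sol k r) = sol k r \<and> sol k r - T r (T' r (sol k r)) = cut {0..r} k"
    using sol[OF assms, of k] sol_of_iff[OF assms, of k "sol k r"] unfolding sol_of_def by blast
  then have "cut {0..r} (eta r) = eta r \<and> eta r - T r (T' r (eta r)) = cut {0..r} k"
    unfolding eta_def by (rule someI)
  then show ?thesis using sol_unique[OF assms] sol_of_iff[OF assms] by simp
qed

lemma eta_at: assumes "r \<le> R" shows "cut {0..r} (eta r) = eta r" "eta r - T r (T' r (eta r)) = cut {0..r} k"
  using sol[OF assms, of k] sol_of_iff[OF assms, of k "eta r"] unfolding sol_of_def sol_k[OF assms] by blast+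

lemma sol_sym: assumes "x \<le> R" shows "cin (sol e x) v = cin e (sol v x)"
proof -
  let ?K = "\<lambda>u. - T R (T' R u)"
  note a = sol[OF assms, of e] and b = sol[OF assms, of v]
  have "cin (sol e x) v = cin (sol e x) (cut {0..x} v)" using cin_cut[of "{0..x}" "sol e x" v] a(1) by simp
  also have "\<dots> = cin (sol e x) (sol v x + ?K (sol v x))"
    unfolding b(2)[symmetric] using cin_cut[of "{0..x}" "sol e x"] a(1) by simp
  also have "\<dots> = cin (sol e x + ?K (sol e x)) (sol v x)" by (simp only: cin_add_left cin_add_right K_sym)
  also have "\<dots> = cin (cut {0..x} (sol e x + ?K (sol e x))) (sol v x)"
    using cin_cut[of "{0..x}" _ "sol v x"] b(1) by simp
  also have "\<dots> = cin e (sol v x)" unfolding a(2) using cin_cut[of "{0..x}" e "sol v x"] b(1) by simp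
  finally show ?thesis .
qed

text \<open>Reversal exchanges \<open>T x\<close> and its adjoint. It therefore turns the equation
  for \<open>eta x\<close>, after application of the adjoint, into the truncated equation whose
  right-hand side is minus the row of the chain at \<open>x\<close>.\<close>

lemma sol_refl_alpha: assumes "x \<le> R" shows "sol (T x (refl x k)) x = refl x (alpha x)"
proof -
  have a: "refl x (alpha x) = T x (refl x (eta x))" by (simp add: alpha_def refl_conv)
  have "refl x (alpha x) - T x (T' x (refl x (alpha x))) = T x (refl x (eta x - T x (alpha x)))"
    by (simp add: a[symmetric] refl_conv[symmetric] refl_diff conv_diff)
  also have "\<dots> = T x (refl x k)" using eta_at(2)[OF assms] by (simp add: alpha_def)
  finally have "sol_of (T x (refl x k)) x (refl x (alpha x))"
    unfolding sol_of_iff[OF assms] by simp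
  from sol_unique[OF assms this] show ?thesis by simp
qed

text \<open>In \<open>cin (sol e x)\<close> against the row at \<open>x\<close> the inverse is moved
  onto the row by symmetry; \<open>sol_refl_alpha\<close> then evaluates it, independently of
  \<open>e\<close>.\<close>

lemma D_eq: assumes "x \<in> {0<..R}" shows "D e x = rep e x + cin e (refl x (alpha x))"
proof -
  have x: "x \<le> R" using assms by simp
  have "cin (sol e x) (T R (refl x k)) = cin (sol e x) (T x (refl x k))"
    using cin_cut[of "{0..x}" "sol e x" "T R (refl x k)"] sol(1)[OF x, of e] by (simp add: cut_conv_causal[OF k_supp x])
  also have "\<dots> = cin e (refl x (alpha x))" by (simp add: sol_sym[OF x] sol_refl_alpha[OF x])
  finally show ?thesis using assms by (simp add: D_def F_def row_causal[OF k_supp x] cin_minus_right)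
qed

text \<open>Moving \<open>T R\<close> to the other side of the pairing in \<open>D_eq\<close>
  produces the reversal of \<open>k\<close> plus \<open>T x (alpha x)\<close>, which on [0,x] is
  \<open>eta x\<close>. This is how \<open>eta\<close> enters the top row.\<close>

lemma D_conv: "AE x in lborel. x \<in> {0<..R} \<longrightarrow> D (T R e) x = cin e (refl x (eta x))"
  using rep_conv[of k R e]
proof eventually_elim
  case (elim x)
  show ?case
  proof
    assume x: "x \<in> {0<..R}"
    then have xR: "x \<le> R" by simp
    have "T' R (refl x (alpha x)) = refl x (T x (alpha x))"
      using conv_star_causal[OF k_supp xR, of "refl x (alpha x)"] by (simp add: refl_conv)
    then have "D (T R e) x = cin e (refl x k) + cin e (refl x (T x (alpha x)))"
      using x elim by (simp add: D_eq cin_conv row_causal[OF k_supp xR])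
    also have "\<dots> = cin e (refl x (cut {0..x} k + T x (alpha x)))" by (simp add: refl_add cin_add_right)
    also have "cut {0..x} k + T x (alpha x) = eta x" using eta_at(2)[OF xR] by (simp add: alpha_def algebra_simps)
    finally show "D (T R e) x = cin e (refl x (eta x))" .
  qed
qed

lemma D_k: "D k x = - (indicator {0<..R} x * coeff x)"
  by (cases "x \<in> {0<..R}") (simp_all add: D_eq coeff_def, simp add: D_def)

lemma inner_eta: assumes "0 \<le> r" "r \<le> R" shows "inner (eta r) k = (norm (eta r))\<^sup>2 - corr k r (eta r)"
proof -
  have "cin (eta r) (eta r) - cin (T r (T' r (eta r))) (eta r) = cin k (eta r)"
    unfolding cin_diff_left[symmetric] eta_at(2)[OF assms(2)] using cin_cut[of "{0..r}" k "eta r"] eta_at(1)[OF assms(2)] by simp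
  then have R: "Re (cin k (eta r)) = (norm (eta r))\<^sup>2 - (norm (T' r (eta r)))\<^sup>2"
    by (simp add: cin_conv cin_self_norm flip: \<open>_ = cin k (eta r)\<close>)
  have "inner (eta r) k = Re (cin k (eta r))" using inner_commute[of "eta r" k] by (simp only: inner_ltwo_def)
  then show ?thesis unfolding R norm_conv_star[OF eta_at(1)[OF assms(2)]] .
qed

lemma coeff_L2: "L2_on {0<..R} coeff" and coeff_bound: "(norm (tr {0<..R} coeff))\<^sup>2 \<le> M"
proof -
  have D: "(\<lambda>x. indicat_real {0<..R} x *\<^sub>R coeff x) = (\<lambda>x. - D k x)"
    by (rule ext) (simp add: D_k indicat_scaleR)
  show "L2_on {0<..R} coeff" unfolding L2_on_iff_sqi D by (rule sqi_uminus[OF sqi_D])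
  have eta: "cut {0..R} (eta R) = eta R" by (rule eta_at) simp
  have eta0: "cut {0..} (eta R) = eta R"
  proof -
    have "cut {0..} (cut {0..R} (eta R)) = cut ({0..} \<inter> {0..R}) (eta R)" by (rule cut_cut) simp_all
    also have "{0..} \<inter> {0..R} = {0..R}" by auto
    finally show ?thesis by (simp only: eta)
  qed
  have "(norm (tr {0<..R} coeff))\<^sup>2 = (norm (mk (D k)))\<^sup>2"
    unfolding tr_def D norm_mk_sq[OF sqi_uminus[OF sqi_D]] norm_mk_sq[OF sqi_D] by simp
  also have "mk (D k) = cut {0..R} (mk (D k))"
    by (rule cut_eq_selfI[symmetric]) (simp, use rep_mk[OF sqi_D] in eventually_elim, auto simp: D_def indicator_def)
  also have "(norm (cut {0..R} (mk (D k))))\<^sup>2 = inner (eta R) k"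
    using chain_identity_norm[of R k] R_pos by (simp add: sol_k)
  \<comment> \<open>With the competitor \<open>eta R\<close>, the left-hand side of
    \<open>SI\<close> collapses by \<open>inner_eta\<close> to
    \<open>inner (eta R) k\<close>.\<close>
  also have "\<dots> \<le> M"
    using SI[OF eta0, of R] inner_eta[of R] R_pos by (simp add: inner_commute[of k])
  finally show "(norm (tr {0<..R} coeff))\<^sup>2 \<le> M" .
qed

end

section \<open>The Krein solution from the triangular factor\<close>

text \<open>Truncation makes the exponential square integrable for every complex \<open>l\<close>;
  reversal leads from \<open>l\<close> to \<open>cnj l\<close>, so both half-planes occur.\<close>

definition tex :: "complex \<Rightarrow> real \<Rightarrow> ltwo" where
  "tex l r = mk (\<lambda>x. indicator {0..r} x * cnj (exp (\<i> * l * of_real x)))"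

lemma sqi_tex: "sqi (\<lambda>x. indicator {0..r} x * cnj (exp (\<i> * l * of_real x)))"
proof (rule sqi_bounded_interval)
  show "(\<lambda>x. cnj (exp (\<i> * l * of_real x))) \<in> borel_measurable borel"
    by (intro borel_measurable_continuous_onI continuous_intros)
  fix x assume x: "x \<in> {0..r}"
  have "- (Im l * x) = (- Im l) * x" by simp
  also have "\<dots> \<le> \<bar>Im l\<bar> * x" by (rule mult_right_mono) (use x in auto)
  also have "\<dots> \<le> \<bar>Im l\<bar> * r" using x by (intro mult_left_mono) auto
  finally show "cmod (cnj (exp (\<i> * l * of_real x))) \<le> exp (\<bar>Im l\<bar> * r)" by simp
qed

lemma rep_tex: "AE x in lborel. rep (tex l r) x = indicator {0..r} x * cnj (exp (\<i> * l * of_real x))"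
  unfolding tex_def by (rule rep_mk[OF sqi_tex])

lemma cut_tex: assumes "r \<le> R" shows "cut {0..r} (tex l R) = tex l r"
proof (rule ltwo_eqI)
  show "AE x in lborel. rep (cut {0..r} (tex l R)) x = rep (tex l r) x"
    using rep_cut[of "{0..r}" "tex l R", simplified] rep_tex[of l r] rep_tex[of l R]
    by eventually_elim (use assms in \<open>auto simp: indicator_def\<close>)
qed

lemma refl_tex: "refl r (tex l r) = exp (\<i> * l * of_real r) \<cdot> tex (cnj l) r"
proof (rule ltwo_eqI)
  have e: "exp (\<i> * l * of_real (r - x)) = exp (\<i> * l * of_real r) * cnj (exp (\<i> * cnj l * of_real x))" for x
    by (simp add: exp_cnj exp_add[symmetric] algebra_simps)
  show "AE x in lborel. rep (refl r (tex l r)) x = rep (exp (\<i> * l * of_real r) \<cdot> tex (cnj l) r) x"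
    using rep_refl[of r "tex l r"] AE_lborel_reflect[OF rep_tex[of l r], of r] rep_tex[of "cnj l" r]
      rep_cscale[of "exp (\<i> * l * of_real r)" "tex (cnj l) r"]
    by eventually_elim (auto simp del: of_real_diff simp: indicator_def e)
qed

lemma cin_refl_tex:
  assumes "x \<le> R" shows "cin (refl x u) (tex l R) = exp (\<i> * l * of_real x) * cnj (cin u (tex (cnj l) x))"
proof -
  have "cin (refl x u) (tex l R) = cin (refl x u) (tex l x)"
    using cin_cut[of "{0..x}" "refl x u" "tex l R"] by (simp add: cut_tex[OF assms])
  also have "\<dots> = cin (refl x (tex l x)) u" by (rule cin_refl)
  also have "\<dots> = exp (\<i> * l * of_real x) * cnj (cin u (tex (cnj l) x))"
    by (simp only: refl_tex cin_cscale_left cnj_cin)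
  finally show ?thesis .
qed

lemma continuous_on_atLeast_Icc:
  fixes f :: "real \<Rightarrow> 'a::topological_space"
  assumes "\<And>R. R > 0 \<Longrightarrow> continuous_on {0..R} f" shows "continuous_on {0..} f"
  unfolding continuous_on_def
proof
  fix x :: real assume x: "x \<in> {0..}"
  have "(f \<longlongrightarrow> f x) (at x within {0..x + 1})"
    using assms[of "x + 1"] x unfolding continuous_on_def by auto
  moreover have "at x within {0..} = at x within {0..x + 1}"
    by (rule at_within_nhd[of x "{..<x + 1}"]) auto
  ultimately show "(f \<longlongrightarrow> f x) (at x within {0..})" by simp
qed

context inverse_schur
begin

definition fs :: "complex \<Rightarrow> real \<Rightarrow> complex" where "fs l r = cin (eta r) (tex l r)"

definition fw :: "complex \<Rightarrow> real \<Rightarrow> complex" where "fw l r = 1 + cin (alpha r) (tex l r)"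

text \<open>The top row is the reversed conjugate of the bottom row at \<open>cnj l\<close>; the
  exponential factor is the one produced by \<open>refl_tex\<close>.\<close>

definition fp :: "complex \<Rightarrow> real \<Rightarrow> complex" where "fp l r = exp (\<i> * l * of_real r) * cnj (fw (cnj l) r)"

definition fq :: "complex \<Rightarrow> real \<Rightarrow> complex" where "fq l r = exp (\<i> * l * of_real r) * cnj (fs (cnj l) r)"

lemma coeff_zero [simp]: "coeff 0 = 0"
  by (simp add: coeff_def)

end

context inverse_schur_at
begin

text \<open>As \<open>eta r\<close> is \<open>sol k r\<close>, the chain identity exhibits the
  bottom row as an indefinite integral in \<open>r\<close>. By \<open>D_k\<close> and
  \<open>D_tex\<close> its density is \<open>- (coeff t * fp l t)\<close>, which is the Krein
  equation for this entry.\<close>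

lemma fs_at: assumes "0 \<le> r" "r \<le> R"
  shows "fs l r = set_lebesgue_integral lborel {0..r} (\<lambda>x. D k x * cnj (D (tex l R) x))"
proof -
  have "fs l r = cin (eta r) (tex l R)"
    using cin_cut[of "{0..r}" "eta r" "tex l R"] eta_at(1)[OF assms(2)] by (simp add: fs_def cut_tex[OF assms(2)])
  also have "\<dots> = (LINT x|lborel. indicator {0..r} x * (D k x * cnj (D (tex l R) x)))"
    using chain_identity[OF assms, of k "tex l R"] by (simp only: sol_k[OF assms(2)])
  finally show ?thesis by (simp add: set_lebesgue_integral_def indicat_scaleR)
qed

lemma fw_at: assumes "0 \<le> r" "r \<le> R"
  shows "fw l r = 1 + set_lebesgue_integral lborel {0..r} (\<lambda>x. D k x * cnj (D (T R (tex l R)) x))"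
proof -
  have "cin (alpha r) (tex l r) = cin (eta r) (T r (tex l R))"
    using conv_cut[of k r "tex l R"] by (simp add: alpha_def cin_conv_star cut_tex[OF assms(2)])
  also have "\<dots> = cin (eta r) (T R (tex l R))"
    using cin_cut[of "{0..r}" "eta r" "T R (tex l R)"] eta_at(1)[OF assms(2)] by (simp add: cut_conv_causal[OF k_supp assms(2)])
  also have "\<dots> = (LINT x|lborel. indicator {0..r} x * (D k x * cnj (D (T R (tex l R)) x)))"
    using chain_identity[OF assms, of k "T R (tex l R)"] by (simp only: sol_k[OF assms(2)])
  finally show ?thesis by (simp add: fw_def set_lebesgue_integral_def indicat_scaleR)
qed

lemma DD_int: "set_integrable lborel {0..r} (\<lambda>x. D k x * cnj (D h x))"
  unfolding set_integrable_def
  by (rule integrable_mult_indicator[OF _ sqi_integrable_mult[OF sqi_D sqi_cnj[OF sqi_D]]]) simp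

lemma fs_cont_at: "continuous_on {0..R} (fs l)" and fw_cont_at: "continuous_on {0..R} (fw l)"
proof -
  have c: "continuous_on {0..R} (\<lambda>r. set_lebesgue_integral lborel {0..r} (\<lambda>x. D k x * cnj (D h x)))" for h
    by (rule continuous_on_subset[OF continuous_on_indefinite[OF DD_int]]) auto
  show "continuous_on {0..R} (fs l)"
    by (rule continuous_on_eq[OF c]) (simp add: fs_at)
  show "continuous_on {0..R} (fw l)"
    by (rule continuous_on_eq[OF continuous_on_add[OF continuous_on_const c]]) (simp add: fw_at)
qed

lemma D_tex: "AE x in lborel. x \<in> {0<..R} \<longrightarrow> cnj (D (tex l R) x) = fp l x"
  using rep_tex[of l R]
proof eventually_elim
  case (elim x)
  show ?case
  proof
    assume x: "x \<in> {0<..R}"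
    then have "cnj (D (tex l R) x) = exp (\<i> * l * of_real x) + cin (refl x (alpha x)) (tex l R)"
      using elim by (simp add: D_eq cnj_cin)
    then show "cnj (D (tex l R) x) = fp l x"
      using x by (simp add: cin_refl_tex fp_def fw_def algebra_simps)
  qed
qed

lemma D_T_tex: "AE x in lborel. x \<in> {0<..R} \<longrightarrow> cnj (D (T R (tex l R)) x) = fq l x"
  using D_conv[of "tex l R"] by eventually_elim (simp add: cnj_cin cin_refl_tex fq_def fs_def)

end

context inverse_schur
begin

lemma at_interval: "R > 0 \<Longrightarrow> inverse_schur_at k M R"
  by unfold_locales

lemma L2_coeff: "L2_on {0..} coeff" and coeff_le: "set_lebesgue_integral lborel {0..} (\<lambda>x. (cmod (coeff x))\<^sup>2) \<le> M"
proof -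
  have e: "indicat_real {0..} x *\<^sub>R coeff x = indicat_real {0<..} x *\<^sub>R coeff x" for x
    by (auto simp: indicator_def order.order_iff_strict)
  have e': "indicat_real {0..} x *\<^sub>R (cmod (coeff x))\<^sup>2 = indicat_real {0<..} x *\<^sub>R (cmod (coeff x))\<^sup>2" for x
    by (auto simp: indicator_def order.order_iff_strict)
  note L = L2_on_limit[OF inverse_schur_at.coeff_L2[OF at_interval] inverse_schur_at.coeff_bound[OF at_interval]]
  show "L2_on {0..} coeff" using L(1) unfolding L2_on_iff_sqi e .
  show "set_lebesgue_integral lborel {0..} (\<lambda>x. (cmod (coeff x))\<^sup>2) \<le> M"
    using L(2) unfolding set_lebesgue_integral_def e' .
qed

lemma fs_cont: "continuous_on {0..} (fs l)" and fw_cont: "continuous_on {0..} (fw l)"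
  by (rule continuous_on_atLeast_Icc, erule inverse_schur_at.fs_cont_at[OF at_interval] inverse_schur_at.fw_cont_at[OF at_interval])+

lemma fp_cont: "continuous_on {0..} (fp l)" and fq_cont: "continuous_on {0..} (fq l)"
  unfolding fp_def fq_def by (intro continuous_intros fs_cont fw_cont)+

lemma coeff_int: assumes "continuous_on {0..} y" shows "set_integrable lborel {0..r} (\<lambda>t. - (coeff t * y t))"
proof -
  have "set_integrable lborel {0..r} (\<lambda>t. coeff t * y t)"
    by (rule set_integrable_L2_continuous[OF L2_on_subset[OF L2_coeff] continuous_on_subset[OF assms]]) auto
  then show ?thesis by (simp add: set_integrable_def)
qed

lemma set_integral_coeff:
  assumes r: "0 \<le> r" and y: "continuous_on {0..} y"
    and D: "AE x in lborel. x \<in> {0<..r + 1} \<longrightarrow> cnj (d x) = y x" and d: "d \<in> borel_measurable borel"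
    and Dk: "\<And>x. dk x = - (indicator {0<..r + 1} x * coeff x)" "dk \<in> borel_measurable borel"
  shows "set_lebesgue_integral lborel {0..r} (\<lambda>x. dk x * cnj (d x)) = set_lebesgue_integral lborel {0..r} (\<lambda>t. - (coeff t * y t))"
  unfolding set_lebesgue_integral_def
proof (rule integral_cong_AE)
  note [measurable] = d Dk(2)
  show "(\<lambda>x. indicat_real {0..r} x *\<^sub>R (dk x * cnj (d x))) \<in> borel_measurable lborel" by measurable
  show "(\<lambda>t. indicat_real {0..r} t *\<^sub>R - (coeff t * y t)) \<in> borel_measurable lborel"
    using coeff_int[OF y, of r] unfolding set_integrable_def by (rule borel_measurable_integrable)
  show "AE x in lborel. indicat_real {0..r} x *\<^sub>R (dk x * cnj (d x)) = indicat_real {0..r} x *\<^sub>R - (coeff x * y x)"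
    using D
  proof eventually_elim
    case (elim x)
    then show ?case by (cases "x = 0") (auto simp: Dk(1) indicator_def)
  qed
qed

lemma indef_fs: "indef (fs l) (\<lambda>t. - (coeff t * fp l t))" and indef_fw: "indef (fw l) (\<lambda>t. - (coeff t * fq l t))"
proof -
  have 1: "fs l r = 0 + set_lebesgue_integral lborel {0..r} (\<lambda>t. - (coeff t * fp l t))"
    and 2: "fw l r = 1 + set_lebesgue_integral lborel {0..r} (\<lambda>t. - (coeff t * fq l t))" if r: "0 \<le> r" for r
  proof -
    interpret a: inverse_schur_at k M "r + 1" by (rule at_interval) (use r in simp)
    show "fs l r = 0 + set_lebesgue_integral lborel {0..r} (\<lambda>t. - (coeff t * fp l t))"
      using a.fs_at[of r l] set_integral_coeff[OF r fp_cont a.D_tex sqi_measurable[OF a.sqi_D] a.D_k sqi_measurable[OF a.sqi_D]] r by simp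
    show "fw l r = 1 + set_lebesgue_integral lborel {0..r} (\<lambda>t. - (coeff t * fq l t))"
      using a.fw_at[of r l] set_integral_coeff[OF r fq_cont a.D_T_tex sqi_measurable[OF a.sqi_D] a.D_k sqi_measurable[OF a.sqi_D]] r by simp
  qed
  show "indef (fs l) (\<lambda>t. - (coeff t * fp l t))" by (rule indefI[OF coeff_int[OF fp_cont] 1])
  show "indef (fw l) (\<lambda>t. - (coeff t * fq l t))" by (rule indefI[OF coeff_int[OF fq_cont] 2])
qed

lemma exp_cnj_cancel: "exp (\<i> * l * of_real r) * cnj (exp (\<i> * cnj l * of_real r)) = 1"
  by (simp add: exp_cnj exp_add[symmetric])

text \<open>The product rule transfers the equation for \<open>fw\<close> at \<open>cnj l\<close>;
  the two exponentials cancel because conjugation undoes the change from \<open>l\<close> to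
  \<open>cnj l\<close>.\<close>

lemma indef_fp: "indef (fp l) (\<lambda>t. \<i> * l * fp l t - cnj (coeff t) * fs l t)"
proof (rule indef_cong[OF indef_mult[OF indef_exp indef_cnj[OF indef_fw]]])
  show "exp (\<i> * l * of_real r) * cnj (fw (cnj l) r) = fp l r" for r by (simp add: fp_def)
  fix t
  have "exp (\<i> * l * of_real t) * cnj (- (coeff t * fq (cnj l) t)) =
     - (exp (\<i> * l * of_real t) * cnj (exp (\<i> * cnj l * of_real t))) * (cnj (coeff t) * fs l t)"
    by (simp add: fq_def)
  also have "\<dots> = - (cnj (coeff t) * fs l t)" by (simp only: exp_cnj_cancel) simp
  finally show "\<i> * l * exp (\<i> * l * of_real t) * cnj (fw (cnj l) t) + exp (\<i> * l * of_real t) * cnj (- (coeff t * fq (cnj l) t)) =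
      \<i> * l * fp l t - cnj (coeff t) * fs l t"
    by (simp add: fp_def)
qed

lemma indef_fq: "indef (fq l) (\<lambda>t. \<i> * l * fq l t - cnj (coeff t) * fw l t)"
proof (rule indef_cong[OF indef_mult[OF indef_exp indef_cnj[OF indef_fs]]])
  show "exp (\<i> * l * of_real r) * cnj (fs (cnj l) r) = fq l r" for r by (simp add: fq_def)
  fix t
  have "exp (\<i> * l * of_real t) * cnj (- (coeff t * fp (cnj l) t)) =
     - (exp (\<i> * l * of_real t) * cnj (exp (\<i> * cnj l * of_real t))) * (cnj (coeff t) * fw l t)"
    by (simp add: fp_def)
  also have "\<dots> = - (cnj (coeff t) * fw l t)" by (simp only: exp_cnj_cancel) simp
  finally show "\<i> * l * exp (\<i> * l * of_real t) * cnj (fs (cnj l) t) + exp (\<i> * l * of_real t) * cnj (- (coeff t * fp (cnj l) t)) =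
      \<i> * l * fq l t - cnj (coeff t) * fw l t"
    by (simp add: fq_def)
qed

lemma krein_coeff: "krein coeff l (fp l) (fq l) (fs l) (fw l)"
proof
  interpret a: inverse_schur_at k M 1 by (rule at_interval) simp
  have z: "fs m 0 = 0" "fw m 0 = 1" for m using a.fs_at[of 0 m] a.fw_at[of 0 m] by simp_all
  have m: "set_lebesgue_integral lborel S (\<lambda>t. - g t) = - set_lebesgue_integral lborel S g" for S and g :: "real \<Rightarrow> complex"
    by (simp add: set_lebesgue_integral_def)
  show "krein_comp coeff l (fp l) (fq l) (fs l) (fw l)"
    unfolding krein_comp_def
  proof (intro conjI allI impI fp_cont fq_cont fs_cont fw_cont)
    fix r :: real assume r: "0 \<le> r"
    show "fp l r = 1 + set_lebesgue_integral lborel {0..r} (\<lambda>t. \<i> * l * fp l t - cnj (coeff t) * fs l t)"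
      using indef_eq[OF indef_fp r] by (simp add: fp_def[of _ 0] z)
    show "fq l r = set_lebesgue_integral lborel {0..r} (\<lambda>t. \<i> * l * fq l t - cnj (coeff t) * fw l t)"
      using indef_eq[OF indef_fq r] by (simp add: fq_def[of _ 0] z)
    show "fs l r = - set_lebesgue_integral lborel {0..r} (\<lambda>t. coeff t * fp l t)"
      using indef_eq[OF indef_fs r] by (simp add: z m)
    show "fw l r = 1 - set_lebesgue_integral lborel {0..r} (\<lambda>t. coeff t * fq l t)"
      using indef_eq[OF indef_fw r] by (simp add: z m)
  qed
qed (rule L2_coeff)

end

section \<open>Identification of the limit at infinity\<close>

lemma norm_tail_tendsto_0:
  assumes u: "cut {0..} u = u" shows "((\<lambda>R. norm (u - cut {0..R} u)) \<longlongrightarrow> 0) at_top"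
proof -
  have i: "integrable lborel (\<lambda>x. (cmod (rep u x))\<^sup>2)" using sqi_rep[of u] by (simp add: sqi_def)
  have u0: "AE x in lborel. x \<notin> {0..} \<longrightarrow> rep u x = 0" by (rule cut_eq_selfD[OF _ u]) simp
  have "((\<lambda>R. LINT x|lborel. indicator {0..R} x * (cmod (rep u x))\<^sup>2) \<longlongrightarrow> (LINT x|lborel. (cmod (rep u x))\<^sup>2)) at_top"
  proof (rule integral_dominated_convergence_at_top[OF _ _ i])
    show "\<forall>\<^sub>F R in at_top. AE x in lborel. norm (indicator {0..R} x * (cmod (rep u x))\<^sup>2) \<le> (cmod (rep u x))\<^sup>2"
      by (intro always_eventually allI AE_I2) (auto simp: indicator_def)
    show "AE x in lborel. ((\<lambda>R. indicator {0..R} x * (cmod (rep u x))\<^sup>2) \<longlongrightarrow> (cmod (rep u x))\<^sup>2) at_top"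
      using u0
    proof eventually_elim
      case (elim x)
      show ?case
        by (rule tendsto_eventually, rule eventually_mono[OF eventually_ge_at_top[of x]]) (use elim in \<open>auto simp: indicator_def\<close>)
    qed
  qed measurable
  then have "((\<lambda>R. (norm u)\<^sup>2 - (norm (cut {0..R} u))\<^sup>2) \<longlongrightarrow> (norm u)\<^sup>2 - (norm u)\<^sup>2) at_top"
    unfolding norm_ltwo_sq[of u, symmetric] by (intro tendsto_diff tendsto_const) (simp add: norm_cut_sq)
  moreover have "(norm u)\<^sup>2 - (norm (cut {0..R} u))\<^sup>2 = (norm (u - cut {0..R} u))\<^sup>2" for R
    using norm_cut_split[of "{0..R}" u] by simp
  ultimately have "((\<lambda>R. (norm (u - cut {0..R} u))\<^sup>2) \<longlongrightarrow> 0) at_top" by simp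
  from tendsto_real_sqrt[OF this] show ?thesis by simp
qed

lemma cut_subset: assumes "cut S u = u" "S \<subseteq> T" "S \<in> sets borel" "T \<in> sets borel" shows "cut T u = u"
proof -
  have "cut T u = cut T (cut S u)" by (simp add: assms)
  also have "\<dots> = cut (T \<inter> S) u" by (rule cut_cut[OF assms(4,3)])
  also have "T \<inter> S = S" using assms(2) by blast
  finally show ?thesis by (simp add: assms)
qed

lemma cin_disjoint:
  assumes u: "cut S u = u" and v: "cut S' v = v" and S: "S \<inter> S' = {}" "S \<in> sets borel" "S' \<in> sets borel" shows "cin u v = 0"
proof -
  have "cin u v = cin u (cut S (cut S' v))" using cin_cut[OF S(2), of u v] by (simp add: u v)
  also have "cut S (cut S' v) = 0"
    unfolding cut_cut[OF S(2,3)] S(1) by (rule ltwo_eqI) (use rep_cut[of "{}" v, simplified] rep_zero in eventually_elim, simp)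
  finally show ?thesis by simp
qed

text \<open>Without truncation \<open>ex l\<close> is an eigenvector of the adjoint convolution.
  Truncating at \<open>R\<close> changes each value on [0,r] by at most \<open>norm k\<close> times
  the norm of the tail of \<open>ex l\<close>, and integration over [0,r] gives the factor
  \<open>sqrt r\<close>.\<close>

lemma cin_conv_star_tail:
  assumes a: "cut {0..r} a = a" and r: "0 \<le> r" "r \<le> R" and k: "cut {0..} k = k" and l: "Im l > 0"
  shows "cmod (cin a (conv (star k) R (ex l)) - cin k (ex l) * cin a (ex l)) \<le> norm a * (sqrt r * (norm k * norm (ex l - cut {0..R} (ex l))))"
proof -
  define d where "d = norm k * norm (ex l - cut {0..R} (ex l))"
  define z where "z = cut {0..r} (conv (star k) R (ex l) - cnj (cin k (ex l)) \<cdot> ex l)"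
  have "cin a (conv (star k) R (ex l)) - cin k (ex l) * cin a (ex l) = cin a z"
    unfolding z_def using cin_cut[of "{0..r}" a] a by (simp add: cin_diff_right cin_cscale_right)
  then have "cmod (cin a (conv (star k) R (ex l)) - cin k (ex l) * cin a (ex l)) \<le> norm a * norm z" by (simp add: norm_cin_le)
  also have "norm z \<le> sqrt r * d"
  proof (rule power2_le_imp_le)
    have "AE x in lborel. (cmod (rep z x))\<^sup>2 \<le> d\<^sup>2 * indicat_real {0..r} x"
      using rep_cut[of "{0..r}" "conv (star k) R (ex l) - cnj (cin k (ex l)) \<cdot> ex l", simplified]
        rep_minus[of "conv (star k) R (ex l)" "cnj (cin k (ex l)) \<cdot> ex l"] rep_conv_star[of k R "ex l"]
        rep_cscale[of "cnj (cin k (ex l))" "ex l"] rep_ex[OF l]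
    proof eventually_elim
      case (elim x)
      show ?case
      proof (cases "x \<in> {0..r}")
        case True
        have "rep z x = cin (cut {0..R} (ex l)) (shift x k) - cnj (cin k (ex l)) * cnj (exp (\<i> * l * of_real x))"
          using elim True r by (simp add: z_def)
        also have "\<dots> = - cin (ex l - cut {0..R} (ex l)) (shift x k)"
          using True by (simp add: cin_diff_left cin_ex_shift[OF k l])
        finally have "cmod (rep z x) \<le> d" using cin_shift_bound[of "ex l - cut {0..R} (ex l)" x k] by (simp add: d_def mult.commute)
        then have "(cmod (rep z x))\<^sup>2 \<le> d\<^sup>2" by (rule power_mono) simp
        then show ?thesis using True by simp
      qed (use elim in \<open>simp add: z_def\<close>)
    qed
    then have "(norm z)\<^sup>2 \<le> (LINT x|lborel. d\<^sup>2 * indicat_real {0..r} x)"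
      unfolding norm_ltwo_sq using sqi_rep[of z] by (intro integral_mono_AE integrable_mult_right integrable_indicator_Icc) (simp add: sqi_def)
    also have "\<dots> = (sqrt r * d)\<^sup>2" using r by (simp add: power_mult_distrib)
    finally show "(norm z)\<^sup>2 \<le> (sqrt r * d)\<^sup>2" .
  qed (use r in \<open>simp add: d_def\<close>)
  finally show ?thesis by (simp add: d_def mult_left_mono)
qed

context inverse_schur
begin

text \<open>The competitor \<open>eta r + W\<close> in the variational inequality shows that the tail beyond \<open>r\<close> of
  \<open>k + T R (alpha r)\<close> stays bounded; paired with a decaying exponential it vanishes.\<close>

lemma tail_bound:
  assumes r: "0 < r" "r \<le> R"
  defines "W \<equiv> cut {r<..R} (k + T R (alpha r))"
  shows "norm W \<le> sqrt M" "cut {0..R} (k + T R (alpha r)) = eta r + W"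
proof -
  interpret a: inverse_schur_at k M r by (rule at_interval) (rule r)
  note eta = a.eta_at[OF order_refl]
  have R0: "0 \<le> R" using r by simp
  have S: "{r<..R} \<in> sets borel" "{0..r} \<inter> {r<..R} = {}" by auto
  have W: "cut {r<..R} W = W" unfolding W_def by simp
  have Ialpha: "cut {0..r} (alpha r) = alpha r" by (simp add: alpha_def)
  have "cut {0..R} v = cut {0..r} v + cut {r<..R} v" for v
  proof -
    show ?thesis
      by (rule ltwo_eqI)
        (use rep_cut[of "{0..R}" v, simplified] rep_cut[of "{0..r}" v, simplified] rep_cut[of "{r<..R}" v, simplified]
            rep_plus[of "cut {0..r} v" "cut {r<..R} v"] in eventually_elim, use r in \<open>auto simp: indicator_def\<close>)
  qed
  then show dec: "cut {0..R} (k + T R (alpha r)) = eta r + W"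
    using eta(2) cut_conv_causal[OF k_supp r(2)] by (simp add: W_def alpha_def cut_add algebra_simps)
  have orth: "cin (eta r) W = 0" by (rule cin_disjoint[OF eta(1) W S(2)]) simp_all
  have etaR: "cut {0..R} (eta r) = eta r" and WR: "cut {0..R} W = W"
    using r by (auto intro!: cut_subset[OF eta(1)] cut_subset[OF W])
  have u: "cut {0..R} (eta r + W) = eta r + W" by (simp add: cut_add etaR WR)
  have u0: "cut {0..} (eta r + W) = eta r + W" by (rule cut_subset[OF u]) auto
  have "T' R (eta r + W) = alpha r + T' R W"
    by (simp add: conv_add alpha_def conv_star_causal[OF k_supp r(2) eta(1)])
  then have "corr k R (eta r + W) = (norm (alpha r + T' R W))\<^sup>2" using norm_conv_star[OF u, of k] by simp
  also have "\<dots> = (norm (alpha r))\<^sup>2 + 2 * Re (cin (alpha r) (T' R W)) + (norm (T' R W))\<^sup>2"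
    by (simp add: power2_norm_eq_inner inner_add_left inner_add_right inner_commute[of "T' R W" "alpha r"]) (simp add: inner_ltwo_def)
  also have "cin (alpha r) (T' R W) = cin (T R (alpha r)) W" by (simp add: cin_conv)
  finally have c: "corr k R (eta r + W) \<ge> corr k r (eta r) + 2 * Re (cin (T R (alpha r)) W)"
    using norm_conv_star[OF eta(1), of k] by (simp add: alpha_def)
  have "(norm (eta r + W))\<^sup>2 = (norm (eta r))\<^sup>2 + (norm W)\<^sup>2"
  proof -
    have "inner (eta r) W = 0" by (simp add: inner_ltwo_def orth)
    then show ?thesis by (simp add: power2_norm_eq_inner inner_add_left inner_add_right inner_commute[of W "eta r"])
  qed
  moreover have "inner k (eta r + W) = inner (eta r) k + inner k W" by (simp add: inner_add_right inner_commute[of k "eta r"])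
  moreover have "inner k W + Re (cin (T R (alpha r)) W) = (norm W)\<^sup>2"
  proof -
    have "inner k W + Re (cin (T R (alpha r)) W) = Re (cin (k + T R (alpha r)) W)" by (simp add: inner_ltwo_def cin_add_left)
    also have "cin (k + T R (alpha r)) W = cin W W"
      using cin_cut[OF S(1), of "k + T R (alpha r)" W] by (simp add: W W_def[symmetric])
    finally show ?thesis by (simp add: cin_self_norm)
  qed
  moreover have "inner (eta r) k = (norm (eta r))\<^sup>2 - corr k r (eta r)" by (rule a.inner_eta) (use r in auto)
  moreover have "corr k r (eta r) \<le> (norm (eta r))\<^sup>2" by (rule corr_le[OF cut_subset[OF eta(1)]]) auto
  \<comment> \<open>After substitution \<open>SI\<close> bounds the squared norm of \<open>W\<close>
    plus the squared norm of \<open>eta r\<close> minus \<open>corr k r (eta r)\<close>; this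
    difference is nonnegative by \<open>corr_le\<close>.\<close>
  ultimately have "(norm W)\<^sup>2 \<le> M" using SI[OF u0, of R] c by linarith
  then show "norm W \<le> sqrt M" by (rule real_le_rsqrt)
qed

text \<open>For each \<open>R\<close> beyond \<open>r\<close> the expression \<open>?L R\<close> is
  the pairing of \<open>W\<close> with \<open>ex l\<close>. Since \<open>W\<close> lives beyond
  \<open>r\<close> with norm at most \<open>sqrt M\<close>, it sees only the tail of
  \<open>ex l\<close>. Letting \<open>R\<close> grow, the eigenvector relation turns
  \<open>?L R\<close> into \<open>cin k (ex l) * fw l r - fs l r\<close>.\<close>

lemma fw_fs_close:
  assumes r: "0 < r" and l: "Im l > 0"
  shows "cmod (cin k (ex l) * fw l r - fs l r) \<le> sqrt M * norm (ex l - cut {0..r} (ex l))"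
proof -
  interpret a: inverse_schur_at k M r by (rule at_interval) (rule r)
  note eta = a.eta_at[OF order_refl]
  have Ialpha: "cut {0..r} (alpha r) = alpha r" by (simp add: alpha_def)
  have tex: "cut {0..r} (ex l) = tex l r"
    by (rule ltwo_eqI) (use rep_cut[of "{0..r}" "ex l", simplified] rep_ex[OF l] rep_tex[of l r] in \<open>eventually_elim, auto simp: indicator_def\<close>)
  have fs: "fs l r = cin (eta r) (ex l)" and fw: "fw l r = 1 + cin (alpha r) (ex l)"
    using cin_cut[of "{0..r}" "eta r" "ex l"] cin_cut[of "{0..r}" "alpha r" "ex l"] by (simp_all add: fs_def fw_def tex eta(1) Ialpha)
  let ?L = "\<lambda>R. cin k (cut {0..R} (ex l)) + cin (alpha r) (T' R (ex l)) - fs l r"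
  have bound: "cmod (?L R) \<le> sqrt M * norm (ex l - cut {0..r} (ex l))" if R: "r \<le> R" for R
  proof -
    define W where "W = cut {r<..R} (k + T R (alpha r))"
    note W = tail_bound[OF r R, folded W_def]
    have "cin k (cut {0..R} (ex l)) + cin (alpha r) (T' R (ex l)) = cin (cut {0..R} (k + T R (alpha r))) (ex l)"
      by (simp add: cut_add cin_add_left cin_cut cin_conv)
    then have "?L R = cin W (ex l)" by (simp add: W(2) cin_add_left fs)
    also have "\<dots> = cin W (ex l - cut {0..r} (ex l))"
    proof -
      have "cin W (cut {0..r} (ex l)) = 0"
        by (rule cin_disjoint[of "{r<..R}" _ "{0..r}"]) (auto simp: W_def)
      then show ?thesis by (simp add: cin_diff_right)
    qed
    finally have "cmod (?L R) \<le> norm W * norm (ex l - cut {0..r} (ex l))" by (simp only: norm_cin_le)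
    also have "\<dots> \<le> sqrt M * norm (ex l - cut {0..r} (ex l))" by (intro mult_right_mono W(1)) simp
    finally show ?thesis .
  qed
  have t0: "((\<lambda>R. norm (ex l - cut {0..R} (ex l))) \<longlongrightarrow> 0) at_top" by (rule norm_tail_tendsto_0[OF cut_ex[OF l]])
  have "((\<lambda>R. cin k (cut {0..R} (ex l))) \<longlongrightarrow> cin k (ex l)) at_top"
  proof (rule LIM_zero_cancel, rule Lim_null_comparison)
    show "\<forall>\<^sub>F R in at_top. norm (cin k (cut {0..R} (ex l)) - cin k (ex l)) \<le> norm k * norm (ex l - cut {0..R} (ex l))"
      using norm_cin_le[of k "cut {0.._} (ex l) - ex l"] by (intro always_eventually allI) (simp add: cin_diff_right norm_minus_commute)
    show "((\<lambda>R. norm k * norm (ex l - cut {0..R} (ex l))) \<longlongrightarrow> 0) at_top" using tendsto_mult_left[OF t0, of "norm k"] by simp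
  qed
  moreover have "((\<lambda>R. cin (alpha r) (T' R (ex l))) \<longlongrightarrow> cin k (ex l) * cin (alpha r) (ex l)) at_top"
  proof (rule LIM_zero_cancel, rule Lim_null_comparison)
    show "\<forall>\<^sub>F R in at_top. norm (cin (alpha r) (T' R (ex l)) - cin k (ex l) * cin (alpha r) (ex l))
        \<le> norm (alpha r) * (sqrt r * (norm k * norm (ex l - cut {0..R} (ex l))))"
      by (rule eventually_mono[OF eventually_ge_at_top[of r]])
         (rule cin_conv_star_tail[OF Ialpha _ _ k_supp l], use r in simp_all)
    show "((\<lambda>R. norm (alpha r) * (sqrt r * (norm k * norm (ex l - cut {0..R} (ex l))))) \<longlongrightarrow> 0) at_top"
      using tendsto_mult_left[OF t0, of "norm (alpha r) * sqrt r * norm k"] by (simp add: mult.assoc)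
  qed
  ultimately have "(?L \<longlongrightarrow> cin k (ex l) + cin k (ex l) * cin (alpha r) (ex l) - fs l r) at_top"
    by (intro tendsto_diff tendsto_add tendsto_const)
  from tendsto_norm[OF this]
  have "cmod (cin k (ex l) + cin k (ex l) * cin (alpha r) (ex l) - fs l r) \<le> sqrt M * norm (ex l - cut {0..r} (ex l))"
    by (rule tendsto_upperbound) (auto intro!: eventually_mono[OF eventually_ge_at_top[of r]] bound)
  then show ?thesis by (simp add: fw distrib_left)
qed

lemma schur_function_coeff: assumes f: "\<And>l. Im l > 0 \<Longrightarrow> cin k (ex l) = f l" shows "schur_function coeff f"
  unfolding schur_function_def
proof (intro allI impI)
  fix l :: complex assume l: "Im l > 0"
  interpret kr: krein coeff l "fp l" "fq l" "fs l" "fw l" by (rule krein_coeff)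
  define X :: "real \<Rightarrow> complex^2^2" where "X r = vector [vector [fp l r, fq l r], vector [fs l r, fw l r]]" for r
  have "krein_solution coeff l X"
    unfolding krein_solution_iff[OF L2_coeff] using kr.kr by (simp add: X_def)
  moreover have "((\<lambda>r. fs l r / fw l r) \<longlongrightarrow> f l) at_top"
  proof (rule LIM_zero_cancel, rule Lim_null_comparison)
    show "\<forall>\<^sub>F r in at_top. norm (fs l r / fw l r - f l) \<le> sqrt M * norm (ex l - cut {0..r} (ex l))"
    proof (rule eventually_mono[OF eventually_gt_at_top[of 0]])
      fix r :: real assume r: "0 < r"
      \<comment> \<open>The energy estimate for the reconstructed system allows division by
        \<open>fw\<close> without losing the rate.\<close>
      have w: "cmod (fw l r) \<ge> 1" by (rule kr.w_ge_1) (use r l in auto)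
      then have "fw l r \<noteq> 0" by auto
      then have "fs l r / fw l r - f l = - (f l * fw l r - fs l r) / fw l r" by (simp add: field_simps)
      then have "norm (fs l r / fw l r - f l) = cmod (f l * fw l r - fs l r) / cmod (fw l r)" by (simp add: norm_divide norm_minus_commute)
      also have "\<dots> \<le> cmod (f l * fw l r - fs l r) / 1" using w by (intro divide_left_mono) auto
      also have "\<dots> \<le> sqrt M * norm (ex l - cut {0..r} (ex l))" using fw_fs_close[OF r l] f[OF l] by simp
      finally show "norm (fs l r / fw l r - f l) \<le> sqrt M * norm (ex l - cut {0..r} (ex l))" .
    qed
    show "((\<lambda>r. sqrt M * norm (ex l - cut {0..r} (ex l))) \<longlongrightarrow> 0) at_top"
      using tendsto_mult_left[OF norm_tail_tendsto_0[OF cut_ex[OF l]], of "sqrt M"] by simp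
  qed
  ultimately show "\<exists>X. krein_solution coeff l X \<and> ((\<lambda>r. X r $ 2 $ 1 / X r $ 2 $ 2) \<longlongrightarrow> f l) at_top"
    by (intro exI[of _ X]) (simp add: X_def)
qed

end

lemma schur_bound_imp_schur_function:
  assumes f: "schur_bound M f"
  shows "\<exists>B. L2_on {0..} B \<and> schur_function B f \<and> set_lebesgue_integral lborel {0..} (\<lambda>x. (cmod (B x))\<^sup>2) \<le> M"
proof -
  have "2 * Re (\<Sum>l\<in>\<Lambda>. cnj (c l) * f l) - (norm (\<Sum>l\<in>\<Lambda>. c l \<cdot> ex l))\<^sup>2 \<le> M"
    if "finite \<Lambda>" "\<forall>l\<in>\<Lambda>. Im l > 0" for \<Lambda> c
  proof -
    have "2 * Re (\<Sum>l\<in>\<Lambda>. cnj (c l) * f l) - (norm (\<Sum>l\<in>\<Lambda>. c l \<cdot> ex l))\<^sup>2 + (norm (\<Sum>l\<in>\<Lambda>. (c l * cnj (f l)) \<cdot> ex l))\<^sup>2 \<le> M"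
      using f that unfolding schur_bound_def by blast
    then show ?thesis using zero_le_power2[of "norm (\<Sum>l\<in>\<Lambda>. (c l * cnj (f l)) \<cdot> ex l)"] by linarith
  qed
  from ex_Riesz[OF this]
  obtain k where k: "\<And>l. Im l > 0 \<Longrightarrow> cin k (ex l) = f l" "k \<in> closure (fst ` ex_span f)" by blast
  note k0 = cut_closure_ex_span[OF k(2)]
  interpret inverse_schur k M
    by unfold_locales (rule k0, rule star_ineq[OF f k0 k(1)])
  show ?thesis using L2_coeff schur_function_coeff[OF k(1)] coeff_le by blast
qed

theorem corollary11p5:
  shows "(\<forall>(A :: real \<Rightarrow> complex) (f :: complex \<Rightarrow> complex) (g :: complex \<Rightarrow> complex).
            L2_on {0..} A \<and> schur_function A f \<and>
            g holomorphic_on {z. Im z > 0} \<and> (\<forall>z. Im z > 0 \<longrightarrow> norm (g z) \<le> 1) \<longrightarrow>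
            (\<exists>B. L2_on {0..} B \<and> schur_function B (\<lambda>z. g z * f z) \<and>
                 L2_norm_on {0..} B \<le> L2_norm_on {0..} A)) \<and>
         convex_measures {\<sigma>. \<exists>A. L2_on {0..} A \<and> spectral_measure A \<sigma>}"
proof (intro conjI allI impI)
  fix A f g
  assume a: "L2_on {0..} A \<and> schur_function A f \<and> g holomorphic_on {z. Im z > 0} \<and> (\<forall>z. Im z > 0 \<longrightarrow> norm (g z) \<le> 1)"
  then have "schur_bound ((L2_norm_on {0..} A)\<^sup>2) (\<lambda>z. g z * f z)"
    by (intro schur_bound_mult krein_schur_bound) auto
  from schur_bound_imp_schur_function[OF this] obtain B where B: "L2_on {0..} B" "schur_function B (\<lambda>z. g z * f z)"
    "set_lebesgue_integral lborel {0..} (\<lambda>x. (cmod (B x))\<^sup>2) \<le> (L2_norm_on {0..} A)\<^sup>2" by blast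
  have "0 \<le> L2_norm_on {0..} A"
    unfolding L2_norm_on_def set_lebesgue_integral_def by (intro real_sqrt_ge_zero integral_nonneg_AE AE_I2) simp
  then have "L2_norm_on {0..} B \<le> L2_norm_on {0..} A"
    using real_sqrt_le_mono[OF B(3)] unfolding L2_norm_on_def[of _ B] by (simp only: real_sqrt_abs abs_of_nonneg)
  with B show "\<exists>B. L2_on {0..} B \<and> schur_function B (\<lambda>z. g z * f z) \<and> L2_norm_on {0..} B \<le> L2_norm_on {0..} A" by blast
qed (rule convex_spectral_measures)

end
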